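(* Assume $F_0$ is in the domain of attraction of the GEV law with extreme value index $\gamma_0>-1/2$ and that the second-order condition (a)-(b) stated in the context holds. Then there exist $\varepsilon_0>0$ and constants $c_1,c_2,c_3>0$ such that the following properties hold with probability tending to $1$ as $n\to\infty$: (i) When $\gamma_0>0$, $L_n$ is strictly concave on $B(\boldsymbol\theta_0,\varepsilon_0)$, has a unique maximizer $\widehat{\boldsymbol\theta}_n$ there, and $$-c_1\|\boldsymbol\theta-\widehat{\boldsymbol\theta}_n\|^2\le L_n(\boldsymbol\theta)-L_n(\widehat{\boldsymbol\theta}_n)\le -c_2\|\boldsymbol\theta-\widehat{\boldsymbol\theta}_n\|^2,\qquad \boldsymbol\theta\in B(\boldsymbol\theta_0,\varepsilon_0).$$ (ii) More generally, if $\gamma_0>-1/2$, then $S_n(\boldsymbol\theta_0)=O_{\mathbb P}(1/\sqrt k)$ and $$L_n(\boldsymbol\theta)-L_n(\boldsymbol\theta_0)\le(\boldsymbol\theta-\boldsymbol\theta_0)^\top S_n(\boldsymbol\theta_0)-c_3\|\boldsymbol\theta-\boldsymbol\theta_0\|^2,\qquad \boldsymbol\theta\in B(\boldsymbol\theta_0,\varepsilon_0),$$ and $$\sup_{\boldsymbol\theta\in B(\boldsymbol\theta_0,\epsilon_n)}\|J_n(\boldsymbol\theta)+\boldsymbol I_{\boldsymbol\theta_0}\|=o_{\mathbb P}(1)$$ for any $\epsilon_n=R/\sqrt k$ with $R=R(n)>0$ such that $R=o\big((\sqrt k/\log k)\wedge k^{1/2+\min(\gamma_0,0)}\big)$.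
   Context: Expressions at $\gamma=0$ (or $\gamma_0=0$) are read as limits, e.g. $(y^{\gamma}-1)/\gamma=\log y$. $Y_1,\dots,Y_n$ are i.i.d. with distribution function $F_0$, order statistics $Y_{1,n}\le\dots\le Y_{n,n}$. Set $F^{\leftarrow}(u)=\inf\{x:F(x)\ge u\}$, $U_0(t)=F_0^{\leftarrow}(1-1/t)$. $F_0\in\mathcal D(G_{\gamma_0})$ means that there is a positive function $a_0$ with $\lim_{t\to\infty}\{U_0(ty)-U_0(t)\}/a_0(t)=(y^{\gamma_0}-1)/\gamma_0$ for all $y>0$. $k=k(n)$ is an intermediate sequence: $k\to\infty$, $k=o(n)$. Second-order condition: there is a positive or negative function $A$ with $A(t)\to0$ as $t\to\infty$ such that (a) $A$ is regularly varying with index $\rho\le0$ and, for all $x>0$, $$\lim_{t\to\infty}\frac{\frac{U_0(tx)-U_0(t)}{a_0(t)}-\frac{x^{\gamma_0}-1}{\gamma_0}}{A(t)}=\int_1^xv^{\gamma_0-1}\int_1^vu^{\rho-1}\,du\,dv;$$ (b) $\sqrt kA(n/k)\to\lambda\in\mathbb R$. Parameter space $\Theta=(-1/2,\infty)\times(0,\infty)$. For $\boldsymbol\theta=(\gamma,\sigma)^\top\in\Theta$ and $z\ge0$, the generalised Pareto log-likelihood is $\ell_{\boldsymbol\theta}(z)=-\log\sigma-(1+1/\gamma)\log(1+\gamma z/\sigma)$ if $1+\gamma z/\sigma>0$ and $-\infty$ otherwise. Let $Z_i=(Y_{n-i+1,n}-Y_{n-k,n})/a_0(n/k)$, $1\le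 i\le k$; $L_n(\boldsymbol\theta)=k^{-1}\sum_{i=1}^k\ell_{\boldsymbol\theta}(Z_i)$, $S_n=\partial L_n/\partial\boldsymbol\theta$, $J_n=\partial^2L_n/\partial\boldsymbol\theta\partial\boldsymbol\theta^\top$, $\boldsymbol\theta_0=(\gamma_0,1)^\top$. $B(\boldsymbol\theta_0,\varepsilon)=\{\boldsymbol\theta\in\Theta:\|\boldsymbol\theta-\boldsymbol\theta_0\|<\varepsilon\}$. The Fisher information at $\boldsymbol\theta_0$ is $\boldsymbol I_{\boldsymbol\theta_0}=-\int_0^1\frac{\partial^2\ell_{\boldsymbol\theta}}{\partial\boldsymbol\theta\partial\boldsymbol\theta^\top}\big|_{\boldsymbol\theta=\boldsymbol\theta_0}\big(\frac{v^{-\gamma_0}-1}{\gamma_0}\big)dv$. $x\wedge y=\min(x,y)$. *)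

theory Defs
  imports "HOL-Probability.Probability" "HOL-Library.Landau_Symbols"
begin

section \<open>Probabilities of events that need not be measurable\<close>

(* Assertions such as "L_n is strictly concave on a ball and has a unique maximizer there" quantify
   over uncountably many parameters, and the library's measure is 0 on non-measurable sets.
   "With probability tending to 1" and the stochastic orders are therefore stated with inner
   probability, which is the ordinary probability on measurable events. *)
definition inner_prob :: "'a measure \<Rightarrow> ('a \<Rightarrow> bool) \<Rightarrow> real" where
  "inner_prob M P = Sup {measure M E | E. E \<in> sets M \<and> E \<subseteq> {\<omega> \<in> space M. P \<omega>}}"

lemma (in prob_space) inner_prob_eq_prob:
  assumes "{\<omega> \<in> space M. P \<omega>} \<in> events"
  shows "inner_prob M P = prob {\<omega> \<in> space M. P \<omega>}"
  unfolding inner_prob_def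
  by (rule cSup_eq_maximum) (use assms in \<open>auto intro: finite_measure_mono\<close>)

definition whp :: "'a measure \<Rightarrow> (nat \<Rightarrow> 'a \<Rightarrow> bool) \<Rightarrow> bool" where
  "whp M P \<longleftrightarrow> (\<lambda>n. inner_prob M (P n)) \<longlonglongrightarrow> 1"

definition bigO_P :: "'a measure \<Rightarrow> (nat \<Rightarrow> 'a \<Rightarrow> 'b::real_normed_vector) \<Rightarrow> (nat \<Rightarrow> real) \<Rightarrow> bool" where
  "bigO_P M X b \<longleftrightarrow>
     (\<forall>\<eta>>0. \<exists>C. eventually (\<lambda>n. inner_prob M (\<lambda>\<omega>. norm (X n \<omega>) \<le> C * b n) \<ge> 1 - \<eta>) sequentially)"

(* o_P(1); extended reals, so that a supremum may be infinite *)
definition smallo_P_1 :: "'a measure \<Rightarrow> (nat \<Rightarrow> 'a \<Rightarrow> ereal) \<Rightarrow> bool" where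
  "smallo_P_1 M X \<longleftrightarrow> (\<forall>\<delta>>0. whp M (\<lambda>n \<omega>. \<bar>X n \<omega>\<bar> \<le> ereal \<delta>))"


section \<open>Domain of attraction and second-order condition\<close>

definition quantile :: "(real \<Rightarrow> real) \<Rightarrow> real \<Rightarrow> real" where
  "quantile F u = Inf {x. F x \<ge> u}"

definition tail_quantile :: "(real \<Rightarrow> real) \<Rightarrow> real \<Rightarrow> real" where
  "tail_quantile F t = quantile F (1 - 1 / t)"

(* (y^g - 1) / g, read as a limit at g = 0 *)
definition box_cox :: "real \<Rightarrow> real \<Rightarrow> real" where
  "box_cox \<gamma> y = (if \<gamma> = 0 then ln y else (y powr \<gamma> - 1) / \<gamma>)"

lemma box_cox_limit:
  assumes "y > 0"
  shows "((\<lambda>\<gamma>. (y powr \<gamma> - 1) / \<gamma>) \<longlongrightarrow> box_cox 0 y) (at 0)"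
proof -
  have "((\<lambda>\<gamma>. y powr \<gamma>) has_real_derivative ln y) (at 0)"
    using assms by (auto intro!: derivative_eq_intros simp: powr_def)
  then show ?thesis
    using assms by (simp add: has_field_derivative_iff box_cox_def)
qed

definition gev_attraction :: "(real \<Rightarrow> real) \<Rightarrow> real \<Rightarrow> (real \<Rightarrow> real) \<Rightarrow> bool" where
  "gev_attraction F \<gamma> a \<longleftrightarrow> (\<forall>t>0. a t > 0) \<and>
     (\<forall>y>0. ((\<lambda>t. (tail_quantile F (t * y) - tail_quantile F t) / a t) \<longlongrightarrow> box_cox \<gamma> y) at_top)"

(* The quotient makes sense for functions of either sign near infinity. *)
definition regularly_varying :: "real \<Rightarrow> (real \<Rightarrow> real) \<Rightarrow> bool" where
  "regularly_varying \<rho> f \<longleftrightarrow> set_borel_measurable lebesgue {0<..} f \<and>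
     (\<forall>x>0. ((\<lambda>t. f (t * x) / f t) \<longlongrightarrow> x powr \<rho>) at_top)"

definition second_order_limit :: "real \<Rightarrow> real \<Rightarrow> real \<Rightarrow> real" where
  "second_order_limit \<gamma> \<rho> x =
     (LBINT v=ereal 1..ereal x. v powr (\<gamma> - 1) * (LBINT u=ereal 1..ereal v. u powr (\<rho> - 1)))"

definition second_order_condition ::
  "(real \<Rightarrow> real) \<Rightarrow> real \<Rightarrow> (real \<Rightarrow> real) \<Rightarrow> real \<Rightarrow> (real \<Rightarrow> real) \<Rightarrow> bool" where
  "second_order_condition F \<gamma> a \<rho> A \<longleftrightarrow>
     ((\<forall>t>0. A t > 0) \<or> (\<forall>t>0. A t < 0)) \<and> (A \<longlongrightarrow> 0) at_top \<and>
     \<rho> \<le> 0 \<and> regularly_varying \<rho> A \<and>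
     (\<forall>x>0. ((\<lambda>t. ((tail_quantile F (t * x) - tail_quantile F t) / a t - box_cox \<gamma> x) / A t)
               \<longlongrightarrow> second_order_limit \<gamma> \<rho> x) at_top)"

definition intermediate_seq :: "(nat \<Rightarrow> nat) \<Rightarrow> bool" where
  "intermediate_seq k \<longleftrightarrow> filterlim k at_top sequentially \<and> (\<lambda>n. real (k n)) \<in> o(\<lambda>n. real n)"


section \<open>Generalised Pareto log-likelihood\<close>

(* Parameters are vectors (gamma, sigma): component 1 is the shape, component 2 the scale. *)
definition Theta :: "(real^2) set" where
  "Theta = {\<theta>. \<theta> $ 1 > - 1 / 2 \<and> \<theta> $ 2 > 0}"

definition theta_ball :: "real^2 \<Rightarrow> real \<Rightarrow> (real^2) set" where
  "theta_ball \<theta>\<^sub>0 \<epsilon> = Theta \<inter> ball \<theta>\<^sub>0 \<epsilon>"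

(* At gamma = 0 the limit of (1 + 1/gamma) ln (1 + gamma z / sigma) is z / sigma. *)
definition gp_loglik :: "real^2 \<Rightarrow> real \<Rightarrow> ereal" where
  "gp_loglik \<theta> z = (let \<gamma> = \<theta> $ 1; \<sigma> = \<theta> $ 2 in
     if 1 + \<gamma> * z / \<sigma> > 0
     then ereal (- ln \<sigma> - (if \<gamma> = 0 then z / \<sigma> else (1 + 1 / \<gamma>) * ln (1 + \<gamma> * z / \<sigma>)))
     else - \<infinity>)"

lemma gp_loglik_limit:
  assumes "\<sigma> > 0"
  shows "((\<lambda>\<gamma>. gp_loglik (vector [\<gamma>, \<sigma>]) z) \<longlongrightarrow> gp_loglik (vector [0, \<sigma>]) z) (at 0)"
proof -
  have "((\<lambda>\<gamma>. ln (1 + \<gamma> * z / \<sigma>)) has_real_derivative z / \<sigma>) (at 0)"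
    using assms by (auto intro!: derivative_eq_intros)
  then have 1: "((\<lambda>\<gamma>. ln (1 + \<gamma> * z / \<sigma>) / \<gamma>) \<longlongrightarrow> z / \<sigma>) (at 0)"
    by (simp add: has_field_derivative_iff)
  have 2: "((\<lambda>\<gamma>. 1 + \<gamma> * z / \<sigma>) \<longlongrightarrow> 1) (at 0)"
    by (auto intro!: tendsto_eq_intros simp: assms less_imp_neq[symmetric])
  have 3: "((\<lambda>\<gamma>. ln (1 + \<gamma> * z / \<sigma>)) \<longlongrightarrow> 0) (at 0)"
    using tendsto_ln[OF 2] by simp
  have "((\<lambda>\<gamma>. - ln \<sigma> - (ln (1 + \<gamma> * z / \<sigma>) + ln (1 + \<gamma> * z / \<sigma>) / \<gamma>))
          \<longlongrightarrow> - ln \<sigma> - (0 + z / \<sigma>)) (at 0)"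
    by (intro tendsto_intros 1 3)
  then have "((\<lambda>\<gamma>. ereal (- ln \<sigma> - (ln (1 + \<gamma> * z / \<sigma>) + ln (1 + \<gamma> * z / \<sigma>) / \<gamma>)))
          \<longlongrightarrow> gp_loglik (vector [0, \<sigma>]) z) (at 0)"
    by (simp add: gp_loglik_def Let_def)
  moreover have "eventually (\<lambda>\<gamma>. 1 + \<gamma> * z / \<sigma> > 0) (at 0)"
    using order_tendstoD(1)[OF 2, of 0] by simp
  then have "eventually (\<lambda>\<gamma>. ereal (- ln \<sigma> - (ln (1 + \<gamma> * z / \<sigma>) + ln (1 + \<gamma> * z / \<sigma>) / \<gamma>)) =
      gp_loglik (vector [\<gamma>, \<sigma>]) z) (at 0)"
    using eventually_neq_at_within[of 0 0 UNIV]
    by eventually_elim (auto simp: gp_loglik_def Let_def distrib_right)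
  ultimately show ?thesis
    by (rule Lim_transform_eventually)
qed

definition partial_deriv :: "'n::finite \<Rightarrow> (real^'n \<Rightarrow> real) \<Rightarrow> real^'n \<Rightarrow> real" where
  "partial_deriv i f x = deriv (\<lambda>t. f (x + t *\<^sub>R axis i 1)) 0"

definition gradient :: "(real^'n::finite \<Rightarrow> real) \<Rightarrow> real^'n \<Rightarrow> real^'n" where
  "gradient f x = (\<chi> i. partial_deriv i f x)"

definition hessian :: "(real^'n::finite \<Rightarrow> real) \<Rightarrow> real^'n \<Rightarrow> real^'n^'n" where
  "hessian f x = (\<chi> i j. partial_deriv i (partial_deriv j f) x)"

(* (v^(-gamma) - 1) / gamma is box_cox gamma (1 / v). Near (gamma, 1) the log-likelihood is finite
   on the range of integration, so real_of_ereal loses nothing there. *)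
definition fisher_info :: "real \<Rightarrow> real^2^2" where
  "fisher_info \<gamma> = - (LBINT v=ereal 0..ereal 1.
     hessian (\<lambda>\<theta>. real_of_ereal (gp_loglik \<theta> (box_cox \<gamma> (1 / v)))) (vector [\<gamma>, 1]))"

(* j-th smallest of Y 1, ..., Y n, for 1 <= j <= n *)
definition order_stat :: "(nat \<Rightarrow> 'a \<Rightarrow> real) \<Rightarrow> nat \<Rightarrow> nat \<Rightarrow> 'a \<Rightarrow> real" where
  "order_stat Y n j \<omega> = sort (map (\<lambda>i. Y i \<omega>) [1..<n + 1]) ! (j - 1)"

definition excess ::
  "(nat \<Rightarrow> 'a \<Rightarrow> real) \<Rightarrow> (real \<Rightarrow> real) \<Rightarrow> (nat \<Rightarrow> nat) \<Rightarrow> nat \<Rightarrow> 'a \<Rightarrow> nat \<Rightarrow> real" where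
  "excess Y a k n \<omega> i =
     (order_stat Y n (n - i + 1) \<omega> - order_stat Y n (n - k n) \<omega>) / a (real n / real (k n))"

definition mean_loglik ::
  "(nat \<Rightarrow> 'a \<Rightarrow> real) \<Rightarrow> (real \<Rightarrow> real) \<Rightarrow> (nat \<Rightarrow> nat) \<Rightarrow> nat \<Rightarrow> 'a \<Rightarrow> real^2 \<Rightarrow> ereal" where
  "mean_loglik Y a k n \<omega> \<theta> =
     ereal (1 / real (k n)) * (\<Sum>i=1..k n. gp_loglik \<theta> (excess Y a k n \<omega> i))"

(* score and loglik_hessian have their usual meaning at points of Theta where the log-likelihood is
   finite, since these form an open set; elsewhere real_of_ereal makes the values arbitrary. *)
definition score ::
  "(nat \<Rightarrow> 'a \<Rightarrow> real) \<Rightarrow> (real \<Rightarrow> real) \<Rightarrow> (nat \<Rightarrow> nat) \<Rightarrow> nat \<Rightarrow> 'a \<Rightarrow> real^2 \<Rightarrow> real^2" where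
  "score Y a k n \<omega> = gradient (\<lambda>\<theta>. real_of_ereal (mean_loglik Y a k n \<omega> \<theta>))"

definition loglik_hessian ::
  "(nat \<Rightarrow> 'a \<Rightarrow> real) \<Rightarrow> (real \<Rightarrow> real) \<Rightarrow> (nat \<Rightarrow> nat) \<Rightarrow> nat \<Rightarrow> 'a \<Rightarrow> real^2 \<Rightarrow> real^2^2" where
  "loglik_hessian Y a k n \<omega> = hessian (\<lambda>\<theta>. real_of_ereal (mean_loglik Y a k n \<omega> \<theta>))"

definition strictly_concave_on :: "'a::real_vector set \<Rightarrow> ('a \<Rightarrow> ereal) \<Rightarrow> bool" where
  "strictly_concave_on S f \<longleftrightarrow> convex S \<and>
     (\<forall>x\<in>S. \<forall>y\<in>S. \<forall>u>0. \<forall>v>0. x \<noteq> y \<longrightarrow> u + v = 1 \<longrightarrow>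
        ereal u * f x + ereal v * f y < f (u *\<^sub>R x + v *\<^sub>R y))"

end

theory Submission
  imports Defs
begin

text \<open>The assertions follow from a coupling with uniform variables and from one way of writing the
log-likelihood.

\<^bold>\<open>The log-likelihood.\<close> With \<open>lin \<theta> r = \<sigma> + \<gamma> * r\<close>, the log-likelihood is
\<open>- ln (lin \<theta> z)\<close> minus the integral of \<open>1 / lin \<theta>\<close> over \<open>{0..z}\<close> (\<open>gp_loglik_eq\<close>), without a
special case at \<open>\<gamma> = 0\<close>. All parameter derivatives are integrals of quotients of affine functions
and are controlled by comparing \<open>lin \<theta>\<close> with \<open>lin \<theta>0\<close> multiplicatively. The set of
parameters at which a sample has finite likelihood is convex, so Taylor's formula along segments
reduces every assertion to two kinds of facts: the size of the score at \<open>\<theta>0\<close>, and upper and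
lower bounds of the Hessian near \<open>\<theta>0\<close>.

\<^bold>\<open>The coupling.\<close> The sample may be replaced by quantiles \<open>quantile F (1 - v i)\<close> of independent uniform
variables (\<open>inner_prob_quantile_transform\<close>). The \<open>k\<close> smallest of the points \<open>v i * n / k\<close> behave
like the order statistics of \<open>k\<close> uniform variables: averages of a function \<open>g\<close> over them converge
to the integral of \<open>g\<close> over \<open>{0<..1}\<close> if \<open>g\<close> is integrable, at rate \<open>1 / sqrt k\<close> if it is square
integrable (\<open>pt_avg_LLN\<close>, \<open>pt_avg_CLT_rate\<close>). The second-order condition, made uniform in \<open>x\<close>
(\<open>second_order_uniform_bound\<close>) and used at the deterministic argument \<open>n / k\<close>, shows that the
excess that belongs to the point \<open>u\<close> differs from its limit \<open>zf u = (u powr (- \<gamma>) - 1) / \<gamma>\<close>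
by \<open>O (1 / sqrt k)\<close> times a power of \<open>1 / u\<close> (\<open>exc_close\<close>).

\<^bold>\<open>The limit.\<close> As functions of \<open>u\<close>, the score at \<open>\<theta>0\<close> is \<open>O (u powr (- \<beta>))\<close> and the Hessian is
\<open>O (u powr (- (2 * \<beta>)))\<close> for some \<open>\<beta> < 1 / 2\<close>; this is where \<open>\<gamma> > - 1 / 2\<close> enters. An integration by
parts (\<open>tail_integral_mean_zero\<close>) shows that the score is centred and that the mean of the
Hessian is minus the Gram matrix of the functions \<open>lin h (zf u) * u powr \<gamma>\<close>, which is therefore the
Fisher information and is positive definite.

\<^bold>\<open>Conclusion.\<close> The score at \<open>\<theta>0\<close> is \<open>O (1 / sqrt k)\<close> by the rate above. If \<open>\<theta>\<close> is so close to
\<open>\<theta>0\<close> that \<open>lin \<theta>\<close> and \<open>lin \<theta>0\<close> agree up to a small relative error at all \<open>k\<close> observations,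
the Hessian is close to minus the Fisher information; the smallest point is of order \<open>1 / k\<close>,
and this dictates the radius of the shrinking balls. On a fixed ball the comparison is possible only for the bulk of
the observations; those belonging to small \<open>u\<close> have an upper bound by an integrable function of \<open>u\<close>
(\<open>hess_upper\<close>), so that their contribution is negligible and the Hessian stays negative
definite. For \<open>\<gamma> > 0\<close> the Hessian also has a lower bound (\<open>hess_lower\<close>), and
\<open>quadratic_behaviour_at_maximiser\<close> applies.\<close>

section \<open>Uniform bounds in the second-order condition\<close>

lemma box_cox_1 [simp]: "box_cox \<gamma> 1 = 0"
  by (simp add: box_cox_def)

lemma box_cox_mult:
  assumes "x > 0" "y > 0"
  shows "box_cox \<gamma> (x * y) = box_cox \<gamma> x + x powr \<gamma> * box_cox \<gamma> y"
  using assms by (auto simp: box_cox_def ln_mult powr_mult field_simps)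

lemma box_cox_has_derivative:
  assumes "x > 0"
  shows "(box_cox \<gamma> has_real_derivative x powr (\<gamma> - 1)) (at x)"
proof (cases "\<gamma> = 0")
  case True
  have "box_cox \<gamma> = ln" by (auto simp: box_cox_def True)
  then show ?thesis
    using assms DERIV_ln[OF assms] True by (simp add: powr_minus powr_diff divide_inverse)
next
  case False
  have *: "box_cox \<gamma> = (\<lambda>y. (y powr \<gamma> - 1) / \<gamma>)" by (auto simp: box_cox_def False)
  show ?thesis
    unfolding * using assms False
    by (auto intro!: derivative_eq_intros simp: powr_diff field_simps)
qed

lemma box_cox_strict_mono:
  assumes "0 < x" "x < y"
  shows "box_cox \<gamma> x < box_cox \<gamma> y"
proof (rule DERIV_pos_imp_increasing[OF assms(2)])
  fix z assume "x \<le> z" "z \<le> y"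
  then show "\<exists>d. (box_cox \<gamma> has_real_derivative d) (at z) \<and> 0 < d"
    using assms box_cox_has_derivative[of z \<gamma>] by (intro exI[of _ "z powr (\<gamma> - 1)"]) auto
qed

lemma box_cox_mono: "0 < x \<Longrightarrow> x \<le> y \<Longrightarrow> box_cox \<gamma> x \<le> box_cox \<gamma> y"
  using box_cox_strict_mono[of x y \<gamma>] by (cases "x = y") auto

lemma box_cox_nonneg: "1 \<le> x \<Longrightarrow> 0 \<le> box_cox \<gamma> x"
  using box_cox_mono[of 1 x \<gamma>] by simp

lemma measurable_box_cox [measurable]: "box_cox \<gamma> \<in> borel_measurable borel"
  unfolding box_cox_def by measurable

lemma box_cox_le_powr:
  assumes "\<kappa> > \<gamma>" "\<kappa> \<ge> 0"
  obtains C where "C > 0" "\<And>x. x \<ge> 1 \<Longrightarrow> box_cox \<gamma> x \<le> C * x powr \<kappa>"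
proof (cases "\<gamma> = 0")
  case True
  then have "\<kappa> > 0" using assms by simp
  then have "box_cox \<gamma> x \<le> (1 / \<kappa>) * x powr \<kappa>" if "x \<ge> 1" for x
    using ln_powr_bound[OF that, of \<kappa>] True by (simp add: box_cox_def)
  then show ?thesis using \<open>\<kappa> > 0\<close> that by (meson divide_pos_pos zero_less_one)
next
  case False
  have "box_cox \<gamma> x \<le> (1 / \<bar>\<gamma>\<bar>) * x powr \<kappa>" if "x \<ge> 1" for x
  proof (cases "\<gamma> > 0")
    case True
    have "x powr \<gamma> \<le> x powr \<kappa>" using assms that by (intro powr_mono) auto
    then show ?thesis using True by (simp add: box_cox_def divide_right_mono)
  next
    case neg: False
    then have "\<gamma> < 0" using False by simp
    have "1 \<le> x powr \<kappa>" using assms that by (simp add: ge_one_powr_ge_zero)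
    moreover have "x powr \<gamma> \<ge> 0" by simp
    ultimately have "1 - x powr \<gamma> \<le> x powr \<kappa>" by linarith
    then have "(1 - x powr \<gamma>) / (- \<gamma>) \<le> x powr \<kappa> / (- \<gamma>)"
      using \<open>\<gamma> < 0\<close> by (intro divide_right_mono) auto
    moreover have "box_cox \<gamma> x = (1 - x powr \<gamma>) / (- \<gamma>)"
      using \<open>\<gamma> < 0\<close> by (simp add: box_cox_def field_simps)
    ultimately show ?thesis using \<open>\<gamma> < 0\<close> by simp
  qed
  then show ?thesis using False that by (meson divide_pos_pos zero_less_abs_iff zero_less_one)
qed

text \<open>The uniform boundedness that is behind Egorov's theorem: the sets of points at which some
\<open>f m\<close> exceeds \<open>K\<close> decrease to the empty set as \<open>K\<close> grows.\<close>

lemma convergent_seq_bounded_off_small_set: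
  fixes f :: "nat \<Rightarrow> real \<Rightarrow> real"
  assumes meas: "\<And>m. f m \<in> borel_measurable lebesgue"
    and conv: "\<And>y. y \<in> {c..d} \<Longrightarrow> convergent (\<lambda>m. f m y)" and "e > 0"
  obtains K B where "B \<in> lmeasurable" "measure lebesgue B < e"
    "\<And>m y. y \<in> {c..d} - B \<Longrightarrow> \<bar>f m y\<bar> \<le> K"
proof -
  note [measurable] = meas
  define B where "B K = {c..d} \<inter> (\<Union>m. {y \<in> space lebesgue. \<bar>f m y\<bar> > real K})" for K :: nat
  have Bm: "B K \<in> sets lebesgue" for K
  proof -
    have "{y \<in> space lebesgue. \<bar>f m y\<bar> > real K} \<in> sets lebesgue" for m by measurable
    then show ?thesis unfolding B_def by (intro sets.Int sets.countable_UN) auto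
  qed
  have Bl: "B K \<in> lmeasurable" for K
    by (rule fmeasurableI2[of "{c..d}"]) (use Bm in \<open>auto simp: B_def\<close>)
  have "decseq B"
  proof (unfold decseq_def, safe)
    fix k l :: nat and y assume "k \<le> l" "y \<in> B l"
    then obtain m where "y \<in> {c..d}" "real l < \<bar>f m y\<bar>" by (auto simp: B_def)
    moreover from this \<open>k \<le> l\<close> have "real k < \<bar>f m y\<bar>" by linarith
    ultimately show "y \<in> B k" unfolding B_def by auto
  qed
  have "(\<Inter>K. B K) = {}"
  proof -
    { fix y assume y: "y \<in> {c..d}"
      obtain K where K: "\<And>m. \<bar>f m y\<bar> \<le> K"
        using convergent_imp_Bseq[OF conv[OF y]] by (auto simp: Bseq_def)
      obtain k where "real k \<ge> K" using real_arch_simple by blast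
      then have "\<bar>f m y\<bar> \<le> real k" for m using K[of m] by linarith
      then have "y \<notin> B k" by (simp add: B_def not_less)
      then have "\<exists>k. y \<notin> B k" by blast }
    moreover have "B 0 \<subseteq> {c..d}" by (auto simp: B_def)
    ultimately show ?thesis by blast
  qed
  then have "(\<lambda>K. measure lebesgue (B K)) \<longlonglongrightarrow> 0"
  proof -
    have "(\<lambda>K. measure lebesgue (B K)) \<longlonglongrightarrow> measure lebesgue (\<Inter>K. B K)"
    proof (rule Lim_measure_decseq[OF _ \<open>decseq B\<close>])
      show "emeasure lebesgue (B K) \<noteq> \<infinity>" for K
        using Bl[of K] by (simp only: fmeasurable_def mem_Collect_eq infinity_ennreal_def less_top)
    qed (use Bm in auto)
    then show ?thesis using \<open>(\<Inter>K. B K) = {}\<close> by simp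
  qed
  then have "eventually (\<lambda>K. measure lebesgue (B K) < e) sequentially"
    using \<open>e > 0\<close> by (rule order_tendstoD)
  then obtain K where "measure lebesgue (B K) < e"
    by (auto dest: eventually_happens)
  then show ?thesis
    by (intro that[of "B K" "real K"] Bl) (auto simp: B_def not_less)
qed

text \<open>Dilation by \<open>1 / x\<close> at most doubles the measure of \<open>B1\<close>, so the points \<open>y\<close> with \<open>x * y \<in> B1\<close> or
\<open>y \<in> B2\<close> have total measure less than \<open>3 / 4\<close>.\<close>

lemma exists_point_avoiding_both:
  fixes a x :: real
  assumes "B1 \<in> lmeasurable" "measure lebesgue B1 < 1/4" "B2 \<in> lmeasurable" "measure lebesgue B2 < 1/4"
    and "x \<ge> 1/2"
  obtains y where "y \<in> {a..a + 1}" "x * y \<notin> B1" "y \<notin> B2"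
proof (rule ccontr)
  assume "\<not> thesis"
  with that have *: "\<And>y. y \<in> {a..a+1} \<Longrightarrow> x * y \<in> B1 \<or> y \<in> B2" by blast
  let ?I = "(\<lambda>z. (1 / x) *\<^sub>R z + 0) ` B1"
  have "{a..a+1} \<subseteq> ?I \<union> B2"
  proof
    fix y assume "y \<in> {a..a+1}"
    with *[OF this] \<open>x \<ge> 1/2\<close> show "y \<in> ?I \<union> B2"
      by (auto intro!: image_eqI[of _ _ "x * y"])
  qed
  moreover have I: "?I \<in> lmeasurable"
  proof (rule fmeasurableI)
    have "?I = (*\<^sub>R) x -` B1 \<inter> space lebesgue"
      using \<open>x \<ge> 1/2\<close> by (auto intro!: image_eqI[of _ _ "x * _"])
    then show "?I \<in> sets lebesgue"
      using measurable_sets[OF lebesgue_measurable_scaling, of B1 x] assms(1) by auto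
    have "emeasure lebesgue ?I = \<bar>1 / x\<bar> ^ DIM(real) * emeasure lebesgue B1"
      by (rule emeasure_lebesgue_affine)
    also have "\<dots> < \<infinity>" using assms(1) by (auto simp: fmeasurable_def ennreal_mult_less_top)
    finally show "emeasure lebesgue ?I < \<infinity>" .
  qed
  ultimately have "measure lebesgue {a..a+1} \<le> measure lebesgue (?I \<union> B2)"
    using assms(3) by (intro measure_mono_fmeasurable) auto
  also have "\<dots> \<le> measure lebesgue ?I + measure lebesgue B2"
    using I assms(3) by (intro measure_Un_le) auto
  also have "measure lebesgue ?I = (1/x) * measure lebesgue B1"
    using \<open>x \<ge> 1/2\<close> by (subst measure_lebesgue_affine) auto
  also have "(1/x) * measure lebesgue B1 \<le> 2 * measure lebesgue B1"
    using \<open>x \<ge> 1/2\<close> by (intro mult_right_mono) (auto simp: field_simps)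
  finally show False using assms by simp
qed

lemma measurable_lebesgue_scale:
  fixes L :: "real \<Rightarrow> real"
  assumes "L \<in> borel_measurable lebesgue"
  shows "(\<lambda>y. L (t * y)) \<in> borel_measurable lebesgue"
  using measurable_compose[OF lebesgue_measurable_scaling[of t] assms] by simp

text \<open>The increments of \<open>ln \<bar>A\<bar>\<close> converge pointwise along \<open>t m\<close> and along \<open>t m * x m\<close>. A point \<open>y\<close> that is
good for both sequences bounds \<open>ln \<bar>A (t m * x m)\<bar> - ln \<bar>A (t m)\<bar>\<close>, because this is the difference
of the increments that lead from either argument to \<open>t m * x m * y\<close>.\<close>

lemma regularly_varying_ratio_bounded:
  fixes A :: "real \<Rightarrow> real"
  assumes A0: "\<And>t. t > 0 \<Longrightarrow> A t \<noteq> 0" and rv: "regularly_varying \<rho> A"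
  obtains C t0 where "C > 0" "t0 > 0"
    "\<And>t x. t \<ge> t0 \<Longrightarrow> x \<in> {1/2..2} \<Longrightarrow> \<bar>A (t * x)\<bar> \<le> C * \<bar>A t\<bar>"
proof (rule ccontr)
  assume contra: "\<not> thesis"
  have "\<exists>t x. t \<ge> real m + 1 \<and> x \<in> {1/2..2} \<and> \<bar>A (t * x)\<bar> > exp (real m) * \<bar>A t\<bar>" for m
  proof (rule ccontr)
    assume "\<not> ?thesis"
    then have "\<And>t x. t \<ge> real m + 1 \<Longrightarrow> x \<in> {1/2..2} \<Longrightarrow> \<bar>A (t * x)\<bar> \<le> exp (real m) * \<bar>A t\<bar>"
      by (meson not_le)
    then show False using contra that[of "exp (real m)" "real m + 1"] by auto
  qed
  then obtain t x where t: "\<And>m. t m \<ge> real m + 1" and x: "\<And>m. x m \<in> {1/2..2}"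
    and big: "\<And>m. \<bar>A (t m * x m)\<bar> > exp (real m) * \<bar>A (t m)\<bar>" by metis
  define L where "L s = ln \<bar>indicator {0<..} s * A s\<bar>" for s
  have Lm: "L \<in> borel_measurable lebesgue"
  proof -
    have [measurable]: "(\<lambda>s. indicator {0<..} s * A s) \<in> borel_measurable lebesgue"
      using rv by (simp add: regularly_varying_def set_borel_measurable_def)
    show ?thesis unfolding L_def by measurable
  qed
  have Leq: "L (s * y) - L s = ln \<bar>A (s * y) / A s\<bar>" if "s > 0" "y > 0" for s y
    using that A0[of s] A0[of "s * y"] by (simp add: L_def abs_divide ln_div)
  have conv: "convergent (\<lambda>m. L (s m * y) - L (s m))"
    if "y > 0" and s: "filterlim s at_top sequentially" and s0: "\<And>m. s m > 0" for s y
  proof -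
    have "((\<lambda>u. A (u * y) / A u) \<longlongrightarrow> y powr \<rho>) at_top"
      using rv that by (simp add: regularly_varying_def)
    then have "(\<lambda>m. ln \<bar>A (s m * y) / A (s m)\<bar>) \<longlonglongrightarrow> ln \<bar>y powr \<rho>\<bar>"
      using that by (intro tendsto_ln tendsto_rabs filterlim_compose[OF _ s]) auto
    then show ?thesis
      using Leq[OF s0 \<open>y > 0\<close>] by (auto simp: convergent_def)
  qed
  have tlim: "filterlim t at_top sequentially"
    by (rule filterlim_at_top_mono[OF filterlim_real_sequentially])
       (use t in \<open>auto intro!: always_eventually intro: order_trans[OF _ t]\<close>)
  have t0: "t m > 0" for m using t[of m] by linarith
  have x0: "x m > 0" for m using x[of m] by auto
  have txlim: "filterlim (\<lambda>m. t m * x m) at_top sequentially"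
  proof (rule filterlim_at_top_mono)
    show "filterlim (\<lambda>m. (1/2) * t m) at_top sequentially"
      by (rule filterlim_tendsto_pos_mult_at_top[OF tendsto_const _ tlim]) simp
    show "\<forall>\<^sub>F m in sequentially. 1 / 2 * t m \<le> t m * x m"
      using x t0 by (intro always_eventually allI) (simp add: mult.commute)
  qed
  obtain K1 B1 where 1: "B1 \<in> lmeasurable" "measure lebesgue B1 < 1/4"
    "\<And>m y. y \<in> {1/2..8} - B1 \<Longrightarrow> \<bar>L (t m * y) - L (t m)\<bar> \<le> K1"
  proof (rule convergent_seq_bounded_off_small_set[of "\<lambda>m y. L (t m * y) - L (t m)" "1/2" 8 "1/4"])
    show "(\<lambda>y. L (t m * y) - L (t m)) \<in> borel_measurable lebesgue" for m
      by (intro borel_measurable_diff measurable_lebesgue_scale[OF Lm]) simp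
    show "convergent (\<lambda>m. L (t m * y) - L (t m))" if "y \<in> {1/2..8}" for y
      using that t0 x0 by (intro conv tlim) auto
  qed auto
  obtain K2 B2 where 2: "B2 \<in> lmeasurable" "measure lebesgue B2 < 1/4"
    "\<And>m y. y \<in> {1/2..8} - B2 \<Longrightarrow> \<bar>L (t m * x m * y) - L (t m * x m)\<bar> \<le> K2"
  proof (rule convergent_seq_bounded_off_small_set[of "\<lambda>m y. L (t m * x m * y) - L (t m * x m)" "1/2" 8 "1/4"])
    show "(\<lambda>y. L (t m * x m * y) - L (t m * x m)) \<in> borel_measurable lebesgue" for m
      by (intro borel_measurable_diff measurable_lebesgue_scale[OF Lm]) simp
    show "convergent (\<lambda>m. L (t m * x m * y) - L (t m * x m))" if "y \<in> {1/2..8}" for y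
      using that t0 x0 by (intro conv txlim) auto
  qed auto
  have "real m \<le> K1 + K2" for m
  proof -
    \<comment> \<open>one intermediate argument \<open>t m * x m * y\<close> that both bounds can reach\<close>
    obtain y where y: "y \<in> {1..1+1}" "x m * y \<notin> B1" "y \<notin> B2"
      using exists_point_avoiding_both[OF 1(1,2) 2(1,2), of "x m" 1] x[of m] by auto
    have "1/2 * 1 \<le> x m * y" "x m * y \<le> 2 * 2"
      by (rule mult_mono; use x[of m] y in auto)+
    then have "\<bar>L (t m * (x m * y)) - L (t m)\<bar> \<le> K1" using y by (intro 1(3)) auto
    moreover have "\<bar>L (t m * x m * y) - L (t m * x m)\<bar> \<le> K2" using y by (intro 2(3)) auto
    moreover have "L (t m * x m) - L (t m) > real m"
    proof -
      have "exp (real m) < \<bar>A (t m * x m) / A (t m)\<bar>"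
        using big[of m] A0[OF t0[of m]] by (simp add: abs_divide field_simps)
      then have "real m < ln \<bar>A (t m * x m) / A (t m)\<bar>"
        by (metis exp_gt_zero exp_less_cancel_iff exp_ln less_trans)
      then show ?thesis using Leq[OF t0 x0] by simp
    qed
    ultimately show ?thesis by (simp add: mult.assoc)
  qed
  then show False by (meson not_le reals_Archimedean2)
qed

locale second_order =
  fixes U a A :: "real \<Rightarrow> real" and \<gamma> \<rho> :: real and H :: "real \<Rightarrow> real"
  assumes U_mono: "mono_on {1<..} U"
    and a_pos: "\<And>t. t > 0 \<Longrightarrow> a t > 0"
    and A_nz: "\<And>t. t > 0 \<Longrightarrow> A t \<noteq> 0"
    and first: "\<And>x. x > 0 \<Longrightarrow> ((\<lambda>t. (U (t * x) - U t) / a t) \<longlongrightarrow> box_cox \<gamma> x) at_top"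
    and rv: "regularly_varying \<rho> A" and rho: "\<rho> \<le> 0"
    and second: "\<And>x. x > 0 \<Longrightarrow>
      ((\<lambda>t. ((U (t * x) - U t) / a t - box_cox \<gamma> x) / A t) \<longlongrightarrow> H x) at_top"
begin

text \<open>\<open>R\<close> is the remainder of the second-order condition and \<open>Q\<close> the corresponding remainder of
\<open>a (t * x) / a t\<close>. They are tied together by \<open>R_mult\<close>, the expansion of \<open>U\<close> from \<open>t\<close> to \<open>t * x * y\<close>
in two steps.\<close>

definition D :: "real \<Rightarrow> real \<Rightarrow> real" where "D t x = (U (t * x) - U t) / a t"
definition R :: "real \<Rightarrow> real \<Rightarrow> real" where "R t x = (D t x - box_cox \<gamma> x) / A t"
definition Q :: "real \<Rightarrow> real \<Rightarrow> real" where "Q t x = (a (t * x) / a t - x powr \<gamma>) / A t"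
definition al :: "real \<Rightarrow> real \<Rightarrow> real" where "al t x = (a (t * x) / a t) * (A (t * x) / A t)"

lemma D_lim: "x > 0 \<Longrightarrow> ((\<lambda>t. D t x) \<longlongrightarrow> box_cox \<gamma> x) at_top"
  unfolding D_def by (rule first)

lemma R_lim: "x > 0 \<Longrightarrow> ((\<lambda>t. R t x) \<longlongrightarrow> H x) at_top"
  unfolding R_def D_def by (rule second)

lemma D_mult:
  assumes "t > 0" "x > 0"
  shows "D t (x * y) = D t x + (a (t * x) / a t) * D (t * x) y"
  using a_pos[of t] a_pos[of "t * x"] assms by (simp add: D_def field_simps)

lemma R_mult:
  assumes "t > 0" "x > 0" "y > 0"
  shows "R t (x * y) = R t x + al t x * R (t * x) y + box_cox \<gamma> y * Q t x"
proof -
  have nz: "A t \<noteq> 0" "A (t * x) \<noteq> 0" using A_nz assms by auto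
  have "R t (x * y) - R t x = ((a (t * x) / a t) * D (t * x) y - x powr \<gamma> * box_cox \<gamma> y) / A t"
    unfolding R_def D_mult[OF assms(1,2)] box_cox_mult[OF assms(2,3)]
    by (simp add: diff_divide_distrib add_divide_distrib)
  moreover have "al t x * R (t * x) y = (a (t * x) / a t) * (D (t * x) y - box_cox \<gamma> y) / A t"
    using nz unfolding al_def R_def by simp
  moreover have "box_cox \<gamma> y * Q t x = ((a (t * x) / a t) * box_cox \<gamma> y - x powr \<gamma> * box_cox \<gamma> y) / A t"
    unfolding Q_def by (simp add: algebra_simps)
  ultimately show ?thesis by (simp add: diff_divide_distrib add_divide_distrib algebra_simps)
qed

lemma D_mono:
  assumes "t * x > 1" "t > 0" "x \<le> y"
  shows "D t x \<le> D t y"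
proof -
  have le: "t * x \<le> t * y" using assms by simp
  then have "t * y > 1" using assms by linarith
  with le have "U (t * x) \<le> U (t * y)"
    using assms by (intro mono_onD[OF U_mono]) auto
  then show ?thesis unfolding D_def using a_pos[of t] assms by (intro divide_right_mono) auto
qed

lemma filterlim_mult_at_top: "c > 0 \<Longrightarrow> filterlim (\<lambda>t::real. t * c) at_top at_top"
  using filterlim_tendsto_pos_mult_at_top[OF tendsto_const _ filterlim_ident, of c]
  by (simp add: mult.commute)

lemma a_ratio_lim: "((\<lambda>t. a (t * 2) / a t) \<longlongrightarrow> 2 powr \<gamma>) at_top"
proof -
  have b: "box_cox \<gamma> 2 > 0" using box_cox_strict_mono[of 1 2 \<gamma>] by simp
  have 2: "((\<lambda>t. D (t * 2) 2) \<longlongrightarrow> box_cox \<gamma> 2) at_top"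
    by (rule filterlim_compose[OF D_lim filterlim_mult_at_top]) auto
  then have "((\<lambda>t. (D t (2 * 2) - D t 2) / D (t * 2) 2) \<longlongrightarrow>
      (box_cox \<gamma> (2 * 2) - box_cox \<gamma> 2) / box_cox \<gamma> 2) at_top"
    using b by (intro tendsto_intros D_lim) auto
  also have "(box_cox \<gamma> (2 * 2) - box_cox \<gamma> 2) / box_cox \<gamma> 2 = 2 powr \<gamma>"
    using b by (subst box_cox_mult) auto
  finally show ?thesis
  proof (rule Lim_transform_eventually)
    have "eventually (\<lambda>t. D (t * 2) 2 > 0) at_top"
      by (rule order_tendstoD(1)[OF 2 b])
    then show "eventually (\<lambda>t. (D t (2 * 2) - D t 2) / D (t * 2) 2 = a (t * 2) / a t) at_top"
      using eventually_gt_at_top[of 0]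
    proof eventually_elim
      case (elim t)
      then show ?case using D_mult[of t 2 2] by simp
    qed
  qed
qed

text \<open>Monotonicity of \<open>D t\<close> bounds \<open>D t (x * 2) - D t x\<close>, uniformly in \<open>x\<close>, by an increment over the fixed
interval \<open>{1/2..4}\<close>; this quantity is the ratio times \<open>D (t * x) 2\<close>, which stays away from \<open>0\<close>.\<close>

lemma a_ratio_bounded:
  obtains C t0 where "C > 0" "\<And>t x. t \<ge> t0 \<Longrightarrow> x \<in> {1/2..2} \<Longrightarrow> a (t * x) / a t \<le> C"
proof -
  define b where "b = box_cox \<gamma> 2"
  have b: "b > 0" using box_cox_strict_mono[of 1 2 \<gamma>] by (simp add: b_def)
  define c where "c = box_cox \<gamma> 4 - box_cox \<gamma> (1/2) + 1"
  have c: "c > 0" using box_cox_mono[of "1/2" 4 \<gamma>] by (simp add: c_def)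
  have "((\<lambda>t. D t 4 - D t (1/2)) \<longlongrightarrow> box_cox \<gamma> 4 - box_cox \<gamma> (1/2)) at_top"
    by (intro tendsto_intros D_lim) auto
  then have "eventually (\<lambda>t. D t 4 - D t (1/2) < c) at_top"
    by (rule order_tendstoD) (simp add: c_def)
  moreover have "eventually (\<lambda>t. D t 2 > b / 2) at_top"
    by (rule order_tendstoD(1)[OF D_lim]) (use b in \<open>auto simp: b_def\<close>)
  ultimately have "eventually (\<lambda>t. D t 4 - D t (1/2) < c \<and> D t 2 > b / 2) at_top"
    by (rule eventually_conj)
  then obtain t1 where t1: "\<And>t. t \<ge> t1 \<Longrightarrow> D t 4 - D t (1/2) < c \<and> D t 2 > b / 2"
    by (auto simp: eventually_at_top_linorder)
  show ?thesis
  proof (rule that[of "c / (b/2)" "max (2 * \<bar>t1\<bar>) 3"])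
    show "0 < c / (b/2)" using b c by simp
    fix t x assume t: "t \<ge> max (2 * \<bar>t1\<bar>) 3" and x: "x \<in> {1/2..2::real}"
    have "t * x \<ge> t * (1/2)" using x t by (intro mult_left_mono) auto
    moreover have "t \<ge> 3" "t \<ge> 2 * t1" using t by auto
    ultimately have tx: "t * x \<ge> t1" "t * x > 1" by linarith+
    have "(a (t * x) / a t) * D (t * x) 2 = D t (x * 2) - D t x"
      using D_mult[of t x 2] t x by simp
    also have "\<dots> \<le> D t 4 - D t (1/2)"
      using D_mono[of t "x * 2" 4] D_mono[of t "1/2" x] t x tx by auto
    also have "\<dots> \<le> c" using t1[of t] t by (simp add: less_imp_le)
    finally have le: "(a (t * x) / a t) * D (t * x) 2 \<le> c" .
    have "(a (t * x) / a t) * (b/2) \<le> (a (t * x) / a t) * D (t * x) 2"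
      using t1[OF tx(1)] a_pos[of t] a_pos[of "t * x"] t tx by (intro mult_left_mono) auto
    from this le have "(a (t * x) / a t) * (b/2) \<le> c" by (rule order_trans)
    moreover have "b / 2 > 0" using b by simp
    ultimately show "a (t * x) / a t \<le> c / (b/2)"
      by (simp only: pos_le_divide_eq)
  qed
qed

lemma convergent_along:
  assumes "filterlim s at_top sequentially" "y > 0"
  shows "convergent (\<lambda>m. R (s m) y)"
  using filterlim_compose[OF R_lim[OF assms(2)] assms(1)] by (auto simp: convergent_def)

text \<open>The truncation keeps the argument of \<open>U\<close> in \<open>{1<..}\<close>, where \<open>U\<close> is monotone.\<close>

lemma measurable_R:
  assumes "t \<ge> 3"
  shows "(\<lambda>y. R t (max (1/2) y)) \<in> borel_measurable lebesgue"
proof -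
  have "mono (\<lambda>y. U (t * max (1/2) y))"
  proof (rule monoI)
    fix x y :: real assume "x \<le> y"
    have "t * max (1/2) x \<le> t * max (1/2) y" using \<open>x \<le> y\<close> assms by (intro mult_left_mono) auto
    moreover have "t * max (1/2) x \<ge> t * (1/2)" "t * max (1/2) y \<ge> t * (1/2)"
      using assms by (intro mult_left_mono; simp)+
    moreover have "t * (1/2) > 1" using assms by simp
    ultimately show "U (t * max (1/2) x) \<le> U (t * max (1/2) y)"
      by (intro mono_onD[OF U_mono] iffD2[OF greaterThan_iff]) linarith+
  qed
  then have [measurable]: "(\<lambda>y. U (t * max (1/2) y)) \<in> borel_measurable borel"
    by (rule borel_measurable_mono)
  have "(\<lambda>y. R t (max (1/2) y)) \<in> borel_measurable lborel"
    unfolding R_def D_def by measurable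
  then show ?thesis by (rule measurable_completion)
qed

text \<open>Pointwise convergence of \<open>R t\<close> already forces a bound that is uniform on \<open>{1/2..2}\<close>. Along a
  sequence violating it, pointwise limits are bounded off a small set, so there are two points
  \<open>y\<close> at which all terms of \<open>R_mult\<close> except \<open>R t x\<close> and \<open>Q t x\<close> are bounded; these two linear
  relations in the two unknowns bound \<open>R t x\<close>.\<close>

lemma R_locally_bounded:
  obtains C t0 where "C > 0" "t0 > 0" "\<And>t x. t \<ge> t0 \<Longrightarrow> x \<in> {1/2..2} \<Longrightarrow> \<bar>R t x\<bar> \<le> C"
proof (rule ccontr)
  assume contra: "\<not> thesis"
  obtain Ca ta where Ca: "Ca > 0" "\<And>t x. t \<ge> ta \<Longrightarrow> x \<in> {1/2..2} \<Longrightarrow> a (t * x) / a t \<le> Ca"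
    using a_ratio_bounded by blast
  obtain CA tA where CA: "CA > 0" "tA > 0"
    "\<And>t x. t \<ge> tA \<Longrightarrow> x \<in> {1/2..2} \<Longrightarrow> \<bar>A (t * x)\<bar> \<le> CA * \<bar>A t\<bar>"
    using regularly_varying_ratio_bounded[OF A_nz rv] by blast
  define t1 where "t1 = max ta tA + 6"
  define T where "T m = max t1 6 + real m" for m :: nat
  have "\<exists>t x. t \<ge> T m \<and> x \<in> {1/2..2} \<and> \<bar>R t x\<bar> > real m + 1" for m
  proof (rule ccontr)
    assume "\<not> ?thesis"
    then have "\<And>t x. t \<ge> T m \<Longrightarrow> x \<in> {1/2..2} \<Longrightarrow> \<bar>R t x\<bar> \<le> real m + 1"
      by (meson not_le)
    moreover have "T m > 0" by (auto simp: T_def)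
    ultimately show False using contra that[of "real m + 1" "T m"] by (meson add_nonneg_pos of_nat_0_le_iff zero_less_one)
  qed
  then obtain t x where t: "\<And>m. t m \<ge> T m" and x: "\<And>m. x m \<in> {1/2..2}"
    and big: "\<And>m. \<bar>R (t m) (x m)\<bar> > real m + 1" by metis
  have tm: "t m \<ge> 6" "t m \<ge> ta" "t m \<ge> tA" "t m \<ge> real m" for m
    using t[of m] by (auto simp: T_def t1_def)
  have t0: "t m > 0" for m using tm(1)[of m] by linarith
  have x0: "x m > 0" for m using x[of m] by auto
  have tlim: "filterlim t at_top sequentially"
    by (rule filterlim_at_top_mono[OF filterlim_real_sequentially]) (use tm in auto)
  have txge: "t m * x m \<ge> 1/2 * t m" for m
    using x[of m] t0[of m] by (simp add: mult.commute)
  have txlim: "filterlim (\<lambda>m. t m * x m) at_top sequentially"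
  proof (rule filterlim_at_top_mono)
    show "filterlim (\<lambda>m. (1/2) * t m) at_top sequentially"
      by (rule filterlim_tendsto_pos_mult_at_top[OF tendsto_const _ tlim]) simp
    show "\<forall>\<^sub>F m in sequentially. 1 / 2 * t m \<le> t m * x m"
      using txge by (intro always_eventually allI)
  qed
  have txm: "t m * x m \<ge> 3" for m using txge[of m] tm(1)[of m] by linarith
  obtain K1 B1 where 1: "B1 \<in> lmeasurable" "measure lebesgue B1 < 1/4"
    "\<And>m y. y \<in> {1/2..8} - B1 \<Longrightarrow> \<bar>R (t m) (max (1/2) y)\<bar> \<le> K1"
  proof (rule convergent_seq_bounded_off_small_set[of "\<lambda>m y. R (t m) (max (1/2) y)" "1/2" 8 "1/4"])
    show "(\<lambda>y. R (t m) (max (1/2) y)) \<in> borel_measurable lebesgue" for m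
      by (rule measurable_R) (use tm(1)[of m] in linarith)
  qed (use convergent_along[OF tlim] in auto)
  obtain K2 B2 where 2: "B2 \<in> lmeasurable" "measure lebesgue B2 < 1/4"
    "\<And>m y. y \<in> {1/2..8} - B2 \<Longrightarrow> \<bar>R (t m * x m) (max (1/2) y)\<bar> \<le> K2"
  proof (rule convergent_seq_bounded_off_small_set[of "\<lambda>m y. R (t m * x m) (max (1/2) y)" "1/2" 8 "1/4"])
    show "(\<lambda>y. R (t m * x m) (max (1/2) y)) \<in> borel_measurable lebesgue" for m
      by (rule measurable_R) (use txm[of m] in linarith)
  qed (use convergent_along[OF txlim] in auto)
  \<comment> \<open>\<open>d\<close> separates the coefficients of \<open>Q\<close> at a point of \<open>{1..2}\<close> and at a point of \<open>{3..4}\<close>\<close>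
  define d where "d = box_cox \<gamma> 3 - box_cox \<gamma> 2"
  have d: "d > 0" using box_cox_strict_mono[of 2 3 \<gamma>] by (simp add: d_def)
  define K where "K = K1 + Ca * CA * K2"
  have rel: "\<bar>R (t m) (x m) + box_cox \<gamma> y * Q (t m) (x m)\<bar> \<le> K"
    if y: "y \<in> {1..4}" "x m * y \<notin> B1" "y \<notin> B2" for m y
  proof -
    have "1/2 * 1 \<le> x m * y" "x m * y \<le> 2 * 4"
      by (rule mult_mono; use x[of m] y in auto)+
    then have a1: "\<bar>R (t m) (x m * y)\<bar> \<le> K1" using 1(3)[of "x m * y" m] y by (simp add: max_def)
    have a2: "\<bar>R (t m * x m) y\<bar> \<le> K2" using 2(3)[of y m] y by (simp add: max_def)
    have "\<bar>al (t m) (x m)\<bar> = (a (t m * x m) / a (t m)) * \<bar>A (t m * x m) / A (t m)\<bar>"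
      using a_pos[of "t m"] a_pos[of "t m * x m"] t0 x0 by (simp add: al_def abs_mult)
    also have "\<dots> \<le> Ca * CA"
    proof (rule mult_mono)
      show "a (t m * x m) / a (t m) \<le> Ca" using Ca(2)[OF tm(2) x] .
      show "\<bar>A (t m * x m) / A (t m)\<bar> \<le> CA"
        using CA(3)[OF tm(3) x, of m m] A_nz[OF t0[of m]] by (simp add: abs_divide field_simps)
    qed (use Ca in auto)
    finally have "\<bar>al (t m) (x m)\<bar> \<le> Ca * CA" .
    then have "\<bar>al (t m) (x m) * R (t m * x m) y\<bar> \<le> Ca * CA * K2"
      unfolding abs_mult using a2 Ca CA by (intro mult_mono) auto
    then show ?thesis
      using a1 R_mult[OF t0 x0, of y m m] y unfolding K_def by auto
  qed
  have "real m + 1 \<le> K + box_cox \<gamma> 2 * (2 * K / d)" for m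
  proof -
    obtain y1 where y1: "y1 \<in> {1..1+1}" "x m * y1 \<notin> B1" "y1 \<notin> B2"
      using exists_point_avoiding_both[OF 1(1,2) 2(1,2), of "x m" 1] x[of m] by auto
    obtain y2 where y2: "y2 \<in> {3..3+1}" "x m * y2 \<notin> B1" "y2 \<notin> B2"
      using exists_point_avoiding_both[OF 1(1,2) 2(1,2), of "x m" 3] x[of m] by auto
    let ?q = "Q (t m) (x m)" and ?b1 = "box_cox \<gamma> y1" and ?b2 = "box_cox \<gamma> y2"
    have r1: "\<bar>R (t m) (x m) + ?b1 * ?q\<bar> \<le> K" and r2: "\<bar>R (t m) (x m) + ?b2 * ?q\<bar> \<le> K"
      using rel y1 y2 by auto
    have b: "0 \<le> ?b1" "?b1 \<le> box_cox \<gamma> 2" "box_cox \<gamma> 3 \<le> ?b2"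
      using y1 y2 box_cox_nonneg[of y1 \<gamma>] box_cox_mono[of y1 2 \<gamma>] box_cox_mono[of 3 y2 \<gamma>] by auto
    have "d * \<bar>?q\<bar> \<le> (?b2 - ?b1) * \<bar>?q\<bar>" using b by (intro mult_right_mono) (auto simp: d_def)
    also have "\<dots> = \<bar>(?b2 - ?b1) * ?q\<bar>" using b d by (simp add: abs_mult d_def)
    also have "\<dots> \<le> 2 * K" using r1 r2 by (simp add: left_diff_distrib)
    finally have q: "\<bar>?q\<bar> \<le> 2 * K / d" using d by (simp add: field_simps)
    have "\<bar>?b1 * ?q\<bar> \<le> box_cox \<gamma> 2 * (2 * K / d)"
      unfolding abs_mult using b q by (intro mult_mono) auto
    then show ?thesis using r1 big[of m] by linarith
  qed
  then show False by (meson add_le_imp_le_left add_increasing2 dual_order.trans le_add_same_cancel1 not_le reals_Archimedean2 zero_le_one)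
qed

text \<open>A Potter-type bound. By \<open>R_mult\<close>, passing from \<open>z\<close> to \<open>2 * z\<close> multiplies the remainder by \<open>al t 2\<close> and
adds \<open>O (z powr \<kappa>)\<close>. Since \<open>al t 2\<close> tends to \<open>2 powr (\<gamma> + \<rho>) < 2 powr \<kappa>\<close>, a bound
\<open>K * x powr \<kappa>\<close> with large \<open>K\<close> survives each doubling.\<close>

lemma second_order_uniform_bound:
  assumes \<kappa>: "\<kappa> > \<gamma>" "\<kappa> \<ge> 0"
  obtains C t0 where "C > 0" "t0 > 0"
    "\<And>t x. t \<ge> t0 \<Longrightarrow> x \<ge> 1/2 \<Longrightarrow> \<bar>D t x - box_cox \<gamma> x\<bar> \<le> C * \<bar>A t\<bar> * x powr \<kappa>"
proof -
  obtain C1 t1 where C1: "C1 > 0" "t1 > 0" "\<And>t x. t \<ge> t1 \<Longrightarrow> x \<in> {1/2..2} \<Longrightarrow> \<bar>R t x\<bar> \<le> C1"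
    using R_locally_bounded by blast
  obtain C3 where C3: "C3 > 0" "\<And>x. x \<ge> 1 \<Longrightarrow> box_cox \<gamma> x \<le> C3 * x powr \<kappa>"
    using box_cox_le_powr[OF \<kappa>] by blast
  have b2: "box_cox \<gamma> 2 > 0" using box_cox_strict_mono[of 1 2 \<gamma>] by simp
  have alim: "((\<lambda>t. al t 2) \<longlongrightarrow> 2 powr \<gamma> * 2 powr \<rho>) at_top"
    unfolding al_def using rv by (intro tendsto_intros a_ratio_lim) (auto simp: regularly_varying_def)
  \<comment> \<open>a number strictly between the limit of \<open>al t 2\<close> and \<open>2 powr \<kappa>\<close>\<close>
  define b where "b = 2 powr ((\<gamma> + \<kappa>) / 2)"
  have "2 powr \<gamma> * 2 powr \<rho> < b"
  proof -
    have "2 powr \<gamma> * 2 powr \<rho> \<le> 2 powr \<gamma>" using rho by (simp add: powr_add[symmetric])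
    also have "\<dots> < b" unfolding b_def using \<kappa> by (intro powr_less_mono) auto
    finally show ?thesis .
  qed
  then have ev1: "eventually (\<lambda>t. al t 2 < b) at_top" by (rule order_tendstoD(2)[OF alim])
  have ev1': "eventually (\<lambda>t. al t 2 > -b) at_top"
    by (rule order_tendstoD(1)[OF alim]) (auto simp: b_def intro: less_trans[of _ 0])
  define q where "q = (H 4 - H 2 - 2 powr \<gamma> * 2 powr \<rho> * H 2) / box_cox \<gamma> 2"
  have Rlim2: "((\<lambda>t. R (t * 2) 2) \<longlongrightarrow> H 2) at_top"
    by (rule filterlim_compose[OF R_lim filterlim_mult_at_top]) auto
  have "((\<lambda>t. (R t 4 - R t 2 - al t 2 * R (t * 2) 2) / box_cox \<gamma> 2) \<longlongrightarrow> q) at_top"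
    unfolding q_def using b2 by (intro tendsto_intros R_lim alim Rlim2) auto
  then have "((\<lambda>t. Q t 2) \<longlongrightarrow> q) at_top"
  proof (rule Lim_transform_eventually)
    show "eventually (\<lambda>t. (R t 4 - R t 2 - al t 2 * R (t * 2) 2) / box_cox \<gamma> 2 = Q t 2) at_top"
      using eventually_gt_at_top[of 0]
    proof eventually_elim
      case (elim t)
      then show ?case using R_mult[of t 2 2] b2 by (simp add: field_simps)
    qed
  qed
  then have ev2: "eventually (\<lambda>t. \<bar>Q t 2\<bar> < \<bar>q\<bar> + 1) at_top"
    by (intro order_tendstoD(2)[OF tendsto_rabs]) auto
  obtain t2 where t2: "\<And>t. t \<ge> t2 \<Longrightarrow> \<bar>al t 2\<bar> \<le> b \<and> \<bar>Q t 2\<bar> \<le> \<bar>q\<bar> + 1"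
    using eventually_conj[OF ev1 eventually_conj[OF ev1' ev2]]
    unfolding eventually_at_top_linorder by (auto simp: abs_le_iff) (metis less_imp_le abs_le_iff minus_le_iff)
  define C2 where "C2 = \<bar>q\<bar> + 1"
  define t0 where "t0 = max t1 t2"
  define B where "B = (2::real) powr \<kappa>"
  have bB: "0 < b" "b < B" unfolding b_def B_def using \<kappa> by auto
  have B1: "B \<ge> 1" unfolding B_def using \<kappa> by (simp add: ge_one_powr_ge_zero)
  \<comment> \<open>the second entry makes \<open>K * 2 powr \<kappa>\<close> absorb \<open>K * b\<close> plus the constants of one doubling step\<close>
  define K where "K = max C1 ((C1 + C2 * C3) / (B - b))"
  have "(C1 + C2 * C3) / (B - b) \<le> K" by (simp add: K_def)
  then have K3: "K * (B - b) \<ge> C1 + C2 * C3" using bB by (simp add: pos_divide_le_eq)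
  have K1: "K \<ge> C1" by (simp add: K_def)
  have "K > 0" using K1 C1 by linarith
  note K = K1 this K3
  have main: "\<forall>t\<ge>t0. \<forall>x\<in>{1..2 ^ Suc m}. \<bar>R t x\<bar> \<le> K * x powr \<kappa>" for m
  proof (induction m)
    case 0
    show ?case
    proof (intro allI ballI impI)
      fix t x assume "t \<ge> t0" and x: "x \<in> {1..2 ^ Suc 0 :: real}"
      then have "\<bar>R t x\<bar> \<le> C1" by (intro C1) (auto simp: t0_def)
      also have "\<dots> \<le> K * 1" using K by simp
      also have "\<dots> \<le> K * x powr \<kappa>"
        using K x \<kappa> by (intro mult_left_mono) (auto simp: ge_one_powr_ge_zero)
      finally show "\<bar>R t x\<bar> \<le> K * x powr \<kappa>" .
    qed
  next
    case (Suc m)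
    show ?case
    proof (intro allI ballI impI)
      fix t x assume t: "t \<ge> t0" and x: "x \<in> {1..2 ^ Suc (Suc m) :: real}"
      show "\<bar>R t x\<bar> \<le> K * x powr \<kappa>"
      proof (cases "x \<le> 2")
        case True
        then have "x \<in> {1..2 ^ Suc m}" using x by (auto intro: order_trans)
        then show ?thesis using Suc t by blast
      next
        case False
        define z where "z = x / 2"
        have z: "z \<in> {1..2 ^ Suc m}" "x = 2 * z" using x False by (auto simp: z_def)
        define s where "s = z powr \<kappa>"
        have s: "s \<ge> 1" using z \<kappa> by (auto simp: s_def ge_one_powr_ge_zero)
        have t': "t > 0" "t * 2 \<ge> t0" "t \<ge> t2" "t \<ge> t1" using t C1 by (auto simp: t0_def)
        have "\<bar>R (t * 2) z\<bar> \<le> K * s" using Suc t'(2) z unfolding s_def by blast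
        then have "\<bar>al t 2 * R (t * 2) z\<bar> \<le> b * (K * s)"
          unfolding abs_mult using t2[OF t'(3)] bB by (intro mult_mono) auto
        moreover have "\<bar>box_cox \<gamma> z * Q t 2\<bar> \<le> (C3 * s) * C2"
          unfolding abs_mult using t2[OF t'(3)] C3 z box_cox_nonneg[of z \<gamma>]
          by (intro mult_mono) (auto simp: s_def C2_def)
        moreover have "\<bar>R t 2\<bar> \<le> C1" by (rule C1) (use t' in auto)
        moreover have "R t x = R t 2 + al t 2 * R (t * 2) z + box_cox \<gamma> z * Q t 2"
          unfolding z(2) by (rule R_mult) (use t' z in auto)
        ultimately have "\<bar>R t x\<bar> \<le> C1 * 1 + b * (K * s) + (C3 * s) * C2" by linarith
        also have "\<dots> \<le> C1 * s + b * (K * s) + (C3 * s) * C2"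
          using C1 s by (intro add_right_mono mult_left_mono) auto
        also have "\<dots> = (C1 + C2 * C3 + K * b) * s" by (simp add: algebra_simps)
        also have "\<dots> \<le> (K * B) * s" using K s by (intro mult_right_mono) (auto simp: algebra_simps)
        also have "\<dots> = K * x powr \<kappa>" using z by (simp add: s_def B_def powr_mult)
        finally show ?thesis .
      qed
    qed
  qed
  have all: "\<bar>R t x\<bar> \<le> (K * B) * x powr \<kappa>" if t: "t \<ge> t0" and x: "x \<ge> 1/2" for t x
  proof (cases "x \<ge> 1")
    case True
    obtain m where "x < 2 ^ m" using real_arch_pow[of 2 x] by auto
    then have "x \<in> {1..2 ^ Suc m}" using True by auto
    then have "\<bar>R t x\<bar> \<le> K * x powr \<kappa>" using main t by blast
    also have "\<dots> \<le> (K * B) * x powr \<kappa>" using K B1 by (intro mult_right_mono) auto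
    finally show ?thesis .
  next
    case False
    then have "\<bar>R t x\<bar> \<le> C1" using x t by (intro C1) (auto simp: t0_def)
    also have "\<dots> \<le> K * 1" using K by simp
    also have "\<dots> \<le> K * (2 * x) powr \<kappa>"
      using x K \<kappa> by (intro mult_left_mono ge_one_powr_ge_zero) auto
    also have "\<dots> = (K * B) * x powr \<kappa>" using x by (simp add: B_def powr_mult)
    finally show ?thesis .
  qed
  show ?thesis
  proof (rule that[of "K * B" t0])
    show "K * B > 0" using K B1 by simp
    show "t0 > 0" using C1 by (simp add: t0_def)
    fix t x assume tx: "t \<ge> t0" "x \<ge> (1/2::real)"
    have "A t \<noteq> 0" using tx C1 by (intro A_nz) (auto simp: t0_def)
    then have "\<bar>D t x - box_cox \<gamma> x\<bar> = \<bar>A t\<bar> * \<bar>R t x\<bar>" by (simp add: R_def abs_divide)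
    also have "\<dots> \<le> \<bar>A t\<bar> * ((K * B) * x powr \<kappa>)" using all[OF tx] by (intro mult_left_mono) auto
    finally show "\<bar>D t x - box_cox \<gamma> x\<bar> \<le> K * B * \<bar>A t\<bar> * x powr \<kappa>" by (simp add: mult_ac)
  qed
qed

end

section \<open>The log-likelihood and its derivatives in integral form\<close>

text \<open>Parameters and directions alike are read as affine functions of the observation: \<open>lin \<theta> z\<close> is the
denominator \<open>\<sigma> + \<gamma> * z\<close>, and \<open>lin h\<close> is its derivative in the direction \<open>h\<close>.\<close>

definition lin :: "real^2 \<Rightarrow> real \<Rightarrow> real" where
  "lin h r = h $ 2 + h $ 1 * r"

text \<open>The term \<open>ln (1 + \<gamma> * z / \<sigma>) / \<gamma>\<close> of the log-likelihood is written as the integral of \<open>1 / lin \<theta>\<close>, which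
is smooth in \<open>\<theta>\<close> across \<open>\<gamma> = 0\<close>.\<close>

definition llik :: "real^2 \<Rightarrow> real \<Rightarrow> real" where
  "llik \<theta> z = - ln (lin \<theta> z) - integral {0..z} (\<lambda>r. 1 / lin \<theta> r)"

definition llik_D1 :: "real^2 \<Rightarrow> real^2 \<Rightarrow> real \<Rightarrow> real" where
  "llik_D1 \<theta> h z = - (lin h z / lin \<theta> z) + integral {0..z} (\<lambda>r. lin h r / (lin \<theta> r)\<^sup>2)"

definition llik_D2 :: "real^2 \<Rightarrow> real^2 \<Rightarrow> real^2 \<Rightarrow> real \<Rightarrow> real" where
  "llik_D2 \<theta> h h' z = lin h z * lin h' z / (lin \<theta> z)\<^sup>2
     - 2 * integral {0..z} (\<lambda>r. lin h r * lin h' r / (lin \<theta> r) ^ 3)"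

lemma lin_0 [simp]: "lin h 0 = h $ 2"
  by (simp add: lin_def)

lemma lin_add_scaleR: "lin (\<theta> + t *\<^sub>R h) r = lin \<theta> r + t * lin h r"
  by (simp add: lin_def algebra_simps)

lemma continuous_on_lin [continuous_intros]: "continuous_on S f \<Longrightarrow> continuous_on S (\<lambda>x. lin h (f x))"
  unfolding lin_def by (intro continuous_intros)

lemma lin_has_derivative: "(lin h has_real_derivative h $ 1) (at r within S)"
  unfolding lin_def by (auto intro!: derivative_eq_intros)

lemma abs_lin_le:
  assumes "r \<ge> 0"
  shows "\<bar>lin h r\<bar> \<le> (1 + r) * norm h"
proof -
  have "\<bar>lin h r\<bar> \<le> \<bar>h $ 2\<bar> + \<bar>h $ 1\<bar> * r"
    unfolding lin_def using assms by (intro order_trans[OF abs_triangle_ineq]) (simp add: abs_mult)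
  also have "\<dots> \<le> norm h + norm h * r"
    using assms component_le_norm_cart[of h] by (intro add_mono mult_right_mono) auto
  finally show ?thesis by (simp add: algebra_simps)
qed

lemma lin_pos_between:
  assumes "\<theta> $ 2 > 0" "lin \<theta> z > 0" "0 \<le> r" "r \<le> z"
  shows "lin \<theta> r > 0"
proof (cases "\<theta> $ 1 \<ge> 0")
  case True
  then have "0 \<le> \<theta> $ 1 * r" using assms by simp
  then show ?thesis using assms by (simp add: lin_def)
next
  case False
  then have "\<theta> $ 1 * z \<le> \<theta> $ 1 * r" using assms by (intro mult_left_mono_neg) auto
  then show ?thesis using assms by (simp add: lin_def)
qed

lemma continuous_on_ratio:
  assumes "\<theta> $ 2 > 0" "lin \<theta> z > 0"
  shows "continuous_on {0..z} (\<lambda>r. lin h r * lin h' r / (lin \<theta> r) ^ m)"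
    "continuous_on {0..z} (\<lambda>r. lin h r / (lin \<theta> r) ^ m)"
    "continuous_on {0..z} (\<lambda>r. 1 / lin \<theta> r)"
proof -
  have "\<forall>r\<in>{0..z}. lin \<theta> r \<noteq> 0" using lin_pos_between[OF assms] by fastforce
  then show "continuous_on {0..z} (\<lambda>r. lin h r * lin h' r / (lin \<theta> r) ^ m)"
    "continuous_on {0..z} (\<lambda>r. lin h r / (lin \<theta> r) ^ m)"
    "continuous_on {0..z} (\<lambda>r. 1 / lin \<theta> r)"
    by (auto intro!: continuous_intros)
qed

lemma gp_loglik_eq:
  assumes "\<theta> $ 2 > 0" "z \<ge> 0"
  shows "gp_loglik \<theta> z = (if lin \<theta> z > 0 then ereal (llik \<theta> z) else - \<infinity>)"
proof -
  let ?g = "\<theta> $ 1" and ?s = "\<theta> $ 2"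
  have w: "1 + ?g * z / ?s = lin \<theta> z / ?s" using assms by (simp add: lin_def field_simps)
  have pos: "1 + ?g * z / ?s > 0 \<longleftrightarrow> lin \<theta> z > 0" using assms by (simp add: w zero_less_divide_iff)
  have "- ln ?s - (if ?g = 0 then z / ?s else (1 + 1 / ?g) * ln (1 + ?g * z / ?s)) = llik \<theta> z"
    if lz: "lin \<theta> z > 0"
  proof (cases "?g = 0")
    case True
    then show ?thesis using assms by (simp add: llik_def lin_def)
  next
    case False
    have "((\<lambda>r. 1 / lin \<theta> r) has_integral ln (lin \<theta> z) / ?g - ln (lin \<theta> 0) / ?g) {0..z}"
    proof (rule fundamental_theorem_of_calculus[OF assms(2)])
      fix r assume "r \<in> {0..z}"
      then have "lin \<theta> r > 0" using lin_pos_between[OF assms(1) lz] by simp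
      then show "((\<lambda>r. ln (lin \<theta> r) / ?g) has_vector_derivative 1 / lin \<theta> r) (at r within {0..z})"
        unfolding has_real_derivative_iff_has_vector_derivative[symmetric]
        using False by (auto intro!: derivative_eq_intros lin_has_derivative)
    qed
    then have "integral {0..z} (\<lambda>r. 1 / lin \<theta> r) = ln (lin \<theta> z) / ?g - ln ?s / ?g"
      by (simp add: integral_unique)
    then show ?thesis
      using False assms lz unfolding llik_def w by (simp add: ln_div field_simps)
  qed
  then show ?thesis unfolding gp_loglik_def Let_def pos by simp
qed

lemma eventually_lin_pos:
  assumes "lin \<theta> r + t0 * lin h r > 0"
  shows "eventually (\<lambda>t. lin \<theta> r + t * lin h r > 0) (nhds t0)"
proof -
  have "isCont (\<lambda>t. lin \<theta> r + t * lin h r) t0" by (intro continuous_intros)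
  then show ?thesis using assms
    by (intro order_tendstoD(1)[of _ "lin \<theta> r + t0 * lin h r"])
       (simp_all add: continuous_at tendsto_nhds_iff isCont_def)
qed

text \<open>With \<open>p = 1\<close> and \<open>p = lin h\<close> this differentiates the integrals in \<open>llik\<close> and \<open>llik_D1\<close>.\<close>

lemma leibniz_ratio:
  fixes p :: "real \<Rightarrow> real"
  assumes p: "continuous_on {0..z} p" and z: "z \<ge> 0"
    and pos: "lin (\<theta> + t0 *\<^sub>R h) 0 > 0" "lin (\<theta> + t0 *\<^sub>R h) z > 0"
  shows "((\<lambda>t. integral {0..z} (\<lambda>r. p r / (lin (\<theta> + t *\<^sub>R h) r) ^ m)) has_real_derivative
      integral {0..z} (\<lambda>r. - (real m * p r * lin h r / (lin (\<theta> + t0 *\<^sub>R h) r) ^ Suc m))) (at t0)"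
proof -
  have "eventually (\<lambda>t. lin \<theta> 0 + t * lin h 0 > 0 \<and> lin \<theta> z + t * lin h z > 0) (nhds t0)"
    using pos unfolding lin_add_scaleR by (intro eventually_conj eventually_lin_pos)
  then obtain e where e: "e > 0" "\<And>t. dist t t0 < e \<Longrightarrow> lin (\<theta> + t *\<^sub>R h) 0 > 0 \<and> lin (\<theta> + t *\<^sub>R h) z > 0"
    unfolding eventually_nhds_metric lin_add_scaleR by blast
  have W: "lin \<theta> r + t * lin h r > 0" if "t \<in> ball t0 e" "r \<in> {0..z}" for t r
    using lin_pos_between[of "\<theta> + t *\<^sub>R h" z r] e(2)[of t] that
    by (simp add: lin_add_scaleR dist_commute)
  have "((\<lambda>t. integral (cbox 0 z) (\<lambda>r. p r / (lin (\<theta> + t *\<^sub>R h) r) ^ m)) has_field_derivative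
      integral (cbox 0 z) (\<lambda>r. - (real m * p r * lin h r / (lin (\<theta> + t0 *\<^sub>R h) r) ^ Suc m))) (at t0 within ball t0 e)"
  proof (rule leibniz_rule_field_derivative)
    fix t r assume tr: "t \<in> ball t0 e" "r \<in> cbox 0 z"
    then have pos: "lin \<theta> r + t * lin h r \<noteq> 0" using W[of t r] by auto
    show "((\<lambda>t. p r / (lin (\<theta> + t *\<^sub>R h) r) ^ m) has_field_derivative
      - (real m * p r * lin h r / (lin (\<theta> + t *\<^sub>R h) r) ^ Suc m)) (at t within ball t0 e)"
    proof (cases m)
      case 0 then show ?thesis by simp
    next
      case (Suc l)
      let ?X = "lin \<theta> r + t * lin h r"
      have "((\<lambda>t. p r * inverse ((lin \<theta> r + t * lin h r) ^ Suc l)) has_field_derivative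
          p r * (- (inverse (?X ^ Suc l) * (real (Suc l) * (lin h r * ?X ^ l)) * inverse (?X ^ Suc l)))) (at t within ball t0 e)"
        using pos by (auto intro!: derivative_eq_intros simp del: power_Suc)
      also have "p r * (- (inverse (?X ^ Suc l) * (real (Suc l) * (lin h r * ?X ^ l)) * inverse (?X ^ Suc l))) =
          - (real (Suc l) * p r * lin h r / ?X ^ Suc (Suc l))"
        using pos by (simp add: divide_simps)
      finally show ?thesis
        unfolding lin_add_scaleR Suc by (simp add: divide_inverse)
    qed
  next
    fix t assume t: "t \<in> ball t0 e"
    have "continuous_on {0..z} (\<lambda>r. p r / (lin (\<theta> + t *\<^sub>R h) r) ^ m)"
      unfolding lin_add_scaleR using W[OF t] p by (intro continuous_intros) force+
    then show "(\<lambda>r. p r / (lin (\<theta> + t *\<^sub>R h) r) ^ m) integrable_on cbox 0 z"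
      by (simp add: integrable_continuous_real)
  next
    have "continuous_on (ball t0 e \<times> cbox 0 z) (\<lambda>x. p (snd x))"
      using p by (intro continuous_on_compose2[OF p continuous_on_snd]) (auto intro: continuous_intros)
    then show "continuous_on (ball t0 e \<times> cbox 0 z)
      (\<lambda>(t, r). - (real m * p r * lin h r / (lin (\<theta> + t *\<^sub>R h) r) ^ Suc m))"
      unfolding lin_add_scaleR split_beta using W by (intro continuous_intros) force+
  qed (use e in auto)
  then show ?thesis using e by (simp add: at_within_open[of t0 "ball t0 e"])
qed

lemma llik_has_derivative:
  assumes z: "z \<ge> 0" and pos: "(\<theta> + t0 *\<^sub>R h) $ 2 > 0" "lin (\<theta> + t0 *\<^sub>R h) z > 0"
  shows "((\<lambda>t. llik (\<theta> + t *\<^sub>R h) z) has_real_derivative llik_D1 (\<theta> + t0 *\<^sub>R h) h z) (at t0)"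
proof -
  have "((\<lambda>t. integral {0..z} (\<lambda>r. 1 / (lin (\<theta> + t *\<^sub>R h) r) ^ 1)) has_real_derivative
      integral {0..z} (\<lambda>r. - (real 1 * 1 * lin h r / (lin (\<theta> + t0 *\<^sub>R h) r) ^ Suc 1))) (at t0)"
    by (rule leibniz_ratio) (use z pos in auto)
  then have I: "((\<lambda>t. integral {0..z} (\<lambda>r. 1 / (lin (\<theta> + t *\<^sub>R h) r))) has_real_derivative
      - integral {0..z} (\<lambda>r. lin h r / (lin (\<theta> + t0 *\<^sub>R h) r)\<^sup>2)) (at t0)"
    by (simp add: numeral_2_eq_2)
  have "((\<lambda>t. ln (lin (\<theta> + t *\<^sub>R h) z)) has_real_derivative lin h z / lin (\<theta> + t0 *\<^sub>R h) z) (at t0)"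
    using pos(2) unfolding lin_add_scaleR by (auto intro!: derivative_eq_intros)
  from DERIV_diff[OF DERIV_minus[OF this] I] show ?thesis
    unfolding llik_def llik_D1_def by simp
qed

lemma llik_D1_has_derivative:
  assumes z: "z \<ge> 0" and pos: "(\<theta> + t0 *\<^sub>R h) $ 2 > 0" "lin (\<theta> + t0 *\<^sub>R h) z > 0"
  shows "((\<lambda>t. llik_D1 (\<theta> + t *\<^sub>R h) h' z) has_real_derivative llik_D2 (\<theta> + t0 *\<^sub>R h) h h' z) (at t0)"
proof -
  have "((\<lambda>t. integral {0..z} (\<lambda>r. lin h' r / (lin (\<theta> + t *\<^sub>R h) r) ^ 2)) has_real_derivative
      integral {0..z} (\<lambda>r. - (real 2 * lin h' r * lin h r / (lin (\<theta> + t0 *\<^sub>R h) r) ^ Suc 2))) (at t0)"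
    by (rule leibniz_ratio) (use z pos in \<open>auto intro!: continuous_intros\<close>)
  also have "(\<lambda>r. - (real 2 * lin h' r * lin h r / (lin (\<theta> + t0 *\<^sub>R h) r) ^ Suc 2)) =
      (\<lambda>r. (- 2) * (lin h r * lin h' r / (lin (\<theta> + t0 *\<^sub>R h) r) ^ 3))"
    by (auto simp: numeral_3_eq_3)
  finally have I: "((\<lambda>t. integral {0..z} (\<lambda>r. lin h' r / (lin (\<theta> + t *\<^sub>R h) r) ^ 2)) has_real_derivative
      - 2 * integral {0..z} (\<lambda>r. lin h r * lin h' r / (lin (\<theta> + t0 *\<^sub>R h) r) ^ 3)) (at t0)"
    unfolding integral_mult_right .
  have "((\<lambda>t. - (lin h' z / lin (\<theta> + t *\<^sub>R h) z)) has_real_derivative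
      lin h z * lin h' z / (lin (\<theta> + t0 *\<^sub>R h) z)\<^sup>2) (at t0)"
    using pos(2) unfolding lin_add_scaleR
    by (auto intro!: derivative_eq_intros simp: power2_eq_square)
  from DERIV_add[OF this I] show ?thesis
    unfolding llik_D1_def llik_D2_def by simp
qed

lemma llik_D1_linear: 
  assumes "\<theta> $ 2 > 0" "lin \<theta> z > 0"
  shows "llik_D1 \<theta> h z = h $ 1 * llik_D1 \<theta> (axis 1 1) z + h $ 2 * llik_D1 \<theta> (axis 2 1) z"
proof -
  have l: "lin h r = h $ 1 * lin (axis 1 1) r + h $ 2 * lin (axis 2 1) r" for r
    by (simp add: lin_def axis_def)
  have int: "(\<lambda>r. lin h r / (lin \<theta> r)\<^sup>2) integrable_on {0..z}" for h
    by (intro integrable_continuous_real continuous_on_ratio assms)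
  have "integral {0..z} (\<lambda>r. lin h r / (lin \<theta> r)\<^sup>2) =
     integral {0..z} (\<lambda>r. h $ 1 * (lin (axis 1 1) r / (lin \<theta> r)\<^sup>2) + h $ 2 * (lin (axis 2 1) r / (lin \<theta> r)\<^sup>2))"
    by (rule integral_cong) (simp add: l add_divide_distrib)
  also have "\<dots> = h $ 1 * integral {0..z} (\<lambda>r. lin (axis 1 1) r / (lin \<theta> r)\<^sup>2) +
      h $ 2 * integral {0..z} (\<lambda>r. lin (axis 2 1) r / (lin \<theta> r)\<^sup>2)"
    by (rule integral_unique, intro has_integral_add has_integral_mult_right integrable_integral int)
  finally show ?thesis
    unfolding llik_D1_def l[of z] by (simp add: algebra_simps add_divide_distrib)
qed

text \<open>A scaled log-likelihood of finitely many observations. Its domain of finiteness \<open>dom\<close> is cut out by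
conditions linear in the parameter; \<open>S1\<close> and \<open>S2\<close> are its first and second directional
derivatives there.\<close>

locale loglik_sum =
  fixes I :: "'i set" and Z :: "'i \<Rightarrow> real" and c :: real
  assumes fin: "finite I" and Z: "\<And>i. i \<in> I \<Longrightarrow> Z i \<ge> 0" and c: "c > 0"
begin

definition L :: "real^2 \<Rightarrow> ereal" where
  "L \<theta> = ereal c * (\<Sum>i\<in>I. gp_loglik \<theta> (Z i))"

definition dom :: "(real^2) set" where
  "dom = {\<theta>. \<theta> $ 2 > 0 \<and> (\<forall>i\<in>I. lin \<theta> (Z i) > 0)}"

definition S1 :: "real^2 \<Rightarrow> real^2 \<Rightarrow> real" where
  "S1 \<theta> h = c * (\<Sum>i\<in>I. llik_D1 \<theta> h (Z i))"

definition S2 :: "real^2 \<Rightarrow> real^2 \<Rightarrow> real^2 \<Rightarrow> real" where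
  "S2 \<theta> h h' = c * (\<Sum>i\<in>I. llik_D2 \<theta> h h' (Z i))"

lemma L_dom: "\<theta> \<in> dom \<Longrightarrow> L \<theta> = ereal (c * (\<Sum>i\<in>I. llik \<theta> (Z i)))"
  unfolding L_def dom_def by (simp add: gp_loglik_eq Z)

lemma L_not_dom: "\<theta> $ 2 > 0 \<Longrightarrow> \<theta> \<notin> dom \<Longrightarrow> L \<theta> = - \<infinity>"
proof -
  assume s: "\<theta> $ 2 > 0" "\<theta> \<notin> dom"
  then obtain i where i: "i \<in> I" "\<not> lin \<theta> (Z i) > 0" by (auto simp: dom_def)
  have "(\<Sum>i\<in>I. gp_loglik \<theta> (Z i)) = - \<infinity>"
  proof -
    have "(\<Sum>i\<in>I. gp_loglik \<theta> (Z i)) = gp_loglik \<theta> (Z i) + (\<Sum>i\<in>I - {i}. gp_loglik \<theta> (Z i))"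
      by (rule sum.remove[OF fin i(1)])
    moreover have "(\<Sum>i\<in>I - {i}. gp_loglik \<theta> (Z i)) \<noteq> \<infinity>"
      using s Z fin by (subst sum_Pinfty) (auto simp: gp_loglik_eq)
    ultimately show ?thesis using i s Z by (simp add: gp_loglik_eq)
  qed
  then show ?thesis using c by (simp add: L_def)
qed

lemma eventually_dom:
  assumes "\<theta> + t0 *\<^sub>R h \<in> dom"
  shows "eventually (\<lambda>t. \<theta> + t *\<^sub>R h \<in> dom) (nhds t0)"
proof -
  have "eventually (\<lambda>t. lin \<theta> 0 + t * lin h 0 > 0 \<and> (\<forall>i\<in>I. lin \<theta> (Z i) + t * lin h (Z i) > 0)) (nhds t0)"
    using assms fin
    by (intro eventually_conj eventually_ball_finite ballI eventually_lin_pos) (auto simp: dom_def lin_add_scaleR)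
  then show ?thesis by eventually_elim (auto simp: dom_def lin_add_scaleR)
qed

lemma dom_segment:
  assumes "\<theta> \<in> dom" "\<theta> + h \<in> dom" "0 \<le> t" "t \<le> 1"
  shows "\<theta> + t *\<^sub>R h \<in> dom"
proof -
  have *: "x + t * y > 0" if "x > 0" "x + y > 0" for x y :: real
  proof -
    have "x + t * y = (1 - t) * x + t * (x + y)" by (simp add: algebra_simps)
    moreover have "(1 - t) * x \<ge> 0" "t * (x + y) \<ge> 0" using that assms by auto
    moreover have "(1 - t) * x > 0 \<or> t * (x + y) > 0" using that assms by (cases "t = 0") auto
    ultimately show ?thesis by linarith
  qed
  have "lin (\<theta> + t *\<^sub>R h) r > 0" if "lin \<theta> r > 0" "lin (\<theta> + h) r > 0" for r
    using *[of "lin \<theta> r" "lin h r"] that lin_add_scaleR[of \<theta> 1 h r] by (simp add: lin_add_scaleR)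
  then show ?thesis using assms *[of "\<theta> $ 2" "h $ 2"] by (auto simp: dom_def)
qed

lemma real_L_has_derivative:
  assumes "\<theta> + t0 *\<^sub>R h \<in> dom"
  shows "((\<lambda>t. real_of_ereal (L (\<theta> + t *\<^sub>R h))) has_real_derivative S1 (\<theta> + t0 *\<^sub>R h) h) (at t0)"
proof -
  have "((\<lambda>t. c * (\<Sum>i\<in>I. llik (\<theta> + t *\<^sub>R h) (Z i))) has_real_derivative S1 (\<theta> + t0 *\<^sub>R h) h) (at t0)"
    unfolding S1_def using assms
    by (intro DERIV_cmult DERIV_sum llik_has_derivative Z) (auto simp: dom_def)
  moreover have "eventually (\<lambda>t. real_of_ereal (L (\<theta> + t *\<^sub>R h)) = c * (\<Sum>i\<in>I. llik (\<theta> + t *\<^sub>R h) (Z i))) (nhds t0)"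
    using eventually_dom[OF assms] by eventually_elim (simp add: L_dom)
  ultimately show ?thesis by (simp add: DERIV_cong_ev)
qed

lemma S1_has_derivative:
  assumes "\<theta> + t0 *\<^sub>R h \<in> dom"
  shows "((\<lambda>t. S1 (\<theta> + t *\<^sub>R h) h') has_real_derivative S2 (\<theta> + t0 *\<^sub>R h) h h') (at t0)"
  unfolding S1_def S2_def using assms
  by (intro DERIV_cmult DERIV_sum llik_D1_has_derivative Z) (auto simp: dom_def)

lemma partial_deriv_L:
  assumes "\<theta> \<in> dom"
  shows "partial_deriv j (\<lambda>\<theta>. real_of_ereal (L \<theta>)) \<theta> = S1 \<theta> (axis j 1)"
  unfolding partial_deriv_def
  by (rule DERIV_imp_deriv) (use real_L_has_derivative[of \<theta> 0] assms in simp)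

lemma gradient_L: "\<theta> \<in> dom \<Longrightarrow> gradient (\<lambda>\<theta>. real_of_ereal (L \<theta>)) \<theta> = (\<chi> j. S1 \<theta> (axis j 1))"
  by (simp add: gradient_def partial_deriv_L)

lemma hessian_L:
  assumes "\<theta> \<in> dom"
  shows "hessian (\<lambda>\<theta>. real_of_ereal (L \<theta>)) \<theta> = (\<chi> i j. S2 \<theta> (axis i 1) (axis j 1))"
proof -
  have "partial_deriv i (partial_deriv j (\<lambda>\<theta>. real_of_ereal (L \<theta>))) \<theta> = S2 \<theta> (axis i 1) (axis j 1)" for i j
  proof -
    have "((\<lambda>t. S1 (\<theta> + t *\<^sub>R axis i 1) (axis j 1)) has_real_derivative S2 \<theta> (axis i 1) (axis j 1)) (at 0)"
      using S1_has_derivative[of \<theta> 0] assms by simp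
    moreover have "eventually (\<lambda>t. partial_deriv j (\<lambda>\<theta>. real_of_ereal (L \<theta>)) (\<theta> + t *\<^sub>R axis i 1) =
        S1 (\<theta> + t *\<^sub>R axis i 1) (axis j 1)) (nhds 0)"
      using eventually_dom[of \<theta> 0 "axis i 1"] assms
      by (auto elim!: eventually_mono simp: partial_deriv_L)
    ultimately have "((\<lambda>t. partial_deriv j (\<lambda>\<theta>. real_of_ereal (L \<theta>)) (\<theta> + t *\<^sub>R axis i 1))
        has_real_derivative S2 \<theta> (axis i 1) (axis j 1)) (at 0)"
      by (simp add: DERIV_cong_ev)
    then show ?thesis unfolding partial_deriv_def[of i] by (rule DERIV_imp_deriv)
  qed
  then show ?thesis by (simp add: hessian_def)
qed

lemma S1_inner:
  assumes "\<theta> \<in> dom"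
  shows "S1 \<theta> h = h \<bullet> gradient (\<lambda>\<theta>. real_of_ereal (L \<theta>)) \<theta>"
proof -
  have "S1 \<theta> h = c * (\<Sum>i\<in>I. h $ 1 * llik_D1 \<theta> (axis 1 1) (Z i) + h $ 2 * llik_D1 \<theta> (axis 2 1) (Z i))"
    unfolding S1_def using assms
    by (intro arg_cong[where f = "(*) c"] sum.cong refl llik_D1_linear) (auto simp: dom_def)
  also have "\<dots> = h $ 1 * S1 \<theta> (axis 1 1) + h $ 2 * S1 \<theta> (axis 2 1)"
    by (simp add: S1_def sum.distrib sum_distrib_left algebra_simps)
  finally show ?thesis by (simp add: gradient_L[OF assms] inner_vec_def sum_2)
qed

text \<open>Taylor's formula along a segment; the domain of finiteness is convex because its
  constraints are linear in the parameter.\<close>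

lemma taylor_segment:
  assumes dom: "\<theta> \<in> dom" "\<theta> + h \<in> dom"
  obtains t where "0 < t" "t < 1"
    "real_of_ereal (L (\<theta> + h)) = real_of_ereal (L \<theta>) + S1 \<theta> h + S2 (\<theta> + t *\<^sub>R h) h h / 2"
proof -
  define f where "f t = real_of_ereal (L (\<theta> + t *\<^sub>R h))" for t
  define diff where "diff m = (if m = (0::nat) then f else if m = 1 then (\<lambda>t. S1 (\<theta> + t *\<^sub>R h) h)
     else (\<lambda>t. S2 (\<theta> + t *\<^sub>R h) h h))" for m
  have d: "\<forall>m t. m < 2 \<and> 0 \<le> t \<and> t \<le> 1 \<longrightarrow> DERIV (diff m) t :> diff (Suc m) t"
  proof (intro allI impI)
    fix m :: nat and t :: real assume mt: "m < 2 \<and> 0 \<le> t \<and> t \<le> 1"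
    then have t: "\<theta> + t *\<^sub>R h \<in> dom" using dom_segment[OF dom] by auto
    from mt have "m = 0 \<or> m = 1" by auto
    then show "DERIV (diff m) t :> diff (Suc m) t"
      using real_L_has_derivative[OF t] S1_has_derivative[OF t, of h] by (auto simp: diff_def f_def[abs_def])
  qed
  have "\<exists>t>0. t < 1 \<and> f 1 = (\<Sum>m<2. diff m 0 / fact m * 1 ^ m) + diff 2 t / fact 2 * 1 ^ 2"
    by (rule Maclaurin) (use d in \<open>auto simp: diff_def\<close>)
  then obtain t where t: "0 < t" "t < 1" and eq: "f 1 = (\<Sum>m<2. diff m 0 / fact m * 1 ^ m) + diff 2 t / fact 2 * 1 ^ 2"
    by blast
  have "f 1 = f 0 + S1 \<theta> h + S2 (\<theta> + t *\<^sub>R h) h h / 2"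
    using eq by (simp add: diff_def numeral_2_eq_2)
  with t show ?thesis by (intro that[of t]) (auto simp: f_def)
qed

end

text \<open>For \<open>\<theta> $ 1 < 0\<close> the first term of \<open>llik_D2\<close> explodes near the end point of the
  support. It is compensated by the part of the integral over the last stretch of length
  \<open>lin \<theta> z / \<bar>\<theta> $ 1\<bar>\<close>, on which \<open>lin \<theta>\<close> at most doubles; this is where \<open>\<theta> $ 1 \<ge> - 1 / 2\<close> enters.\<close>

lemma llik_D2_upper:
  assumes s: "\<theta> $ 2 \<ge> 1/2" and g: "\<theta> $ 1 \<ge> -1/2" and z: "z \<ge> 0" and pos: "lin \<theta> z > 0"
  shows "llik_D2 \<theta> h h z \<le> 384 * (1 + z) ^ 3 * (norm h)\<^sup>2"
proof -
  let ?W = "lin \<theta> z" and ?q = "lin h z" and ?f = "\<lambda>r. lin h r * lin h r / (lin \<theta> r) ^ 3"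
  have s0: "\<theta> $ 2 > 0" using s by simp
  note Wr = lin_pos_between[OF s0 pos]
  have intf: "?f integrable_on {0..z}"
    by (intro integrable_continuous_real continuous_on_ratio s0 pos)
  have f0: "?f r \<ge> 0" if "r \<in> {0..z}" for r using Wr[of r] that by simp
  have q: "?q\<^sup>2 \<le> (1 + z)\<^sup>2 * (norm h)\<^sup>2"
    using abs_le_square_iff[of ?q "(1 + z) * norm h"] abs_lin_le[OF z, of h] z
    by (simp add: power_mult_distrib)
  have z23: "(1 + z)\<^sup>2 \<le> (1 + z) ^ 3" using z by (intro power_increasing) auto
  show ?thesis
  proof (cases "?W \<ge> 1/4")
    case True
    then have W: "(1/4)\<^sup>2 \<le> ?W\<^sup>2" by (intro power_mono) auto
    have "llik_D2 \<theta> h h z \<le> ?q\<^sup>2 / ?W\<^sup>2"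
      using integral_nonneg[OF intf] f0 by (simp add: llik_D2_def power2_eq_square)
    also have "\<dots> \<le> ?q\<^sup>2 / (1/4)\<^sup>2" using W pos by (intro divide_left_mono) auto
    also have "\<dots> \<le> 16 * ((1 + z)\<^sup>2 * (norm h)\<^sup>2)" using q by (simp add: power2_eq_square)
    also have "\<dots> \<le> 384 * ((1 + z) ^ 3 * (norm h)\<^sup>2)"
      using z23 by (intro mult_mono mult_right_mono) auto
    finally show ?thesis by (simp add: mult.assoc)
  next
    case False
    define g' where "g' = - (\<theta> $ 1)"
    have gz: "g' * z = \<theta> $ 2 - ?W" by (simp add: g'_def lin_def)
    have gz4: "g' * z \<ge> 1/4" using False s gz by linarith
    have g': "g' > 0"
    proof (rule ccontr)
      assume "\<not> g' > 0"
      then have "g' * z \<le> 0" using z by (simp add: mult_nonpos_nonneg)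
      then show False using gz4 by simp
    qed
    have g'2: "g' \<le> 1/2" using g by (simp add: g'_def)
    \<comment> \<open>\<open>lin \<theta>\<close> doubles from \<open>z\<close> down to \<open>z - d\<close>\<close>
    define d where "d = ?W / g'"
    have d: "d > 0" using g' pos by (simp add: d_def)
    have dz: "d \<le> z" using gz s False g' by (simp add: d_def field_simps)
    have W_r: "lin \<theta> r = ?W + g' * (z - r)" for r by (simp add: lin_def g'_def algebra_simps)
    have q_r: "lin h r = ?q - h $ 1 * (z - r)" for r by (simp add: lin_def algebra_simps)
    \<comment> \<open>a lower bound of the integrand, from \<open>(x - y)\<^sup>2 \<ge> (3/4) * x\<^sup>2 - 3 * y\<^sup>2\<close>\<close>
    define lo where "lo r = (3/4) * ?q\<^sup>2 / (lin \<theta> r) ^ 3 - 3 * (h $ 1)\<^sup>2 * d\<^sup>2 / ?W ^ 3" for r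
    have lo_int: "(lo has_integral ((3/4) * ?q\<^sup>2 * (3 / (8 * g' * ?W\<^sup>2)) - 3 * (h $ 1)\<^sup>2 * d\<^sup>2 / ?W ^ 3 * d)) {z - d..z}"
    proof -
      have "((\<lambda>r. 1 / (lin \<theta> r) ^ 3) has_integral (1 / (2 * g' * (lin \<theta> z)\<^sup>2) - 1 / (2 * g' * (lin \<theta> (z - d))\<^sup>2))) {z - d..z}"
      proof (rule fundamental_theorem_of_calculus)
        fix r assume r: "r \<in> {z - d..z}"
        then have "lin \<theta> r > 0" using Wr[of r] dz by auto
        then show "((\<lambda>r. 1 / (2 * g' * (lin \<theta> r)\<^sup>2)) has_vector_derivative 1 / (lin \<theta> r) ^ 3) (at r within {z - d..z})"
          unfolding has_real_derivative_iff_has_vector_derivative[symmetric] using g'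
          by (auto intro!: derivative_eq_intros lin_has_derivative simp: g'_def[symmetric])
             (simp add: g'_def field_simps power2_eq_square power3_eq_cube)
      qed (use d in simp)
      moreover have "lin \<theta> (z - d) = 2 * ?W" using g' W_r[of "z - d"] by (simp add: d_def)
      moreover have "1 / (2 * g' * ?W\<^sup>2) - 1 / (2 * g' * (2 * ?W)\<^sup>2) = 3 / (8 * g' * ?W\<^sup>2)"
        using g' pos by (simp add: field_simps power2_eq_square)
      ultimately have "((\<lambda>r. 1 / (lin \<theta> r) ^ 3) has_integral 3 / (8 * g' * ?W\<^sup>2)) {z - d..z}"
        by (simp add: mult.assoc)
      from has_integral_mult_right[OF this, of "(3/4) * ?q\<^sup>2"]
      have "((\<lambda>r. (3/4) * ?q\<^sup>2 / (lin \<theta> r) ^ 3) has_integral (3/4) * ?q\<^sup>2 * (3 / (8 * g' * ?W\<^sup>2))) {z - d..z}" by simp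
      moreover have "((\<lambda>r. 3 * (h $ 1)\<^sup>2 * d\<^sup>2 / ?W ^ 3) has_integral 3 * (h $ 1)\<^sup>2 * d\<^sup>2 / ?W ^ 3 * d) {z - d..z}"
        using has_integral_const_real[of "3 * (h $ 1)\<^sup>2 * d\<^sup>2 / ?W ^ 3" "z - d" z] d by (simp add: mult.commute)
      ultimately show ?thesis unfolding lo_def by (rule has_integral_diff)
    qed
    have lo_le: "lo r \<le> ?f r" if r: "r \<in> {z - d..z}" for r
    proof -
      have W: "lin \<theta> r \<ge> ?W" using r g' W_r[of r] by simp
      then have W3: "?W ^ 3 \<le> (lin \<theta> r) ^ 3" using pos by (intro power_mono) auto
      have zr: "(z - r)\<^sup>2 \<le> d\<^sup>2" using r by (intro power_mono) auto
      have "(3/4) * ?q\<^sup>2 - 3 * (h $ 1 * (z - r))\<^sup>2 \<le> (lin h r)\<^sup>2"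
      proof -
        have "0 \<le> (?q / 2 - 2 * (h $ 1 * (z - r)))\<^sup>2" by simp
        then show ?thesis unfolding q_r[of r] by (simp add: power2_eq_square algebra_simps)
      qed
      then have "((3/4) * ?q\<^sup>2 - 3 * (h $ 1 * (z - r))\<^sup>2) / (lin \<theta> r) ^ 3 \<le> (lin h r)\<^sup>2 / (lin \<theta> r) ^ 3"
        using W pos by (intro divide_right_mono) auto
      moreover have "3 * (h $ 1 * (z - r))\<^sup>2 / (lin \<theta> r) ^ 3 \<le> 3 * (h $ 1)\<^sup>2 * d\<^sup>2 / ?W ^ 3"
        using W3 zr pos by (intro frac_le) (auto simp: power_mult_distrib mult_left_mono)
      ultimately show ?thesis unfolding lo_def by (simp add: diff_divide_distrib power2_eq_square)
    qed
    have "(3/4) * ?q\<^sup>2 * (3 / (8 * g' * ?W\<^sup>2)) - 3 * (h $ 1)\<^sup>2 * d\<^sup>2 / ?W ^ 3 * d \<le> integral {z - d..z} ?f"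
    proof (rule has_integral_le[OF lo_int])
      have "?f integrable_on {z - d..z}"
        by (rule integrable_subinterval_real[OF intf]) (use dz in auto)
      then show "(?f has_integral integral {z - d..z} ?f) {z - d..z}" by (rule integrable_integral)
    qed (use lo_le in auto)
    also have "\<dots> \<le> integral {0..z} ?f"
    proof (rule integral_subset_le)
      show "?f integrable_on {z - d..z}"
        by (rule integrable_subinterval_real[OF intf]) (use dz in auto)
    qed (use dz f0 intf in auto)
    finally have I: "(9 / 32) * (?q\<^sup>2 / (g' * ?W\<^sup>2)) - 3 * (h $ 1)\<^sup>2 * (d ^ 3 / ?W ^ 3) \<le> integral {0..z} ?f"
      by (simp add: power2_eq_square power3_eq_cube mult_ac)
    have d3: "d ^ 3 / ?W ^ 3 = 1 / g' ^ 3" using pos by (simp add: d_def power_divide)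
    define a where "a = ?q\<^sup>2 / ?W\<^sup>2"
    define b where "b = ?q\<^sup>2 / (g' * ?W\<^sup>2)"
    have a0: "a \<ge> 0" by (simp add: a_def)
    \<comment> \<open>\<open>b \<ge> 2 * a\<close> because the shape is at least \<open>- 1 / 2\<close>; twice the integral outweighs \<open>a\<close> as \<open>2 * (9 / 32) * 2 > 1\<close>\<close>
    have "a * 2 \<le> a * (1 / g')" using g' g'2 a0 by (intro mult_left_mono) (auto simp: field_simps)
    also have "a * (1 / g') = b" by (simp add: a_def b_def)
    finally have "a * 2 \<le> b" .
    moreover have "llik_D2 \<theta> h h z = a - 2 * integral {0..z} ?f"
      by (simp add: llik_D2_def a_def power2_eq_square)
    moreover have "(9 / 32) * b - 3 * (h $ 1)\<^sup>2 * (1 / g' ^ 3) \<le> integral {0..z} ?f"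
      using I unfolding d3 b_def .
    ultimately have "llik_D2 \<theta> h h z \<le> 6 * (h $ 1)\<^sup>2 * (1 / g' ^ 3)"
      using a0 by linarith
    also have "\<dots> \<le> 6 * (norm h)\<^sup>2 * (64 * z ^ 3)"
    proof (intro mult_mono)
      have "1 / g' \<le> 4 * z" using gz4 g' by (simp add: field_simps)
      then have "(1 / g') ^ 3 \<le> (4 * z) ^ 3" using g' by (intro power_mono) auto
      then show "1 / g' ^ 3 \<le> 64 * z ^ 3" by (simp add: power_divide power_mult_distrib)
      show "(h $ 1)\<^sup>2 \<le> (norm h)\<^sup>2" using component_le_norm_cart[of h 1] by (simp add: abs_le_square_iff[symmetric])
    qed (use g' in auto)
    also have "\<dots> \<le> 384 * (1 + z) ^ 3 * (norm h)\<^sup>2"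
    proof -
      have "z ^ 3 \<le> (1 + z) ^ 3" using z by (intro power_mono) auto
      then have "(norm h)\<^sup>2 * z ^ 3 \<le> (norm h)\<^sup>2 * (1 + z) ^ 3" by (intro mult_left_mono) auto
      then show ?thesis by (simp add: mult_ac)
    qed
    finally show ?thesis .
  qed
qed

section \<open>Log-likelihoods with a controlled Hessian\<close>

lemma strictly_concave_on_arg_max_unique:
  assumes "strictly_concave_on S f" "is_arg_max f (\<lambda>x. x \<in> S) x" "is_arg_max f (\<lambda>x. x \<in> S) y"
    and fin: "\<bar>f x\<bar> \<noteq> \<infinity>"
  shows "x = y"
proof (rule ccontr)
  assume "x \<noteq> y"
  have S: "x \<in> S" "y \<in> S" "f y = f x" using assms(2,3) by (auto simp: is_arg_max_linorder intro: antisym)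
  let ?z = "(1/2) *\<^sub>R x + (1/2) *\<^sub>R y"
  have "ereal (1/2) * f x + ereal (1/2) * f y < f ?z"
    using assms(1)[unfolded strictly_concave_on_def, THEN conjunct2, rule_format, OF S(1,2), of "1/2" "1/2"] \<open>x \<noteq> y\<close> by simp
  moreover have "ereal (1/2) * f x + ereal (1/2) * f y = f x"
    unfolding S(3) using fin by (cases "f x") auto
  moreover have "?z \<in> S" using assms(1) S unfolding strictly_concave_on_def convex_def by auto
  then have "f ?z \<le> f x" using assms(2) by (auto simp: is_arg_max_linorder)
  ultimately show False by auto
qed

context loglik_sum
begin

abbreviation "RL \<theta> \<equiv> real_of_ereal (L \<theta>)"

lemma L_eq_RL: "\<theta> \<in> dom \<Longrightarrow> L \<theta> = ereal (RL \<theta>)"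
  by (simp add: L_dom)

lemma taylor_upper:
  assumes "\<theta> \<in> dom" "\<theta>' \<in> dom"
    and neg: "\<And>t h. 0 < t \<Longrightarrow> t < 1 \<Longrightarrow> S2 (\<theta> + t *\<^sub>R (\<theta>' - \<theta>)) h h \<le> - b * (norm h)\<^sup>2"
  shows "RL \<theta>' \<le> RL \<theta> + S1 \<theta> (\<theta>' - \<theta>) - b / 2 * (norm (\<theta>' - \<theta>))\<^sup>2"
proof -
  obtain t where t: "0 < t" "t < 1"
    "RL (\<theta> + (\<theta>' - \<theta>)) = RL \<theta> + S1 \<theta> (\<theta>' - \<theta>) + S2 (\<theta> + t *\<^sub>R (\<theta>' - \<theta>)) (\<theta>' - \<theta>) (\<theta>' - \<theta>) / 2"
    using taylor_segment[of \<theta> "\<theta>' - \<theta>"] assms by auto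
  with neg[OF t(1,2), of "\<theta>' - \<theta>"] show ?thesis by simp
qed

lemma taylor_lower:
  assumes "\<theta> \<in> dom" "\<theta>' \<in> dom"
    and low: "\<And>t h. 0 < t \<Longrightarrow> t < 1 \<Longrightarrow> S2 (\<theta> + t *\<^sub>R (\<theta>' - \<theta>)) h h \<ge> - b * (norm h)\<^sup>2"
  shows "RL \<theta>' \<ge> RL \<theta> + S1 \<theta> (\<theta>' - \<theta>) - b / 2 * (norm (\<theta>' - \<theta>))\<^sup>2"
proof -
  obtain t where t: "0 < t" "t < 1"
    "RL (\<theta> + (\<theta>' - \<theta>)) = RL \<theta> + S1 \<theta> (\<theta>' - \<theta>) + S2 (\<theta> + t *\<^sub>R (\<theta>' - \<theta>)) (\<theta>' - \<theta>) (\<theta>' - \<theta>) / 2"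
    using taylor_segment[of \<theta> "\<theta>' - \<theta>"] assms by auto
  with low[OF t(1,2), of "\<theta>' - \<theta>"] show ?thesis by simp
qed

lemma segment_in_convex:
  fixes \<theta> \<theta>' :: "real^2"
  assumes "convex B" "\<theta> \<in> B" "\<theta>' \<in> B" "0 < t" "t < 1"
  shows "\<theta> + t *\<^sub>R (\<theta>' - \<theta>) \<in> B"
proof -
  have "\<theta> + t *\<^sub>R (\<theta>' - \<theta>) = (1 - t) *\<^sub>R \<theta> + t *\<^sub>R \<theta>'" by (simp add: algebra_simps)
  with assms show ?thesis unfolding convex_alt by force
qed

text \<open>Taylor's formula at a convex combination \<open>z\<close> of \<open>x\<close> and \<open>y\<close> bounds the values at both end points; in
the weighted sum the linear terms cancel.\<close>

lemma strictly_concave_L: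
  assumes B: "convex B" "B \<subseteq> dom" and b: "b > 0"
    and neg: "\<And>\<theta> h. \<theta> \<in> B \<Longrightarrow> S2 \<theta> h h \<le> - b * (norm h)\<^sup>2"
  shows "strictly_concave_on B L"
  unfolding strictly_concave_on_def
proof (intro conjI ballI allI impI)
  fix x y and u v :: real assume xy: "x \<in> B" "y \<in> B" "x \<noteq> y" and uv: "u > 0" "v > 0" "u + v = 1"
  define z where "z = u *\<^sub>R x + v *\<^sub>R y"
  have zB: "z \<in> B" using B xy uv unfolding z_def convex_def by auto
  have dx: "x - z = v *\<^sub>R (x - y)" and dy: "y - z = (- u) *\<^sub>R (x - y)"
    using uv(3) by (auto simp: z_def algebra_simps scaleR_add_left[symmetric])
  have tay: "RL w \<le> RL z + S1 z (w - z) - b / 2 * (norm (w - z))\<^sup>2" if "w \<in> B" for w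
    using that zB B by (intro taylor_upper neg segment_in_convex) auto
  have lin: "S1 z (t *\<^sub>R h) = t * S1 z h" for t h
    using zB B S1_inner[of z] by auto
  have pos: "(norm (x - z))\<^sup>2 > 0" using dx uv xy by simp
  have "u * RL x + v * RL y \<le> u * (RL z + S1 z (x - z) - b / 2 * (norm (x - z))\<^sup>2) + v * (RL z + S1 z (y - z) - b / 2 * (norm (y - z))\<^sup>2)"
    using uv tay xy by (intro add_mono mult_left_mono) auto
  also have "\<dots> = (u + v) * RL z + u * S1 z (x - z) + v * S1 z (y - z) - u * (b / 2 * (norm (x - z))\<^sup>2) - v * (b / 2 * (norm (y - z))\<^sup>2)"
    by (simp add: algebra_simps)
  also have "(u + v) * RL z + u * S1 z (x - z) + v * S1 z (y - z) = RL z"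
    unfolding dx dy lin using uv by simp
  also have "RL z - u * (b / 2 * (norm (x - z))\<^sup>2) - v * (b / 2 * (norm (y - z))\<^sup>2) < RL z"
  proof -
    have "u * (b / 2 * (norm (x - z))\<^sup>2) > 0" "v * (b / 2 * (norm (y - z))\<^sup>2) \<ge> 0" using uv b pos by simp_all
    then show ?thesis by linarith
  qed
  finally have "u * RL x + v * RL y < RL z" .
  moreover have "x \<in> dom" "y \<in> dom" "z \<in> dom" using xy zB B by auto
  moreover have "ereal u * ereal (RL x) + ereal v * ereal (RL y) < ereal (RL z)"
    using calculation by simp
  ultimately show "ereal u * L x + ereal v * L y < L (u *\<^sub>R x + v *\<^sub>R y)"
    by (simp only: L_eq_RL[symmetric] z_def[symmetric])
qed (rule B)

text \<open>Strong concavity and a small score at the centre confine the maximiser to the interior of the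
  ball, where the score has to vanish; the quadratic bounds are then Taylor's formula at the
  maximiser.\<close>

lemma quadratic_behaviour_at_maximiser:
  assumes B: "convex B" "open B" "B \<subseteq> dom" and ball: "cball \<theta>\<^sub>0 r \<subseteq> B" and r: "r > 0" and b: "b > 0"
    and neg: "\<And>\<theta> h. \<theta> \<in> B \<Longrightarrow> S2 \<theta> h h \<le> - b * (norm h)\<^sup>2"
    and low: "\<And>\<theta> h. \<theta> \<in> B \<Longrightarrow> S2 \<theta> h h \<ge> - b' * (norm h)\<^sup>2"
    and small: "norm (gradient RL \<theta>\<^sub>0) < b / 2 * r"
  shows "strictly_concave_on B L \<and> (\<exists>!\<theta>h. is_arg_max L (\<lambda>\<theta>. \<theta> \<in> B) \<theta>h) \<and>
    (\<forall>\<theta>h. is_arg_max L (\<lambda>\<theta>. \<theta> \<in> B) \<theta>h \<longrightarrow>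
      (\<forall>\<theta>\<in>B. ereal (- (b' / 2) * (norm (\<theta> - \<theta>h))\<^sup>2) \<le> L \<theta> - L \<theta>h \<and>
               L \<theta> - L \<theta>h \<le> ereal (- (b / 2) * (norm (\<theta> - \<theta>h))\<^sup>2)))"
proof (intro conjI allI impI)
  have t0: "\<theta>\<^sub>0 \<in> B" using ball r by (meson centre_in_cball less_imp_le subsetD)
  have inB: "\<theta> \<in> dom" if "\<theta> \<in> B" for \<theta> using that B by auto
  have up: "RL y \<le> RL x + S1 x (y - x) - b / 2 * (norm (y - x))\<^sup>2" if "x \<in> B" "y \<in> B" for x y
    using that B by (intro taylor_upper neg segment_in_convex) auto
  have lo: "RL y \<ge> RL x + S1 x (y - x) - b' / 2 * (norm (y - x))\<^sup>2" if "x \<in> B" "y \<in> B" for x y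
    using that B by (intro taylor_lower low segment_in_convex) auto
  show conc: "strictly_concave_on B L" by (rule strictly_concave_L[OF B(1,3) b neg])
  have outside: "RL \<theta> < RL \<theta>\<^sub>0" if "\<theta> \<in> B" "norm (\<theta> - \<theta>\<^sub>0) \<ge> r" for \<theta>
  proof -
    let ?d = "norm (\<theta> - \<theta>\<^sub>0)"
    have d0: "?d > 0" using that r by linarith
    have "S1 \<theta>\<^sub>0 (\<theta> - \<theta>\<^sub>0) \<le> ?d * norm (gradient RL \<theta>\<^sub>0)"
      unfolding S1_inner[OF inB[OF t0]] by (rule norm_cauchy_schwarz)
    also have "\<dots> < ?d * (b / 2 * r)" using small d0 by (intro mult_strict_left_mono) auto
    also have "\<dots> \<le> ?d * (b / 2 * ?d)" using that b by (intro mult_left_mono) auto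
    also have "\<dots> = b / 2 * ?d\<^sup>2" by (simp add: power2_eq_square)
    finally show ?thesis using up[OF t0 that(1)] by linarith
  qed
  have cont: "continuous_on (cball \<theta>\<^sub>0 r) RL"
  proof (rule continuous_on_subset[OF _ ball])
    show "continuous_on B RL"
    proof (rule convex_on_continuous[where f = "\<lambda>\<theta>. - RL \<theta>", OF B(2), THEN continuous_on_minus, simplified])
      show "convex_on B (\<lambda>\<theta>. - RL \<theta>)"
      proof (rule convex_onI[OF _ B(1)])
        fix t :: real and x y assume t: "0 < t" "t < 1" and xy: "x \<in> B" "y \<in> B"
        show "- RL ((1 - t) *\<^sub>R x + t *\<^sub>R y) \<le> (1 - t) * - RL x + t * - RL y"
        proof (cases "x = y")
          case True then show ?thesis by (simp add: scaleR_add_left[symmetric] algebra_simps)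
        next
          case False
          have z: "(1 - t) *\<^sub>R x + t *\<^sub>R y \<in> B" using B(1) t xy unfolding convex_alt by auto
          have "ereal (1 - t) * L x + ereal t * L y < L ((1 - t) *\<^sub>R x + t *\<^sub>R y)"
            using conc t xy False unfolding strictly_concave_on_def by auto
          then have "ereal (1 - t) * ereal (RL x) + ereal t * ereal (RL y) < ereal (RL ((1 - t) *\<^sub>R x + t *\<^sub>R y))"
            using inB xy z by (simp only: L_eq_RL[symmetric])
          then show ?thesis by simp
        qed
      qed
    qed
  qed
  have max_iff: "is_arg_max L (\<lambda>\<theta>. \<theta> \<in> B) \<theta>h \<longleftrightarrow> \<theta>h \<in> B \<and> (\<forall>\<theta>\<in>B. RL \<theta> \<le> RL \<theta>h)" for \<theta>h
  proof -
    have "L \<theta> \<le> L \<theta>' \<longleftrightarrow> RL \<theta> \<le> RL \<theta>'" if "\<theta> \<in> B" "\<theta>' \<in> B" for \<theta> \<theta>'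
      using that inB by (subst L_eq_RL, simp, subst L_eq_RL[of \<theta>']) auto
    then show ?thesis by (auto simp: is_arg_max_linorder)
  qed
  show ex1: "\<exists>!\<theta>h. is_arg_max L (\<lambda>\<theta>. \<theta> \<in> B) \<theta>h"
  proof (rule ex_ex1I)
    obtain m where m: "m \<in> cball \<theta>\<^sub>0 r" "\<forall>\<theta>\<in>cball \<theta>\<^sub>0 r. RL \<theta> \<le> RL m"
      using continuous_attains_sup[OF compact_cball _ cont] r by auto
    have "RL \<theta> \<le> RL m" if "\<theta> \<in> B" for \<theta>
    proof (cases "norm (\<theta> - \<theta>\<^sub>0) \<ge> r")
      case True
      have "RL \<theta>\<^sub>0 \<le> RL m" using m r by auto
      then show ?thesis using outside[OF that True] by linarith
    next
      case False then show ?thesis using m(2) by (auto simp: dist_norm norm_minus_commute)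
    qed
    then show "\<exists>\<theta>h. is_arg_max L (\<lambda>\<theta>. \<theta> \<in> B) \<theta>h" using max_iff m(1) ball by blast
  next
    fix x y assume xy: "is_arg_max L (\<lambda>\<theta>. \<theta> \<in> B) x" "is_arg_max L (\<lambda>\<theta>. \<theta> \<in> B) y"
    then have "x \<in> dom" using inB max_iff by blast
    then have "\<bar>L x\<bar> \<noteq> \<infinity>" by (simp add: L_dom)
    then show "x = y" by (rule strictly_concave_on_arg_max_unique[OF conc xy])
  qed
  fix \<theta>h assume mx: "is_arg_max L (\<lambda>\<theta>. \<theta> \<in> B) \<theta>h"
  then have hB: "\<theta>h \<in> B" and hmax: "\<And>\<theta>. \<theta> \<in> B \<Longrightarrow> RL \<theta> \<le> RL \<theta>h" using max_iff by auto
  have crit: "S1 \<theta>h h = 0" for h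
  proof -
    have "((\<lambda>t. \<theta>h + t *\<^sub>R h) \<longlongrightarrow> \<theta>h + 0 *\<^sub>R h) (at (0::real))" by (intro tendsto_intros)
    then have "eventually (\<lambda>t. \<theta>h + t *\<^sub>R h \<in> B) (at (0::real))"
      using B(2) hB by (auto intro: topological_tendstoD)
    then obtain d where d: "d > 0" "\<And>t. t \<noteq> 0 \<Longrightarrow> dist t 0 < d \<Longrightarrow> \<theta>h + t *\<^sub>R h \<in> B"
      unfolding eventually_at by blast
    have "DERIV (\<lambda>t. RL (\<theta>h + t *\<^sub>R h)) 0 :> S1 \<theta>h h"
      using real_L_has_derivative[of \<theta>h 0 h] inB[OF hB] by simp
    then show ?thesis
    proof (rule DERIV_local_max[OF _ d(1)])
      show "\<forall>y. \<bar>0 - y\<bar> < d \<longrightarrow> RL (\<theta>h + y *\<^sub>R h) \<le> RL (\<theta>h + 0 *\<^sub>R h)"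
      proof (intro allI impI)
        fix y assume "\<bar>0 - y\<bar> < d"
        then show "RL (\<theta>h + y *\<^sub>R h) \<le> RL (\<theta>h + 0 *\<^sub>R h)"
          using d(2)[of y] hmax by (cases "y = 0") (auto simp: dist_real_def)
      qed
    qed
  qed
  show "\<forall>\<theta>\<in>B. ereal (- (b' / 2) * (norm (\<theta> - \<theta>h))\<^sup>2) \<le> L \<theta> - L \<theta>h \<and>
               L \<theta> - L \<theta>h \<le> ereal (- (b / 2) * (norm (\<theta> - \<theta>h))\<^sup>2)"
  proof
    fix \<theta> assume t: "\<theta> \<in> B"
    show "ereal (- (b' / 2) * (norm (\<theta> - \<theta>h))\<^sup>2) \<le> L \<theta> - L \<theta>h \<and>
               L \<theta> - L \<theta>h \<le> ereal (- (b / 2) * (norm (\<theta> - \<theta>h))\<^sup>2)"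
    proof -
      have "L \<theta> - L \<theta>h = ereal (RL \<theta> - RL \<theta>h)"
        by (subst L_eq_RL[OF inB[OF t]], subst L_eq_RL[OF inB[OF hB]]) simp
      then show ?thesis using up[OF hB t] lo[OF hB t] crit by simp
    qed
  qed
qed

end

section \<open>Inner probability\<close>

context prob_space
begin

lemma inner_prob_bdd: "bdd_above {prob E | E. E \<in> events \<and> E \<subseteq> {\<omega> \<in> space M. P \<omega>}}"
  by (rule bdd_aboveI[of _ 1]) auto

lemma prob_le_inner_prob:
  assumes "E \<in> events" "E \<subseteq> {\<omega> \<in> space M. P \<omega>}"
  shows "prob E \<le> inner_prob M P"
  unfolding inner_prob_def by (rule cSup_upper[OF _ inner_prob_bdd]) (use assms in auto)

lemma inner_prob_leI:
  assumes "\<And>E. E \<in> events \<Longrightarrow> E \<subseteq> {\<omega> \<in> space M. P \<omega>} \<Longrightarrow> prob E \<le> c"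
  shows "inner_prob M P \<le> c"
  unfolding inner_prob_def by (rule cSup_least) (use assms in auto)

lemma inner_prob_le_1: "inner_prob M P \<le> 1"
  by (rule inner_prob_leI) auto

lemma inner_prob_mono:
  assumes "\<And>\<omega>. \<omega> \<in> space M \<Longrightarrow> P \<omega> \<Longrightarrow> Q \<omega>"
  shows "inner_prob M P \<le> inner_prob M Q"
  by (rule inner_prob_leI, rule prob_le_inner_prob) (use assms in auto)

lemma inner_prob_conj:
  assumes "inner_prob M P \<ge> 1 - a" "inner_prob M Q \<ge> 1 - b"
  shows "inner_prob M (\<lambda>\<omega>. P \<omega> \<and> Q \<omega>) \<ge> 1 - (a + b)"
proof -
  have 1: "prob E + prob F - 1 \<le> inner_prob M (\<lambda>\<omega>. P \<omega> \<and> Q \<omega>)"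
    if "E \<in> events" "E \<subseteq> {\<omega> \<in> space M. P \<omega>}" "F \<in> events" "F \<subseteq> {\<omega> \<in> space M. Q \<omega>}" for E F
  proof -
    have "prob (E \<union> F) \<le> 1" by simp
    moreover have "prob (E \<union> F) = prob E + prob F - prob (E \<inter> F)"
      using that by (simp add: finite_measure_Union' finite_measure_Diff' Un_Diff_Int)
        (metis Int_commute finite_measure_Union' finite_measure_Diff' add_diff_eq)
    moreover have "prob (E \<inter> F) \<le> inner_prob M (\<lambda>\<omega>. P \<omega> \<and> Q \<omega>)"
      by (rule prob_le_inner_prob) (use that in auto)
    ultimately show ?thesis by linarith
  qed
  have 2: "inner_prob M P \<le> inner_prob M (\<lambda>\<omega>. P \<omega> \<and> Q \<omega>) + 1 - prob F"
    if "F \<in> events" "F \<subseteq> {\<omega> \<in> space M. Q \<omega>}" for F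
    by (rule inner_prob_leI) (use 1[OF _ _ that] in fastforce)
  have "inner_prob M Q \<le> inner_prob M (\<lambda>\<omega>. P \<omega> \<and> Q \<omega>) + 1 - inner_prob M P"
    by (rule inner_prob_leI) (use 2 in fastforce)
  then show ?thesis using assms by linarith
qed

lemma whp_iff:
  "whp M P \<longleftrightarrow> (\<forall>\<eta>>0. eventually (\<lambda>n. inner_prob M (P n) \<ge> 1 - \<eta>) sequentially)"
proof
  assume "whp M P"
  then show "\<forall>\<eta>>0. eventually (\<lambda>n. inner_prob M (P n) \<ge> 1 - \<eta>) sequentially"
    unfolding whp_def by (auto dest!: order_tendstoD(1)[where a = "1 - _"] elim: eventually_mono)
next
  assume *: "\<forall>\<eta>>0. eventually (\<lambda>n. inner_prob M (P n) \<ge> 1 - \<eta>) sequentially"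
  show "whp M P"
    unfolding whp_def
  proof (rule order_tendstoI)
    fix a :: real assume "a < 1"
    then have "eventually (\<lambda>n. inner_prob M (P n) \<ge> 1 - (1 - a) / 2) sequentially"
      using * by simp
    then show "eventually (\<lambda>n. a < inner_prob M (P n)) sequentially"
      by eventually_elim (use \<open>a < 1\<close> in \<open>auto simp: field_simps\<close>)
  next
    fix a :: real assume "1 < a"
    then show "eventually (\<lambda>n. inner_prob M (P n) < a) sequentially"
      by (intro always_eventually allI le_less_trans[OF inner_prob_le_1])
  qed
qed

end

section \<open>Coupling with a uniform sample\<close>

definition unif :: "real measure" where
  "unif = uniform_measure lborel {0<..<1}"

definition unif_sample :: "(nat \<Rightarrow> real) measure" where
  "unif_sample = PiM UNIV (\<lambda>_. unif)"

lemma sets_unif [measurable_cong, simp]: "sets unif = sets borel"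
  by (simp add: unif_def)

lemma space_unif [simp]: "space unif = UNIV"
  by (simp add: unif_def)

lemma prob_space_unif: "prob_space unif"
  unfolding unif_def by (rule prob_space_uniform_measure) auto

lemma AE_unif: "AE x in unif. 0 < x \<and> x < 1"
  unfolding unif_def by (subst AE_uniform_measure) auto

lemma emeasure_unif: "A \<in> sets borel \<Longrightarrow> emeasure unif A = emeasure lborel ({0<..<1} \<inter> A)"
  by (simp add: unif_def emeasure_uniform_measure divide_ennreal_def)

interpretation unif: prob_space unif
  by (rule prob_space_unif)

interpretation unif_seq: product_prob_space "\<lambda>_::nat. unif" UNIV
  by unfold_locales

lemma prob_space_unif_sample: "prob_space unif_sample"
  unfolding unif_sample_def by (rule prob_space_PiM) (rule prob_space_unif)

interpretation unif_sample: prob_space unif_sample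
  by (rule prob_space_unif_sample)

lemma space_unif_sample [simp]: "space unif_sample = UNIV"
  by (simp add: unif_sample_def space_PiM)

lemma sets_unif_sample: "sets unif_sample = sets borel"
proof -
  have "sets unif_sample = sets (Pi\<^sub>M UNIV (\<lambda>i::nat. borel :: real measure))"
    unfolding unif_sample_def by (rule sets_PiM_cong) auto
  then show ?thesis by (simp add: sets_PiM_equal_borel)
qed

lemma measurable_component_unif_sample [measurable]: "(\<lambda>v. v i) \<in> borel_measurable unif_sample"
  unfolding unif_sample_def
  by (metis UNIV_I measurable_component_singleton measurable_cong_sets sets_unif)

lemma distr_unif_sample_component: "distr unif_sample borel (\<lambda>v. v i) = unif"
proof -
  have "distr unif_sample unif (\<lambda>v. v i) = unif"
    unfolding unif_sample_def using unif_seq.PiM_component[of i] by simp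
  then show ?thesis
    by (metis distr_cong sets_unif)
qed

lemma indep_unif_sample: "unif_sample.indep_vars (\<lambda>_. borel) (\<lambda>i v. v i) UNIV"
proof (subst unif_sample.indep_vars_iff_distr_eq_PiM')
  show "distr unif_sample (Pi\<^sub>M UNIV (\<lambda>i. borel)) (\<lambda>x. \<lambda>i\<in>UNIV. x i) =
    Pi\<^sub>M UNIV (\<lambda>i. distr unif_sample borel (\<lambda>v. v i))"
    unfolding distr_unif_sample_component restrict_UNIV
    by (subst distr_id2) (auto simp: unif_sample_def intro!: sets_PiM_cong)
qed auto

lemma AE_unif_sample: "AE v in unif_sample. \<forall>i. 0 < v i \<and> v i < 1"
proof (subst AE_all_countable, rule)
  fix i
  have "AE x in distr unif_sample borel (\<lambda>v. v i). 0 < x \<and> x < 1"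
    unfolding distr_unif_sample_component by (rule AE_unif)
  then show "AE v in unif_sample. 0 < v i \<and> v i < 1"
    by (subst (asm) AE_distr_iff) auto
qed

locale real_cdf =
  fixes N :: "real measure" and F :: "real \<Rightarrow> real"
  assumes rd: "real_distribution N" and F: "F = cdf N"
begin

sublocale cdf_distribution N
  using rd by (simp add: cdf_distribution_def)

lemma quantile_eq_I: "quantile F u = I u"
  by (simp add: quantile_def F)

lemma quantile_le_iff: "0 < u \<Longrightarrow> u < 1 \<Longrightarrow> quantile F u \<le> x \<longleftrightarrow> u \<le> F x"
  using pseudoinverse[of u x] by (auto simp: quantile_def F)

lemma mono_on_quantile: "mono_on {0<..<1} (quantile F)"
  using mono_I by (simp add: mono_on_def quantile_eq_I)

lemma countable_discont: "countable {u\<in>{0<..<1}. \<not> isCont (quantile F) u}"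
  by (rule mono_on_ctble_discont_open[OF _ mono_on_quantile]) simp

lemma distr_quantile:
  assumes q: "q \<in> borel_measurable borel" "\<And>u. 0 < u \<Longrightarrow> u < 1 \<Longrightarrow> q u = quantile F (1 - u)"
  shows "distr unif borel q = N"
proof (rule cdf_unique)
  show "real_distribution N" by (rule rd)
  have "prob_space (distr unif borel q)"
    by (rule unif.prob_space_distr) (use q in \<open>simp cong: measurable_cong_sets\<close>)
  then show "real_distribution (distr unif borel q)"
    by (simp add: real_distribution_def real_distribution_axioms_def)
  show "cdf (distr unif borel q) = cdf N"
  proof
    fix x
    have [measurable]: "q \<in> borel_measurable borel" by fact
    have b: "0 \<le> F x" "F x \<le> 1" using cdf_bounded_prob[of x] cdf_nonneg[of x] by (auto simp: F)
    have "emeasure (distr unif borel q) {..x} = emeasure lborel ({0<..<1} \<inter> (q -` {..x} \<inter> space unif))"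
    proof (subst emeasure_distr)
      show "q \<in> borel_measurable unif" by (simp cong: measurable_cong_sets)
      have "q -` {..x} \<in> sets borel" using measurable_sets[OF \<open>q \<in> borel_measurable borel\<close>, of "{..x}"] by simp
      then show "emeasure unif (q -` {..x} \<inter> space unif) = emeasure lborel ({0<..<1} \<inter> (q -` {..x} \<inter> space unif))"
        by (simp add: emeasure_unif)
    qed auto
    also have "{0<..<1} \<inter> (q -` {..x} \<inter> space unif) = {0<..<1} \<inter> {1 - F x..}"
      using quantile_le_iff[of "1 - _" x] by (auto simp: q)
    also have "emeasure lborel ({0<..<1} \<inter> {1 - F x..}) = emeasure lborel {1 - F x<..<1}"
    proof (rule emeasure_eq_AE)
      show "AE xa in lborel. (xa \<in> {0<..<1} \<inter> {1 - F x..}) = (xa \<in> {1 - F x<..<1})"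
        using AE_lborel_singleton[of "1 - F x"] by eventually_elim (use b in auto)
    qed auto
    also have "\<dots> = ennreal (F x)" using b by simp
    finally show "cdf (distr unif borel q) x = cdf N x"
      using b by (simp add: cdf_def F measure_def)
  qed
qed

end

text \<open>An event about a real sample may be checked on the quantile transform of a uniform sample.
  The event need not be measurable: a measurable witness on the uniform side is approximated from
  inside by a compact set on which the quantile transform is continuous, and the image of that
  compact set is a compact, hence measurable, witness on the other side.\<close>

lemma inner_prob_quantile_transform:
  fixes Y :: "nat \<Rightarrow> 'a \<Rightarrow> real"
  assumes M: "prob_space M"
    and indep: "prob_space.indep_vars M (\<lambda>_. borel) Y {1..}"
    and cdf: "\<forall>i\<ge>1. cdf (distr M borel (Y i)) = F"
  shows "inner_prob unif_sample (\<lambda>v. P (\<lambda>i. quantile F (1 - v i)))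
           \<le> inner_prob M (\<lambda>\<omega>. P (\<lambda>i. Y (Suc i) \<omega>))"
proof -
  interpret M: prob_space M by fact
  have Y [measurable]: "Y i \<in> borel_measurable M" if "i \<ge> 1" for i
    using indep that by (auto simp: M.indep_vars_def)
  define N where "N = distr M borel (Y 1)"
  have rdY: "real_distribution (distr M borel (Y i))" if "i \<ge> 1" for i
    using M.prob_space_distr[OF Y[OF that]]
    by (simp add: real_distribution_def real_distribution_axioms_def)
  interpret real_cdf N F
    by (rule real_cdf.intro) (use rdY[of 1] cdf in \<open>simp_all add: N_def\<close>)
  have distr_Y: "distr M borel (Y i) = N" if "i \<ge> 1" for i
    by (rule cdf_unique[OF rdY[OF that] rdY[of 1, folded N_def]]) (use cdf that in \<open>auto simp: F[symmetric]\<close>)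
  define q where "q u = (if 0 < u \<and> u < 1 then quantile F (1 - u) else 0)" for u
  have q_meas [measurable]: "q \<in> borel_measurable borel"
  proof -
    have "mono_on {0<..<1} (\<lambda>u. - q u)"
      using mono_on_quantile by (auto simp: mono_on_def q_def)
    then have "(\<lambda>u. - q u) \<in> borel_measurable (restrict_space borel {0<..<1})"
      by (rule borel_measurable_mono_on_fnc)
    then have "(\<lambda>u. - (- q u)) \<in> borel_measurable (restrict_space borel {0<..<1})"
      by (rule borel_measurable_uminus)
    then have "(\<lambda>u. if u \<in> {0<..<1} then q u else 0) \<in> borel_measurable borel"
      by (subst measurable_If_restrict_space_iff) (auto simp: greaterThanLessThan_def greaterThan_def lessThan_def Int_def)
    moreover have "(\<lambda>u. if u \<in> {0<..<1} then q u else 0) = q"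
      by (auto simp: q_def fun_eq_iff)
    ultimately show ?thesis by simp
  qed
  have dq: "distr unif borel q = N"
    by (rule distr_quantile) (auto simp: q_def)
  define Q where "Q v = (\<lambda>i::nat. q (v i))" for v :: "nat \<Rightarrow> real"
  define X where "X \<omega> = (\<lambda>i. Y (Suc i) \<omega>)" for \<omega>
  have Q_meas [measurable]: "Q \<in> measurable unif_sample (PiM UNIV (\<lambda>_. borel))"
    unfolding Q_def by (rule measurable_PiM_single') auto
  have X_meas [measurable]: "X \<in> measurable M (PiM UNIV (\<lambda>_. borel))"
    unfolding X_def by (rule measurable_PiM_single') auto
  have distr_Q: "distr unif_sample (PiM UNIV (\<lambda>_. borel)) Q = PiM UNIV (\<lambda>_. N)"
  proof -
    have "unif_sample.indep_vars (\<lambda>_. borel) (\<lambda>i v. q (v i)) (UNIV::nat set)"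
      using unif_sample.indep_vars_compose2[OF indep_unif_sample, of "\<lambda>_. q" "\<lambda>_. borel"] by simp
    then have "distr unif_sample (Pi\<^sub>M UNIV (\<lambda>i. borel)) (\<lambda>v. \<lambda>i\<in>UNIV. q (v i)) =
        Pi\<^sub>M UNIV (\<lambda>i. distr unif_sample borel (\<lambda>v. q (v i)))"
      by (subst (asm) unif_sample.indep_vars_iff_distr_eq_PiM') auto
    moreover have "distr unif_sample borel (\<lambda>v. q (v i)) = N" for i
      using dq distr_distr[of q borel borel "\<lambda>v. v i" unif_sample]
      by (simp add: distr_unif_sample_component o_def)
    ultimately show ?thesis by (simp add: Q_def[abs_def] restrict_UNIV)
  qed
  have distr_X: "distr M (PiM UNIV (\<lambda>_. borel)) X = PiM UNIV (\<lambda>_. N)"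
  proof -
    have 1: "distr M (Pi\<^sub>M {1..} (\<lambda>i. borel)) (\<lambda>\<omega>. \<lambda>i\<in>{1..}. Y i \<omega>) = Pi\<^sub>M {1..} (\<lambda>i. N)"
    proof -
      have "Pi\<^sub>M {1..} (\<lambda>i. distr M borel (Y i)) = Pi\<^sub>M {1..} (\<lambda>i. N)"
        by (rule PiM_cong) (auto simp: distr_Y)
      then show ?thesis
        using indep Y by (subst (asm) M.indep_vars_iff_distr_eq_PiM') auto
    qed
    have NN: "prob_space N" using rdY[of 1] by (simp add: N_def real_distribution_def)
    have sN [simp]: "sets N = sets borel" by (simp add: N_def)
    have 2: "distr (Pi\<^sub>M {1..} (\<lambda>i. N)) (Pi\<^sub>M UNIV (\<lambda>i::nat. N)) (\<lambda>\<omega>. \<lambda>n\<in>UNIV. \<omega> (Suc n)) = Pi\<^sub>M UNIV (\<lambda>i. N)"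
      by (rule distr_PiM_reindex) (auto intro: NN)
    have X: "X = (\<lambda>\<omega>. \<lambda>n\<in>UNIV. \<omega> (Suc n)) \<circ> (\<lambda>\<omega>. \<lambda>i\<in>{1..}. Y i \<omega>)"
      by (simp add: X_def fun_eq_iff)
    have "distr M (PiM UNIV (\<lambda>_. N)) X =
       distr (distr M (Pi\<^sub>M {1..} (\<lambda>i. borel)) (\<lambda>\<omega>. \<lambda>i\<in>{1..}. Y i \<omega>))
         (Pi\<^sub>M UNIV (\<lambda>i::nat. N)) (\<lambda>\<omega>. \<lambda>n\<in>UNIV. \<omega> (Suc n))"
      unfolding X
    proof (rule distr_distr[symmetric])
      show "(\<lambda>\<omega>. \<lambda>n\<in>UNIV. \<omega> (Suc n)) \<in> measurable (Pi\<^sub>M {1..} (\<lambda>i. borel)) (Pi\<^sub>M UNIV (\<lambda>i. N))"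
      proof (rule measurable_PiM_single')
        fix i
        have "(\<lambda>\<omega>. \<omega> (Suc i)) \<in> measurable (Pi\<^sub>M {1..} (\<lambda>i. borel :: real measure)) borel"
          by (rule measurable_component_singleton) simp
        then show "(\<lambda>\<omega>. (\<lambda>n\<in>UNIV. \<omega> (Suc n)) i) \<in> measurable (Pi\<^sub>M {1..} (\<lambda>i. borel)) N"
          unfolding measurable_cong_sets[OF refl sN] by simp
      qed auto
      show "(\<lambda>\<omega>. \<lambda>i\<in>{1..}. Y i \<omega>) \<in> measurable M (Pi\<^sub>M {1..} (\<lambda>i. borel))"
        by (rule measurable_restrict) auto
    qed
    also have "\<dots> = PiM UNIV (\<lambda>_. N)" unfolding 1 using 2 by simp
    finally have "distr M (PiM UNIV (\<lambda>_. N)) X = PiM UNIV (\<lambda>_. N)" .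
    moreover have "distr M (PiM UNIV (\<lambda>_. N)) X = distr M (PiM UNIV (\<lambda>_. borel)) X"
      by (rule distr_cong[OF refl sets_PiM_cong[OF refl sN] refl])
    ultimately show ?thesis by metis
  qed
  \<comment> \<open>samples all of whose coordinates are points of continuity of \<open>q\<close>; this excludes a null set, as the monotone \<open>q\<close> has countably many discontinuities\<close>
  define G where "G = {v :: nat \<Rightarrow> real. \<forall>i. 0 < v i \<and> v i < 1 \<and> isCont q (v i)}"
  define D where "D = {u\<in>{0<..<1}. \<not> isCont q u}"
  have "countable D"
  proof -
    have "D \<subseteq> (\<lambda>u. 1 - u) ` {u\<in>{0<..<1}. \<not> isCont (quantile F) u}"
    proof
      fix u assume u: "u \<in> D"
      have "\<not> isCont (quantile F) (1 - u)"
      proof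
        assume "isCont (quantile F) (1 - u)"
        then have "isCont (\<lambda>u. quantile F (1 - u)) u"
          by (rule isCont_o2[where f = "\<lambda>u. 1 - u", rotated]) simp
        moreover have "eventually (\<lambda>x. x \<in> {0<..<1}) (nhds u)"
          by (rule eventually_nhds_in_open) (use u in \<open>simp_all add: D_def\<close>)
        then have "eventually (\<lambda>x. q x = quantile F (1 - x)) (nhds u)"
          by eventually_elim (simp add: q_def)
        ultimately have "isCont q u" by (simp add: isCont_cong)
        then show False using u by (simp add: D_def)
      qed
      then show "u \<in> (\<lambda>u. 1 - u) ` {u\<in>{0<..<1}. \<not> isCont (quantile F) u}"
        using u by (intro image_eqI[of _ _ "1 - u"]) (auto simp: D_def)
    qed
    then show ?thesis using countable_discont by (meson countable_image countable_subset)
  qed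
  have AE_G: "AE v in unif_sample. v \<in> G"
  proof -
    have "AE u in unif. u \<notin> D"
      unfolding unif_def
    proof (rule AE_uniform_measureI)
      show "AE x in lborel. x \<in> {0<..<1} \<longrightarrow> x \<notin> D"
        using AE_not_in[OF countable_imp_null_set_lborel[OF \<open>countable D\<close>]] by eventually_elim simp
    qed simp
    then have "AE u in distr unif_sample borel (\<lambda>v. v i). u \<notin> D" for i
      unfolding distr_unif_sample_component .
    then have "AE v in unif_sample. v i \<notin> D" for i
    proof (subst (asm) AE_distr_iff)
      have "D \<in> sets borel" using \<open>countable D\<close> by (rule sets.countable[rotated]) auto
      then show "{x \<in> space borel. x \<notin> D} \<in> sets borel" by (simp add: Collect_neg_eq)
    qed auto
    then have "AE v in unif_sample. \<forall>i. v i \<notin> D" by (simp add: AE_all_countable)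
    with AE_unif_sample show ?thesis by eventually_elim (auto simp: G_def D_def)
  qed
  then obtain H where H: "H \<in> null_sets unif_sample" "- G \<subseteq> H"
    by (elim AE_E) (auto simp: null_sets_def Compl_eq)
  show ?thesis
  proof (rule unif_sample.inner_prob_leI)
    fix E assume E: "E \<in> unif_sample.events"
      "E \<subseteq> {v \<in> space unif_sample. P (\<lambda>i. quantile F (1 - v i))}"
    define E' where "E' = E - H"
    have E': "E' \<in> sets borel" using E H by (auto simp: E'_def sets_unif_sample[symmetric])
    have "emeasure unif_sample E = emeasure unif_sample E'"
      unfolding E'_def using H(1) E(1) by (simp add: emeasure_Diff_null_set)
    also have "\<dots> = (SUP K \<in> {K. K \<subseteq> E' \<and> compact K}. emeasure unif_sample K)"
      by (rule inner_regular) (use E' sets_unif_sample in auto)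
    also have "\<dots> \<le> ennreal (inner_prob M (\<lambda>\<omega>. P (X \<omega>)))"
    proof (rule SUP_least, safe)
      fix K assume K: "K \<subseteq> E'" "compact K"
      then have KG: "K \<subseteq> G" using H by (auto simp: E'_def)
      have "continuous_on K Q"
        unfolding Q_def
      proof (rule continuous_on_coordinatewise_then_product)
        fix i
        have "isCont (\<lambda>v. q (v i)) v" if "v \<in> K" for v
        proof -
          have "isCont (\<lambda>v::nat \<Rightarrow> real. v i) v"
            using continuous_on_product_coordinates[of i] continuous_on_eq_continuous_at[OF open_UNIV]
            by blast
          moreover have "isCont q (v i)" using KG that by (auto simp: G_def)
          ultimately show ?thesis by (rule isCont_o2[where f = "\<lambda>v. v i" and g = q])
        qed
        then show "continuous_on K (\<lambda>v. q (v i))" by (simp add: continuous_at_imp_continuous_on)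
      qed
      then have QK: "compact (Q ` K)" using K by (intro compact_continuous_image)
      have QK': "Q ` K \<in> sets (PiM UNIV (\<lambda>_. borel :: real measure))"
        using compact_imp_closed[OF QK] by (simp add: sets_PiM_equal_borel borel_closed)
      have "emeasure unif_sample K \<le> emeasure unif_sample (Q -` (Q ` K) \<inter> space unif_sample)"
        by (rule emeasure_mono) (use measurable_sets[OF Q_meas QK'] in auto)
      also have "\<dots> = emeasure (distr unif_sample (PiM UNIV (\<lambda>_. borel)) Q) (Q ` K)"
        by (rule emeasure_distr[OF Q_meas QK', symmetric])
      also have "\<dots> = emeasure (distr M (PiM UNIV (\<lambda>_. borel)) X) (Q ` K)"
        by (simp add: distr_Q distr_X)
      also have "\<dots> = emeasure M (X -` (Q ` K) \<inter> space M)"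
        by (rule emeasure_distr[OF X_meas QK'])
      also have "\<dots> = ennreal (M.prob (X -` (Q ` K) \<inter> space M))"
        by (rule M.emeasure_eq_measure)
      also have "\<dots> \<le> ennreal (inner_prob M (\<lambda>\<omega>. P (X \<omega>)))"
      proof (rule ennreal_leI, rule M.prob_le_inner_prob)
        show "X -` (Q ` K) \<inter> space M \<in> M.events"
          using QK' by (rule measurable_sets[OF X_meas])
        show "X -` (Q ` K) \<inter> space M \<subseteq> {\<omega> \<in> space M. P (X \<omega>)}"
        proof safe
          fix \<omega> v assume v: "v \<in> K" "X \<omega> = Q v"
          have "Q v = (\<lambda>i. quantile F (1 - v i))"
            using KG v by (auto simp: Q_def q_def G_def fun_eq_iff)
          moreover have "P (\<lambda>i. quantile F (1 - v i))"
            using K v E by (auto simp: E'_def)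
          ultimately show "P (X \<omega>)" using v by simp
        qed
      qed
      finally show "emeasure unif_sample K \<le> ennreal (inner_prob M (\<lambda>\<omega>. P (X \<omega>)))" .
    qed
    finally have "ennreal (unif_sample.prob E) \<le> ennreal (inner_prob M (\<lambda>\<omega>. P (X \<omega>)))"
      by (simp add: unif_sample.emeasure_eq_measure)
    moreover have "0 \<le> inner_prob M (\<lambda>\<omega>. P (X \<omega>))"
      using M.prob_le_inner_prob[of "{}"] by simp
    ultimately show "unif_sample.prob E \<le> inner_prob M (\<lambda>\<omega>. P (\<lambda>i. Y (Suc i) \<omega>))"
      by (simp add: X_def)
  qed
qed

section \<open>Averages over a uniform sample\<close>

lemma (in prob_space) second_moment_of_centred_indep_sum:
  fixes X :: "nat \<Rightarrow> 'a \<Rightarrow> real"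
  assumes indep: "indep_vars (\<lambda>_. borel) X {..<n}"
    and X: "\<And>i. i < n \<Longrightarrow> X i \<in> borel_measurable M"
    and sq: "\<And>i. i < n \<Longrightarrow> integrable M (\<lambda>\<omega>. (X i \<omega>)\<^sup>2)"
    and mean: "\<And>i. i < n \<Longrightarrow> expectation (X i) = 0"
  shows "integrable M (\<lambda>\<omega>. (\<Sum>i<n. X i \<omega>)\<^sup>2)"
    and "expectation (\<lambda>\<omega>. (\<Sum>i<n. X i \<omega>)\<^sup>2) = (\<Sum>i<n. expectation (\<lambda>\<omega>. (X i \<omega>)\<^sup>2))"
proof -
  have int: "integrable M (X i)" if "i < n" for i
    using square_integrable_imp_integrable[OF X sq] that by blast
  have cross: "integrable M (\<lambda>\<omega>. X i \<omega> * X j \<omega>) \<and>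
      expectation (\<lambda>\<omega>. X i \<omega> * X j \<omega>) = (if i = j then expectation (\<lambda>\<omega>. (X i \<omega>)\<^sup>2) else 0)"
    if "i < n" "j < n" for i j
  proof (cases "i = j")
    case True then show ?thesis using sq[of i] that by (simp add: power2_eq_square)
  next
    case False
    have "indep_vars (\<lambda>_. borel) X {i, j}"
      by (rule indep_vars_subset[OF indep]) (use that in auto)
    then have "integrable M (\<lambda>\<omega>. \<Prod>l\<in>{i, j}. X l \<omega>)"
      and "expectation (\<lambda>\<omega>. \<Prod>l\<in>{i, j}. X l \<omega>) = (\<Prod>l\<in>{i, j}. expectation (X l))"
      using that int by (intro indep_vars_integrable indep_vars_lebesgue_integral; auto)+
    then show ?thesis using False mean that by simp
  qed
  have eq: "(\<Sum>i<n. X i \<omega>)\<^sup>2 = (\<Sum>i<n. \<Sum>j<n. X i \<omega> * X j \<omega>)" for \<omega>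
    by (simp add: power2_eq_square sum_product)
  show "integrable M (\<lambda>\<omega>. (\<Sum>i<n. X i \<omega>)\<^sup>2)"
    unfolding eq using cross by (intro Bochner_Integration.integrable_sum) auto
  have "expectation (\<lambda>\<omega>. (\<Sum>i<n. X i \<omega>)\<^sup>2) = (\<Sum>i<n. \<Sum>j<n. expectation (\<lambda>\<omega>. X i \<omega> * X j \<omega>))"
    unfolding eq
  proof (subst Bochner_Integration.integral_sum)
    show "integrable M (\<lambda>\<omega>. \<Sum>j<n. X i \<omega> * X j \<omega>)" if "i \<in> {..<n}" for i
      using cross that by (intro Bochner_Integration.integrable_sum) auto
    show "(\<Sum>i<n. expectation (\<lambda>\<omega>. \<Sum>j<n. X i \<omega> * X j \<omega>)) =
        (\<Sum>i<n. \<Sum>j<n. expectation (\<lambda>\<omega>. X i \<omega> * X j \<omega>))"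
      using cross by (intro sum.cong refl Bochner_Integration.integral_sum) auto
  qed
  also have "\<dots> = (\<Sum>i<n. \<Sum>j<n. if i = j then expectation (\<lambda>\<omega>. (X i \<omega>)\<^sup>2) else 0)"
    using cross by (intro sum.cong) auto
  also have "\<dots> = (\<Sum>i<n. expectation (\<lambda>\<omega>. (X i \<omega>)\<^sup>2))" by simp
  finally show "expectation (\<lambda>\<omega>. (\<Sum>i<n. X i \<omega>)\<^sup>2) = (\<Sum>i<n. expectation (\<lambda>\<omega>. (X i \<omega>)\<^sup>2))" .
qed

text \<open>There are about \<open>k\<close> scaled points \<open>v j * n / k\<close> per unit length, so this average approximates the
integral of \<open>g\<close>.\<close>

definition scaled_avg :: "nat \<Rightarrow> nat \<Rightarrow> (real \<Rightarrow> real) \<Rightarrow> (nat \<Rightarrow> real) \<Rightarrow> real" where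
  "scaled_avg n k g v = (\<Sum>j<n. g (v j * real n / real k)) / real k"

lemma unif_density: "unif = density lborel (\<lambda>x. ennreal (indicator {0<..<1} x))"
  unfolding unif_def uniform_measure_def
  by (rule density_cong) (auto simp: divide_ennreal_def split: split_indicator)

lemma integral_unif_sample_component:
  fixes g :: "real \<Rightarrow> real"
  assumes g: "integrable lborel g" and nk: "0 < k" "0 < n"
    and supp: "\<And>x. x \<notin> {0<..<real n / real k} \<Longrightarrow> g x = 0"
  shows "integrable unif_sample (\<lambda>v. g (v j * real n / real k))"
    and "unif_sample.expectation (\<lambda>v. g (v j * real n / real k)) = real k / real n * (\<integral>x. g x \<partial>lborel)"
proof -
  let ?c = "real n / real k"
  have c: "?c > 0" using nk by simp
  have [measurable]: "g \<in> borel_measurable borel" using g by auto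
  have ind: "indicator {0<..<1} x *\<^sub>R g (x * real n / real k) = g (0 + ?c * x)" for x :: real
  proof (cases "x \<in> {0<..<1}")
    case True then show ?thesis by (simp add: mult.commute)
  next
    case False
    then have "?c * x \<notin> {0<..<?c}" using c nk by (auto simp: zero_less_mult_iff field_simps)
    then show ?thesis using False supp by simp
  qed
  have meas: "(\<lambda>x. g (x * real n / real k)) \<in> borel_measurable unif"
    by (simp cong: measurable_cong_sets)
  have int: "integrable unif (\<lambda>x. g (x * real n / real k))"
  proof -
    have "integrable lborel (\<lambda>x. indicator {0<..<1} x *\<^sub>R g (x * real n / real k))"
      unfolding ind using c nk by (intro lborel_integrable_real_affine[OF g]) auto
    then show ?thesis unfolding unif_density by (subst integrable_density) auto
  qed
  then have "integrable (distr unif_sample borel (\<lambda>v. v j)) (\<lambda>x. g (x * real n / real k))"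
    by (simp add: distr_unif_sample_component)
  then show "integrable unif_sample (\<lambda>v. g (v j * real n / real k))"
    by (subst (asm) integrable_distr_eq) auto
  have "unif_sample.expectation (\<lambda>v. g (v j * real n / real k)) =
      (\<integral>x. g (x * real n / real k) \<partial>distr unif_sample borel (\<lambda>v. v j))"
    by (rule integral_distr[symmetric]) auto
  also have "\<dots> = (\<integral>x. g (x * real n / real k) \<partial>unif)" by (simp add: distr_unif_sample_component)
  also have "\<dots> = (\<integral>x. g (0 + ?c * x) \<partial>lborel)"
    unfolding unif_density ind[symmetric] by (subst integral_density) auto
  also have "\<dots> = (\<integral>x. g x \<partial>lborel) / ?c"
    using lborel_integral_real_affine[of ?c g 0] c nk by (simp add: field_simps)
  finally show "unif_sample.expectation (\<lambda>v. g (v j * real n / real k)) = real k / real n * (\<integral>x. g x \<partial>lborel)"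
    by simp
qed

lemma measurable_scaled_avg [measurable]:
  assumes "g \<in> borel_measurable borel"
  shows "scaled_avg n k g \<in> borel_measurable unif_sample"
proof -
  note [measurable] = assms
  show ?thesis unfolding scaled_avg_def by measurable
qed

lemma scaled_avg_chebyshev:
  fixes g :: "real \<Rightarrow> real"
  assumes g: "integrable lborel g" "integrable lborel (\<lambda>x. (g x)\<^sup>2)" and nk: "0 < k" "0 < n"
    and supp: "\<And>x. x \<notin> {0<..<real n / real k} \<Longrightarrow> g x = 0" and "c > 0"
  shows "unif_sample.prob {v. \<bar>scaled_avg n k g v - (\<integral>x. g x \<partial>lborel)\<bar> \<ge> c}
     \<le> (\<integral>x. (g x)\<^sup>2 \<partial>lborel) / (real k * c\<^sup>2)"
proof -
  have [measurable]: "g \<in> borel_measurable borel" using g by auto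
  define m where "m = real k / real n * (\<integral>x. g x \<partial>lborel)"
  define X where "X j v = g (v j * real n / real k) - m" for j and v :: "nat \<Rightarrow> real"
  note c1 = integral_unif_sample_component[OF g(1) nk supp]
  have c2: "integrable unif_sample (\<lambda>v. (g (v j * real n / real k))\<^sup>2)"
    "unif_sample.expectation (\<lambda>v. (g (v j * real n / real k))\<^sup>2) = real k / real n * (\<integral>x. (g x)\<^sup>2 \<partial>lborel)" for j
    using integral_unif_sample_component[OF g(2) nk, of j] supp by auto
  have [measurable]: "X j \<in> borel_measurable unif_sample" for j unfolding X_def by measurable
  have indep: "unif_sample.indep_vars (\<lambda>_. borel) X {..<n}"
  proof -
    have "unif_sample.indep_vars (\<lambda>_. borel) (\<lambda>j v. (\<lambda>x. g (x * real n / real k) - m) (v j)) (UNIV::nat set)"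
      by (rule unif_sample.indep_vars_compose2[OF indep_unif_sample]) simp
    then show ?thesis
      unfolding X_def[abs_def] by (rule unif_sample.indep_vars_subset) auto
  qed
  have e1: "unif_sample.expectation (\<lambda>v. g (v j * real n / real k)) = m" for j
    unfolding m_def by (rule c1(2))
  have mean: "unif_sample.expectation (X j) = 0" for j
    unfolding X_def using c1(1)[of j] by (simp add: e1 unif_sample.prob_space[simplified])
  have X2: "(X j v)\<^sup>2 = (g (v j * real n / real k))\<^sup>2 - 2 * m * g (v j * real n / real k) + m\<^sup>2" for j v
    by (simp add: X_def power2_diff algebra_simps)
  have sq: "integrable unif_sample (\<lambda>v. (X j v)\<^sup>2)" for j
    unfolding X2 using c1(1)[of j] c2(1)[of j] by auto
  have var: "unif_sample.expectation (\<lambda>v. (X j v)\<^sup>2) \<le> real k / real n * (\<integral>x. (g x)\<^sup>2 \<partial>lborel)" for j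
  proof -
    have "unif_sample.expectation (\<lambda>v. (X j v)\<^sup>2) = real k / real n * (\<integral>x. (g x)\<^sup>2 \<partial>lborel) - 2 * m * m + m\<^sup>2"
      unfolding X2 using c1(1)[of j] c2(1)[of j]
      by (simp add: e1 c2(2) unif_sample.prob_space[simplified])
    also have "\<dots> \<le> real k / real n * (\<integral>x. (g x)\<^sup>2 \<partial>lborel)" by (simp add: power2_eq_square)
    finally show ?thesis .
  qed
  note sm = unif_sample.second_moment_of_centred_indep_sum[OF indep _ sq mean]
  have eq: "\<bar>scaled_avg n k g v - (\<integral>x. g x \<partial>lborel)\<bar> \<ge> c \<longleftrightarrow> \<bar>\<Sum>j<n. X j v\<bar> \<ge> real k * c" for v
  proof -
    have "(\<Sum>j<n. X j v) = real k * (scaled_avg n k g v - (\<integral>x. g x \<partial>lborel))"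
      using nk by (simp add: X_def sum_subtractf scaled_avg_def m_def right_diff_distrib)
    then have "\<bar>\<Sum>j<n. X j v\<bar> = real k * \<bar>scaled_avg n k g v - (\<integral>x. g x \<partial>lborel)\<bar>"
      by (simp add: abs_mult)
    then show ?thesis using nk by simp
  qed
  have "unif_sample.prob {v \<in> space unif_sample. \<bar>\<Sum>j<n. X j v\<bar> \<ge> real k * c}
      \<le> unif_sample.expectation (\<lambda>v. (\<Sum>j<n. X j v)\<^sup>2) / (real k * c)\<^sup>2"
    by (rule unif_sample.second_moment_method[OF _ sm(1)]) (use nk \<open>c > 0\<close> in auto)
  also have "unif_sample.expectation (\<lambda>v. (\<Sum>j<n. X j v)\<^sup>2) \<le> (\<Sum>j<n. real k / real n * (\<integral>x. (g x)\<^sup>2 \<partial>lborel))"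
    by (subst sm(2)) (simp, rule sum_mono, rule var)
  also have "\<dots> = real k * (\<integral>x. (g x)\<^sup>2 \<partial>lborel)" using nk by simp
  finally show ?thesis
    using nk \<open>c > 0\<close> by (simp add: eq divide_right_mono power_mult_distrib power2_eq_square divide_simps mult_ac)
qed

lemma scaled_avg_markov:
  fixes g :: "real \<Rightarrow> real"
  assumes g: "integrable lborel g" and nk: "0 < k" "0 < n"
    and supp: "\<And>x. x \<notin> {0<..<real n / real k} \<Longrightarrow> g x = 0" and "c > 0"
    and nonneg: "\<And>x. g x \<ge> 0"
  shows "unif_sample.prob {v. scaled_avg n k g v \<ge> c} \<le> (\<integral>x. g x \<partial>lborel) / c"
proof -
  note c1 = integral_unif_sample_component[OF g nk supp]
  have int: "integrable unif_sample (scaled_avg n k g)"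
    unfolding scaled_avg_def using c1(1) by auto
  have "unif_sample.expectation (scaled_avg n k g) = (\<integral>x. g x \<partial>lborel)"
    unfolding scaled_avg_def using c1 nk by simp
  moreover have "unif_sample.prob {v \<in> space unif_sample. scaled_avg n k g v \<ge> c} \<le> unif_sample.expectation (scaled_avg n k g) / c"
    by (rule integral_Markov_inequality_measure[OF int, of "{}"])
       (use \<open>c > 0\<close> nonneg in \<open>auto simp: scaled_avg_def intro!: divide_nonneg_nonneg sum_nonneg\<close>)
  ultimately show ?thesis by simp
qed

text \<open>The permitted failure probability \<open>\<eta>\<close> is kept explicit: constants inside \<open>P\<close> may depend on it, and
conjunctions add up.\<close>

definition likely :: "real \<Rightarrow> (nat \<Rightarrow> (nat \<Rightarrow> real) \<Rightarrow> bool) \<Rightarrow> bool" where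
  "likely \<eta> P \<longleftrightarrow> eventually (\<lambda>n. inner_prob unif_sample (P n) \<ge> 1 - \<eta>) sequentially"

lemma likely_mono:
  assumes "likely \<eta> P" "eventually (\<lambda>n. \<forall>v. P n v \<longrightarrow> Q n v) sequentially"
  shows "likely \<eta> Q"
  using assms(2) assms(1)[unfolded likely_def] unfolding likely_def
proof eventually_elim
  case (elim n)
  then have "inner_prob unif_sample (P n) \<le> inner_prob unif_sample (Q n)"
    by (intro unif_sample.inner_prob_mono) auto
  then show ?case using elim by linarith
qed

lemma likely_conj:
  assumes "likely \<eta>\<^sub>1 P" "likely \<eta>\<^sub>2 Q"
  shows "likely (\<eta>\<^sub>1 + \<eta>\<^sub>2) (\<lambda>n v. P n v \<and> Q n v)"
  using assms unfolding likely_def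
  by eventually_elim (rule unif_sample.inner_prob_conj)

lemma likely_eta_mono: "likely \<eta> P \<Longrightarrow> \<eta> \<le> \<eta>' \<Longrightarrow> likely \<eta>' P"
  unfolding likely_def by (auto elim: eventually_mono)

lemma likely_if_bad_unlikely:
  assumes "eventually (\<lambda>n. E n \<in> sets unif_sample \<and> unif_sample.prob (E n) \<le> \<eta> \<and> - E n \<subseteq> {v. P n v}) sequentially"
  shows "likely \<eta> P"
  using assms unfolding likely_def
proof eventually_elim
  case (elim n)
  have "unif_sample.prob (- E n) = 1 - unif_sample.prob (E n)"
    using unif_sample.prob_compl[of "E n"] elim by (simp add: Compl_eq_Diff_UNIV)
  moreover have "- E n \<in> sets unif_sample" using elim
    by (metis Compl_eq_Diff_UNIV sets.compl_sets space_unif_sample)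
  then have "unif_sample.prob (- E n) \<le> inner_prob unif_sample (P n)"
    using elim by (intro unif_sample.prob_le_inner_prob) auto
  ultimately show ?case using elim by linarith
qed

lemma likely_AE:
  assumes "AE v in unif_sample. P v"
  shows "likely 0 (\<lambda>_. P)"
proof -
  obtain N where N: "{v \<in> space unif_sample. \<not> P v} \<subseteq> N" "emeasure unif_sample N = 0" "N \<in> sets unif_sample"
    using assms by (rule AE_E)
  show ?thesis
    by (rule likely_if_bad_unlikely[of "\<lambda>_. N"]) (use N in \<open>auto simp: measure_def\<close>)
qed

locale intermediate =
  fixes k :: "nat \<Rightarrow> nat"
  assumes inter: "intermediate_seq k"
begin

lemma k_at_top: "filterlim k at_top sequentially"
  using inter by (simp add: intermediate_seq_def)

lemma k_real_at_top: "filterlim (\<lambda>n. real (k n)) at_top sequentially"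
  by (rule filterlim_compose[OF filterlim_real_sequentially k_at_top])

lemma ratio_at_top: "filterlim (\<lambda>n. real n / real (k n)) at_top sequentially"
proof -
  have "(\<lambda>n. real (k n) / real n) \<longlonglongrightarrow> 0"
    using inter by (auto simp: intermediate_seq_def intro: smalloD_tendsto)
  moreover have "eventually (\<lambda>n. real (k n) / real n > 0) sequentially"
    using eventually_gt_at_top[of 0] filterlim_at_top_dense[THEN iffD1, OF k_real_at_top, rule_format, of 0]
    by eventually_elim auto
  ultimately have "filterlim (\<lambda>n. inverse (real (k n) / real n)) at_top sequentially"
    by (intro filterlim_inverse_at_top)
  then show ?thesis by (simp add: inverse_eq_divide)
qed

lemma ev_k_ge: "eventually (\<lambda>n. c \<le> real (k n)) sequentially"
  using k_real_at_top by (simp add: filterlim_at_top)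

lemma ev_ratio_ge: "eventually (\<lambda>n. c \<le> real n / real (k n)) sequentially"
  using ratio_at_top by (simp add: filterlim_at_top)

lemma ev_nk: "eventually (\<lambda>n. 0 < k n \<and> 0 < n \<and> 2 * k n < n) sequentially"
  using ev_k_ge[of 1] ev_ratio_ge[of 3]
proof eventually_elim
  case (elim n)
  then have "3 * real (k n) \<le> real n" "0 < k n" by (auto simp: pos_le_divide_eq)
  then have "3 * k n \<le> n" by linarith
  then show ?case using \<open>0 < k n\<close> by auto
qed

text \<open>The points range over \<open>{0<..<n / k}\<close>, which contains the window \<open>{0<..2}\<close> as soon as \<open>2 * k < n\<close>.\<close>

lemma supp_ok: "2 * k n < n \<Longrightarrow> 0 < k n \<Longrightarrow> x \<notin> {0<..<real n / real (k n)} \<Longrightarrow> x \<notin> {0<..2}"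
proof
  assume n: "2 * k n < n" "0 < k n" "x \<notin> {0<..<real n / real (k n)}" and "x \<in> {0<..2}"
  then have "real n \<le> x * real (k n)" "0 < x" "x \<le> 2" by (auto simp: field_simps)
  moreover from \<open>x \<le> 2\<close> have "x * real (k n) \<le> 2 * real (k n)" by (intro mult_right_mono) auto
  moreover have "2 * real (k n) < real n" using n(1) by linarith
  ultimately show False by linarith
qed

lemma scaled_avg_L2:
  assumes g: "integrable lborel g" "integrable lborel (\<lambda>x. (g x)\<^sup>2)"
    and supp: "\<And>x. x \<notin> {0<..2} \<Longrightarrow> g x = 0" and "\<eta> > 0"
  obtains C where "C > 0"
    "likely \<eta> (\<lambda>n v. \<bar>scaled_avg n (k n) g v - (\<integral>x. g x \<partial>lborel)\<bar> \<le> C / sqrt (real (k n)))"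
proof -
  define V where "V = (\<integral>x. (g x)\<^sup>2 \<partial>lborel)"
  have V: "V \<ge> 0" by (simp add: V_def)
  define C where "C = sqrt ((V + 1) / \<eta>)"
  have C: "C > 0" "C\<^sup>2 = (V + 1) / \<eta>" using V \<open>\<eta> > 0\<close> by (auto simp: C_def)
  have [measurable]: "g \<in> borel_measurable borel" using g by auto
  have "likely \<eta> (\<lambda>n v. \<bar>scaled_avg n (k n) g v - (\<integral>x. g x \<partial>lborel)\<bar> \<le> C / sqrt (real (k n)))"
  proof (rule likely_if_bad_unlikely)
    show "eventually (\<lambda>n. {v. \<bar>scaled_avg n (k n) g v - (\<integral>x. g x \<partial>lborel)\<bar> \<ge> C / sqrt (real (k n))} \<in> sets unif_sample \<and>
       unif_sample.prob {v. \<bar>scaled_avg n (k n) g v - (\<integral>x. g x \<partial>lborel)\<bar> \<ge> C / sqrt (real (k n))} \<le> \<eta> \<and>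
       - {v. \<bar>scaled_avg n (k n) g v - (\<integral>x. g x \<partial>lborel)\<bar> \<ge> C / sqrt (real (k n))} \<subseteq>
       {v. \<bar>scaled_avg n (k n) g v - (\<integral>x. g x \<partial>lborel)\<bar> \<le> C / sqrt (real (k n))}) sequentially"
      using ev_nk
    proof eventually_elim
      case (elim n)
      have A: "{v \<in> space unif_sample. \<bar>scaled_avg n (k n) g v - (\<integral>x. g x \<partial>lborel)\<bar> \<ge> C / sqrt (real (k n))} \<in> sets unif_sample"
        by measurable
      have "unif_sample.prob {v. \<bar>scaled_avg n (k n) g v - (\<integral>x. g x \<partial>lborel)\<bar> \<ge> C / sqrt (real (k n))}
          \<le> V / (real (k n) * (C / sqrt (real (k n)))\<^sup>2)"
        unfolding V_def by (rule scaled_avg_chebyshev[OF g]) (use elim supp supp_ok C in auto)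
      also have "\<dots> = V / ((V + 1) / \<eta>)" using elim C by (simp add: power_divide)
      also have "\<dots> \<le> \<eta>" using V \<open>\<eta> > 0\<close> by (simp add: field_simps)
      finally show ?case using A by auto
    qed
  qed
  then show ?thesis using that C by blast
qed

text \<open>Truncation: the bounded part of \<open>g\<close> is square integrable, so \<open>scaled_avg_L2\<close> applies to it, and
the average of the remainder has a small expectation.\<close>

lemma scaled_avg_L1:
  assumes g: "integrable lborel g"
    and supp: "\<And>x. x \<notin> {0<..2} \<Longrightarrow> g x = 0" and "\<eta> > 0" "\<epsilon> > 0"
  shows "likely \<eta> (\<lambda>n v. \<bar>scaled_avg n (k n) g v - (\<integral>x. g x \<partial>lborel)\<bar> \<le> \<epsilon>)"
proof -
  have [measurable]: "g \<in> borel_measurable borel" using g by auto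
  define d where "d = min (\<epsilon> / 3) (\<epsilon> * \<eta> / 6)"
  have d: "d > 0" using assms by (simp add: d_def)
  define g1 where "g1 B x = (if \<bar>g x\<bar> \<le> real B then g x else 0)" for B :: nat and x
  define g2 where "g2 B x = (if \<bar>g x\<bar> \<le> real B then 0 else \<bar>g x\<bar>)" for B :: nat and x
  have [measurable]: "g1 B \<in> borel_measurable borel" "g2 B \<in> borel_measurable borel" for B
    unfolding g1_def g2_def by measurable
  have "(\<lambda>B. \<integral>x. g2 B x \<partial>lborel) \<longlonglongrightarrow> (\<integral>x. (0::real) \<partial>(lborel :: real measure))"
  proof (rule integral_dominated_convergence[where w = "\<lambda>x. \<bar>g x\<bar>"])
    show "AE x in lborel. (\<lambda>B. g2 B x) \<longlonglongrightarrow> 0"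
    proof (rule AE_I2)
      fix x
      obtain B0 where "\<bar>g x\<bar> \<le> real B0" using real_arch_simple by blast
      then have "eventually (\<lambda>B. g2 B x = 0) sequentially"
        unfolding eventually_sequentially by (intro exI[of _ B0]) (auto simp: g2_def)
      then show "(\<lambda>B. g2 B x) \<longlonglongrightarrow> 0" by (rule tendsto_eventually)
    qed
  qed (use g in \<open>auto simp: g2_def\<close>)
  then have "eventually (\<lambda>B. (\<integral>x. g2 B x \<partial>lborel) < d) sequentially"
    using d by (intro order_tendstoD) auto
  then obtain B where B: "(\<integral>x. g2 B x \<partial>lborel) < d" by (auto dest: eventually_happens)
  have i2: "integrable lborel (g2 B)"
    by (rule Bochner_Integration.integrable_bound[OF g]) (auto simp: g2_def)
  have i1: "integrable lborel (g1 B)"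
    by (rule Bochner_Integration.integrable_bound[OF g]) (auto simp: g1_def)
  have i12: "integrable lborel (\<lambda>x. (g1 B x)\<^sup>2)"
  proof (rule Bochner_Integration.integrable_bound[OF integrable_mult_right[OF g, of "real B"]])
    have "(g1 B x)\<^sup>2 \<le> real B * \<bar>g x\<bar>" for x
      by (auto simp: g1_def power2_eq_square abs_mult[symmetric]) 
         (metis abs_ge_zero abs_mult_self_eq mult_right_mono)
    then show "AE x in lborel. norm ((g1 B x)\<^sup>2) \<le> norm (real B * g x)" by (auto simp: abs_mult)
  qed auto
  obtain C where C: "C > 0"
    "likely (\<eta> / 2) (\<lambda>n v. \<bar>scaled_avg n (k n) (g1 B) v - (\<integral>x. g1 B x \<partial>lborel)\<bar> \<le> C / sqrt (real (k n)))"
  proof (rule scaled_avg_L2[OF i1 i12, of "\<eta>/2"])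
    show "g1 B x = 0" if "x \<notin> {0<..2}" for x using supp[OF that] by (simp add: g1_def)
  qed (use \<open>\<eta> > 0\<close> in auto)
  have 2: "likely (\<eta> / 2) (\<lambda>n v. scaled_avg n (k n) (g2 B) v \<le> \<epsilon> / 3)"
  proof (rule likely_if_bad_unlikely)
    show "eventually (\<lambda>n. {v. scaled_avg n (k n) (g2 B) v \<ge> \<epsilon> / 3} \<in> sets unif_sample \<and>
       unif_sample.prob {v. scaled_avg n (k n) (g2 B) v \<ge> \<epsilon> / 3} \<le> \<eta> / 2 \<and>
       - {v. scaled_avg n (k n) (g2 B) v \<ge> \<epsilon> / 3} \<subseteq> {v. scaled_avg n (k n) (g2 B) v \<le> \<epsilon> / 3}) sequentially"
      using ev_nk
    proof eventually_elim
      case (elim n)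
      have A: "{v \<in> space unif_sample. scaled_avg n (k n) (g2 B) v \<ge> \<epsilon> / 3} \<in> sets unif_sample" by measurable
      have "unif_sample.prob {v. scaled_avg n (k n) (g2 B) v \<ge> \<epsilon> / 3} \<le> (\<integral>x. g2 B x \<partial>lborel) / (\<epsilon> / 3)"
        by (rule scaled_avg_markov[OF i2]) (use elim supp supp_ok \<open>\<epsilon> > 0\<close> in \<open>auto simp: g2_def\<close>)
      also have "\<dots> \<le> \<eta> / 2" using B \<open>\<epsilon> > 0\<close> by (simp add: d_def field_simps)
      finally show ?case using A by auto
    qed
  qed
  have small: "eventually (\<lambda>n. C / sqrt (real (k n)) \<le> \<epsilon> / 3) sequentially"
    using ev_k_ge[of "(3 * C / \<epsilon>)\<^sup>2"] ev_k_ge[of 1]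
  proof eventually_elim
    case (elim n)
    then have "3 * C / \<epsilon> \<le> sqrt (real (k n))"
      using C \<open>\<epsilon> > 0\<close> by (intro real_le_rsqrt) auto
    then show ?case using elim \<open>\<epsilon> > 0\<close> by (simp add: field_simps)
  qed
  have "likely (\<eta> / 2 + \<eta> / 2) (\<lambda>n v. \<bar>scaled_avg n (k n) g v - (\<integral>x. g x \<partial>lborel)\<bar> \<le> \<epsilon>)"
  proof (rule likely_mono[OF likely_conj[OF C(2) 2]])
    show "eventually (\<lambda>n. \<forall>v. \<bar>scaled_avg n (k n) (g1 B) v - (\<integral>x. g1 B x \<partial>lborel)\<bar> \<le> C / sqrt (real (k n)) \<and>
        scaled_avg n (k n) (g2 B) v \<le> \<epsilon> / 3 \<longrightarrow> \<bar>scaled_avg n (k n) g v - (\<integral>x. g x \<partial>lborel)\<bar> \<le> \<epsilon>) sequentially"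
      using small
    proof eventually_elim
      case (elim n)
      show ?case
      proof (intro allI impI, elim conjE)
        fix v assume 1: "\<bar>scaled_avg n (k n) (g1 B) v - (\<integral>x. g1 B x \<partial>lborel)\<bar> \<le> C / sqrt (real (k n))"
          and 2: "scaled_avg n (k n) (g2 B) v \<le> \<epsilon> / 3"
        have "\<bar>scaled_avg n (k n) g v - scaled_avg n (k n) (g1 B) v\<bar> \<le> scaled_avg n (k n) (g2 B) v"
          unfolding scaled_avg_def diff_divide_distrib[symmetric] sum_subtractf[symmetric] abs_divide abs_of_nat
          by (intro divide_right_mono order_trans[OF sum_abs] sum_mono) (auto simp: g1_def g2_def)
        moreover have "\<bar>(\<integral>x. g x \<partial>lborel) - (\<integral>x. g1 B x \<partial>lborel)\<bar> \<le> (\<integral>x. g2 B x \<partial>lborel)"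
          unfolding Bochner_Integration.integral_diff[OF g i1, symmetric]
          by (rule integral_abs_bound_integral[OF Bochner_Integration.integrable_diff[OF g i1] i2])
             (auto simp: g1_def g2_def)
        moreover have "(\<integral>x. g2 B x \<partial>lborel) \<le> \<epsilon> / 3" using B by (simp add: d_def)
        ultimately show "\<bar>scaled_avg n (k n) g v - (\<integral>x. g x \<partial>lborel)\<bar> \<le> \<epsilon>"
          using 1 2 elim by linarith
      qed
    qed
  qed
  then show ?thesis by simp
qed

text \<open>For a varying upper end point \<open>b\<close> the average below is \<open>1 / k\<close> times the number of scaled
  points up to \<open>b\<close>.\<close>

lemma scaled_avg_count:
  assumes "\<eta> > 0" and b: "eventually (\<lambda>n. 0 \<le> b n \<and> b n \<le> 2) sequentially"
  shows "likely \<eta> (\<lambda>n v. \<bar>scaled_avg n (k n) (indicator {0<..b n}) v - b n\<bar> \<le> sqrt (2 / \<eta>) / sqrt (real (k n)))"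
proof (rule likely_if_bad_unlikely)
  let ?E = "\<lambda>n. {v. \<bar>scaled_avg n (k n) (indicator {0<..b n}) v - b n\<bar> \<ge> sqrt (2 / \<eta>) / sqrt (real (k n))}"
  show "eventually (\<lambda>n. ?E n \<in> sets unif_sample \<and> unif_sample.prob (?E n) \<le> \<eta> \<and>
     - ?E n \<subseteq> {v. \<bar>scaled_avg n (k n) (indicator {0<..b n}) v - b n\<bar> \<le> sqrt (2 / \<eta>) / sqrt (real (k n))}) sequentially"
    using ev_nk b
  proof eventually_elim
    case (elim n)
    have I: "(\<integral>x. indicator {0<..b n} x \<partial>lborel) = b n" "(\<lambda>x. (indicator {0<..b n} x :: real)\<^sup>2) = indicator {0<..b n}"
      using elim by (simp, simp add: fun_eq_iff split: split_indicator)
    have int: "integrable lborel (indicator {0<..b n} :: real \<Rightarrow> real)"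
      using elim by (intro integrable_real_indicator) auto
    have A: "{v \<in> space unif_sample. \<bar>scaled_avg n (k n) (indicator {0<..b n}) v - b n\<bar> \<ge> sqrt (2 / \<eta>) / sqrt (real (k n))} \<in> sets unif_sample"
      by measurable
    have "unif_sample.prob (?E n) \<le> b n / (real (k n) * (sqrt (2 / \<eta>) / sqrt (real (k n)))\<^sup>2)"
    proof -
      have "(indicator {0<..b n} x :: real) = 0" if "x \<notin> {0<..<real n / real (k n)}" for x
        using supp_ok[of n x] that elim by auto
      then show ?thesis
        using scaled_avg_chebyshev[of "indicator {0<..b n}" "k n" n "sqrt (2 / \<eta>) / sqrt (real (k n))"] elim \<open>\<eta> > 0\<close>
        unfolding I using int by simp
    qed
    also have "\<dots> = b n / 2 * \<eta>" using elim \<open>\<eta> > 0\<close> by (simp add: power_divide)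
    also have "\<dots> \<le> 1 * \<eta>" using elim \<open>\<eta> > 0\<close> by (intro mult_right_mono) auto
    finally show ?case using A by auto
  qed
qed

text \<open>A union bound: each of the \<open>n\<close> points falls below \<open>c / n\<close> with probability at most \<open>c / n\<close>.\<close>

lemma no_tiny_points:
  assumes "c > 0"
  shows "likely c (\<lambda>n v. \<forall>j<n. v j * real n / real (k n) \<ge> c / real (k n))"
proof (rule likely_if_bad_unlikely)
  let ?E = "\<lambda>n. \<Union>j<n. {v. v j < c / real n}"
  have m: "{v. v j < x} \<in> sets unif_sample" for j x
  proof -
    have "{v \<in> space unif_sample. v j < x} \<in> sets unif_sample" by measurable
    then show ?thesis by simp
  qed
  show "eventually (\<lambda>n. ?E n \<in> sets unif_sample \<and> unif_sample.prob (?E n) \<le> c \<and>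
     - ?E n \<subseteq> {v. \<forall>j<n. v j * real n / real (k n) \<ge> c / real (k n)}) sequentially"
    using ev_nk
  proof eventually_elim
    case (elim n)
    have "unif_sample.prob {v. v j < c / real n} \<le> c / real n" for j
    proof -
      have "emeasure unif_sample {v. v j < c / real n} = emeasure (distr unif_sample borel (\<lambda>v. v j)) {..<c / real n}"
        by (subst emeasure_distr) (auto simp: vimage_def)
      also have "\<dots> = emeasure lborel ({0<..<1} \<inter> {..<c / real n})"
        by (simp add: distr_unif_sample_component emeasure_unif)
      also have "\<dots> \<le> emeasure lborel {0<..<c / real n}" by (rule emeasure_mono) auto
      also have "\<dots> = ennreal (c / real n)" using \<open>c > 0\<close> by simp
      finally show ?thesis using \<open>c > 0\<close> by (simp add: unif_sample.emeasure_eq_measure)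
    qed
    then have "(\<Sum>j<n. unif_sample.prob {v. v j < c / real n}) \<le> (\<Sum>j<n. c / real n)" by (rule sum_mono)
    also have "\<dots> = c" using elim by simp
    finally have "(\<Sum>j<n. unif_sample.prob {v. v j < c / real n}) \<le> c" .
    moreover have "unif_sample.prob (?E n) \<le> (\<Sum>j<n. unif_sample.prob {v. v j < c / real n})"
      by (rule unif_sample.finite_measure_subadditive_finite) (use m in auto)
    moreover have "- ?E n \<subseteq> {v. \<forall>j<n. v j * real n / real (k n) \<ge> c / real (k n)}"
      using elim by (auto simp: field_simps not_less)
    ultimately show ?case using m by auto
  qed
qed

end

section \<open>Order statistics of a uniform sample\<close>

lemma sorted_nth_le_iff_count:
  assumes "k < n"
  shows "sort (map x [0..<n]) ! k \<le> b \<longleftrightarrow> k < card {j. j < n \<and> x j \<le> (b :: real)}"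
proof -
  let ?xs = "sort (map x [0..<n])"
  have len: "length ?xs = n" by simp
  have "card {j. j < n \<and> x j \<le> b} = length (filter (\<lambda>y. y \<le> b) (map x [0..<n]))"
    unfolding length_filter_conv_card by (rule arg_cong[where f = card]) auto
  also have "\<dots> = size (filter_mset (\<lambda>y. y \<le> b) (mset (map x [0..<n])))"
    by (metis mset_filter size_mset)
  also have "\<dots> = size (filter_mset (\<lambda>y. y \<le> b) (mset ?xs))" by simp
  also have "\<dots> = length (filter (\<lambda>y. y \<le> b) ?xs)"
    by (metis mset_filter size_mset)
  also have "\<dots> = card {i. i < n \<and> ?xs ! i \<le> b}"
    unfolding length_filter_conv_card len ..
  finally have c: "card {j. j < n \<and> x j \<le> b} = card {i. i < n \<and> ?xs ! i \<le> b}" .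
  have mono: "?xs ! i \<le> ?xs ! j" if "i \<le> j" "j < n" for i j
    using that by (intro sorted_nth_mono) auto
  show ?thesis
  proof
    assume "?xs ! k \<le> b"
    then have "{..k} \<subseteq> {i. i < n \<and> ?xs ! i \<le> b}" 
        using assms mono[of _ k] by (auto intro: order_trans)
    then have "card {..k} \<le> card {i. i < n \<and> ?xs ! i \<le> b}" by (intro card_mono) auto
    then show "k < card {j. j < n \<and> x j \<le> b}" using c by simp
  next
    assume *: "k < card {j. j < n \<and> x j \<le> b}"
    show "?xs ! k \<le> b"
    proof (rule ccontr)
      assume "\<not> ?xs ! k \<le> b"
      have "{i. i < n \<and> ?xs ! i \<le> b} \<subseteq> {..<k}"
      proof safe
        fix i assume i: "i < n" "?xs ! i \<le> b"
        show "i < k"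
        proof (rule ccontr)
          assume "\<not> i < k"
          then have "?xs ! k \<le> ?xs ! i" using i by (intro mono) auto
          then show False using i \<open>\<not> ?xs ! k \<le> b\<close> by linarith
        qed
      qed
      then have "card {i. i < n \<and> ?xs ! i \<le> b} \<le> card {..<k}" by (intro card_mono) auto
      then show False using * c by simp
    qed
  qed
qed

lemma sum_sort_nth:
  fixes h :: "real \<Rightarrow> real"
  shows "(\<Sum>j<n. h (x j)) = (\<Sum>i<n. h (sort (map x [0..<n]) ! i))"
proof -
  have "(\<Sum>j<n. h (x j)) = sum_list (map h (map x [0..<n]))"
    by (simp add: interv_sum_list_conv_sum_set_nat atLeast0LessThan o_def)
  also have "\<dots> = sum_list (map h (sort (map x [0..<n])))"
    by (metis mset_map mset_sort sum_mset_sum_list)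
  also have "\<dots> = (\<Sum>i<n. h (sort (map x [0..<n]) ! i))"
    by (simp add: sum_list_sum_nth atLeast0LessThan)
  finally show ?thesis .
qed

text \<open>The \<open>i\<close>-th smallest scaled point (counting from \<open>0\<close>), capped at \<open>1\<close> so that the smallest
  \<open>k\<close> of them lie in \<open>{0<..1}\<close>.\<close>

definition spt :: "nat \<Rightarrow> nat \<Rightarrow> (nat \<Rightarrow> real) \<Rightarrow> nat \<Rightarrow> real" where
  "spt n k v i = sort (map (\<lambda>j. v j * real n / real k) [0..<n]) ! i"

definition pt :: "nat \<Rightarrow> nat \<Rightarrow> (nat \<Rightarrow> real) \<Rightarrow> nat \<Rightarrow> real" where
  "pt n k v i = min (spt n k v i) 1"

definition pt_avg :: "nat \<Rightarrow> nat \<Rightarrow> (real \<Rightarrow> real) \<Rightarrow> (nat \<Rightarrow> real) \<Rightarrow> real" where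
  "pt_avg n k g v = (\<Sum>i<k. g (pt n k v i)) / real k"

lemma spt_mono: "i \<le> j \<Longrightarrow> j < n \<Longrightarrow> spt n k v i \<le> spt n k v j"
  unfolding spt_def by (intro sorted_nth_mono) auto

lemma spt_is_point:
  assumes "i < n"
  obtains j where "j < n" "spt n k v i = v j * real n / real k"
proof -
  have "spt n k v i \<in> set (sort (map (\<lambda>j. v j * real n / real k) [0..<n]))"
    unfolding spt_def using assms by (intro nth_mem) simp
  then show ?thesis using that by auto
qed

lemma card_points_eq_scaled_avg:
  assumes "\<And>j. j < n \<Longrightarrow> v j > 0" "k > 0" "n > 0"
  shows "real (card {j. j < n \<and> v j * real n / real k \<le> b}) = real k * scaled_avg n k (indicator {0<..b}) v"
proof -
  have "(\<Sum>j<n. indicator {0<..b} (v j * real n / real k)) = (\<Sum>j<n. if v j * real n / real k \<le> b then 1 else 0 :: real)"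
    using assms by (intro sum.cong) (auto simp: indicator_def)
  also have "\<dots> = real (card ({..<n} \<inter> {j. v j * real n / real k \<le> b}))"
    by (simp add: sum.If_cases)
  also have "{..<n} \<inter> {j. v j * real n / real k \<le> b} = {j. j < n \<and> v j * real n / real k \<le> b}" by auto
  finally show ?thesis using assms by (simp add: scaled_avg_def)
qed

text \<open>The two sums differ only by the terms between the number of points up to \<open>1\<close> and \<open>k\<close>, where the capped
points lie in \<open>{1/2..1}\<close>.\<close>

lemma pt_avg_close:
  assumes v: "\<And>j. j < n \<Longrightarrow> v j > 0" and nk: "0 < k" "k < n"
    and half: "spt n k v k \<ge> 1/2" and B: "\<And>u. u \<in> {1/2..1} \<Longrightarrow> \<bar>g u\<bar> \<le> B"
  shows "\<bar>pt_avg n k g v - scaled_avg n k (\<lambda>u. indicator {0<..1} u * g u) v\<bar>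
     \<le> B * \<bar>scaled_avg n k (indicator {0<..1}) v - 1\<bar>"
proof -
  let ?s = "spt n k v"
  define m where "m = card {j. j < n \<and> v j * real n / real k \<le> 1}"
  have m: "real m = real k * scaled_avg n k (indicator {0<..1}) v"
    unfolding m_def by (rule card_points_eq_scaled_avg) (use v nk in auto)
  have mn: "m \<le> n" unfolding m_def using card_mono[of "{..<n}" "{j. j < n \<and> v j * real n / real k \<le> 1}"] by auto
  have le1: "?s i \<le> 1 \<longleftrightarrow> i < m" if "i < n" for i
    unfolding spt_def m_def by (rule sorted_nth_le_iff_count[OF that])
  have pos: "?s i > 0" if "i < n" for i
    by (rule spt_is_point[OF that, of k v]) (use v nk in auto)
  have "(\<Sum>j<n. indicator {0<..1} (v j * real n / real k) * g (v j * real n / real k)) =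
      (\<Sum>i<n. indicator {0<..1} (?s i) * g (?s i))"
    unfolding spt_def by (rule sum_sort_nth[where h = "\<lambda>u. indicator {0<..1} u * g u"])
  also have "\<dots> = (\<Sum>i<n. if i < m then g (?s i) else 0)"
    by (intro sum.cong) (use le1 pos in \<open>auto simp: indicator_def\<close>)
  also have "\<dots> = (\<Sum>i<m. g (?s i))"
    using mn by (subst sum.mono_neutral_cong_right[of _ "{..<m}" _ "\<lambda>i. g (?s i)"]) auto
  finally have S: "real k * scaled_avg n k (\<lambda>u. indicator {0<..1} u * g u) v = (\<Sum>i<m. g (?s i))"
    using nk by (simp add: scaled_avg_def)
  have B0: "0 \<le> B" using B[of 1] by (auto intro: order_trans[OF abs_ge_zero])
  have "\<bar>(\<Sum>i<k. g (pt n k v i)) - (\<Sum>i<m. g (?s i))\<bar> \<le> B * \<bar>real m - real k\<bar>"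
  proof (cases "m \<le> k")
    case True
    have "(\<Sum>i<k. g (pt n k v i)) = (\<Sum>i<m. g (pt n k v i)) + (\<Sum>i\<in>{m..<k}. g (pt n k v i))"
      using True by (subst sum.union_disjoint[symmetric]) (auto intro!: sum.cong)
    also have "(\<Sum>i<m. g (pt n k v i)) = (\<Sum>i<m. g (?s i))"
      using le1 mn by (intro sum.cong) (auto simp: pt_def min_def)
    also have "(\<Sum>i\<in>{m..<k}. g (pt n k v i)) = (\<Sum>i\<in>{m..<k}. g 1)"
    proof (intro sum.cong refl)
      fix i assume "i \<in> {m..<k}"
      then have "\<not> ?s i \<le> 1" using le1[of i] nk by auto
      then show "g (pt n k v i) = g 1" by (simp add: pt_def min_def)
    qed
    finally have "(\<Sum>i<k. g (pt n k v i)) - (\<Sum>i<m. g (?s i)) = real (k - m) * g 1" by simp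
    then have "\<bar>(\<Sum>i<k. g (pt n k v i)) - (\<Sum>i<m. g (?s i))\<bar> = real (k - m) * \<bar>g 1\<bar>" by (simp add: abs_mult)
    also have "\<dots> \<le> real (k - m) * B" using B[of 1] by (intro mult_left_mono) auto
    finally show ?thesis using True by (simp add: of_nat_diff mult.commute)
  next
    case False
    have "(\<Sum>i<m. g (?s i)) = (\<Sum>i<k. g (?s i)) + (\<Sum>i\<in>{k..<m}. g (?s i))"
      using False by (subst sum.union_disjoint[symmetric]) (auto intro!: sum.cong)
    moreover have "(\<Sum>i<k. g (pt n k v i)) = (\<Sum>i<k. g (?s i))"
      using le1 mn False by (intro sum.cong) (auto simp: pt_def min_def)
    ultimately have "\<bar>(\<Sum>i<k. g (pt n k v i)) - (\<Sum>i<m. g (?s i))\<bar> = \<bar>\<Sum>i\<in>{k..<m}. g (?s i)\<bar>" by simp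
    also have "\<dots> \<le> (\<Sum>i\<in>{k..<m}. B)"
    proof (intro order_trans[OF sum_abs] sum_mono B)
      fix i assume i: "i \<in> {k..<m}"
      then have "?s k \<le> ?s i" using mn by (intro spt_mono) auto
      then show "?s i \<in> {1/2..1}" using half le1[of i] i mn by auto
    qed
    finally show ?thesis using False by (simp add: of_nat_diff mult.commute)
  qed
  then have "\<bar>real k * (pt_avg n k g v - scaled_avg n k (\<lambda>u. indicator {0<..1} u * g u) v)\<bar>
      \<le> B * \<bar>real k * (scaled_avg n k (indicator {0<..1}) v - 1)\<bar>"
    using nk by (simp add: right_diff_distrib S m pt_avg_def)
  then have "real k * \<bar>pt_avg n k g v - scaled_avg n k (\<lambda>u. indicator {0<..1} u * g u) v\<bar>
      \<le> real k * (B * \<bar>scaled_avg n k (indicator {0<..1}) v - 1\<bar>)"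
    by (simp add: abs_mult mult_ac)
  then show ?thesis using nk by simp
qed

context intermediate
begin

lemma ev_over_sqrt:
  assumes "d > 0"
  shows "eventually (\<lambda>n. C / sqrt (real (k n)) \<le> d) sequentially"
  using ev_k_ge[of "(\<bar>C\<bar> / d)\<^sup>2"] ev_k_ge[of 1]
proof eventually_elim
  case (elim n)
  have "\<bar>C\<bar> / d \<le> sqrt (real (k n))" using elim assms by (intro real_le_rsqrt) auto
  then have "\<bar>C\<bar> / sqrt (real (k n)) \<le> d" using elim assms by (simp add: field_simps)
  moreover have "C / sqrt (real (k n)) \<le> \<bar>C\<bar> / sqrt (real (k n))" by (intro divide_right_mono) auto
  ultimately show ?case by linarith
qed

lemma all_points_in_unit: "likely 0 (\<lambda>n v. \<forall>j. 0 < v j \<and> v j < 1)"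
  by (rule likely_AE[OF AE_unif_sample])

text \<open>The \<open>k\<close>-th point is at most \<open>b\<close> if and only if more than \<open>k\<close> points are, so it is located by
counting the points up to \<open>1 \<plusminus> C / sqrt k\<close>.\<close>

lemma spt_k_close:
  assumes "\<eta> > 0"
  obtains C where "C > 0" "likely \<eta> (\<lambda>n v. \<bar>spt n (k n) v (k n) - 1\<bar> \<le> C / sqrt (real (k n)))"
proof -
  define c where "c = sqrt (2 / (\<eta> / 2))"
  have c: "c > 0" using assms by (simp add: c_def)
  define C where "C = c + 1"
  have C: "C > 0" using c by (simp add: C_def)
  have small: "eventually (\<lambda>n. C / sqrt (real (k n)) \<le> 1) sequentially" by (rule ev_over_sqrt) simp
  have l1: "likely (\<eta>/2) (\<lambda>n v. \<bar>scaled_avg n (k n) (indicator {0<..1 + C / sqrt (real (k n))}) v -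
      (1 + C / sqrt (real (k n)))\<bar> \<le> c / sqrt (real (k n)))"
    unfolding c_def by (rule scaled_avg_count) (use assms C small in \<open>auto elim!: eventually_mono\<close>)
  have l2: "likely (\<eta>/2) (\<lambda>n v. \<bar>scaled_avg n (k n) (indicator {0<..1 - C / sqrt (real (k n))}) v -
      (1 - C / sqrt (real (k n)))\<bar> \<le> c / sqrt (real (k n)))"
    unfolding c_def
  proof (rule scaled_avg_count)
    show "eventually (\<lambda>n. 0 \<le> 1 - C / sqrt (real (k n)) \<and> 1 - C / sqrt (real (k n)) \<le> 2) sequentially"
      using small
    proof eventually_elim
      case (elim n)
      have "C / sqrt (real (k n)) \<ge> 0" using C by simp
      then show ?case using elim by linarith
    qed
  qed (use assms in auto)
  have "likely (0 + (\<eta>/2 + \<eta>/2)) (\<lambda>n v. \<bar>spt n (k n) v (k n) - 1\<bar> \<le> C / sqrt (real (k n)))"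
  proof (rule likely_mono[OF likely_conj[OF all_points_in_unit likely_conj[OF l1 l2]]])
    show "eventually (\<lambda>n. \<forall>v. (\<forall>j. 0 < v j \<and> v j < 1) \<and>
        \<bar>scaled_avg n (k n) (indicator {0<..1 + C / sqrt (real (k n))}) v - (1 + C / sqrt (real (k n)))\<bar> \<le> c / sqrt (real (k n)) \<and>
        \<bar>scaled_avg n (k n) (indicator {0<..1 - C / sqrt (real (k n))}) v - (1 - C / sqrt (real (k n)))\<bar> \<le> c / sqrt (real (k n)) \<longrightarrow>
        \<bar>spt n (k n) v (k n) - 1\<bar> \<le> C / sqrt (real (k n))) sequentially"
      using ev_nk ev_k_ge[of 4]
    proof eventually_elim
      case (elim n)
      let ?r = "sqrt (real (k n))"
      have r: "?r \<ge> 2" using elim by (simp add: real_le_rsqrt)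
      then have r0: "?r > 0" by linarith
      have rr: "real (k n) / ?r = ?r" by (simp add: real_div_sqrt)
      show ?case
      proof (intro allI impI, elim conjE)
        fix v assume v: "\<forall>j::nat. 0 < v j \<and> v j < (1::real)"
          and 1: "\<bar>scaled_avg n (k n) (indicator {0<..1 + C / ?r}) v - (1 + C / ?r)\<bar> \<le> c / ?r"
          and 2: "\<bar>scaled_avg n (k n) (indicator {0<..1 - C / ?r}) v - (1 - C / ?r)\<bar> \<le> c / ?r"
        have kC: "real (k n) * (C / ?r) = C * ?r" "real (k n) * (c / ?r) = c * ?r"
          using rr by (metis mult.commute times_divide_eq_right)+
        have cnt: "real (card {j. j < n \<and> v j * real n / real (k n) \<le> b}) =
            real (k n) * scaled_avg n (k n) (indicator {0<..b}) v" for b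
          by (rule card_points_eq_scaled_avg) (use v elim in auto)
        have "real (k n) * (1 + C / ?r - c / ?r) \<le> real (card {j. j < n \<and> v j * real n / real (k n) \<le> 1 + C / ?r})"
          unfolding cnt using 1 by (intro mult_left_mono) auto
        then have "real (k n) + C * ?r - c * ?r \<le> real (card {j. j < n \<and> v j * real n / real (k n) \<le> 1 + C / ?r})"
          by (simp only: distrib_left right_diff_distrib kC mult_1_right)
        then have "real (k n) < real (card {j. j < n \<and> v j * real n / real (k n) \<le> 1 + C / ?r})"
          using r by (simp add: C_def algebra_simps)
        then have up: "spt n (k n) v (k n) \<le> 1 + C / ?r"
          unfolding spt_def using elim by (subst sorted_nth_le_iff_count) auto
        have "real (card {j. j < n \<and> v j * real n / real (k n) \<le> 1 - C / ?r}) \<le> real (k n) * (1 - C / ?r + c / ?r)"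
          unfolding cnt using 2 by (intro mult_left_mono) auto
        then have "real (card {j. j < n \<and> v j * real n / real (k n) \<le> 1 - C / ?r}) \<le> real (k n) - C * ?r + c * ?r"
          by (simp only: distrib_left right_diff_distrib kC mult_1_right)
        then have "real (card {j. j < n \<and> v j * real n / real (k n) \<le> 1 - C / ?r}) < real (k n)"
          using r by (simp add: C_def algebra_simps)
        then have lo: "\<not> spt n (k n) v (k n) \<le> 1 - C / ?r"
          unfolding spt_def using elim by (subst sorted_nth_le_iff_count) auto
        from up lo show "\<bar>spt n (k n) v (k n) - 1\<bar> \<le> C / ?r" by (simp add: abs_le_iff)
      qed
    qed
  qed
  then show ?thesis using that C by simp
qed

lemma continuous_bounded_near_1:
  fixes g :: "real \<Rightarrow> real"
  assumes "continuous_on {0<..1} g"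
  obtains B where "B > 0" "\<And>u. u \<in> {1/2..1} \<Longrightarrow> \<bar>g u\<bar> \<le> B"
proof -
  have "compact (g ` {1/2..1})"
    by (rule compact_continuous_image) (auto intro: continuous_on_subset[OF assms])
  then have "bounded (g ` {1/2..1})" by (rule compact_imp_bounded)
  then obtain B where "\<forall>x\<in>g ` {1/2..1}. norm x \<le> B" unfolding bounded_iff by blast
  show ?thesis
  proof (rule that[of "\<bar>B\<bar> + 1"])
    fix u :: real assume "u \<in> {1/2..1}"
    then have "norm (g u) \<le> B" using \<open>\<forall>x\<in>g ` {1/2..1}. norm x \<le> B\<close> by blast
    then show "\<bar>g u\<bar> \<le> \<bar>B\<bar> + 1" by simp
  qed simp
qed

lemma pt_avg_vs_scaled_avg:
  assumes g: "continuous_on {0<..1} g" and "\<eta> > 0"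
  obtains C where "C > 0" "likely \<eta> (\<lambda>n v. \<bar>pt_avg n (k n) g v -
      scaled_avg n (k n) (\<lambda>u. indicator {0<..1} u * g u) v\<bar> \<le> C / sqrt (real (k n)))"
proof -
  obtain B where B: "B > 0" "\<And>u. u \<in> {1/2..1} \<Longrightarrow> \<bar>g u\<bar> \<le> B"
    using continuous_bounded_near_1[OF g] by blast
  obtain C where C: "C > 0" "likely (\<eta>/2) (\<lambda>n v. \<bar>spt n (k n) v (k n) - 1\<bar> \<le> C / sqrt (real (k n)))"
    using spt_k_close[of "\<eta>/2"] \<open>\<eta> > 0\<close> by auto
  define c where "c = sqrt (2 / (\<eta> / 2))"
  have c: "c > 0" using assms by (simp add: c_def)
  have sm: "eventually (\<lambda>n. C / sqrt (real (k n)) \<le> 1/2) sequentially" by (rule ev_over_sqrt) simp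
  have l: "likely (\<eta>/2) (\<lambda>n v. \<bar>scaled_avg n (k n) (indicator {0<..1}) v - 1\<bar> \<le> c / sqrt (real (k n)))"
    using scaled_avg_count[of "\<eta>/2" "\<lambda>_. 1"] \<open>\<eta> > 0\<close> by (simp add: c_def)
  have "likely (0 + (\<eta>/2 + \<eta>/2)) (\<lambda>n v. \<bar>pt_avg n (k n) g v -
      scaled_avg n (k n) (\<lambda>u. indicator {0<..1} u * g u) v\<bar> \<le> (B * c) / sqrt (real (k n)))"
  proof (rule likely_mono[OF likely_conj[OF all_points_in_unit likely_conj[OF C(2) l]]])
    show "eventually (\<lambda>n. \<forall>v. (\<forall>j. 0 < v j \<and> v j < 1) \<and>
        \<bar>spt n (k n) v (k n) - 1\<bar> \<le> C / sqrt (real (k n)) \<and>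
        \<bar>scaled_avg n (k n) (indicator {0<..1}) v - 1\<bar> \<le> c / sqrt (real (k n)) \<longrightarrow>
        \<bar>pt_avg n (k n) g v - scaled_avg n (k n) (\<lambda>u. indicator {0<..1} u * g u) v\<bar>
          \<le> (B * c) / sqrt (real (k n))) sequentially"
      using ev_nk sm
    proof eventually_elim
      case (elim n)
      show ?case
      proof (intro allI impI, elim conjE)
        fix v assume v: "\<forall>j::nat. 0 < v j \<and> v j < (1::real)"
          and 1: "\<bar>spt n (k n) v (k n) - 1\<bar> \<le> C / sqrt (real (k n))"
          and 2: "\<bar>scaled_avg n (k n) (indicator {0<..1}) v - 1\<bar> \<le> c / sqrt (real (k n))"
        have "\<bar>pt_avg n (k n) g v - scaled_avg n (k n) (\<lambda>u. indicator {0<..1} u * g u) v\<bar>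
            \<le> B * \<bar>scaled_avg n (k n) (indicator {0<..1}) v - 1\<bar>"
        proof (rule pt_avg_close)
          show "1/2 \<le> spt n (k n) v (k n)" using 1 elim(2) by linarith
        qed (use v elim B in auto)
        also have "\<dots> \<le> B * (c / sqrt (real (k n)))" using 2 B by (intro mult_left_mono) auto
        finally show "\<bar>pt_avg n (k n) g v - scaled_avg n (k n) (\<lambda>u. indicator {0<..1} u * g u) v\<bar>
          \<le> (B * c) / sqrt (real (k n))" by simp
      qed
    qed
  qed
  then show ?thesis using that[of "B * c"] B c by simp
qed

lemma pt_avg_LLN:
  assumes g: "continuous_on {0<..1} g" and int: "set_integrable lborel {0<..1} g" and "\<eta> > 0" "\<epsilon> > 0"
  shows "likely \<eta> (\<lambda>n v. \<bar>pt_avg n (k n) g v - (LBINT u:{0<..1}. g u)\<bar> \<le> \<epsilon>)"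
proof -
  obtain C where C: "C > 0" "likely (\<eta>/2) (\<lambda>n v. \<bar>pt_avg n (k n) g v -
      scaled_avg n (k n) (\<lambda>u. indicator {0<..1} u * g u) v\<bar> \<le> C / sqrt (real (k n)))"
    using pt_avg_vs_scaled_avg[OF g, of "\<eta>/2"] \<open>\<eta> > 0\<close> by auto
  have sm: "eventually (\<lambda>n. C / sqrt (real (k n)) \<le> \<epsilon>/2) sequentially"
    by (rule ev_over_sqrt) (use \<open>\<epsilon> > 0\<close> in simp)
  have l: "likely (\<eta>/2) (\<lambda>n v. \<bar>scaled_avg n (k n) (\<lambda>u. indicator {0<..1} u * g u) v -
      (\<integral>u. indicator {0<..1} u * g u \<partial>lborel)\<bar> \<le> \<epsilon>/2)"
    by (rule scaled_avg_L1) (use int assms in \<open>auto simp: set_integrable_def\<close>)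
  have "likely (\<eta>/2 + \<eta>/2) (\<lambda>n v. \<bar>pt_avg n (k n) g v - (LBINT u:{0<..1}. g u)\<bar> \<le> \<epsilon>)"
  proof (rule likely_mono[OF likely_conj[OF C(2) l]])
    show "eventually (\<lambda>n. \<forall>v. \<bar>pt_avg n (k n) g v - scaled_avg n (k n) (\<lambda>u. indicator {0<..1} u * g u) v\<bar> \<le> C / sqrt (real (k n)) \<and>
        \<bar>scaled_avg n (k n) (\<lambda>u. indicator {0<..1} u * g u) v - (\<integral>u. indicator {0<..1} u * g u \<partial>lborel)\<bar> \<le> \<epsilon>/2 \<longrightarrow>
        \<bar>pt_avg n (k n) g v - (LBINT u:{0<..1}. g u)\<bar> \<le> \<epsilon>) sequentially"
      using sm
    proof eventually_elim
      case (elim n)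
      show ?case
        unfolding set_lebesgue_integral_def real_scaleR_def
      proof (intro allI impI, elim conjE)
        fix v assume 1: "\<bar>pt_avg n (k n) g v - scaled_avg n (k n) (\<lambda>u. indicator {0<..1} u * g u) v\<bar> \<le> C / sqrt (real (k n))"
          and 2: "\<bar>scaled_avg n (k n) (\<lambda>u. indicator {0<..1} u * g u) v - (\<integral>u. indicator {0<..1} u * g u \<partial>lborel)\<bar> \<le> \<epsilon>/2"
        show "\<bar>pt_avg n (k n) g v - (\<integral>u. indicator {0<..1} u * g u \<partial>lborel)\<bar> \<le> \<epsilon>"
          using 1 2 elim by linarith
      qed
    qed
  qed
  then show ?thesis by simp
qed

text \<open>Only the order of magnitude in the central limit theorem is claimed, so Chebyshev's inequality suffices.\<close>

lemma pt_avg_CLT_rate: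
  assumes g: "continuous_on {0<..1} g" and int: "set_integrable lborel {0<..1} g"
    and int2: "set_integrable lborel {0<..1} (\<lambda>u. (g u)\<^sup>2)" and "\<eta> > 0"
  obtains C where "C > 0" "likely \<eta> (\<lambda>n v. \<bar>pt_avg n (k n) g v - (LBINT u:{0<..1}. g u)\<bar> \<le> C / sqrt (real (k n)))"
proof -
  obtain C where C: "C > 0" "likely (\<eta>/2) (\<lambda>n v. \<bar>pt_avg n (k n) g v -
      scaled_avg n (k n) (\<lambda>u. indicator {0<..1} u * g u) v\<bar> \<le> C / sqrt (real (k n)))"
    using pt_avg_vs_scaled_avg[OF g, of "\<eta>/2"] \<open>\<eta> > 0\<close> by auto
  have i2: "(\<lambda>u. (indicator {0<..1} u * g u)\<^sup>2) = (\<lambda>u. indicator {0<..1} u * (g u)\<^sup>2)"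
    by (auto simp: indicator_def)
  obtain C' where C': "C' > 0" "likely (\<eta>/2) (\<lambda>n v. \<bar>scaled_avg n (k n) (\<lambda>u. indicator {0<..1} u * g u) v -
      (\<integral>u. indicator {0<..1} u * g u \<partial>lborel)\<bar> \<le> C' / sqrt (real (k n)))"
  proof (rule scaled_avg_L2[of "\<lambda>u. indicator {0<..1} u * g u" "\<eta>/2"])
    show "integrable lborel (\<lambda>x. (indicat_real {0<..1} x * g x)\<^sup>2)"
      unfolding i2 using int2 by (simp add: set_integrable_def)
  qed (use int assms in \<open>auto simp: set_integrable_def\<close>)
  have "likely (\<eta>/2 + \<eta>/2) (\<lambda>n v. \<bar>pt_avg n (k n) g v - (LBINT u:{0<..1}. g u)\<bar> \<le> (C + C') / sqrt (real (k n)))"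
    by (rule likely_mono[OF likely_conj[OF C(2) C'(2)]])
       (auto simp: set_lebesgue_integral_def add_divide_distrib intro!: always_eventually)
  then show ?thesis using that[of "C + C'"] C C' by simp
qed

end

section \<open>Excesses of the quantile-transformed sample\<close>

lemma sort_map_antimono:
  fixes f :: "real \<Rightarrow> real"
  assumes "\<And>x y. x \<in> set xs \<Longrightarrow> y \<in> set xs \<Longrightarrow> x \<le> y \<Longrightarrow> f y \<le> f x"
  shows "sort (map f xs) = rev (map f (sort xs))"
proof (rule properties_for_sort)
  show "mset (rev (map f (sort xs))) = mset (map f xs)" by simp
  have "sorted_wrt (\<lambda>x y. y \<le> x) (map f (sort xs))"
    unfolding sorted_wrt_map
    by (rule sorted_wrt_mono_rel[of _ "(\<le>)"]) (use assms in auto)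
  then show "sorted (rev (map f (sort xs)))" by (simp add: sorted_wrt_rev)
qed

lemma order_stat_quantile_transform:
  fixes q :: "real \<Rightarrow> real"
  assumes q: "\<And>x y. 0 < x \<Longrightarrow> x \<le> y \<Longrightarrow> y < 1 \<Longrightarrow> q y \<le> q x"
    and v: "\<And>j. 0 < v j \<and> v j < 1" and i: "i < n" and k: "0 < k"
  shows "order_stat (\<lambda>l y. y (l - 1)) n (n - i) (\<lambda>l. q (v l)) = q (spt n k v i * real k / real n)"
proof -
  have "map (\<lambda>l. q (v (l - 1))) [1..<n + 1] = map q (map v [0..<n])"
    by (simp add: map_Suc_upt[symmetric] o_def del: upt_Suc)
  then have "order_stat (\<lambda>l y. y (l - 1)) n (n - i) (\<lambda>l. q (v l)) = sort (map q (map v [0..<n])) ! (n - i - 1)"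
    by (simp add: order_stat_def)
  also have "sort (map q (map v [0..<n])) = rev (map q (sort (map v [0..<n])))"
    by (rule sort_map_antimono) (use q v in auto)
  also have "\<dots> ! (n - i - 1) = q (sort (map v [0..<n]) ! i)"
    using i by (simp add: rev_nth)
  also have "sort (map v [0..<n]) ! i = spt n k v i * real k / real n"
  proof -
    have "sort (map (\<lambda>j. v j * real n / real k) [0..<n]) = map (\<lambda>x. x * real n / real k) (sort (map v [0..<n]))"
    proof (rule properties_for_sort)
      show "mset (map (\<lambda>x. x * real n / real k) (sort (map v [0..<n]))) = mset (map (\<lambda>j. v j * real n / real k) [0..<n])"
        by (simp add: image_mset.compositionality o_def)
      show "sorted (map (\<lambda>x. x * real n / real k) (sort (map v [0..<n])))"
        unfolding sorted_wrt_map
        by (rule sorted_wrt_mono_rel[of _ "(\<le>)"]) (auto intro!: divide_right_mono mult_right_mono)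
    qed
    then show ?thesis using i k by (simp add: spt_def)
  qed
  finally show ?thesis .
qed

lemma box_cox_lipschitz_near_1:
  obtains C where "C > 0" "\<And>x. x \<in> {1/2..2} \<Longrightarrow> \<bar>box_cox \<gamma> x\<bar> \<le> C * \<bar>x - 1\<bar>"
proof -
  have "continuous_on {1/2..2} (\<lambda>x::real. x powr (\<gamma> - 1))" by (intro continuous_intros) auto
  then have "compact ((\<lambda>x::real. x powr (\<gamma> - 1)) ` {1/2..2})"
    by (rule compact_continuous_image) simp
  then have "bounded ((\<lambda>x::real. x powr (\<gamma> - 1)) ` {1/2..2})" by (rule compact_imp_bounded)
  then obtain B where B: "\<forall>y\<in>(\<lambda>x::real. x powr (\<gamma> - 1)) ` {1/2..2}. norm y \<le> B"
    unfolding bounded_iff by blast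
  have "\<bar>box_cox \<gamma> x\<bar> \<le> (\<bar>B\<bar> + 1) * \<bar>x - 1\<bar>" if "x \<in> {1/2..2}" for x
  proof -
    have "norm (box_cox \<gamma> x - box_cox \<gamma> 1) \<le> (\<bar>B\<bar> + 1) * norm (x - 1)"
    proof (rule field_differentiable_bound[of "{1/2..2}" "box_cox \<gamma>" "\<lambda>x. x powr (\<gamma> - 1)"])
      fix z :: real assume z: "z \<in> {1/2..2}"
      then show "(box_cox \<gamma> has_field_derivative z powr (\<gamma> - 1)) (at z within {1/2..2})"
        using has_field_derivative_at_within[OF box_cox_has_derivative[of z \<gamma>]] by simp
      have "norm (z powr (\<gamma> - 1)) \<le> B" using B z by blast
      then show "norm (z powr (\<gamma> - 1)) \<le> \<bar>B\<bar> + 1" by linarith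
    qed (use that in auto)
    then show ?thesis by simp
  qed
  then show ?thesis by (intro that[of "\<bar>B\<bar> + 1"]) auto
qed

locale gp_sample = second_order "tail_quantile F" a A \<gamma> \<rho> H + intermediate k
  for F a A :: "real \<Rightarrow> real" and \<gamma> \<rho> H k +
  fixes lam :: real
  assumes qmono: "mono_on {0<..<1} (quantile F)"
    and A_rate: "(\<lambda>n. sqrt (real (k n)) * A (real n / real (k n))) \<longlonglongrightarrow> lam"
begin

definition qsample :: "(nat \<Rightarrow> real) \<Rightarrow> nat \<Rightarrow> real" where
  "qsample v = (\<lambda>i. quantile F (1 - v i))"

text \<open>Samples \<open>y\<close> themselves serve as outcomes, with the coordinates as observations. Since coordinates are
numbered from \<open>0\<close> and observations from \<open>1\<close>, the \<open>l\<close>-th observation is \<open>y (l - 1)\<close>. Excesses are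
numbered from \<open>0\<close>, beginning with the largest.\<close>

definition exc :: "nat \<Rightarrow> (nat \<Rightarrow> real) \<Rightarrow> nat \<Rightarrow> real" where
  "exc n v i = excess (\<lambda>l y. y (l - 1)) a k n (qsample v) (Suc i)"

text \<open>Both order statistics are expanded around \<open>n / k\<close>. The second term is the effect of the random
threshold; its argument is close to \<open>1\<close>.\<close>

lemma exc_eq:
  assumes v: "\<And>j. 0 < v j \<and> v j < 1" and i: "i < k n" and nk: "0 < k n" "k n < n"
  shows "exc n v i = D (real n / real (k n)) (1 / spt n (k n) v i) - D (real n / real (k n)) (1 / spt n (k n) v (k n))"
proof -
  let ?T = "real n / real (k n)" and ?s = "spt n (k n) v"
  have q: "quantile F (1 - y) \<le> quantile F (1 - x)" if "0 < x" "x \<le> y" "y < 1" for x y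
    by (rule mono_onD[OF qmono]) (use that in auto)
  have os: "order_stat (\<lambda>l y. y (l - 1)) n (n - j) (qsample v) = tail_quantile F (?T * (1 / ?s j))" if "j < n" for j
  proof -
    have "order_stat (\<lambda>l y. y (l - 1)) n (n - j) (qsample v) = quantile F (1 - ?s j * real (k n) / real n)"
      unfolding qsample_def
      by (rule order_stat_quantile_transform[where q = "\<lambda>x. quantile F (1 - x)"]) (use q v that nk in auto)
    also have "\<dots> = tail_quantile F (?T * (1 / ?s j))"
      using nk by (simp add: tail_quantile_def mult.commute)
    finally show ?thesis .
  qed
  have "n - Suc i + 1 = n - i" using i nk by simp
  then show ?thesis
    unfolding exc_def excess_def using os[of i] os[of "k n"] i nk
    by (simp add: D_def diff_divide_distrib)
qed

text \<open>Because the second-order bound is applied at the deterministic argument \<open>n / k n\<close>, the only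
  randomness in the comparison is in the points themselves, and the random threshold costs
  \<open>O (1 / sqrt k)\<close> since the \<open>k\<close>-th point is within \<open>O (1 / sqrt k)\<close> of \<open>1\<close>.\<close>

lemma exc_close:
  assumes \<kappa>: "\<kappa> > \<gamma>" "\<kappa> \<ge> 0" and "\<eta> > 0"
  obtains C c where "C > 0" "c > 0" "likely \<eta> (\<lambda>n v. \<forall>i<k n. 0 \<le> exc n v i \<and>
      0 < pt n (k n) v i \<and> pt n (k n) v i \<le> 1 \<and> c / real (k n) \<le> pt n (k n) v i \<and>
      \<bar>exc n v i - box_cox \<gamma> (1 / pt n (k n) v i)\<bar> \<le> C / sqrt (real (k n)) * pt n (k n) v i powr (- \<kappa>))"
proof -
  obtain C1 t0 where C1: "C1 > 0" "t0 > 0"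
    "\<And>t x. t \<ge> t0 \<Longrightarrow> x \<ge> 1/2 \<Longrightarrow> \<bar>D t x - box_cox \<gamma> x\<bar> \<le> C1 * \<bar>A t\<bar> * x powr \<kappa>"
    using second_order_uniform_bound[OF \<kappa>] by blast
  obtain C2 where C2: "C2 > 0" "\<And>x. x \<in> {1/2..2} \<Longrightarrow> \<bar>box_cox \<gamma> x\<bar> \<le> C2 * \<bar>x - 1\<bar>"
    using box_cox_lipschitz_near_1 by blast
  obtain C3 where C3: "C3 > 0" "likely (\<eta>/2) (\<lambda>n v. \<bar>spt n (k n) v (k n) - 1\<bar> \<le> C3 / sqrt (real (k n)))"
    using spt_k_close[of "\<eta>/2"] \<open>\<eta> > 0\<close> by auto
  define c where "c = min (\<eta>/2) 1"
  have c: "c > 0" "c \<le> 1" using \<open>\<eta> > 0\<close> by (auto simp: c_def)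
  have tiny: "likely (\<eta>/2) (\<lambda>n v. \<forall>j<n. v j * real n / real (k n) \<ge> c / real (k n))"
    by (rule likely_eta_mono[OF no_tiny_points]) (use c in \<open>auto simp: c_def\<close>)
  have sm: "eventually (\<lambda>n. C3 / sqrt (real (k n)) \<le> 1/2) sequentially" by (rule ev_over_sqrt) simp
  have Aev: "eventually (\<lambda>n. \<bar>sqrt (real (k n)) * A (real n / real (k n))\<bar> < \<bar>lam\<bar> + 1) sequentially"
    using tendsto_rabs[OF A_rate] by (rule order_tendstoD) simp
  define K where "K = C1 * (\<bar>lam\<bar> + 1)"
  have K: "K > 0" using C1 by (simp add: K_def)
  define C4 where "C4 = 2 * C2 * C3 + K * 2 powr \<kappa>"
  have C4: "C4 > 0" using C2 C3 K by (simp add: C4_def add_pos_pos)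
  define C where "C = K + 2 * C4"
  have "likely (0 + (\<eta>/2 + \<eta>/2)) (\<lambda>n v. \<forall>i<k n. 0 \<le> exc n v i \<and>
      0 < pt n (k n) v i \<and> pt n (k n) v i \<le> 1 \<and> c / real (k n) \<le> pt n (k n) v i \<and>
      \<bar>exc n v i - box_cox \<gamma> (1 / pt n (k n) v i)\<bar> \<le> C / sqrt (real (k n)) * pt n (k n) v i powr (- \<kappa>))"
  proof (rule likely_mono[OF likely_conj[OF all_points_in_unit likely_conj[OF C3(2) tiny]]])
    show "eventually (\<lambda>n. \<forall>v. (\<forall>j. 0 < v j \<and> v j < 1) \<and>
        \<bar>spt n (k n) v (k n) - 1\<bar> \<le> C3 / sqrt (real (k n)) \<and>
        (\<forall>j<n. v j * real n / real (k n) \<ge> c / real (k n)) \<longrightarrow>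
      (\<forall>i<k n. 0 \<le> exc n v i \<and>
      0 < pt n (k n) v i \<and> pt n (k n) v i \<le> 1 \<and> c / real (k n) \<le> pt n (k n) v i \<and>
      \<bar>exc n v i - box_cox \<gamma> (1 / pt n (k n) v i)\<bar> \<le> C / sqrt (real (k n)) * pt n (k n) v i powr (- \<kappa>))) sequentially"
      using ev_nk ev_k_ge[of 1] sm ev_ratio_ge[of t0] ev_ratio_ge[of 3] Aev
    proof eventually_elim
      case (elim n)
      let ?T = "real n / real (k n)" and ?r = "sqrt (real (k n))"
      have r: "?r \<ge> 1" using elim by simp
      have AT: "C1 * \<bar>A ?T\<bar> \<le> K / ?r"
      proof -
        have "\<bar>A ?T\<bar> \<le> (\<bar>lam\<bar> + 1) / ?r"
          using elim(6) r by (simp add: abs_mult pos_le_divide_eq mult.commute)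
        then have "C1 * \<bar>A ?T\<bar> \<le> C1 * ((\<bar>lam\<bar> + 1) / ?r)" using C1 by (intro mult_left_mono) auto
        then show ?thesis by (simp add: K_def)
      qed
      show ?case
      proof (intro allI impI, elim conjE)
        fix v i assume v: "\<forall>j::nat. 0 < v j \<and> v j < (1::real)"
          and s1: "\<bar>spt n (k n) v (k n) - 1\<bar> \<le> C3 / ?r"
          and t: "\<forall>j<n. v j * real n / real (k n) \<ge> c / real (k n)" and i: "i < k n"
        define s where "s = spt n (k n) v i"
        define w where "w = spt n (k n) v (k n)"
        define p where "p = pt n (k n) v i"
        have w: "w \<ge> 1/2" "w \<le> 3/2" "\<bar>w - 1\<bar> \<le> C3 / ?r"
          using s1 elim(3) unfolding w_def by linarith+
        have sw: "s \<le> w" unfolding s_def w_def by (rule spt_mono) (use i elim in auto)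
        have in': "i < n" using i elim by auto
        have sc: "c / real (k n) \<le> s"
          unfolding s_def by (rule spt_is_point[OF in', of "k n" v]) (use t in auto)
        moreover have "0 < c / real (k n)" using c elim by simp
        ultimately have s0: "s > 0" by linarith
        have p: "p = min s 1" by (simp add: p_def pt_def s_def)
        have p0: "0 < p" "p \<le> 1" "p \<le> s" using s0 by (auto simp: p)
        have pc: "c / real (k n) \<le> p"
        proof -
          have "c / real (k n) \<le> c / 1" using c elim by (intro divide_left_mono) auto
          then show ?thesis using sc c by (simp add: p)
        qed
        have "exc n v i = D ?T (1 / s) - D ?T (1 / w)"
          unfolding s_def w_def by (rule exc_eq) (use v i elim in auto)
        then have e: "exc n v i = D ?T (1 / s) - D ?T (1 / w)" .
        have "0 \<le> exc n v i"
        proof -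
          have "?T * (1 / w) \<ge> 3 * (2/3)"
            using elim(5) w by (intro mult_mono) (auto simp: field_simps)
          then have "?T * (1 / w) > 1" by simp
          moreover have "?T > 0" using elim by simp
          moreover have "1 / w \<le> 1 / s" using sw s0 w by (intro divide_left_mono) auto
          ultimately have "D ?T (1 / w) \<le> D ?T (1 / s)" by (rule D_mono)
          then show ?thesis by (simp add: e)
        qed
        have pk: "p powr (- \<kappa>) \<ge> 1"
          using p0 \<kappa> by (simp add: powr_minus_divide le_divide_eq powr_le1)
        have b1: "\<bar>D ?T (1 / s) - box_cox \<gamma> (1 / s)\<bar> \<le> K / ?r * p powr (- \<kappa>)"
        proof -
          have "\<bar>D ?T (1 / s) - box_cox \<gamma> (1 / s)\<bar> \<le> C1 * \<bar>A ?T\<bar> * (1 / s) powr \<kappa>"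
            using C1(3)[of ?T "1 / s"] elim sw s0 w by (auto simp: field_simps)
          also have "\<dots> \<le> K / ?r * (1 / s) powr \<kappa>" using AT by (intro mult_right_mono) auto
          also have "\<dots> \<le> K / ?r * (1 / p) powr \<kappa>"
            using p0 s0 \<kappa> K by (intro mult_left_mono powr_mono2 divide_left_mono) auto
          finally show ?thesis using p0 by (simp add: powr_minus_divide powr_divide)
        qed
        have bw: "\<bar>box_cox \<gamma> (1 / w)\<bar> \<le> 2 * C2 * C3 / ?r"
        proof -
          have "\<bar>1 / w - 1\<bar> = \<bar>w - 1\<bar> / w" using w by (simp add: field_simps abs_if split: if_splits)
          also have "\<dots> \<le> (C3 / ?r) / (1/2)" using w C3 by (intro frac_le) auto
          finally have "\<bar>1 / w - 1\<bar> \<le> 2 * C3 / ?r" by (simp add: mult.commute)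
          moreover have "\<bar>box_cox \<gamma> (1 / w)\<bar> \<le> C2 * \<bar>1 / w - 1\<bar>" by (rule C2) (use w in \<open>auto simp: field_simps\<close>)
          ultimately have "\<bar>box_cox \<gamma> (1 / w)\<bar> \<le> C2 * (2 * C3 / ?r)"
            using C2 by (meson mult_left_mono less_imp_le order_trans)
          then show ?thesis by (simp add: mult_ac)
        qed
        have b2: "\<bar>D ?T (1 / w)\<bar> \<le> C4 / ?r"
        proof -
          have "\<bar>D ?T (1 / w) - box_cox \<gamma> (1 / w)\<bar> \<le> C1 * \<bar>A ?T\<bar> * (1 / w) powr \<kappa>"
            using C1(3)[of ?T "1 / w"] elim w by (auto simp: field_simps)
          also have "\<dots> \<le> K / ?r * 2 powr \<kappa>"
            using AT w \<kappa> K by (intro mult_mono powr_mono2) (auto simp: field_simps)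
          finally show ?thesis using bw by (simp add: C4_def add_divide_distrib)
        qed
        have b3: "\<bar>box_cox \<gamma> (1 / s) - box_cox \<gamma> (1 / p)\<bar> \<le> C4 / ?r"
        proof (cases "s \<le> 1")
          case True then show ?thesis using C4 by (simp add: p)
        next
          case False
          then have "p = 1" by (simp add: p)
          have "box_cox \<gamma> (1 / w) \<le> box_cox \<gamma> (1 / s)" "box_cox \<gamma> (1 / s) \<le> box_cox \<gamma> 1"
            using False sw w
            by (intro box_cox_mono divide_left_mono; simp)
               (use box_cox_mono[of "1 / s" 1 \<gamma>] False in simp)
          then have "\<bar>box_cox \<gamma> (1 / s) - box_cox \<gamma> (1 / p)\<bar> \<le> \<bar>box_cox \<gamma> (1 / w)\<bar>"
            using \<open>p = 1\<close> by simp
          also have "\<dots> \<le> C4 / ?r"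
            using order_trans[OF bw] K r by (simp add: C4_def divide_right_mono)
          finally show ?thesis .
        qed
        have "\<bar>exc n v i - box_cox \<gamma> (1 / p)\<bar> \<le> K / ?r * p powr (- \<kappa>) + C4 / ?r * 1 + C4 / ?r * 1"
          using b1 b2 b3 unfolding e by linarith
        also have "\<dots> \<le> K / ?r * p powr (- \<kappa>) + C4 / ?r * p powr (- \<kappa>) + C4 / ?r * p powr (- \<kappa>)"
          using pk C4 K r by (intro add_mono mult_left_mono) auto
        also have "\<dots> = C / ?r * p powr (- \<kappa>)"
          by (simp add: C_def add_divide_distrib distrib_right)
        finally show "0 \<le> exc n v i \<and>
          0 < pt n (k n) v i \<and> pt n (k n) v i \<le> 1 \<and> c / real (k n) \<le> pt n (k n) v i \<and>
          \<bar>exc n v i - box_cox \<gamma> (1 / pt n (k n) v i)\<bar> \<le> C / sqrt (real (k n)) * pt n (k n) v i powr (- \<kappa>)"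
          using \<open>0 \<le> exc n v i\<close> p0 pc unfolding p_def by auto
      qed
    qed
  qed
  then show ?thesis using that[of C c] c K C4 by (simp add: C_def add_pos_pos)
qed

end

section \<open>The log-likelihood at the limiting excesses\<close>

lemma set_integrable_powr_unit:
  assumes "b < 1"
  shows "set_integrable lborel {0<..1} (\<lambda>u::real. u powr (- b))"
proof -
  have "(\<lambda>u. u powr (- b)) absolutely_integrable_on {0<..1::real}"
    by (intro nonnegative_absolutely_integrable_1 integrable_on_powr_from_0') (use assms in auto)
  then have "integrable (completion lborel) (\<lambda>u::real. indicator {0<..1} u *\<^sub>R u powr (- b))"
    by (simp add: set_integrable_def)
  then show ?thesis
    unfolding set_integrable_def by (subst (asm) integrable_completion) auto
qed

lemma set_integrable_powr_bound:
  fixes g :: "real \<Rightarrow> real"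
  assumes "continuous_on {0<..1} g" "b < 1" "\<And>u. 0 < u \<Longrightarrow> u \<le> 1 \<Longrightarrow> \<bar>g u\<bar> \<le> C * u powr (- b)"
  shows "set_integrable lborel {0<..1} g"
proof (rule set_integrable_bound)
  show "set_integrable lborel {0<..1} (\<lambda>u. C * u powr (- b))"
    using set_integrable_powr_unit[OF assms(2)] by (rule set_integrable_mult_right)
  show "set_borel_measurable lborel {0<..1} g"
    unfolding set_borel_measurable_def
    using borel_measurable_continuous_on_indicator[OF _ assms(1)] by simp
  show "AE x in lborel. x \<in> {0<..1} \<longrightarrow> norm (g x) \<le> norm (C * x powr - b)"
    using assms(3) by (intro AE_I2) (force intro: order_trans[OF _ abs_ge_self])
qed

lemma powr_inverse: "u > 0 \<Longrightarrow> (1 / u) powr a = u powr (- a)" for u :: real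
  by (simp add: powr_divide powr_minus_divide)

lemma powr_squared: "(u powr a)\<^sup>2 = u powr (2 * a)" for u :: real
  by (simp only: power2_eq_square powr_add[symmetric] mult_2)

lemma inverse_power_close:
  fixes x :: real
  assumes "\<bar>x - 1\<bar> \<le> e" "e \<le> 1/2"
  shows "\<bar>1 / x\<^sup>2 - 1\<bar> \<le> 38 * e" "\<bar>1 / x ^ 3 - 1\<bar> \<le> 38 * e"
proof -
  have x: "1/2 \<le> x" "x \<le> 3/2" using assms by (auto simp: abs_le_iff)
  have x2: "x\<^sup>2 \<ge> (1/2)\<^sup>2" "x ^ 3 \<ge> (1/2) ^ 3" using x by (intro power_mono; simp)+
  have "\<bar>1 / x\<^sup>2 - 1\<bar> = \<bar>x - 1\<bar> * \<bar>1 + x\<bar> / x\<^sup>2"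
  proof -
    have "1 / x\<^sup>2 - 1 = - ((x - 1) * (1 + x)) / x\<^sup>2"
      using x by (simp add: field_simps power2_eq_square)
    then show ?thesis using x by (simp add: abs_mult)
  qed
  also have "\<dots> \<le> e * (5/2) / (1/2)\<^sup>2" using assms x x2 by (intro frac_le mult_mono) auto
  finally show "\<bar>1 / x\<^sup>2 - 1\<bar> \<le> 38 * e" using assms by (simp add: power2_eq_square)
  have "\<bar>1 / x ^ 3 - 1\<bar> = \<bar>x - 1\<bar> * \<bar>1 + x + x\<^sup>2\<bar> / x ^ 3"
  proof -
    have "1 / x ^ 3 - 1 = - ((x - 1) * (1 + x + x\<^sup>2)) / x ^ 3"
      using x by (simp add: field_simps power2_eq_square power3_eq_cube)
    then show ?thesis using x by (simp add: abs_mult)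
  qed
  also have "\<dots> \<le> e * (19/4) / (1/2) ^ 3"
  proof (intro frac_le mult_mono)
    have "x\<^sup>2 \<le> (3/2)\<^sup>2" using x by (intro power_mono) auto
    then show "\<bar>1 + x + x\<^sup>2\<bar> \<le> 19/4" using x by (simp add: power2_eq_square)
  qed (use assms x x2 in auto)
  finally show "\<bar>1 / x ^ 3 - 1\<bar> \<le> 38 * e" using assms by (simp add: power3_eq_cube)
qed

lemma integral_end_point_diff:
  fixes f :: "real \<Rightarrow> real"
  assumes f: "continuous_on {0..max x y} f" and xy: "0 \<le> x" "0 \<le> y"
    and B: "\<And>r. min x y \<le> r \<Longrightarrow> r \<le> max x y \<Longrightarrow> \<bar>f r\<bar> \<le> B"
  shows "\<bar>integral {0..x} f - integral {0..y} f\<bar> \<le> B * \<bar>x - y\<bar>"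
proof -
  have "norm (integral {0..x} f - integral {0..y} f) \<le> B * norm (x - y)"
  proof (rule field_differentiable_bound[of "{min x y..max x y}" "\<lambda>x. integral {0..x} f" f])
    fix r assume r: "r \<in> {min x y..max x y}"
    have "((\<lambda>x. integral {0..x} f) has_real_derivative f r) (at r within {0..max x y})"
      by (rule integral_has_real_derivative[OF f]) (use r xy in auto)
    then show "((\<lambda>x. integral {0..x} f) has_field_derivative f r) (at r within {min x y..max x y})"
      by (rule DERIV_subset) (use xy in auto)
  qed (use B in auto)
  then show ?thesis by simp
qed

locale gp_limit =
  fixes \<gamma> :: real
  assumes gamma: "\<gamma> > - 1/2"
begin

text \<open>The essential properties of \<open>\<beta>\<close> are \<open>0 < \<beta>\<close> and \<open>- \<gamma> \<le> \<beta> < 1 / 2\<close>. The limit of the excess that belongs to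
the point \<open>u\<close> is \<open>zf u\<close>.\<close>

definition \<beta> :: real where "\<beta> = max (- \<gamma>) (1/4)"
definition \<theta>0 :: "real^2" where "\<theta>0 = vector [\<gamma>, 1]"
definition zf :: "real \<Rightarrow> real" where "zf u = box_cox \<gamma> (1 / u)"

lemma beta: "1/4 \<le> \<beta>" "- \<gamma> \<le> \<beta>" "\<beta> < 1/2" "0 \<le> \<gamma> + \<beta>" "\<gamma> < \<gamma> + \<beta>"
  using gamma by (auto simp: \<beta>_def)

lemma \<theta>0_nth [simp]: "\<theta>0 $ 1 = \<gamma>" "\<theta>0 $ 2 = 1"
  by (simp_all add: \<theta>0_def)

lemma lin_\<theta>0: "lin \<theta>0 r = 1 + \<gamma> * r"
  by (simp add: lin_def)

lemma lin_\<theta>0_zf: "u > 0 \<Longrightarrow> lin \<theta>0 (zf u) = u powr (- \<gamma>)"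
  by (simp add: lin_\<theta>0 zf_def box_cox_def powr_minus_divide powr_divide)

lemma lin_\<theta>0_zf_pos: "u > 0 \<Longrightarrow> lin \<theta>0 (zf u) > 0"
  by (simp add: lin_\<theta>0_zf)

lemma zf_nonneg: "0 < u \<Longrightarrow> u \<le> 1 \<Longrightarrow> zf u \<ge> 0"
  unfolding zf_def by (intro box_cox_nonneg) simp

lemma zf_1 [simp]: "zf 1 = 0"
  by (simp add: zf_def)

lemma zf_antimono: "0 < u \<Longrightarrow> u \<le> v \<Longrightarrow> zf v \<le> zf u"
  unfolding zf_def by (intro box_cox_mono divide_left_mono) auto

lemma zf_strict: "0 < u \<Longrightarrow> u < v \<Longrightarrow> zf v < zf u"
  unfolding zf_def by (intro box_cox_strict_mono divide_strict_left_mono) auto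

lemma zf_has_derivative:
  assumes "u > 0"
  shows "(zf has_real_derivative - (u powr (- \<gamma> - 1))) (at u)"
proof -
  have "((\<lambda>u. box_cox \<gamma> (1 / u)) has_real_derivative ((1 / u) powr (\<gamma> - 1)) * (- 1 / u\<^sup>2)) (at u)"
    by (rule DERIV_chain2[OF box_cox_has_derivative])
       (use assms in \<open>auto intro!: derivative_eq_intros simp: power2_eq_square\<close>)
  also have "((1 / u) powr (\<gamma> - 1)) * (- 1 / u\<^sup>2) = - (u powr (- \<gamma> - 1))"
  proof -
    have "(1 / u) powr (\<gamma> - 1) * (1 / u\<^sup>2) = u powr (- (\<gamma> - 1)) * u powr (- 2)"
      using assms powr_inverse[of u "\<gamma> - 1"] by (simp add: powr_minus_divide[of u "2"])
    also have "\<dots> = u powr (- (\<gamma> - 1) + - 2)" by (rule powr_add[symmetric])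
    also have "- (\<gamma> - 1) + - 2 = - \<gamma> - 1" by simp
    finally show ?thesis by simp
  qed
  finally show ?thesis unfolding zf_def[abs_def] .
qed

lemma continuous_on_zf: "continuous_on {0<..} zf"
  by (intro continuous_at_imp_continuous_on ballI DERIV_isCont[OF zf_has_derivative]) auto

text \<open>The exponent \<open>\<beta> < 1 / 2\<close> governs all growth as \<open>u\<close> tends to \<open>0\<close>: the score is
  \<open>O (u powr - \<beta>)\<close>, hence square integrable, and the Hessian is \<open>O (u powr (- 2 * \<beta>))\<close>.\<close>

lemma weight_bound:
  obtains K where "K \<ge> 1" "\<And>u. 0 < u \<Longrightarrow> u \<le> 1 \<Longrightarrow> (1 + zf u) * u powr \<gamma> \<le> K * u powr (- \<beta>)"
proof -
  obtain C where C: "C > 0" "\<And>x. x \<ge> 1 \<Longrightarrow> box_cox \<gamma> x \<le> C * x powr (\<gamma> + \<beta>)"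
    using box_cox_le_powr[OF beta(5,4)] by blast
  show ?thesis
  proof (rule that[of "1 + C"])
    fix u :: real assume u: "0 < u" "u \<le> 1"
    have "1 \<le> (1 / u) powr (\<gamma> + \<beta>)" using u beta by (intro ge_one_powr_ge_zero) auto
    moreover have "zf u \<le> C * (1 / u) powr (\<gamma> + \<beta>)" unfolding zf_def by (rule C) (use u in simp)
    ultimately have "1 + zf u \<le> (1 + C) * (1 / u) powr (\<gamma> + \<beta>)" by (simp add: distrib_right)
    then have "(1 + zf u) * u powr \<gamma> \<le> (1 + C) * (1 / u) powr (\<gamma> + \<beta>) * u powr \<gamma>"
      by (intro mult_right_mono) auto
    also have "(1 / u) powr (\<gamma> + \<beta>) = u powr (- (\<gamma> + \<beta>))"
      using u by (intro powr_inverse) simp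
    also have "(1 + C) * u powr (- (\<gamma> + \<beta>)) * u powr \<gamma> = (1 + C) * u powr (- \<beta>)"
      by (simp add: powr_add[symmetric])
    finally show "(1 + zf u) * u powr \<gamma> \<le> (1 + C) * u powr (- \<beta>)" .
  qed (use C in simp)
qed

definition K0 :: real where
  "K0 = (SOME K. K \<ge> 1 \<and> (\<forall>u. 0 < u \<longrightarrow> u \<le> 1 \<longrightarrow> (1 + zf u) * u powr \<gamma> \<le> K * u powr (- \<beta>)))"

lemma K0: "K0 \<ge> 1" "\<And>u. 0 < u \<Longrightarrow> u \<le> 1 \<Longrightarrow> (1 + zf u) * u powr \<gamma> \<le> K0 * u powr (- \<beta>)"
proof -
  have "\<exists>K. K \<ge> 1 \<and> (\<forall>u. 0 < u \<longrightarrow> u \<le> 1 \<longrightarrow> (1 + zf u) * u powr \<gamma> \<le> K * u powr (- \<beta>))"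
    using weight_bound by metis
  from someI_ex[OF this] show "K0 \<ge> 1" "\<And>u. 0 < u \<Longrightarrow> u \<le> 1 \<Longrightarrow> (1 + zf u) * u powr \<gamma> \<le> K0 * u powr (- \<beta>)"
    unfolding K0_def by auto
qed

lemma weight_bound_sq:
  assumes "0 < u" "u \<le> 1"
  shows "(1 + zf u)\<^sup>2 * u powr (2 * \<gamma>) \<le> K0\<^sup>2 * u powr (- (2 * \<beta>))"
proof -
  have "((1 + zf u) * u powr \<gamma>)\<^sup>2 \<le> (K0 * u powr (- \<beta>))\<^sup>2"
    using K0(2)[OF assms] zf_nonneg[OF assms] by (intro power_mono) auto
  then show ?thesis by (simp only: power_mult_distrib powr_squared mult_minus_right)
qed

text \<open>The following facts concern \<open>I u = integral {0..zf u} f\<close>. Differentiating \<open>u * I u\<close> gives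
  \<open>I u - f (zf u) * u powr (- \<gamma>)\<close>, so the latter integrates to \<open>0\<close>. With \<open>f\<close> one of the integrands of
  \<open>llik_D1\<close> and \<open>llik_D2\<close> this yields that the score is centred and that the expected
  Hessian is minus a Gram matrix.\<close>

lemma tail_integral_has_derivative:
  fixes f :: "real \<Rightarrow> real"
  assumes f: "\<And>u. 0 < u \<Longrightarrow> u \<le> 1 \<Longrightarrow> continuous_on {0..zf u} f" and u: "0 < u" "u < 1"
  shows "((\<lambda>u. integral {0..zf u} f) has_real_derivative - (f (zf u) * u powr (- \<gamma> - 1))) (at u)"
proof -
  have z: "0 < zf u" "zf u < zf (u / 2)" using zf_strict[of u 1] zf_strict[of "u/2" u] u by auto
  have "((\<lambda>x. integral {0..x} f) has_real_derivative f (zf u)) (at (zf u) within {0..zf (u/2)})"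
    by (rule integral_has_real_derivative[OF f]) (use u z in auto)
  then have "((\<lambda>x. integral {0..x} f) has_real_derivative f (zf u)) (at (zf u))"
    using z by (simp add: at_within_Icc_at)
  from DERIV_chain2[OF this zf_has_derivative[OF u(1)]] show ?thesis by simp
qed

lemma tail_integral_continuous:
  fixes f :: "real \<Rightarrow> real"
  assumes f: "\<And>u. 0 < u \<Longrightarrow> u \<le> 1 \<Longrightarrow> continuous_on {0..zf u} f"
  shows "continuous_on {0<..1} (\<lambda>u. integral {0..zf u} f)"
proof -
  have c: "continuous_on {u..1} (\<lambda>u. integral {0..zf u} f)" if u: "0 < u" "u \<le> 1" for u
  proof (rule continuous_on_compose2[of "{0..zf u}" "\<lambda>x. integral {0..x} f" "{u..1}" zf])
    show "continuous_on {0..zf u} (\<lambda>x. integral {0..x} f)"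
      by (rule indefinite_integral_continuous_1, rule integrable_continuous_real, rule f) (use u in auto)
    show "continuous_on {u..1} zf" by (rule continuous_on_subset[OF continuous_on_zf]) (use u in auto)
    show "zf ` {u..1} \<subseteq> {0..zf u}" using zf_nonneg zf_antimono u by auto
  qed
  have "continuous (at x within {0<..1}) (\<lambda>u. integral {0..zf u} f)" if x: "x \<in> {0<..1}" for x
  proof -
    have "continuous (at x within {x/2..1}) (\<lambda>u. integral {0..zf u} f)"
      using c[of "x/2"] x by (auto simp: continuous_on_eq_continuous_within)
    moreover have "at x within {x/2..1} = at x within {0<..1}"
      by (rule at_within_nhd[of _ "{x/2<..}"]) (use x in auto)
    ultimately show ?thesis by simp
  qed
  then show ?thesis by (simp add: continuous_on_eq_continuous_within)
qed

lemma tail_integral_bound: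
  fixes f :: "real \<Rightarrow> real"
  assumes f: "\<And>u. 0 < u \<Longrightarrow> u \<le> 1 \<Longrightarrow> continuous_on {0..zf u} f" and b: "b > 0"
    and bound: "\<And>u. 0 < u \<Longrightarrow> u \<le> 1 \<Longrightarrow> \<bar>f (zf u) * u powr (- \<gamma> - 1)\<bar> \<le> C * u powr (- b - 1)"
    and u: "0 < u" "u \<le> 1"
  shows "\<bar>integral {0..zf u} f\<bar> \<le> C / b * (u powr (- b) - 1)"
proof (cases "u = 1")
  case True then show ?thesis by simp
next
  case False
  then have u1: "u < 1" using u by simp
  have main: "s * integral {0..zf u} f \<le> C / b * (u powr (- b) - 1)" if s: "\<bar>s\<bar> = 1" for s
  proof -
    define G where "G v = C / b * v powr (- b) - s * integral {0..zf v} f" for v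
    have dG: "(G has_real_derivative (- C * v powr (- b - 1) + s * (f (zf v) * v powr (- \<gamma> - 1)))) (at v)"
      if v: "0 < v" "v < 1" for v
    proof -
      have "((\<lambda>v. C / b * v powr (- b)) has_real_derivative - C * v powr (- b - 1)) (at v)"
        using v b by (auto intro!: derivative_eq_intros)
      from DERIV_diff[OF this DERIV_cmult[OF tail_integral_has_derivative[OF f v], of s]]
      show ?thesis unfolding G_def by simp
    qed
    have cont: "continuous_on {u..1} G"
      unfolding G_def using u b
      by (intro continuous_intros continuous_on_subset[OF tail_integral_continuous[OF f]]) auto
    have "\<exists>l v. u < v \<and> v < 1 \<and> DERIV G v :> l \<and> G 1 - G u = (1 - u) * l"
    proof (rule MVT[OF u1 cont])
      fix x assume "u < x" "x < 1"
      then show "G differentiable (at x)" using dG[of x] u unfolding real_differentiable_def by auto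
    qed
    then obtain l v where v: "u < v" "v < 1" "DERIV G v :> l" "G 1 - G u = (1 - u) * l" by blast
    have "l = - C * v powr (- b - 1) + s * (f (zf v) * v powr (- \<gamma> - 1))"
      using DERIV_unique[OF v(3) dG] v u by simp
    moreover have "s * (f (zf v) * v powr (- \<gamma> - 1)) \<le> C * v powr (- b - 1)"
    proof -
      have "s * (f (zf v) * v powr (- \<gamma> - 1)) \<le> \<bar>s * (f (zf v) * v powr (- \<gamma> - 1))\<bar>" by (rule abs_ge_self)
      also have "\<dots> = \<bar>f (zf v) * v powr (- \<gamma> - 1)\<bar>" using s by (simp add: abs_mult)
      also have "\<dots> \<le> C * v powr (- b - 1)" by (rule bound) (use v u in auto)
      finally show ?thesis .
    qed
    ultimately have "l \<le> 0" by simp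
    then have "G 1 \<le> G u" using v(4) u1 by (metis diff_le_0_iff_le mult_nonneg_nonpos diff_ge_0_iff_ge less_imp_le)
    then show ?thesis by (simp add: G_def right_diff_distrib)
  qed
  show ?thesis using main[of 1] main[of "-1"] by (simp add: abs_le_iff)
qed

lemma tail_integral_mean_zero:
  fixes f :: "real \<Rightarrow> real"
  assumes f: "\<And>u. 0 < u \<Longrightarrow> u \<le> 1 \<Longrightarrow> continuous_on {0..zf u} f" and b: "0 < b" "b < 1"
    and bound: "\<And>u. 0 < u \<Longrightarrow> u \<le> 1 \<Longrightarrow> \<bar>f (zf u) * u powr (- \<gamma> - 1)\<bar> \<le> C * u powr (- b - 1)"
  shows "(LBINT u:{0<..1}. integral {0..zf u} f - f (zf u) * u powr (- \<gamma>)) = 0"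
    and "set_integrable lborel {0<..1} (\<lambda>u. integral {0..zf u} f)"
    and "set_integrable lborel {0<..1} (\<lambda>u. f (zf u) * u powr (- \<gamma>))"
proof -
  have fz: "continuous_on {0<..1} (\<lambda>u. f (zf u))"
  proof -
    have "continuous (at x within {0<..1}) (\<lambda>u. f (zf u))" if x: "x \<in> {0<..1}" for x
    proof -
      have "continuous_on {x/2..1} (\<lambda>u. f (zf u))"
      proof (rule continuous_on_compose2[of "{0..zf (x/2)}" f])
        show "continuous_on {x/2..1} zf" by (rule continuous_on_subset[OF continuous_on_zf]) (use x in auto)
        show "zf ` {x/2..1} \<subseteq> {0..zf (x/2)}" using zf_nonneg zf_antimono[of "x/2"] x by auto
      qed (use f[of "x/2"] x in auto)
      then have "continuous (at x within {x/2..1}) (\<lambda>u. f (zf u))"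
        using x by (auto simp: continuous_on_eq_continuous_within)
      moreover have "at x within {x/2..1} = at x within {0<..1}"
        by (rule at_within_nhd[of _ "{x/2<..}"]) (use x in auto)
      ultimately show ?thesis by simp
    qed
    then show ?thesis by (simp add: continuous_on_eq_continuous_within)
  qed
  have Ic: "continuous_on {0<..1} (\<lambda>u. integral {0..zf u} f)" by (rule tail_integral_continuous[OF f])
  have C0: "C \<ge> 0" using bound[of 1] by (auto intro: order_trans[OF abs_ge_zero])
  have Ib: "\<bar>integral {0..zf u} f\<bar> \<le> C / b * u powr (- b)" if "0 < u" "u \<le> 1" for u
  proof -
    have "C / b * (u powr (- b) - 1) \<le> C / b * u powr (- b)" using C0 b by (intro mult_left_mono) auto
    then show ?thesis using tail_integral_bound[OF f b(1) bound that] by linarith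
  qed
  have fb: "\<bar>f (zf u) * u powr (- \<gamma>)\<bar> \<le> C * u powr (- b)" if "0 < u" "u \<le> 1" for u
  proof -
    have "\<bar>f (zf u) * u powr (- \<gamma>)\<bar> = \<bar>f (zf u) * u powr (- \<gamma> - 1)\<bar> * u"
      using that by (simp add: powr_diff abs_mult)
    also have "\<dots> \<le> C * u powr (- b - 1) * u" using bound[OF that] that by (intro mult_right_mono) auto
    also have "\<dots> = C * u powr (- b)" using that by (simp add: powr_diff)
    finally show ?thesis .
  qed
  show i1: "set_integrable lborel {0<..1} (\<lambda>u. integral {0..zf u} f)"
    by (rule set_integrable_powr_bound[OF Ic b(2) Ib])
  have fgc: "continuous_on {0<..1} (\<lambda>u. f (zf u) * u powr (- \<gamma>))"
    by (intro continuous_intros fz) auto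
  show i2: "set_integrable lborel {0<..1} (\<lambda>u. f (zf u) * u powr (- \<gamma>))"
    by (rule set_integrable_powr_bound[OF fgc b(2) fb])
  define P where "P u = u * integral {0..zf u} f" for u
  define p where "p u = integral {0..zf u} f - f (zf u) * u powr (- \<gamma>)" for u
  have ip: "set_integrable lborel {0<..1} p" unfolding p_def by (rule set_integral_diff[OF i1 i2])
  have Pb: "\<bar>P u\<bar> \<le> C / b * (u powr (1 - b) - u)" if "0 < u" "u \<le> 1" for u
  proof -
    have "\<bar>P u\<bar> \<le> u * (C / b * (u powr (- b) - 1))"
      unfolding P_def abs_mult using tail_integral_bound[OF f b(1) bound that] that by (intro mult_mono) auto
    also have "\<dots> = C / b * (u powr (1 - b) - u)"
      using that by (simp add: powr_diff powr_minus_divide algebra_simps)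
    finally show ?thesis .
  qed
  have "(LBINT u=ereal 0..ereal 1. p u) = 0 - 0"
  proof (rule interval_integral_FTC_integrable)
    fix x :: real assume "ereal 0 < ereal x" "ereal x < ereal 1"
    then have x: "0 < x" "x < 1" by auto
    have "(P has_real_derivative 1 * integral {0..zf x} f + (- (f (zf x) * x powr (- \<gamma> - 1))) * x) (at x)"
      unfolding P_def by (rule DERIV_mult[OF DERIV_ident tail_integral_has_derivative[OF f x]])
    also have "1 * integral {0..zf x} f + (- (f (zf x) * x powr (- \<gamma> - 1))) * x = p x"
      using x by (simp add: p_def powr_diff)
    finally show "(P has_vector_derivative p x) (at x)"
      by (simp add: has_real_derivative_iff_has_vector_derivative)
    have "continuous_on {0<..<1} p"
      unfolding p_def by (intro continuous_on_diff continuous_on_subset[OF Ic] continuous_on_subset[OF fgc]) auto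
    then show "isCont p x" using x by (simp add: continuous_on_eq_continuous_at)
  next
    show "set_integrable lborel (einterval (ereal 0) (ereal 1)) p"
      by (rule set_integrable_subset[OF ip]) auto
    show "((P \<circ> real_of_ereal) \<longlongrightarrow> 0) (at_right (ereal 0))"
      unfolding ereal_tendsto_simps1(2)
    proof (rule Lim_null_comparison)
      show "eventually (\<lambda>u. norm (P u) \<le> C / b * (u powr (1 - b) - u)) (at_right 0)"
        using eventually_at_right_less[of "0::real"] eventually_at_right_real[of 0 "1::real", simplified]
        by eventually_elim (use Pb in auto)
      show "((\<lambda>u. C / b * (u powr (1 - b) - u)) \<longlongrightarrow> 0) (at_right 0)"
      proof -
        have "((\<lambda>u::real. u powr (1 - b)) \<longlongrightarrow> 0) (at_right 0)"
        proof (rule tendsto_zero_powrI[where b = "1 - b"])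
          show "eventually (\<lambda>x::real. 0 \<le> x) (at_right 0)"
            using eventually_at_right_less[of "0::real"] by eventually_elim simp
        qed (use b in \<open>auto intro!: tendsto_ident_at\<close>)
        from tendsto_mult_left[OF tendsto_diff[OF this tendsto_ident_at], of "C / b"] show ?thesis by simp
      qed
    qed
    show "((P \<circ> real_of_ereal) \<longlongrightarrow> 0) (at_left (ereal 1))"
      unfolding ereal_tendsto_simps1(1)
    proof (rule Lim_null_comparison)
      show "eventually (\<lambda>u. norm (P u) \<le> C / b * (u powr (1 - b) - u)) (at_left 1)"
        using eventually_at_left_real[of 0 "1::real", simplified]
        by eventually_elim (use Pb in auto)
      show "((\<lambda>u. C / b * (u powr (1 - b) - u)) \<longlongrightarrow> 0) (at_left 1)"
        using b by (auto intro!: tendsto_eq_intros)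
    qed
  qed simp
  then have "(LBINT u:{0<..<1}. p u) = 0" by (simp add: interval_integral_Ioo)
  moreover have "(LBINT u:{0<..<1}. p u) = (LBINT u:{0<..1}. p u)"
    unfolding set_lebesgue_integral_def
  proof (rule integral_cong_AE)
    show "AE x in lborel. indicator {0<..<1} x *\<^sub>R p x = indicator {0<..1} x *\<^sub>R p x"
      using AE_lborel_singleton[of "1::real"] by eventually_elim (auto simp: indicator_def)
    show "(\<lambda>x. indicator {0<..<1} x *\<^sub>R p x) \<in> borel_measurable lborel"
    proof -
      have "set_integrable lborel {0<..<1} p" by (rule set_integrable_subset[OF ip]) auto
      then show ?thesis by (auto simp: set_integrable_def)
    qed
    show "(\<lambda>x. indicator {0<..1} x *\<^sub>R p x) \<in> borel_measurable lborel"
      using ip by (auto simp: set_integrable_def)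
  qed
  ultimately show "(LBINT u:{0<..1}. integral {0..zf u} f - f (zf u) * u powr (- \<gamma>)) = 0"
    by (simp add: p_def)
qed

end

context gp_limit
begin

lemma powr_diff_one: "u powr (a - 1) = u powr a * u powr (- 1)" for u :: real
  by (simp only: diff_conv_add_uminus powr_add)

lemma continuous_on_ratio_\<theta>0:
  assumes "0 < u"
  shows "continuous_on {0..zf u} (\<lambda>r. lin h r * lin h' r / (lin \<theta>0 r) ^ m)"
    "continuous_on {0..zf u} (\<lambda>r. lin h r / (lin \<theta>0 r) ^ m)"
  using lin_\<theta>0_zf_pos[OF assms] by (intro continuous_on_ratio; simp)+

definition f1 :: "real^2 \<Rightarrow> real \<Rightarrow> real" where "f1 h r = lin h r / (lin \<theta>0 r)\<^sup>2"
definition f2 :: "real^2 \<Rightarrow> real^2 \<Rightarrow> real \<Rightarrow> real" where "f2 h h' r = lin h r * lin h' r / (lin \<theta>0 r) ^ 3"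

lemma f1_bound:
  assumes u: "0 < u" "u \<le> 1"
  shows "\<bar>f1 h (zf u) * u powr (- \<gamma> - 1)\<bar> \<le> (K0 * norm h) * u powr (- \<beta> - 1)"
proof -
  have "f1 h (zf u) = lin h (zf u) * u powr (2 * \<gamma>)"
    using u by (simp add: f1_def lin_\<theta>0_zf powr_squared divide_powr_uminus)
  then have "\<bar>f1 h (zf u) * u powr (- \<gamma> - 1)\<bar> = \<bar>lin h (zf u)\<bar> * (u powr (2 * \<gamma>) * u powr (- \<gamma> - 1))"
    by (simp add: abs_mult)
  also have "u powr (2 * \<gamma>) * u powr (- \<gamma> - 1) = u powr \<gamma> * u powr (- 1)"
    by (simp only: powr_add[symmetric], rule arg_cong[where f = "\<lambda>x. u powr x"], simp)
  also have "\<bar>lin h (zf u)\<bar> * (u powr \<gamma> * u powr (- 1)) \<le> ((1 + zf u) * norm h) * (u powr \<gamma> * u powr (- 1))"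
    using abs_lin_le[OF zf_nonneg[OF u]] by (intro mult_right_mono) auto
  also have "\<dots> = ((1 + zf u) * u powr \<gamma>) * (norm h * u powr (- 1))" by (simp add: mult_ac)
  also have "\<dots> \<le> (K0 * u powr (- \<beta>)) * (norm h * u powr (- 1))"
    using K0(2)[OF u] by (intro mult_right_mono) auto
  also have "\<dots> = (K0 * norm h) * (u powr (- \<beta>) * u powr (- 1))" by (simp add: mult_ac)
  also have "u powr (- \<beta>) * u powr (- 1) = u powr (- \<beta> - 1)" by (rule powr_diff_one[symmetric])
  finally show ?thesis .
qed

lemma f2_zf: "0 < u \<Longrightarrow> f2 h h' (zf u) * u powr (- \<gamma>) = lin h (zf u) * lin h' (zf u) * u powr (2 * \<gamma>)"
proof -
  assume u: "0 < u"
  have "(u powr (- \<gamma>)) ^ 3 = u powr (- (3 * \<gamma>))"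
    by (simp add: power3_eq_cube powr_add[symmetric])
  then have "f2 h h' (zf u) = lin h (zf u) * lin h' (zf u) * u powr (3 * \<gamma>)"
    using u by (simp add: f2_def lin_\<theta>0_zf divide_powr_uminus)
  then show ?thesis by (simp add: powr_add[symmetric] mult.assoc)
qed

lemma abs_lin_mult_le:
  assumes "r \<ge> 0"
  shows "\<bar>lin h r * lin h' r\<bar> \<le> (1 + r)\<^sup>2 * (norm h * norm h')"
proof -
  have "\<bar>lin h r\<bar> * \<bar>lin h' r\<bar> \<le> ((1 + r) * norm h) * ((1 + r) * norm h')"
    using abs_lin_le[OF assms] assms by (intro mult_mono) auto
  then show ?thesis by (simp add: abs_mult power2_eq_square mult_ac)
qed

lemma gram_bound:
  assumes u: "0 < u" "u \<le> 1"
  shows "\<bar>lin h (zf u) * lin h' (zf u) * u powr (2 * \<gamma>)\<bar> \<le> K0\<^sup>2 * (norm h * norm h') * u powr (- (2 * \<beta>))"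
proof -
  have "\<bar>lin h (zf u) * lin h' (zf u) * u powr (2 * \<gamma>)\<bar> = \<bar>lin h (zf u) * lin h' (zf u)\<bar> * u powr (2 * \<gamma>)"
    by (simp add: abs_mult)
  also have "\<dots> \<le> ((1 + zf u)\<^sup>2 * (norm h * norm h')) * u powr (2 * \<gamma>)"
    by (intro mult_right_mono abs_lin_mult_le zf_nonneg u) auto
  also have "\<dots> = ((1 + zf u)\<^sup>2 * u powr (2 * \<gamma>)) * (norm h * norm h')" by (simp add: mult_ac)
  also have "\<dots> \<le> (K0\<^sup>2 * u powr (- (2 * \<beta>))) * (norm h * norm h')"
    by (intro mult_right_mono weight_bound_sq u) auto
  finally show ?thesis by (simp add: mult_ac)
qed

lemma f2_bound:
  assumes u: "0 < u" "u \<le> 1"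
  shows "\<bar>f2 h h' (zf u) * u powr (- \<gamma> - 1)\<bar> \<le> (K0\<^sup>2 * (norm h * norm h')) * u powr (- (2 * \<beta>) - 1)"
proof -
  have "f2 h h' (zf u) * u powr (- \<gamma> - 1) = (f2 h h' (zf u) * u powr (- \<gamma>)) * u powr (- 1)"
    by (simp only: powr_diff_one mult.assoc)
  then have "\<bar>f2 h h' (zf u) * u powr (- \<gamma> - 1)\<bar> = \<bar>lin h (zf u) * lin h' (zf u) * u powr (2 * \<gamma>)\<bar> * u powr (- 1)"
    using f2_zf[OF u(1)] by (simp add: abs_mult)
  also have "\<dots> \<le> (K0\<^sup>2 * (norm h * norm h') * u powr (- (2 * \<beta>))) * u powr (- 1)"
    by (intro mult_right_mono gram_bound u) auto
  also have "\<dots> = (K0\<^sup>2 * (norm h * norm h')) * (u powr (- (2 * \<beta>)) * u powr (- 1))" by (simp add: mult_ac)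
  also have "u powr (- (2 * \<beta>)) * u powr (- 1) = u powr (- (2 * \<beta>) - 1)" by (rule powr_diff_one[symmetric])
  finally show ?thesis .
qed

lemma f1_cont: "0 < u \<Longrightarrow> u \<le> 1 \<Longrightarrow> continuous_on {0..zf u} (f1 h)"
  unfolding f1_def by (rule continuous_on_ratio_\<theta>0)

lemma f2_cont: "0 < u \<Longrightarrow> u \<le> 1 \<Longrightarrow> continuous_on {0..zf u} (f2 h h')"
  unfolding f2_def by (rule continuous_on_ratio_\<theta>0)

lemma continuous_on_zf_unit: "continuous_on {0<..1} zf"
  by (rule continuous_on_subset[OF continuous_on_zf]) auto

text \<open>The score and the Hessian at \<open>\<theta>0\<close> in the direction \<open>h\<close>, as functions of the point \<open>u\<close>. The Gram matrix \<open>gram\<close>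
is the Fisher information (\<open>fisher_info_nth\<close>).\<close>

definition score_fun :: "real^2 \<Rightarrow> real \<Rightarrow> real" where
  "score_fun h u = llik_D1 \<theta>0 h (zf u)"

definition hess_fun :: "real^2 \<Rightarrow> real^2 \<Rightarrow> real \<Rightarrow> real" where
  "hess_fun h h' u = llik_D2 \<theta>0 h h' (zf u)"

definition gram :: "real^2 \<Rightarrow> real^2 \<Rightarrow> real" where
  "gram h h' = (LBINT u:{0<..1}. lin h (zf u) * lin h' (zf u) * u powr (2 * \<gamma>))"

lemma score_fun_eq:
  assumes "0 < u"
  shows "score_fun h u = integral {0..zf u} (f1 h) - f1 h (zf u) * u powr (- \<gamma>)"
proof -
  have "f1 h (zf u) * u powr (- \<gamma>) = lin h (zf u) / lin \<theta>0 (zf u)"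
    using assms by (simp add: f1_def lin_\<theta>0_zf power2_eq_square)
  then show ?thesis by (simp add: score_fun_def llik_D1_def f1_def[abs_def])
qed

lemma hess_fun_eq:
  assumes "0 < u"
  shows "hess_fun h h' u = f2 h h' (zf u) * u powr (- \<gamma>) - 2 * integral {0..zf u} (f2 h h')"
proof -
  have "f2 h h' (zf u) * u powr (- \<gamma>) = lin h (zf u) * lin h' (zf u) / (lin \<theta>0 (zf u))\<^sup>2"
    using assms by (simp add: f2_def lin_\<theta>0_zf power2_eq_square power3_eq_cube)
  then show ?thesis by (simp add: hess_fun_def llik_D2_def f2_def[abs_def])
qed

lemma score_fun_continuous: "continuous_on {0<..1} (score_fun h)"
proof -
  have "continuous_on {0<..1} (\<lambda>u. integral {0..zf u} (f1 h) - lin h (zf u) / u powr (- \<gamma>))"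
    by (intro continuous_intros tail_integral_continuous f1_cont continuous_on_zf_unit) auto
  moreover have "integral {0..zf u} (f1 h) - lin h (zf u) / u powr (- \<gamma>) = score_fun h u" if "u \<in> {0<..1}" for u
    using that by (simp add: score_fun_def llik_D1_def f1_def[abs_def] lin_\<theta>0_zf)
  ultimately show ?thesis by (rule continuous_on_eq)
qed

lemma hess_fun_continuous: "continuous_on {0<..1} (hess_fun h h')"
proof -
  have "continuous_on {0<..1} (\<lambda>u. lin h (zf u) * lin h' (zf u) / (u powr (- \<gamma>))\<^sup>2 - 2 * integral {0..zf u} (f2 h h'))"
    by (intro continuous_intros tail_integral_continuous f2_cont continuous_on_zf_unit) auto
  moreover have "lin h (zf u) * lin h' (zf u) / (u powr (- \<gamma>))\<^sup>2 - 2 * integral {0..zf u} (f2 h h') = hess_fun h h' u"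
    if "u \<in> {0<..1}" for u
    using that by (simp add: hess_fun_def llik_D2_def f2_def[abs_def] lin_\<theta>0_zf)
  ultimately show ?thesis by (rule continuous_on_eq)
qed

lemma beta_pos: "0 < \<beta>" "\<beta> < 1" "0 < 2 * \<beta>" "2 * \<beta> < 1"
  using beta by auto

lemma score_fun_bound:
  assumes u: "0 < u" "u \<le> 1"
  shows "\<bar>score_fun h u\<bar> \<le> (K0 * norm h * (1 + 1 / \<beta>)) * u powr (- \<beta>)"
proof -
  have "\<bar>integral {0..zf u} (f1 h)\<bar> \<le> K0 * norm h / \<beta> * (u powr (- \<beta>) - 1)"
    by (rule tail_integral_bound[OF f1_cont beta_pos(1) f1_bound u])
  also have "\<dots> \<le> K0 * norm h / \<beta> * u powr (- \<beta>)"
    using K0 beta_pos by (intro mult_left_mono) auto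
  finally have 1: "\<bar>integral {0..zf u} (f1 h)\<bar> \<le> K0 * norm h / \<beta> * u powr (- \<beta>)" .
  have "\<bar>f1 h (zf u) * u powr (- \<gamma>)\<bar> = \<bar>f1 h (zf u) * u powr (- \<gamma> - 1)\<bar> * u"
    using u by (simp add: powr_diff abs_mult)
  also have "\<dots> \<le> (K0 * norm h) * u powr (- \<beta> - 1) * u"
    using f1_bound[OF u] u by (intro mult_right_mono) auto
  also have "\<dots> = (K0 * norm h) * u powr (- \<beta>)" using u by (simp add: powr_diff)
  finally have 2: "\<bar>f1 h (zf u) * u powr (- \<gamma>)\<bar> \<le> (K0 * norm h) * u powr (- \<beta>)" .
  have "\<bar>score_fun h u\<bar> \<le> K0 * norm h / \<beta> * u powr (- \<beta>) + (K0 * norm h) * u powr (- \<beta>)"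
    unfolding score_fun_eq[OF u(1)] using 1 2 by linarith
  then show ?thesis by (simp add: algebra_simps)
qed

lemma score_fun_mean:
  shows "set_integrable lborel {0<..1} (score_fun h)"
    "set_integrable lborel {0<..1} (\<lambda>u. (score_fun h u)\<^sup>2)"
    "(LBINT u:{0<..1}. score_fun h u) = 0"
proof -
  let ?C = "K0 * norm h * (1 + 1 / \<beta>)"
  show "set_integrable lborel {0<..1} (score_fun h)"
    by (rule set_integrable_powr_bound[OF score_fun_continuous beta_pos(2) score_fun_bound])
  show "set_integrable lborel {0<..1} (\<lambda>u. (score_fun h u)\<^sup>2)"
  proof (rule set_integrable_powr_bound)
    show "continuous_on {0<..1} (\<lambda>u. (score_fun h u)\<^sup>2)" by (intro continuous_intros score_fun_continuous)
    fix u :: real assume u: "0 < u" "u \<le> 1"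
    have "\<bar>score_fun h u\<bar>\<^sup>2 \<le> (?C * u powr (- \<beta>))\<^sup>2" using score_fun_bound[OF u] by (intro power_mono) auto
    then show "\<bar>(score_fun h u)\<^sup>2\<bar> \<le> ?C\<^sup>2 * u powr (- (2 * \<beta>))"
      by (simp add: power_mult_distrib powr_squared)
  qed (rule beta_pos)
  have "(LBINT u:{0<..1}. score_fun h u) = (LBINT u:{0<..1}. integral {0..zf u} (f1 h) - f1 h (zf u) * u powr (- \<gamma>))"
    by (rule set_lebesgue_integral_cong) (auto simp: score_fun_eq)
  also have "\<dots> = 0"
    by (rule tail_integral_mean_zero[OF f1_cont beta_pos(1,2) f1_bound])
  finally show "(LBINT u:{0<..1}. score_fun h u) = 0" .
qed

lemma hess_fun_bound:
  assumes u: "0 < u" "u \<le> 1"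
  shows "\<bar>hess_fun h h' u\<bar> \<le> (K0\<^sup>2 * (1 + 1 / \<beta>)) * (norm h * norm h') * u powr (- (2 * \<beta>))"
proof -
  have "\<bar>integral {0..zf u} (f2 h h')\<bar> \<le> K0\<^sup>2 * (norm h * norm h') / (2 * \<beta>) * (u powr (- (2 * \<beta>)) - 1)"
    by (rule tail_integral_bound[OF f2_cont beta_pos(3) f2_bound u])
  also have "\<dots> \<le> K0\<^sup>2 * (norm h * norm h') / (2 * \<beta>) * u powr (- (2 * \<beta>))"
    using K0 beta_pos by (intro mult_left_mono) auto
  finally have 1: "\<bar>integral {0..zf u} (f2 h h')\<bar> \<le> K0\<^sup>2 * (norm h * norm h') / (2 * \<beta>) * u powr (- (2 * \<beta>))" .
  have 2: "\<bar>f2 h h' (zf u) * u powr (- \<gamma>)\<bar> \<le> K0\<^sup>2 * (norm h * norm h') * u powr (- (2 * \<beta>))"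
    unfolding f2_zf[OF u(1)] by (rule gram_bound[OF u])
  have "\<bar>hess_fun h h' u\<bar> \<le> K0\<^sup>2 * (norm h * norm h') * u powr (- (2 * \<beta>)) +
      2 * (K0\<^sup>2 * (norm h * norm h') / (2 * \<beta>) * u powr (- (2 * \<beta>)))"
    unfolding hess_fun_eq[OF u(1)] using 1 2 by linarith
  also have "\<dots> = (K0\<^sup>2 * (1 + 1 / \<beta>)) * (norm h * norm h') * u powr (- (2 * \<beta>))"
    by (simp add: algebra_simps)
  finally show ?thesis .
qed

lemma hess_fun_mean:
  shows "set_integrable lborel {0<..1} (hess_fun h h')"
    "(LBINT u:{0<..1}. hess_fun h h' u) = - gram h h'"
proof -
  show "set_integrable lborel {0<..1} (hess_fun h h')"
    by (rule set_integrable_powr_bound[OF hess_fun_continuous beta_pos(4) hess_fun_bound])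
  note mz = tail_integral_mean_zero[OF f2_cont beta_pos(3,4) f2_bound, of h h']
  have g: "(LBINT u:{0<..1}. f2 h h' (zf u) * u powr (- \<gamma>)) = gram h h'"
    unfolding gram_def by (rule set_lebesgue_integral_cong) (auto simp: f2_zf)
  have I: "(LBINT u:{0<..1}. integral {0..zf u} (f2 h h')) = gram h h'"
    using mz(1) set_integral_diff(2)[OF mz(2,3)] g by simp
  have "(LBINT u:{0<..1}. hess_fun h h' u) =
      (LBINT u:{0<..1}. f2 h h' (zf u) * u powr (- \<gamma>) - 2 * integral {0..zf u} (f2 h h'))"
    by (rule set_lebesgue_integral_cong) (auto simp: hess_fun_eq)
  also have "\<dots> = gram h h' - 2 * gram h h'"
    using set_integral_diff(2)[OF mz(3) set_integrable_mult_right[OF mz(2), of 2]] g I by simp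
  finally show "(LBINT u:{0<..1}. hess_fun h h' u) = - gram h h'" by simp
qed

lemma gram_integrable: "set_integrable lborel {0<..1} (\<lambda>u. lin h (zf u) * lin h' (zf u) * u powr (2 * \<gamma>))"
proof (rule set_integrable_powr_bound[OF _ beta_pos(4) gram_bound])
  show "continuous_on {0<..1} (\<lambda>u. lin h (zf u) * lin h' (zf u) * u powr (2 * \<gamma>))"
    by (intro continuous_intros continuous_on_zf_unit) auto
qed

lemma gram_expand:
  "gram h h = (h $ 1)\<^sup>2 * gram (axis 1 1) (axis 1 1) + 2 * h $ 1 * h $ 2 * gram (axis 1 1) (axis 2 1)
     + (h $ 2)\<^sup>2 * gram (axis 2 1) (axis 2 1)"
proof -
  let ?g = "\<lambda>h h' u. lin h (zf u) * lin h' (zf u) * u powr (2 * \<gamma>)"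
  have l: "lin h r = h $ 1 * lin (axis 1 1) r + h $ 2 * lin (axis 2 1) r" for r
    by (simp add: lin_def axis_def)
  have "?g h h u = (h $ 1)\<^sup>2 * ?g (axis 1 1) (axis 1 1) u + 2 * h $ 1 * h $ 2 * ?g (axis 1 1) (axis 2 1) u
     + (h $ 2)\<^sup>2 * ?g (axis 2 1) (axis 2 1) u" for u
    unfolding l[of "zf u"] by (simp add: algebra_simps power2_eq_square)
  then have "gram h h = (LBINT u:{0<..1}. (h $ 1)\<^sup>2 * ?g (axis 1 1) (axis 1 1) u + 2 * h $ 1 * h $ 2 * ?g (axis 1 1) (axis 2 1) u
     + (h $ 2)\<^sup>2 * ?g (axis 2 1) (axis 2 1) u)"
    unfolding gram_def by presburger
  also have "\<dots> = (h $ 1)\<^sup>2 * gram (axis 1 1) (axis 1 1) + 2 * h $ 1 * h $ 2 * gram (axis 1 1) (axis 2 1)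
     + (h $ 2)\<^sup>2 * gram (axis 2 1) (axis 2 1)"
    unfolding gram_def
    by (subst set_integral_add; (intro set_integral_add set_integrable_mult_right gram_integrable)?;
       (subst set_integral_add)?; (intro set_integrable_mult_right gram_integrable)?; simp)
  finally show ?thesis .
qed

text \<open>The integrand vanishes for at most one \<open>u\<close>, since \<open>zf\<close> is strictly decreasing and \<open>lin h\<close> is
affine.\<close>

lemma gram_pos:
  assumes "h \<noteq> 0"
  shows "gram h h > 0"
proof -
  let ?g = "\<lambda>u. lin h (zf u) * lin h (zf u) * u powr (2 * \<gamma>)"
  have nn: "?g u \<ge> 0" for u by simp
  have "gram h h \<ge> 0" unfolding gram_def set_lebesgue_integral_def by (rule integral_nonneg_AE) simp
  moreover have "gram h h \<noteq> 0"
  proof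
    assume "gram h h = 0"
    then have "AE u in lborel. indicator {0<..1} u *\<^sub>R ?g u = 0"
      using gram_integrable[of h h] unfolding gram_def set_lebesgue_integral_def set_integrable_def
      by (subst (asm) integral_nonneg_eq_0_iff_AE) auto
    then have ae: "AE u in lborel. u \<in> {0<..1} \<longrightarrow> lin h (zf u) = 0"
      by eventually_elim (auto simp: indicator_def)
    have fin: "finite {u\<in>{0<..1}. lin h (zf u) = 0}"
    proof (rule ccontr)
      assume "infinite {u\<in>{0<..1}. lin h (zf u) = 0}"
      then have inf: "infinite {u\<in>{0<..1}. lin h (zf u) = 0}" .
      obtain u where u: "u \<in> {u\<in>{0<..1}. lin h (zf u) = 0}"
        using infinite_imp_nonempty[OF inf] by blast
      have "infinite ({u\<in>{0<..1}. lin h (zf u) = 0} - {u})" using inf by simp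
      then obtain v where v: "v \<in> {u\<in>{0<..1}. lin h (zf u) = 0} - {u}"
        using infinite_imp_nonempty by blast
      have "h $ 1 * (zf u - zf v) = lin h (zf u) - lin h (zf v)" by (simp add: lin_def algebra_simps)
      then have "h $ 1 * (zf u - zf v) = 0" using u v by simp
      moreover have "zf v \<noteq> zf u"
        using zf_strict[of u v] zf_strict[of v u] u v
        by (cases u v rule: linorder_cases) auto
      ultimately have h1: "h $ 1 = 0" by simp
      moreover have "h $ 2 = 0" using u h1 by (simp add: lin_def)
      ultimately show False using assms by (simp add: vec_eq_iff forall_2)
    qed
    have "AE u in lborel. u \<notin> {u\<in>{0<..1}. lin h (zf u) = 0}"
      using countable_imp_null_set_lborel[OF countable_finite[OF fin]] by (rule AE_not_in)
    with ae have "AE u in lborel. u \<notin> {0<..1::real}" by eventually_elim auto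
    then have "{0<..1::real} \<in> null_sets lborel" by (subst AE_iff_null_sets) auto
    then have "emeasure lborel {0<..1::real} = 0" by (rule null_setsD1)
    then show False by simp
  qed
  ultimately show ?thesis by simp
qed

lemma gram_coercive:
  obtains c where "c > 0" "\<And>h. gram h h \<ge> c * (norm h)\<^sup>2"
proof -
  have cont: "continuous_on (sphere 0 1) (\<lambda>h. gram h h)"
    by (subst gram_expand) (intro continuous_intros)
  have "sphere (0::real^2) 1 \<noteq> {}" using norm_axis_1[of "1::2"] by (metis dist_0_norm empty_iff mem_sphere)
  then obtain h0 where h0: "h0 \<in> sphere (0::real^2) 1" "\<And>h. h \<in> sphere 0 1 \<Longrightarrow> gram h0 h0 \<le> gram h h"
    using continuous_attains_inf[OF compact_sphere _ cont] by blast
  have pos: "gram h0 h0 > 0" by (rule gram_pos) (use h0 in auto)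
  have "gram h h \<ge> gram h0 h0 * (norm h)\<^sup>2" for h
  proof (cases "h = 0")
    case True then show ?thesis by (subst gram_expand) simp
  next
    case False
    define g where "g = (1 / norm h) *\<^sub>R h"
    have g: "g \<in> sphere 0 1" "h = norm h *\<^sub>R g" using False by (auto simp: g_def)
    have "gram (norm h *\<^sub>R g) (norm h *\<^sub>R g) = (norm h)\<^sup>2 * gram g g"
      unfolding gram_expand[of "norm h *\<^sub>R g"] gram_expand[of g] by (simp add: algebra_simps power2_eq_square)
    then have "gram h h = (norm h)\<^sup>2 * gram g g" using g(2) by simp
    then show ?thesis using h0(2)[OF g(1)] by (simp add: mult.commute mult_right_mono)
  qed
  then show ?thesis using that pos by blast
qed

section \<open>Comparison of observed and limiting excesses\<close>

text \<open>Within the relative distance \<open>\<eta>0\<close> of \<open>zf u\<close>, the denominator \<open>lin \<theta>0\<close> loses at most half of its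
value \<open>u powr (- \<gamma>)\<close>.\<close>

definition \<eta>0 :: real where "\<eta>0 = 1 / (2 * (1 + \<bar>\<gamma>\<bar>))"

lemma eta0: "0 < \<eta>0" "\<eta>0 \<le> 1/2" "\<eta>0 * (1 + \<bar>\<gamma>\<bar>) = 1/2" "\<bar>\<gamma>\<bar> * \<eta>0 \<le> 1/2"
  by (auto simp: \<eta>0_def field_simps)

lemma between_bounds:
  assumes u: "0 < u" "u \<le> 1" and e: "0 \<le> e" "e \<le> \<eta>0"
    and x: "\<bar>x - zf u\<bar> \<le> e * u powr (- \<gamma>)"
  shows "lin \<theta>0 x \<ge> u powr (- \<gamma>) / 2" "1 + x \<le> 2 * (1 + zf u)"
proof -
  let ?z = "zf u" and ?W = "u powr (- \<gamma>)"
  have W: "?W = 1 + \<gamma> * ?z" using lin_\<theta>0_zf[OF u(1)] by (simp add: lin_\<theta>0)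
  have z: "?z \<ge> 0" by (rule zf_nonneg[OF u])
  have "\<bar>\<gamma> * (x - ?z)\<bar> \<le> \<bar>\<gamma>\<bar> * (\<eta>0 * ?W)"
    unfolding abs_mult using x e by (intro mult_left_mono order_trans[OF x] mult_right_mono) auto
  also have "\<dots> \<le> 1/2 * ?W" using eta0(4) by (metis mult.assoc mult_right_mono powr_ge_zero)
  finally have "\<bar>\<gamma> * (x - ?z)\<bar> \<le> ?W / 2" by simp
  moreover have "lin \<theta>0 x = ?W + \<gamma> * (x - ?z)" by (simp add: lin_\<theta>0 W algebra_simps)
  ultimately show "lin \<theta>0 x \<ge> ?W / 2" by linarith
  have "?W \<le> (1 + \<bar>\<gamma>\<bar>) * (1 + ?z)"
  proof -
    have "\<gamma> * ?z \<le> \<bar>\<gamma>\<bar> * ?z" using z by (intro mult_right_mono) auto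
    then show ?thesis using W z by (simp add: algebra_simps)
  qed
  then have "e * ?W \<le> \<eta>0 * ((1 + \<bar>\<gamma>\<bar>) * (1 + ?z))" using e eta0 by (intro mult_mono) auto
  also have "\<dots> = (1 + ?z) / 2" using eta0(3) by (metis mult.assoc mult.commute times_divide_eq_right mult.right_neutral)
  finally show "1 + x \<le> 2 * (1 + ?z)" using x z by (simp add: abs_le_iff field_simps)
qed

lemma between_weights:
  assumes u: "0 < u" "u \<le> 1" and e: "0 \<le> e" "e \<le> \<eta>0"
    and x: "\<bar>x - zf u\<bar> \<le> e * u powr (- \<gamma>)" "0 \<le> x"
  shows "lin \<theta>0 x > 0"
    "(1 + x)\<^sup>2 / (lin \<theta>0 x)\<^sup>2 \<le> 16 * K0\<^sup>2 * u powr (- (2 * \<beta>))"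
    "(1 + x)\<^sup>2 / (lin \<theta>0 x) ^ 3 \<le> 32 * K0\<^sup>2 * u powr (- (2 * \<beta>)) * u powr \<gamma>"
    "(1 + x) / (lin \<theta>0 x)\<^sup>2 \<le> 8 * K0 * u powr (- \<beta>) * u powr \<gamma>"
proof -
  note b = between_bounds[OF u e x(1)]
  have Wp: "u powr (- \<gamma>) / 2 > 0" using u by simp
  with b(1) show pos: "lin \<theta>0 x > 0" by linarith
  have z: "zf u \<ge> 0" by (rule zf_nonneg[OF u])
  have sq: "(1 + x)\<^sup>2 \<le> 4 * (1 + zf u)\<^sup>2"
  proof -
    have "(1 + x)\<^sup>2 \<le> (2 * (1 + zf u))\<^sup>2" using b(2) x by (intro power_mono) auto
    then show ?thesis by (simp only: power_mult_distrib) simp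
  qed
  have W2: "(u powr (- \<gamma>) / 2)\<^sup>2 \<le> (lin \<theta>0 x)\<^sup>2" and W3: "(u powr (- \<gamma>) / 2) ^ 3 \<le> (lin \<theta>0 x) ^ 3"
    using b(1) by (intro power_mono; simp)+
  have i2: "1 / (u powr (- \<gamma>) / 2)\<^sup>2 = 4 * u powr (2 * \<gamma>)"
    by (simp add: power_divide powr_squared powr_minus_divide)
  have i3: "1 / (u powr (- \<gamma>) / 2) ^ 3 = 8 * (u powr (2 * \<gamma>) * u powr \<gamma>)"
    using u by (simp add: power_divide powr_minus_divide power3_eq_cube powr_add[symmetric])
  have "(1 + x)\<^sup>2 / (lin \<theta>0 x)\<^sup>2 \<le> 4 * (1 + zf u)\<^sup>2 / (u powr (- \<gamma>) / 2)\<^sup>2"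
    using sq W2 Wp z by (intro frac_le) auto
  also have "\<dots> = 4 * (1 + zf u)\<^sup>2 * (1 / (u powr (- \<gamma>) / 2)\<^sup>2)" by simp
  also have "\<dots> = 16 * ((1 + zf u)\<^sup>2 * u powr (2 * \<gamma>))"
    unfolding i2 by (simp add: mult_ac)
  also have "\<dots> \<le> 16 * (K0\<^sup>2 * u powr (- (2 * \<beta>)))" by (intro mult_left_mono weight_bound_sq u) auto
  finally show "(1 + x)\<^sup>2 / (lin \<theta>0 x)\<^sup>2 \<le> 16 * K0\<^sup>2 * u powr (- (2 * \<beta>))" by simp
  have "(1 + x)\<^sup>2 / (lin \<theta>0 x) ^ 3 \<le> 4 * (1 + zf u)\<^sup>2 / (u powr (- \<gamma>) / 2) ^ 3"
    using sq W3 Wp z by (intro frac_le) auto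
  also have "\<dots> = 4 * (1 + zf u)\<^sup>2 * (1 / (u powr (- \<gamma>) / 2) ^ 3)" by simp
  also have "\<dots> = 32 * ((1 + zf u)\<^sup>2 * u powr (2 * \<gamma>)) * u powr \<gamma>"
    unfolding i3 by (simp add: mult_ac)
  also have "\<dots> \<le> 32 * (K0\<^sup>2 * u powr (- (2 * \<beta>))) * u powr \<gamma>"
    by (intro mult_left_mono mult_right_mono weight_bound_sq u) auto
  finally show "(1 + x)\<^sup>2 / (lin \<theta>0 x) ^ 3 \<le> 32 * K0\<^sup>2 * u powr (- (2 * \<beta>)) * u powr \<gamma>" by simp
  have "(1 + x) / (lin \<theta>0 x)\<^sup>2 \<le> 2 * (1 + zf u) / (u powr (- \<gamma>) / 2)\<^sup>2"
    by (rule frac_le[OF _ b(2) _ W2]) (use Wp z in auto)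
  also have "\<dots> = 2 * (1 + zf u) * (1 / (u powr (- \<gamma>) / 2)\<^sup>2)" by simp
  also have "\<dots> = 8 * ((1 + zf u) * u powr \<gamma>) * u powr \<gamma>"
    unfolding i2 powr_squared[symmetric] by (simp add: power2_eq_square algebra_simps)
  also have "\<dots> \<le> 8 * (K0 * u powr (- \<beta>)) * u powr \<gamma>"
    by (intro mult_left_mono mult_right_mono K0(2) u) auto
  finally show "(1 + x) / (lin \<theta>0 x)\<^sup>2 \<le> 8 * K0 * u powr (- \<beta>) * u powr \<gamma>" by simp
qed

end

lemma lin_nonneg_between:
  assumes "h $ 2 \<ge> 0" "lin h z \<ge> 0" "0 \<le> r" "r \<le> z"
  shows "lin h r \<ge> 0"
proof (cases "h $ 1 \<ge> 0")
  case True
  then have "0 \<le> h $ 1 * r" using assms by simp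
  then show ?thesis using assms by (simp add: lin_def)
next
  case False
  then have "h $ 1 * z \<le> h $ 1 * r" using assms by (intro mult_left_mono_neg) auto
  then show ?thesis using assms by (simp add: lin_def)
qed

context gp_limit
begin

lemma segment_between:
  assumes "x \<in> {min Z z..max Z z}" "\<bar>Z - z\<bar> \<le> d"
  shows "\<bar>x - z\<bar> \<le> (d::real)"
  using assms by (auto simp: abs_le_iff)

lemma abs_lin_\<theta>0_le: "r \<ge> 0 \<Longrightarrow> \<bar>lin \<theta>0 r\<bar> \<le> (1 + \<bar>\<gamma>\<bar>) * (1 + r)"
proof -
  assume r: "r \<ge> 0"
  have "\<bar>lin \<theta>0 r\<bar> \<le> 1 + \<bar>\<gamma>\<bar> * r"
    unfolding lin_\<theta>0 using r by (intro order_trans[OF abs_triangle_ineq]) (simp add: abs_mult)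
  also have "\<dots> \<le> (1 + \<bar>\<gamma>\<bar>) * (1 + r)" using r by (simp add: algebra_simps)
  finally show ?thesis .
qed

text \<open>The mean value theorem in the observation; the derivative on the segment between the observation
and its limit is bounded by \<open>between_weights\<close>.\<close>

lemma score_close:
  assumes u: "0 < u" "u \<le> 1" and Z: "0 \<le> Z" and d: "0 \<le> d" "d * u powr (- \<beta>) \<le> \<eta>0"
    and close: "\<bar>Z - zf u\<bar> \<le> d * u powr (- \<beta>) * u powr (- \<gamma>)"
  shows "\<bar>llik_D1 \<theta>0 h Z - score_fun h u\<bar> \<le> 16 * (1 + \<bar>\<gamma>\<bar>) * K0 * norm h * (d * u powr (- (2 * \<beta>)))"
proof -
  let ?z = "zf u" and ?e = "d * u powr (- \<beta>)"
  let ?S = "{min Z ?z..max Z ?z}"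
  have z: "0 \<le> ?z" by (rule zf_nonneg[OF u])
  have e: "0 \<le> ?e" using d by simp
  have xS: "0 \<le> x" "\<bar>x - ?z\<bar> \<le> ?e * u powr (- \<gamma>)" if "x \<in> ?S" for x
    using that Z z segment_between[OF that close] by auto
  note bw = between_weights[OF u e d(2) xS(2) xS(1)]
  define B where "B = 16 * (1 + \<bar>\<gamma>\<bar>) * K0 * norm h * u powr (- \<beta>) * u powr \<gamma>"
  have "max Z ?z \<in> ?S" by auto
  from bw(1)[OF this this] have posm: "lin \<theta>0 (max Z ?z) > 0" .
  have cont: "continuous_on {0..max Z ?z} (\<lambda>r. lin h r / (lin \<theta>0 r)\<^sup>2)"
    by (rule continuous_on_ratio) (use posm in auto)
  have "norm (llik_D1 \<theta>0 h Z - llik_D1 \<theta>0 h ?z) \<le> B * norm (Z - ?z)"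
  proof (rule field_differentiable_bound[of ?S "llik_D1 \<theta>0 h"
        "\<lambda>x. - ((h $ 1 * lin \<theta>0 x - lin h x * \<gamma>) / (lin \<theta>0 x * lin \<theta>0 x)) + lin h x / (lin \<theta>0 x)\<^sup>2"])
    fix x assume x: "x \<in> ?S"
    note pos = bw(1)[OF x x]
    have "((\<lambda>x. integral {0..x} (\<lambda>r. lin h r / (lin \<theta>0 r)\<^sup>2)) has_real_derivative lin h x / (lin \<theta>0 x)\<^sup>2) (at x within {0..max Z ?z})"
      by (rule integral_has_real_derivative[OF cont]) (use x xS(1)[OF x] in auto)
    then have I: "((\<lambda>x. integral {0..x} (\<lambda>r. lin h r / (lin \<theta>0 r)\<^sup>2)) has_real_derivative lin h x / (lin \<theta>0 x)\<^sup>2) (at x within ?S)"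
      by (rule DERIV_subset) (use Z z in auto)
    have "((\<lambda>x. lin h x / lin \<theta>0 x) has_real_derivative (h $ 1 * lin \<theta>0 x - lin h x * \<theta>0 $ 1) / (lin \<theta>0 x * lin \<theta>0 x)) (at x within ?S)"
      by (rule DERIV_divide[OF lin_has_derivative lin_has_derivative]) (use pos in simp)
    from DERIV_add[OF DERIV_minus[OF this] I]
    show "(llik_D1 \<theta>0 h has_field_derivative
        - ((h $ 1 * lin \<theta>0 x - lin h x * \<gamma>) / (lin \<theta>0 x * lin \<theta>0 x)) + lin h x / (lin \<theta>0 x)\<^sup>2) (at x within ?S)"
      unfolding llik_D1_def[abs_def] by simp
    have "- ((h $ 1 * lin \<theta>0 x - lin h x * \<gamma>) / (lin \<theta>0 x * lin \<theta>0 x)) + lin h x / (lin \<theta>0 x)\<^sup>2 =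
        (- (h $ 1 * lin \<theta>0 x) + lin h x * \<gamma> + lin h x) / (lin \<theta>0 x)\<^sup>2"
      by (simp add: power2_eq_square add_divide_distrib diff_divide_distrib)
    then have "norm (- ((h $ 1 * lin \<theta>0 x - lin h x * \<gamma>) / (lin \<theta>0 x * lin \<theta>0 x)) + lin h x / (lin \<theta>0 x)\<^sup>2) =
        \<bar>- (h $ 1 * lin \<theta>0 x) + lin h x * \<gamma> + lin h x\<bar> / (lin \<theta>0 x)\<^sup>2"
      by simp
    also have "\<dots> \<le> (2 * (1 + \<bar>\<gamma>\<bar>) * norm h * (1 + x)) / (lin \<theta>0 x)\<^sup>2"
    proof (intro divide_right_mono)
      have a1: "\<bar>h $ 1 * lin \<theta>0 x\<bar> \<le> norm h * ((1 + \<bar>\<gamma>\<bar>) * (1 + x))"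
        unfolding abs_mult by (intro mult_mono component_le_norm_cart abs_lin_\<theta>0_le xS(1)[OF x]) auto
      have a2: "\<bar>lin h x\<bar> \<le> (1 + x) * norm h" by (rule abs_lin_le[OF xS(1)[OF x]])
      then have a3: "\<bar>lin h x * \<gamma>\<bar> \<le> (1 + x) * norm h * \<bar>\<gamma>\<bar>" unfolding abs_mult by (intro mult_right_mono) auto
      have "\<bar>- (h $ 1 * lin \<theta>0 x) + lin h x * \<gamma> + lin h x\<bar> \<le> \<bar>h $ 1 * lin \<theta>0 x\<bar> + \<bar>lin h x * \<gamma>\<bar> + \<bar>lin h x\<bar>"
        by linarith
      also have "\<dots> \<le> norm h * ((1 + \<bar>\<gamma>\<bar>) * (1 + x)) + (1 + x) * norm h * \<bar>\<gamma>\<bar> + (1 + x) * norm h"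
        using a1 a2 a3 by linarith
      also have "\<dots> = 2 * (1 + \<bar>\<gamma>\<bar>) * norm h * (1 + x)" by (simp add: algebra_simps)
      finally show "\<bar>- (h $ 1 * lin \<theta>0 x) + lin h x * \<gamma> + lin h x\<bar> \<le> 2 * (1 + \<bar>\<gamma>\<bar>) * norm h * (1 + x)" .
    qed simp
    also have "\<dots> = (2 * (1 + \<bar>\<gamma>\<bar>) * norm h) * ((1 + x) / (lin \<theta>0 x)\<^sup>2)" by simp
    also have "\<dots> \<le> (2 * (1 + \<bar>\<gamma>\<bar>) * norm h) * (8 * K0 * u powr (- \<beta>) * u powr \<gamma>)"
      by (intro mult_left_mono bw(4)[OF x x]) auto
    also have "\<dots> = B" by (simp add: B_def mult_ac)
    finally show "norm (- ((h $ 1 * lin \<theta>0 x - lin h x * \<gamma>) / (lin \<theta>0 x * lin \<theta>0 x)) + lin h x / (lin \<theta>0 x)\<^sup>2) \<le> B" .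
  qed auto
  also have "B * norm (Z - ?z) \<le> B * (?e * u powr (- \<gamma>))"
    using close K0 by (intro mult_left_mono) (auto simp: B_def)
  also have "\<dots> = 16 * (1 + \<bar>\<gamma>\<bar>) * K0 * norm h * d * ((u powr (- \<beta>) * u powr (- \<beta>)) * (u powr \<gamma> * u powr (- \<gamma>)))"
    by (simp add: B_def mult_ac)
  also have "(u powr (- \<beta>) * u powr (- \<beta>)) * (u powr \<gamma> * u powr (- \<gamma>)) = u powr (- (2 * \<beta>))"
    using u by (simp add: powr_add[symmetric])
  finally show ?thesis by (simp add: score_fun_def mult.assoc)
qed

text \<open>The mean value theorem in the observation, as for the score.\<close>

lemma hess_close_obs:
  assumes u: "0 < u" "u \<le> 1" and Z: "0 \<le> Z" and e: "0 \<le> e" "e \<le> \<eta>0"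
    and close: "\<bar>Z - zf u\<bar> \<le> e * u powr (- \<gamma>)"
  shows "\<bar>llik_D2 \<theta>0 h h' Z - hess_fun h h' u\<bar> \<le> 128 * (1 + \<bar>\<gamma>\<bar>) * K0\<^sup>2 * (norm h * norm h') * (e * u powr (- (2 * \<beta>)))"
proof -
  let ?z = "zf u"
  let ?S = "{min Z ?z..max Z ?z}"
  have z: "0 \<le> ?z" by (rule zf_nonneg[OF u])
  have xS: "0 \<le> x" "\<bar>x - ?z\<bar> \<le> e * u powr (- \<gamma>)" if "x \<in> ?S" for x
    using that Z z segment_between[OF that close] by auto
  note bw = between_weights[OF u e xS(2) xS(1)]
  define B where "B = 128 * (1 + \<bar>\<gamma>\<bar>) * K0\<^sup>2 * (norm h * norm h') * u powr (- (2 * \<beta>)) * u powr \<gamma>"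
  have "max Z ?z \<in> ?S" by auto
  from bw(1)[OF this this] have posm: "lin \<theta>0 (max Z ?z) > 0" .
  let ?f = "\<lambda>r. lin h r * lin h' r / (lin \<theta>0 r) ^ 3"
  have cont: "continuous_on {0..max Z ?z} ?f"
    by (rule continuous_on_ratio) (use posm in auto)
  let ?D = "\<lambda>x. ((h $ 1 * lin h' x + lin h x * h' $ 1) * lin \<theta>0 x - 2 * \<gamma> * (lin h x * lin h' x) - 2 * (lin h x * lin h' x)) / (lin \<theta>0 x) ^ 3"
  have "norm (llik_D2 \<theta>0 h h' Z - llik_D2 \<theta>0 h h' ?z) \<le> B * norm (Z - ?z)"
  proof (rule field_differentiable_bound[of ?S "llik_D2 \<theta>0 h h'" ?D])
    fix x assume x: "x \<in> ?S"
    note pos = bw(1)[OF x x]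
    have "((\<lambda>x. integral {0..x} ?f) has_real_derivative ?f x) (at x within {0..max Z ?z})"
      by (rule integral_has_real_derivative[OF cont]) (use x xS(1)[OF x] in auto)
    then have I: "((\<lambda>x. integral {0..x} ?f) has_real_derivative ?f x) (at x within ?S)"
      by (rule DERIV_subset) (use Z z in auto)
    have num: "((\<lambda>x. lin h x * lin h' x) has_real_derivative (h $ 1 * lin h' x + lin h x * h' $ 1)) (at x within ?S)"
      using DERIV_mult[OF lin_has_derivative[of h x ?S] lin_has_derivative[of h' x ?S]] by (simp add: algebra_simps)
    have den: "((\<lambda>x. (lin \<theta>0 x)\<^sup>2) has_real_derivative 2 * lin \<theta>0 x * \<gamma>) (at x within ?S)"
      using DERIV_power[OF lin_has_derivative[of \<theta>0 x ?S], of 2] by (simp add: mult_ac)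
    have "((\<lambda>x. lin h x * lin h' x / (lin \<theta>0 x)\<^sup>2) has_real_derivative
        ((h $ 1 * lin h' x + lin h x * h' $ 1) * (lin \<theta>0 x)\<^sup>2 - lin h x * lin h' x * (2 * lin \<theta>0 x * \<gamma>)) /
         ((lin \<theta>0 x)\<^sup>2 * (lin \<theta>0 x)\<^sup>2)) (at x within ?S)"
      by (rule DERIV_divide[OF num den]) (use pos in simp)
    from DERIV_diff[OF this DERIV_cmult[OF I, of 2]]
    have "(llik_D2 \<theta>0 h h' has_field_derivative
        ((h $ 1 * lin h' x + lin h x * h' $ 1) * (lin \<theta>0 x)\<^sup>2 - lin h x * lin h' x * (2 * lin \<theta>0 x * \<gamma>)) /
         ((lin \<theta>0 x)\<^sup>2 * (lin \<theta>0 x)\<^sup>2) - 2 * ?f x) (at x within ?S)"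
      unfolding llik_D2_def[abs_def] by simp
    also have "((h $ 1 * lin h' x + lin h x * h' $ 1) * (lin \<theta>0 x)\<^sup>2 - lin h x * lin h' x * (2 * lin \<theta>0 x * \<gamma>)) /
         ((lin \<theta>0 x)\<^sup>2 * (lin \<theta>0 x)\<^sup>2) - 2 * ?f x = ?D x"
      using pos by (simp add: field_simps power2_eq_square power3_eq_cube)
    finally show "(llik_D2 \<theta>0 h h' has_field_derivative ?D x) (at x within ?S)" .
    have x0: "0 \<le> x" by (rule xS(1)[OF x])
    have q: "\<bar>lin h x\<bar> \<le> (1 + x) * norm h" "\<bar>lin h' x\<bar> \<le> (1 + x) * norm h'"
      by (rule abs_lin_le[OF x0])+
    have qq: "\<bar>lin h x * lin h' x\<bar> \<le> (1 + x)\<^sup>2 * (norm h * norm h')" by (rule abs_lin_mult_le[OF x0])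
    have c1: "\<bar>h $ 1 * lin h' x\<bar> \<le> (1 + x) * (norm h * norm h')"
    proof -
      have "\<bar>h $ 1\<bar> * \<bar>lin h' x\<bar> \<le> norm h * ((1 + x) * norm h')"
        by (intro mult_mono component_le_norm_cart q) auto
      then show ?thesis by (simp add: abs_mult mult_ac)
    qed
    have c2: "\<bar>lin h x * h' $ 1\<bar> \<le> (1 + x) * (norm h * norm h')"
    proof -
      have "\<bar>lin h x\<bar> * \<bar>h' $ 1\<bar> \<le> ((1 + x) * norm h) * norm h'"
        using x0 by (intro mult_mono component_le_norm_cart q) auto
      then show ?thesis by (simp add: abs_mult mult_ac)
    qed
    have "\<bar>(h $ 1 * lin h' x + lin h x * h' $ 1) * lin \<theta>0 x\<bar> \<le> (2 * ((1 + x) * (norm h * norm h'))) * ((1 + \<bar>\<gamma>\<bar>) * (1 + x))"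
      unfolding abs_mult[of "_ + _"] using c1 c2 abs_lin_\<theta>0_le[OF x0] x0
      by (intro mult_mono) (auto intro: order_trans[OF abs_triangle_ineq])
    moreover have "\<bar>2 * \<gamma> * (lin h x * lin h' x)\<bar> \<le> 2 * \<bar>\<gamma>\<bar> * ((1 + x)\<^sup>2 * (norm h * norm h'))"
      using mult_left_mono[OF qq, of "2 * \<bar>\<gamma>\<bar>"] by (simp add: abs_mult mult.assoc)
    moreover have "\<bar>2 * (lin h x * lin h' x)\<bar> \<le> 2 * ((1 + x)\<^sup>2 * (norm h * norm h'))"
      using qq by (simp add: abs_mult)
    ultimately have "\<bar>(h $ 1 * lin h' x + lin h x * h' $ 1) * lin \<theta>0 x - 2 * \<gamma> * (lin h x * lin h' x) - 2 * (lin h x * lin h' x)\<bar>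
       \<le> (2 * ((1 + x) * (norm h * norm h'))) * ((1 + \<bar>\<gamma>\<bar>) * (1 + x)) + 2 * \<bar>\<gamma>\<bar> * ((1 + x)\<^sup>2 * (norm h * norm h'))
         + 2 * ((1 + x)\<^sup>2 * (norm h * norm h'))"
      by linarith
    also have "\<dots> = 4 * (1 + \<bar>\<gamma>\<bar>) * (norm h * norm h') * (1 + x)\<^sup>2"
      by (simp add: algebra_simps power2_eq_square)
    finally have "norm (?D x) \<le> 4 * (1 + \<bar>\<gamma>\<bar>) * (norm h * norm h') * (1 + x)\<^sup>2 / (lin \<theta>0 x) ^ 3"
      using pos by (simp add: divide_right_mono)
    also have "\<dots> = 4 * (1 + \<bar>\<gamma>\<bar>) * (norm h * norm h') * ((1 + x)\<^sup>2 / (lin \<theta>0 x) ^ 3)" by simp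
    also have "\<dots> \<le> 4 * (1 + \<bar>\<gamma>\<bar>) * (norm h * norm h') * (32 * K0\<^sup>2 * u powr (- (2 * \<beta>)) * u powr \<gamma>)"
      by (intro mult_left_mono bw(3)[OF x x]) auto
    also have "\<dots> = B" by (simp add: B_def mult_ac)
    finally show "norm (?D x) \<le> B" .
  qed auto
  also have "B * norm (Z - ?z) \<le> B * (e * u powr (- \<gamma>))"
    using close by (intro mult_left_mono) (auto simp: B_def)
  also have "\<dots> = 128 * (1 + \<bar>\<gamma>\<bar>) * K0\<^sup>2 * (norm h * norm h') * (e * (u powr (- (2 * \<beta>)) * (u powr \<gamma> * u powr (- \<gamma>))))"
    by (simp add: B_def mult_ac)
  also have "u powr (- (2 * \<beta>)) * (u powr \<gamma> * u powr (- \<gamma>)) = u powr (- (2 * \<beta>))"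
    using u by (simp add: powr_add[symmetric])
  finally show ?thesis by (simp add: hess_fun_def)
qed

text \<open>An envelope for the integral in \<open>llik_D2\<close> that does not depend on the directions.\<close>

definition env :: "real \<Rightarrow> real" where
  "env Z = integral {0..Z} (\<lambda>r. (1 + r)\<^sup>2 / (lin \<theta>0 r) ^ 3)"

definition K1 :: real where "K1 = K0\<^sup>2 * (1 / \<beta> + 32)"

lemma K1_pos: "K1 > 0"
  using K0(1) beta_pos unfolding K1_def by (intro mult_pos_pos add_pos_pos zero_less_power) auto

lemma env_bound:
  assumes u: "0 < u" "u \<le> 1" and Z: "0 \<le> Z" and e: "0 \<le> e" "e \<le> \<eta>0"
    and close: "\<bar>Z - zf u\<bar> \<le> e * u powr (- \<gamma>)"
  shows "env Z \<le> K1 * u powr (- (2 * \<beta>))"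
proof -
  let ?z = "zf u" and ?h = "vector [1, 1] :: real^2"
  let ?f = "f2 ?h ?h"
  have lin1: "lin ?h r = 1 + r" for r by (simp add: lin_def)
  have env: "env x = integral {0..x} ?f" for x
    unfolding env_def by (rule integral_cong) (simp add: f2_def lin1 power2_eq_square)
  have nrm: "norm ?h * norm ?h = 2"
    by (simp add: norm_vec_def L2_set_def sum_2)
  have z: "0 \<le> ?z" by (rule zf_nonneg[OF u])
  have "\<bar>integral {0..?z} ?f\<bar> \<le> K0\<^sup>2 * (norm ?h * norm ?h) / (2 * \<beta>) * (u powr (- (2 * \<beta>)) - 1)"
    by (rule tail_integral_bound[OF f2_cont beta_pos(3) f2_bound u])
  also have "\<dots> \<le> K0\<^sup>2 / \<beta> * u powr (- (2 * \<beta>))"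
    unfolding nrm using beta_pos by (simp add: mult_left_mono divide_right_mono)
  finally have 1: "env ?z \<le> K0\<^sup>2 / \<beta> * u powr (- (2 * \<beta>))" by (simp add: env)
  have xS: "0 \<le> x" "\<bar>x - ?z\<bar> \<le> e * u powr (- \<gamma>)" if "min Z ?z \<le> x" "x \<le> max Z ?z" for x
    using that Z z segment_between[OF _ close, of x] by auto
  note bw = between_weights[OF u e xS(2) xS(1)]
  have "\<bar>integral {0..Z} ?f - integral {0..?z} ?f\<bar> \<le> (32 * K0\<^sup>2 * u powr (- (2 * \<beta>)) * u powr \<gamma>) * \<bar>Z - ?z\<bar>"
  proof (rule integral_end_point_diff)
    have "lin \<theta>0 (max Z ?z) > 0" by (rule bw(1)) auto
    then show "continuous_on {0..max Z ?z} ?f"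
      unfolding f2_def by (intro continuous_on_ratio) auto
    fix r assume r: "min Z ?z \<le> r" "r \<le> max Z ?z"
    have "?f r = (1 + r)\<^sup>2 / (lin \<theta>0 r) ^ 3" by (simp add: f2_def lin1 power2_eq_square)
    moreover have "0 \<le> (1 + r)\<^sup>2 / (lin \<theta>0 r) ^ 3" using bw(1)[OF r r] by simp
    ultimately show "\<bar>?f r\<bar> \<le> 32 * K0\<^sup>2 * u powr (- (2 * \<beta>)) * u powr \<gamma>"
      using bw(3)[OF r r] by simp
  qed (use Z z in auto)
  also have "\<dots> \<le> (32 * K0\<^sup>2 * u powr (- (2 * \<beta>)) * u powr \<gamma>) * (1 * u powr (- \<gamma>))"
    using e eta0 by (intro mult_left_mono order_trans[OF close] mult_right_mono) auto
  also have "\<dots> = 32 * K0\<^sup>2 * (u powr (- (2 * \<beta>)) * (u powr \<gamma> * u powr (- \<gamma>)))" by (simp add: mult_ac)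
  also have "u powr (- (2 * \<beta>)) * (u powr \<gamma> * u powr (- \<gamma>)) = u powr (- (2 * \<beta>))"
    using u by (simp add: powr_add[symmetric])
  finally have "env Z \<le> env ?z + 32 * K0\<^sup>2 * u powr (- (2 * \<beta>))" by (simp add: env)
  with 1 show ?thesis by (simp add: K1_def algebra_simps)
qed

definition K2 :: real where "K2 = 608 * K0\<^sup>2 + 76 * K1 + 128 * (1 + \<bar>\<gamma>\<bar>) * K0\<^sup>2"

lemma K2_pos: "K2 > 0"
  using K0 K1_pos by (simp add: K2_def add_nonneg_pos add_pos_nonneg)

text \<open>A change \<open>\<Delta>\<close> of the parameter changes the denominator at an observation that belongs to \<open>u\<close> by
the relative amount \<open>\<bar>lin \<Delta> Z\<bar> / lin \<theta>0 Z \<le> 4 * norm \<Delta> * wt u\<close>.\<close>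

definition wt :: "real \<Rightarrow> real" where "wt u = (1 + zf u) * u powr \<gamma>"

text \<open>The comparison is multiplicative: it suffices that \<open>lin \<theta>\<close> and \<open>lin \<theta>0\<close> agree up to a factor
  \<open>1 \<plusminus> e\<close> on \<open>{0..Z}\<close>, and since both are affine this need only be checked at the two end points.\<close>

lemma hess_close:
  assumes u: "0 < u" "u \<le> 1" and Z: "0 \<le> Z" and e: "0 \<le> e" "e \<le> \<eta>0"
    and close: "\<bar>Z - zf u\<bar> \<le> e * u powr (- \<gamma>)"
    and t: "norm (\<theta> - \<theta>0) \<le> e" "4 * norm (\<theta> - \<theta>0) * wt u \<le> e"
  shows "\<theta> $ 2 > 0" "lin \<theta> Z > 0"
    "\<bar>llik_D2 \<theta> h h' Z - hess_fun h h' u\<bar> \<le> K2 * (norm h * norm h') * (e * u powr (- (2 * \<beta>)))"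
proof -
  let ?\<Delta> = "\<theta> - \<theta>0"
  note bw = between_weights[OF u e close Z]
  have e12: "e \<le> 1/2" using e eta0 by linarith
  have d0: "\<bar>lin ?\<Delta> 0\<bar> \<le> e" using abs_lin_le[of 0 ?\<Delta>] t by simp
  have dZ: "\<bar>lin ?\<Delta> Z\<bar> \<le> e * lin \<theta>0 Z"
  proof -
    have "\<bar>lin ?\<Delta> Z\<bar> \<le> (1 + Z) * norm ?\<Delta>" by (rule abs_lin_le[OF Z])
    also have "\<dots> \<le> 2 * (1 + zf u) * norm ?\<Delta>"
      by (intro mult_right_mono between_bounds(2)[OF u e close]) auto
    also have "\<dots> = (4 * norm ?\<Delta> * wt u) * (u powr (- \<gamma>) / 2)"
    proof -
      have "u powr \<gamma> * u powr (- \<gamma>) = 1" using u by (simp add: powr_add[symmetric])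
      moreover have "(4 * norm ?\<Delta> * wt u) * (u powr (- \<gamma>) / 2) = 2 * (1 + zf u) * norm ?\<Delta> * (u powr \<gamma> * u powr (- \<gamma>))"
        by (simp add: wt_def algebra_simps)
      ultimately show ?thesis by (metis mult.right_neutral)
    qed
    also have "\<dots> \<le> e * lin \<theta>0 Z"
      using between_bounds(1)[OF u e close] t e by (intro mult_mono) auto
    finally show ?thesis .
  qed
  have rel: "\<bar>lin \<theta> r - lin \<theta>0 r\<bar> \<le> e * lin \<theta>0 r" if r: "0 \<le> r" "r \<le> Z" for r
  proof -
    have "lin (e *\<^sub>R \<theta>0 + s *\<^sub>R ?\<Delta>) r \<ge> 0" if s: "\<bar>s\<bar> = 1" for s
    proof (rule lin_nonneg_between[OF _ _ r])
      have "\<bar>s * lin ?\<Delta> x\<bar> = \<bar>lin ?\<Delta> x\<bar>" for x using s by (simp add: abs_mult)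
      from this[of 0] this[of Z] have "\<bar>s * lin ?\<Delta> 0\<bar> \<le> e" "\<bar>s * lin ?\<Delta> Z\<bar> \<le> e * lin \<theta>0 Z"
        using d0 dZ by linarith+
      then show "(e *\<^sub>R \<theta>0 + s *\<^sub>R ?\<Delta>) $ 2 \<ge> 0" "lin (e *\<^sub>R \<theta>0 + s *\<^sub>R ?\<Delta>) Z \<ge> 0"
        unfolding lin_add_scaleR by (auto simp: lin_def abs_le_iff algebra_simps)
    qed
    from this[of 1] this[of "-1"] show ?thesis
      by (auto simp: lin_def abs_le_iff algebra_simps)
  qed
  have pos0: "lin \<theta>0 r > 0" if "0 \<le> r" "r \<le> Z" for r
    using lin_pos_between[of \<theta>0 Z r] bw(1) that by simp
  have pos: "lin \<theta> r > 0" if "0 \<le> r" "r \<le> Z" for r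
  proof -
    have "e * lin \<theta>0 r \<le> 1/2 * lin \<theta>0 r" using e12 pos0[OF that] by (intro mult_right_mono) auto
    then show ?thesis using rel[OF that] pos0[OF that] by linarith
  qed
  show \<theta>2: "\<theta> $ 2 > 0" using pos[of 0] Z by simp
  show \<theta>Z: "lin \<theta> Z > 0" using pos[of Z] Z by simp
  have ratio: "\<bar>1 / (lin \<theta> r)\<^sup>2 - 1 / (lin \<theta>0 r)\<^sup>2\<bar> \<le> 38 * e / (lin \<theta>0 r)\<^sup>2"
    "\<bar>1 / (lin \<theta> r) ^ 3 - 1 / (lin \<theta>0 r) ^ 3\<bar> \<le> 38 * e / (lin \<theta>0 r) ^ 3" if r: "0 \<le> r" "r \<le> Z" for r
  proof -
    define x where "x = lin \<theta> r / lin \<theta>0 r"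
    have W: "lin \<theta>0 r > 0" by (rule pos0[OF r])
    have "\<bar>x - 1\<bar> = \<bar>lin \<theta> r - lin \<theta>0 r\<bar> / lin \<theta>0 r" using W by (simp add: x_def field_simps abs_if split: if_splits)
    also have "\<dots> \<le> e" using rel[OF r] W by (simp add: pos_divide_le_eq)
    finally have x: "\<bar>x - 1\<bar> \<le> e" .
    have lx: "lin \<theta> r = x * lin \<theta>0 r" using W by (simp add: x_def)
    have "1 / (lin \<theta> r)\<^sup>2 - 1 / (lin \<theta>0 r)\<^sup>2 = (1 / x\<^sup>2 - 1) / (lin \<theta>0 r)\<^sup>2"
      "1 / (lin \<theta> r) ^ 3 - 1 / (lin \<theta>0 r) ^ 3 = (1 / x ^ 3 - 1) / (lin \<theta>0 r) ^ 3"
      by (simp_all add: lx power_mult_distrib diff_divide_distrib)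
    then show "\<bar>1 / (lin \<theta> r)\<^sup>2 - 1 / (lin \<theta>0 r)\<^sup>2\<bar> \<le> 38 * e / (lin \<theta>0 r)\<^sup>2"
      "\<bar>1 / (lin \<theta> r) ^ 3 - 1 / (lin \<theta>0 r) ^ 3\<bar> \<le> 38 * e / (lin \<theta>0 r) ^ 3"
      using inverse_power_close[OF x e12] W by (simp_all add: abs_divide divide_right_mono)
  qed
  let ?q = "\<lambda>r. lin h r * lin h' r" and ?n = "norm h * norm h'"
  have T1: "\<bar>?q Z / (lin \<theta> Z)\<^sup>2 - ?q Z / (lin \<theta>0 Z)\<^sup>2\<bar> \<le> 608 * K0\<^sup>2 * ?n * (e * u powr (- (2 * \<beta>)))"
  proof -
    have "?q Z / (lin \<theta> Z)\<^sup>2 - ?q Z / (lin \<theta>0 Z)\<^sup>2 = ?q Z * (1 / (lin \<theta> Z)\<^sup>2 - 1 / (lin \<theta>0 Z)\<^sup>2)"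
      by (simp add: right_diff_distrib)
    then have "\<bar>?q Z / (lin \<theta> Z)\<^sup>2 - ?q Z / (lin \<theta>0 Z)\<^sup>2\<bar> = \<bar>?q Z\<bar> * \<bar>1 / (lin \<theta> Z)\<^sup>2 - 1 / (lin \<theta>0 Z)\<^sup>2\<bar>"
      by (simp only: abs_mult)
    also have "\<dots> \<le> ((1 + Z)\<^sup>2 * ?n) * (38 * e / (lin \<theta>0 Z)\<^sup>2)"
      using Z by (intro mult_mono abs_lin_mult_le ratio) auto
    also have "\<dots> = 38 * e * ?n * ((1 + Z)\<^sup>2 / (lin \<theta>0 Z)\<^sup>2)" by simp
    also have "\<dots> \<le> 38 * e * ?n * (16 * K0\<^sup>2 * u powr (- (2 * \<beta>)))"
      using e by (intro mult_left_mono bw(2)) auto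
    finally show ?thesis by (simp add: mult_ac)
  qed
  have T2: "\<bar>integral {0..Z} (\<lambda>r. ?q r / (lin \<theta> r) ^ 3) - integral {0..Z} (\<lambda>r. ?q r / (lin \<theta>0 r) ^ 3)\<bar>
      \<le> 38 * K1 * ?n * (e * u powr (- (2 * \<beta>)))"
  proof -
    have i1: "(\<lambda>r. ?q r / (lin \<theta> r) ^ 3) integrable_on {0..Z}"
      by (intro integrable_continuous_real continuous_on_ratio \<theta>2 \<theta>Z)
    have i2: "(\<lambda>r. ?q r / (lin \<theta>0 r) ^ 3) integrable_on {0..Z}"
      by (intro integrable_continuous_real continuous_on_ratio bw(1)) simp
    have "continuous_on {0..Z} (\<lambda>r. (1 + r)\<^sup>2 / (lin \<theta>0 r) ^ 3)"
      using pos0 by (intro continuous_intros) (auto simp: less_imp_neq[symmetric])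
    then have i3: "(\<lambda>r. (1 + r)\<^sup>2 / (lin \<theta>0 r) ^ 3) integrable_on {0..Z}" by (rule integrable_continuous_real)
    have "norm (integral {0..Z} (\<lambda>r. ?q r / (lin \<theta> r) ^ 3 - ?q r / (lin \<theta>0 r) ^ 3)) \<le>
        integral {0..Z} (\<lambda>r. 38 * e * ?n * ((1 + r)\<^sup>2 / (lin \<theta>0 r) ^ 3))"
    proof (rule integral_norm_bound_integral)
      show "(\<lambda>r. ?q r / (lin \<theta> r) ^ 3 - ?q r / (lin \<theta>0 r) ^ 3) integrable_on {0..Z}"
        by (rule integrable_diff[OF i1 i2])
      show "(\<lambda>r. 38 * e * ?n * ((1 + r)\<^sup>2 / (lin \<theta>0 r) ^ 3)) integrable_on {0..Z}"
        using integrable_on_mult_right[OF i3, of "38 * e * ?n"] by simp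
      fix r assume r: "r \<in> {0..Z}"
      have "?q r / (lin \<theta> r) ^ 3 - ?q r / (lin \<theta>0 r) ^ 3 = ?q r * (1 / (lin \<theta> r) ^ 3 - 1 / (lin \<theta>0 r) ^ 3)"
        by (simp add: right_diff_distrib)
      then have "norm (?q r / (lin \<theta> r) ^ 3 - ?q r / (lin \<theta>0 r) ^ 3) = \<bar>?q r\<bar> * \<bar>1 / (lin \<theta> r) ^ 3 - 1 / (lin \<theta>0 r) ^ 3\<bar>"
        by (simp only: real_norm_def abs_mult)
      also have "\<dots> \<le> ((1 + r)\<^sup>2 * ?n) * (38 * e / (lin \<theta>0 r) ^ 3)"
        using r by (intro mult_mono abs_lin_mult_le ratio) auto
      finally show "norm (?q r / (lin \<theta> r) ^ 3 - ?q r / (lin \<theta>0 r) ^ 3) \<le> 38 * e * ?n * ((1 + r)\<^sup>2 / (lin \<theta>0 r) ^ 3)"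
        by (simp add: mult_ac)
    qed
    also have "\<dots> = 38 * e * ?n * env Z" unfolding env_def by (rule integral_mult_right)
    also have "\<dots> \<le> 38 * e * ?n * (K1 * u powr (- (2 * \<beta>)))"
      using e by (intro mult_left_mono env_bound[OF u Z e close]) auto
    finally show ?thesis
      unfolding integral_diff[OF i1 i2] by (simp add: mult_ac)
  qed
  have tri: "\<bar>x\<bar> \<le> \<bar>a\<bar> + 2 * \<bar>b\<bar>" if "x = a - 2 * b" for x a b :: real
    using that by linarith
  have tri': "\<bar>x - z\<bar> \<le> a + b" if "\<bar>x - y\<bar> \<le> a" "\<bar>y - z\<bar> \<le> b" for x y z a b :: real
    using that by linarith
  have "llik_D2 \<theta> h h' Z - llik_D2 \<theta>0 h h' Z = (?q Z / (lin \<theta> Z)\<^sup>2 - ?q Z / (lin \<theta>0 Z)\<^sup>2)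
      - 2 * (integral {0..Z} (\<lambda>r. ?q r / (lin \<theta> r) ^ 3) - integral {0..Z} (\<lambda>r. ?q r / (lin \<theta>0 r) ^ 3))"
    by (simp add: llik_D2_def)
  then have "\<bar>llik_D2 \<theta> h h' Z - llik_D2 \<theta>0 h h' Z\<bar> \<le> \<bar>?q Z / (lin \<theta> Z)\<^sup>2 - ?q Z / (lin \<theta>0 Z)\<^sup>2\<bar>
      + 2 * \<bar>integral {0..Z} (\<lambda>r. ?q r / (lin \<theta> r) ^ 3) - integral {0..Z} (\<lambda>r. ?q r / (lin \<theta>0 r) ^ 3)\<bar>"
    by (rule tri)
  also have "\<dots> \<le> 608 * K0\<^sup>2 * ?n * (e * u powr (- (2 * \<beta>))) + 2 * (38 * K1 * ?n * (e * u powr (- (2 * \<beta>))))"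
    by (intro add_mono T1 mult_left_mono T2) simp
  finally have "\<bar>llik_D2 \<theta> h h' Z - llik_D2 \<theta>0 h h' Z\<bar> \<le> 608 * K0\<^sup>2 * ?n * (e * u powr (- (2 * \<beta>))) + 2 * (38 * K1 * ?n * (e * u powr (- (2 * \<beta>))))" .
  moreover have "\<bar>llik_D2 \<theta>0 h h' Z - hess_fun h h' u\<bar> \<le> 128 * (1 + \<bar>\<gamma>\<bar>) * K0\<^sup>2 * ?n * (e * u powr (- (2 * \<beta>)))"
    by (rule hess_close_obs[OF u Z e close])
  ultimately have "\<bar>llik_D2 \<theta> h h' Z - hess_fun h h' u\<bar> \<le> 608 * K0\<^sup>2 * ?n * (e * u powr (- (2 * \<beta>)))
      + 2 * (38 * K1 * ?n * (e * u powr (- (2 * \<beta>)))) + 128 * (1 + \<bar>\<gamma>\<bar>) * K0\<^sup>2 * ?n * (e * u powr (- (2 * \<beta>)))"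
    by (rule tri')
  also have "\<dots> = K2 * ?n * (e * u powr (- (2 * \<beta>)))"
    by (simp add: K2_def algebra_simps)
  finally show "\<bar>llik_D2 \<theta> h h' Z - hess_fun h h' u\<bar> \<le> K2 * ?n * (e * u powr (- (2 * \<beta>)))" .
qed

text \<open>Away from \<open>\<theta>0\<close> no comparison with the limit is available for the largest excesses, but there
the Hessian is still bounded above by an integrable function of \<open>u\<close>. For \<open>\<gamma> > 0\<close> the quotient
\<open>lin h / lin \<theta>\<close> is bounded; otherwise \<open>llik_D2_upper\<close> applies, and \<open>zf u\<close> grows more slowly than
any negative power of \<open>u\<close>, so that its cube is still \<open>O (u powr (- 1 / 2))\<close>.\<close>

lemma hess_upper:
  obtains K \<epsilon> where "K > 0" "\<epsilon> > 0"
    "\<And>u Z e \<theta> h. 0 < u \<Longrightarrow> u \<le> 1 \<Longrightarrow> 0 \<le> Z \<Longrightarrow> 0 \<le> e \<Longrightarrow> e \<le> \<eta>0 \<Longrightarrow> \<bar>Z - zf u\<bar> \<le> e * u powr (- \<gamma>) \<Longrightarrow>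
      \<theta> \<in> theta_ball \<theta>0 \<epsilon> \<Longrightarrow> lin \<theta> Z > 0 \<Longrightarrow> llik_D2 \<theta> h h Z \<le> K * (norm h)\<^sup>2 * u powr (- (2 * \<beta>))"
proof (cases "\<gamma> > 0")
  case True
  define m where "m = min (\<gamma> / 2) (1/2)"
  have m: "m > 0" using True by (simp add: m_def)
  show ?thesis
  proof (rule that[of "1 / m\<^sup>2" m])
    fix u Z e :: real and \<theta> h :: "real^2"
    assume u: "0 < u" "u \<le> 1" and Z: "0 \<le> Z" and \<theta>: "\<theta> \<in> theta_ball \<theta>0 m" and pos: "lin \<theta> Z > 0"
    have n: "norm (\<theta> - \<theta>0) < m" using \<theta> by (simp add: theta_ball_def dist_norm norm_minus_commute)
    have "\<bar>(\<theta> - \<theta>0) $ 1\<bar> < m" "\<bar>(\<theta> - \<theta>0) $ 2\<bar> < m"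
      by (rule le_less_trans[OF component_le_norm_cart n])+
    then have "\<bar>\<theta> $ 1 - \<gamma>\<bar> < m" "\<bar>\<theta> $ 2 - 1\<bar> < m" by simp_all
    moreover have "m \<le> \<gamma> / 2" "m \<le> 1/2" by (auto simp: m_def)
    ultimately have c: "\<theta> $ 1 \<ge> m" "\<theta> $ 2 \<ge> m" by linarith+
    have "m * 1 + m * Z \<le> \<theta> $ 2 * 1 + \<theta> $ 1 * Z" using c Z by (intro add_mono mult_right_mono) auto
    then have lZ: "lin \<theta> Z \<ge> m * (1 + Z)" by (simp add: lin_def algebra_simps)
    have s2: "\<theta> $ 2 > 0" using c m by linarith
    have "0 \<le> integral {0..Z} (\<lambda>r. lin h r * lin h r / (lin \<theta> r) ^ 3)"
    proof (rule integral_nonneg)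
      show "(\<lambda>r. lin h r * lin h r / (lin \<theta> r) ^ 3) integrable_on {0..Z}"
        by (intro integrable_continuous_real continuous_on_ratio s2 pos)
      fix r assume "r \<in> {0..Z}"
      then have "lin \<theta> r > 0" using lin_pos_between[OF s2 pos] by auto
      then show "0 \<le> lin h r * lin h r / (lin \<theta> r) ^ 3" by simp
    qed
    then have "llik_D2 \<theta> h h Z \<le> lin h Z * lin h Z / (lin \<theta> Z)\<^sup>2" by (simp add: llik_D2_def)
    also have "\<dots> \<le> ((1 + Z)\<^sup>2 * (norm h * norm h)) / (m * (1 + Z))\<^sup>2"
    proof (rule frac_le)
      show "lin h Z * lin h Z \<le> (1 + Z)\<^sup>2 * (norm h * norm h)"
        using abs_lin_mult_le[OF Z, of h h] by simp
      show "(m * (1 + Z))\<^sup>2 \<le> (lin \<theta> Z)\<^sup>2" using lZ m Z by (intro power_mono) auto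
    qed (use m Z in auto)
    also have "\<dots> = 1 / m\<^sup>2 * (norm h)\<^sup>2 * 1" using Z by (simp add: power_mult_distrib power2_eq_square)
    also have "\<dots> \<le> 1 / m\<^sup>2 * (norm h)\<^sup>2 * u powr (- (2 * \<beta>))"
    proof (rule mult_left_mono)
      have "u powr (2 * \<beta>) \<le> 1" using u beta_pos by (intro powr_le1) auto
      then show "1 \<le> u powr (- (2 * \<beta>))" using u by (simp add: powr_minus_divide)
    qed simp
    finally show "llik_D2 \<theta> h h Z \<le> 1 / m\<^sup>2 * (norm h)\<^sup>2 * u powr (- (2 * \<beta>))" .
  qed (use m in auto)
next
  case False
  obtain C where C: "C > 0" "\<And>x. x \<ge> 1 \<Longrightarrow> box_cox \<gamma> x \<le> C * x powr (1/6)"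
    using box_cox_le_powr[of \<gamma> "1/6"] False by auto
  show ?thesis
  proof (rule that[of "384 * (8 * (1 + C) ^ 3)" "1/2"])
    fix u Z e :: real and \<theta> h :: "real^2"
    assume u: "0 < u" "u \<le> 1" and Z: "0 \<le> Z" and e: "0 \<le> e" "e \<le> \<eta>0"
      and close: "\<bar>Z - zf u\<bar> \<le> e * u powr (- \<gamma>)"
      and \<theta>: "\<theta> \<in> theta_ball \<theta>0 (1/2)" and pos: "lin \<theta> Z > 0"
    have n: "norm (\<theta> - \<theta>0) < 1/2" using \<theta> by (simp add: theta_ball_def dist_norm norm_minus_commute)
    have "\<bar>(\<theta> - \<theta>0) $ 2\<bar> < 1/2" by (rule le_less_trans[OF component_le_norm_cart n])
    then have "\<bar>\<theta> $ 2 - 1\<bar> < 1/2" by simp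
    then have s: "\<theta> $ 2 \<ge> 1/2" by linarith
    have g: "\<theta> $ 1 \<ge> -1/2" using \<theta> by (simp add: theta_ball_def Theta_def)
    have "1 \<le> (1 / u) powr (1/6)" using u by (intro ge_one_powr_ge_zero) auto
    moreover have "zf u \<le> C * (1 / u) powr (1/6)" unfolding zf_def by (rule C) (use u in simp)
    ultimately have "1 + zf u \<le> (1 + C) * (1 / u) powr (1/6)" by (simp add: distrib_right)
    moreover have "1 + Z \<le> 2 * (1 + zf u)" by (rule between_bounds(2)[OF u e close])
    ultimately have "1 + Z \<le> 2 * ((1 + C) * (1 / u) powr (1/6))"
      by (meson order_trans mult_left_mono zero_le_numeral)
    then have "(1 + Z) ^ 3 \<le> (2 * ((1 + C) * (1 / u) powr (1/6))) ^ 3" using Z by (intro power_mono) auto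
    also have "\<dots> = 8 * (1 + C) ^ 3 * ((1 / u) powr (1/6)) ^ 3" by (simp add: power_mult_distrib)
    also have "((1 / u) powr (1/6)) ^ 3 = (1 / u) powr (1/2)"
      by (simp add: power3_eq_cube powr_add[symmetric])
    also have "\<dots> = u powr (- (1/2))" using u by (intro powr_inverse)
    also have "8 * (1 + C) ^ 3 * u powr (- (1/2)) \<le> 8 * (1 + C) ^ 3 * u powr (- (2 * \<beta>))"
      using u beta C by (intro mult_left_mono powr_mono') auto
    finally have Z3: "(1 + Z) ^ 3 \<le> 8 * (1 + C) ^ 3 * u powr (- (2 * \<beta>))" .
    have "llik_D2 \<theta> h h Z \<le> 384 * (1 + Z) ^ 3 * (norm h)\<^sup>2" by (rule llik_D2_upper[OF s g Z pos])
    also have "\<dots> \<le> 384 * (8 * (1 + C) ^ 3 * u powr (- (2 * \<beta>))) * (norm h)\<^sup>2"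
      using Z3 by (intro mult_right_mono mult_left_mono) auto
    finally show "llik_D2 \<theta> h h Z \<le> 384 * (8 * (1 + C) ^ 3) * (norm h)\<^sup>2 * u powr (- (2 * \<beta>))"
      by (simp add: mult_ac)
  qed (use C in auto)
qed

text \<open>For positive shape, \<open>lin \<theta> \<ge> lin \<theta>0 / 2\<close> on the whole half line when \<open>\<theta>\<close> is close to \<open>\<theta>0\<close>, so the
envelope \<open>env\<close> bounds the only negative term.\<close>

lemma hess_lower:
  assumes "\<gamma> > 0"
  obtains K \<epsilon> where "K > 0" "\<epsilon> > 0"
    "\<And>u Z e \<theta> h. 0 < u \<Longrightarrow> u \<le> 1 \<Longrightarrow> 0 \<le> Z \<Longrightarrow> 0 \<le> e \<Longrightarrow> e \<le> \<eta>0 \<Longrightarrow> \<bar>Z - zf u\<bar> \<le> e * u powr (- \<gamma>) \<Longrightarrow>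
      \<theta> \<in> theta_ball \<theta>0 \<epsilon> \<Longrightarrow> \<theta> $ 1 > 0 \<and> lin \<theta> Z > 0 \<and> llik_D2 \<theta> h h Z \<ge> - K * (norm h)\<^sup>2 * u powr (- (2 * \<beta>))"
proof -
  define m where "m = min (\<gamma> / 2) (1/2)"
  have m: "m > 0" using assms by (simp add: m_def)
  show ?thesis
  proof (rule that[of "16 * K1" m])
    fix u Z e :: real and \<theta> h :: "real^2"
    assume u: "0 < u" "u \<le> 1" and Z: "0 \<le> Z" and e: "0 \<le> e" "e \<le> \<eta>0"
      and close: "\<bar>Z - zf u\<bar> \<le> e * u powr (- \<gamma>)" and \<theta>: "\<theta> \<in> theta_ball \<theta>0 m"
    have n: "norm (\<theta> - \<theta>0) < m" using \<theta> by (simp add: theta_ball_def dist_norm norm_minus_commute)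
    have "\<bar>(\<theta> - \<theta>0) $ 1\<bar> < m" "\<bar>(\<theta> - \<theta>0) $ 2\<bar> < m"
      by (rule le_less_trans[OF component_le_norm_cart n])+
    then have "\<bar>\<theta> $ 1 - \<gamma>\<bar> < m" "\<bar>\<theta> $ 2 - 1\<bar> < m" by simp_all
    moreover have "m \<le> \<gamma> / 2" "m \<le> 1/2" by (auto simp: m_def)
    ultimately have c: "\<theta> $ 1 \<ge> \<gamma> / 2" "\<theta> $ 2 \<ge> 1/2" by linarith+
    have lr: "lin \<theta> r \<ge> lin \<theta>0 r / 2" and l0: "lin \<theta>0 r > 0" if "r \<ge> 0" for r
    proof -
      have "\<gamma> / 2 * r \<le> \<theta> $ 1 * r" using c that by (intro mult_right_mono) auto
      then show "lin \<theta> r \<ge> lin \<theta>0 r / 2" using c by (simp add: lin_def add_divide_distrib)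
      show "lin \<theta>0 r > 0" using assms that by (simp add: lin_\<theta>0 add_pos_nonneg)
    qed
    have pos: "lin \<theta> r > 0" if "r \<ge> 0" for r using lr[OF that] l0[OF that] by linarith
    have s2: "\<theta> $ 2 > 0" using c by linarith
    have "continuous_on {0..Z} (\<lambda>r. (1 + r)\<^sup>2 / (lin \<theta>0 r) ^ 3)"
      using l0 by (intro continuous_intros) (auto simp: less_imp_neq[symmetric])
    then have i3: "(\<lambda>r. (1 + r)\<^sup>2 / (lin \<theta>0 r) ^ 3) integrable_on {0..Z}" by (rule integrable_continuous_real)
    have "integral {0..Z} (\<lambda>r. lin h r * lin h r / (lin \<theta> r) ^ 3) \<le> integral {0..Z} (\<lambda>r. 8 * (norm h)\<^sup>2 * ((1 + r)\<^sup>2 / (lin \<theta>0 r) ^ 3))"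
    proof (rule integral_le)
      show "(\<lambda>r. lin h r * lin h r / (lin \<theta> r) ^ 3) integrable_on {0..Z}"
        using pos[OF Z] by (intro integrable_continuous_real continuous_on_ratio s2)
      show "(\<lambda>r. 8 * (norm h)\<^sup>2 * ((1 + r)\<^sup>2 / (lin \<theta>0 r) ^ 3)) integrable_on {0..Z}"
        using integrable_on_mult_right[OF i3, of "8 * (norm h)\<^sup>2"] by simp
      fix r assume r: "r \<in> {0..Z}"
      have "lin h r * lin h r / (lin \<theta> r) ^ 3 \<le> ((1 + r)\<^sup>2 * (norm h * norm h)) / (lin \<theta>0 r / 2) ^ 3"
      proof (rule frac_le)
        show "lin h r * lin h r \<le> (1 + r)\<^sup>2 * (norm h * norm h)"
          using abs_lin_mult_le[of r h h] r by simp
        show "(lin \<theta>0 r / 2) ^ 3 \<le> (lin \<theta> r) ^ 3" using lr[of r] l0[of r] r by (intro power_mono) auto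
      qed (use l0[of r] r in auto)
      also have "\<dots> = 8 * (norm h)\<^sup>2 * ((1 + r)\<^sup>2 / (lin \<theta>0 r) ^ 3)"
        by (simp add: power_divide power2_eq_square)
      finally show "lin h r * lin h r / (lin \<theta> r) ^ 3 \<le> 8 * (norm h)\<^sup>2 * ((1 + r)\<^sup>2 / (lin \<theta>0 r) ^ 3)" .
    qed
    also have "\<dots> = 8 * (norm h)\<^sup>2 * env Z" unfolding env_def by (rule integral_mult_right)
    also have "\<dots> \<le> 8 * (norm h)\<^sup>2 * (K1 * u powr (- (2 * \<beta>)))"
      by (intro mult_left_mono env_bound[OF u Z e close]) auto
    finally have I: "integral {0..Z} (\<lambda>r. lin h r * lin h r / (lin \<theta> r) ^ 3) \<le> 8 * (norm h)\<^sup>2 * (K1 * u powr (- (2 * \<beta>)))" .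
    have "0 \<le> lin h Z * lin h Z / (lin \<theta> Z)\<^sup>2" by simp
    then have "llik_D2 \<theta> h h Z \<ge> - 2 * (8 * (norm h)\<^sup>2 * (K1 * u powr (- (2 * \<beta>))))"
      unfolding llik_D2_def using I by linarith
    then have "llik_D2 \<theta> h h Z \<ge> - (16 * K1) * (norm h)\<^sup>2 * u powr (- (2 * \<beta>))" by (simp add: mult_ac)
    moreover have "\<theta> $ 1 > 0" using c assms by linarith
    ultimately show "\<theta> $ 1 > 0 \<and> lin \<theta> Z > 0 \<and> llik_D2 \<theta> h h Z \<ge> - (16 * K1) * (norm h)\<^sup>2 * u powr (- (2 * \<beta>))"
      using pos[OF Z] by simp
  qed (use m K1_pos in auto)
qed

end

section \<open>Good samples\<close>

lemma llik_D2_expand: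
  assumes "\<theta> $ 2 > 0" "lin \<theta> z > 0"
  shows "llik_D2 \<theta> h h z = (h $ 1)\<^sup>2 * llik_D2 \<theta> (axis 1 1) (axis 1 1) z
    + 2 * h $ 1 * h $ 2 * llik_D2 \<theta> (axis 1 1) (axis 2 1) z + (h $ 2)\<^sup>2 * llik_D2 \<theta> (axis 2 1) (axis 2 1) z"
proof -
  let ?f = "\<lambda>h h' r. lin h r * lin h' r / (lin \<theta> r) ^ 3"
  have l: "lin h r = h $ 1 * lin (axis 1 1) r + h $ 2 * lin (axis 2 1) r" for r
    by (simp add: lin_def axis_def)
  have e: "lin h r * lin h r / w = (h $ 1)\<^sup>2 * (lin (axis 1 1) r * lin (axis 1 1) r / w)
      + 2 * h $ 1 * h $ 2 * (lin (axis 1 1) r * lin (axis 2 1) r / w) + (h $ 2)\<^sup>2 * (lin (axis 2 1) r * lin (axis 2 1) r / w)" for r w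
    unfolding l[of r] by (simp add: algebra_simps power2_eq_square add_divide_distrib)
  have int: "?f a b integrable_on {0..z}" for a b
    by (intro integrable_continuous_real continuous_on_ratio assms)
  have "integral {0..z} (?f h h) = integral {0..z} (\<lambda>r. (h $ 1)\<^sup>2 * ?f (axis 1 1) (axis 1 1) r
      + 2 * h $ 1 * h $ 2 * ?f (axis 1 1) (axis 2 1) r + (h $ 2)\<^sup>2 * ?f (axis 2 1) (axis 2 1) r)"
    by (rule integral_cong) (rule e)
  also have "\<dots> = (h $ 1)\<^sup>2 * integral {0..z} (?f (axis 1 1) (axis 1 1))
      + 2 * h $ 1 * h $ 2 * integral {0..z} (?f (axis 1 1) (axis 2 1)) + (h $ 2)\<^sup>2 * integral {0..z} (?f (axis 2 1) (axis 2 1))"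
    by (rule integral_unique, intro has_integral_add has_integral_mult_right integrable_integral int)
  finally show ?thesis unfolding llik_D2_def e by (simp add: algebra_simps)
qed

lemma abs_quadratic_le:
  fixes h :: "real^2"
  assumes "\<bar>a\<bar> \<le> d" "\<bar>b\<bar> \<le> d" "\<bar>c\<bar> \<le> d"
  shows "\<bar>(h $ 1)\<^sup>2 * a + 2 * h $ 1 * h $ 2 * b + (h $ 2)\<^sup>2 * c\<bar> \<le> 4 * d * (norm h)\<^sup>2"
proof -
  have n: "\<bar>h $ 1\<bar> \<le> norm h" "\<bar>h $ 2\<bar> \<le> norm h" by (rule component_le_norm_cart)+
  have "\<bar>(h $ 1)\<^sup>2 * a\<bar> \<le> (norm h)\<^sup>2 * d" "\<bar>(h $ 2)\<^sup>2 * c\<bar> \<le> (norm h)\<^sup>2 * d"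
    unfolding abs_mult using assms n by (intro mult_mono; simp add: abs_le_square_iff[symmetric])+
  moreover have "\<bar>2 * h $ 1 * h $ 2 * b\<bar> \<le> 2 * norm h * norm h * d"
    unfolding abs_mult using assms n by (intro mult_mono) auto
  ultimately show ?thesis by (simp add: power2_eq_square algebra_simps)
qed

lemma norm_matrix22_le:
  fixes M :: "real^2^2"
  shows "norm M \<le> (\<Sum>i\<in>UNIV. \<Sum>j\<in>UNIV. \<bar>M $ i $ j\<bar>)"
proof -
  have "norm M \<le> (\<Sum>i\<in>UNIV. norm (M $ i))"
    unfolding norm_vec_def by (rule L2_set_le_sum) simp
  also have "\<dots> \<le> (\<Sum>i\<in>UNIV. \<Sum>j\<in>UNIV. \<bar>M $ i $ j\<bar>)"
    by (intro sum_mono norm_le_l1_cart)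
  finally show ?thesis .
qed

lemma convex_theta_ball: "convex (theta_ball \<theta> \<epsilon>)"
proof -
  have "Theta = {\<theta>. (axis 1 1) \<bullet> \<theta> > - 1 / 2} \<inter> {\<theta>. (axis 2 1 :: real^2) \<bullet> \<theta> > 0}"
    by (auto simp: Theta_def inner_axis')
  then have "convex Theta"
    by (metis convex_Int convex_halfspace_gt)
  then show ?thesis unfolding theta_ball_def by (intro convex_Int convex_ball)
qed

lemma theta_ballD: "\<theta> \<in> theta_ball \<theta>' \<epsilon> \<Longrightarrow> norm (\<theta> - \<theta>') < \<epsilon>" "\<theta> \<in> theta_ball \<theta>' \<epsilon> \<Longrightarrow> \<theta> $ 2 > 0"
  by (auto simp: theta_ball_def dist_norm norm_minus_commute Theta_def)

lemma theta_ball_mono: "\<epsilon> \<le> \<epsilon>' \<Longrightarrow> theta_ball \<theta> \<epsilon> \<subseteq> theta_ball \<theta> \<epsilon>'"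
  by (auto simp: theta_ball_def)

context gp_limit
begin

lemma hess_fun_expand:
  assumes "0 < u"
  shows "hess_fun h h u = (h $ 1)\<^sup>2 * hess_fun (axis 1 1) (axis 1 1) u
    + 2 * h $ 1 * h $ 2 * hess_fun (axis 1 1) (axis 2 1) u + (h $ 2)\<^sup>2 * hess_fun (axis 2 1) (axis 2 1) u"
  unfolding hess_fun_def by (rule llik_D2_expand) (use lin_\<theta>0_zf_pos[OF assms] in auto)

text \<open>The integrable weight that dominates the second derivatives, and its part above the level \<open>l\<close>.\<close>

definition ew :: "real \<Rightarrow> real" where "ew u = u powr (- (2 * \<beta>))"
definition ew_tail :: "real \<Rightarrow> real \<Rightarrow> real" where "ew_tail l u = max 0 (ew u - l)"
definition I0 :: real where "I0 = (LBINT u:{0<..1}. ew u)"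

lemma continuous_on_ew: "continuous_on {0<..1} ew"
  unfolding ew_def by (intro continuous_intros) auto

lemma ew_integrable: "set_integrable lborel {0<..1} ew"
  unfolding ew_def by (rule set_integrable_powr_unit[OF beta_pos(4)])

lemma I0_nonneg: "I0 \<ge> 0"
  unfolding I0_def set_lebesgue_integral_def by (rule integral_nonneg_AE) (auto simp: ew_def)

lemma continuous_on_ew_tail: "continuous_on {0<..1} (ew_tail l)"
  unfolding ew_tail_def by (intro continuous_intros continuous_on_ew)

lemma ew_tail_integrable:
  assumes "l \<ge> 0"
  shows "set_integrable lborel {0<..1} (ew_tail l)"
  by (rule set_integrable_powr_bound[OF continuous_on_ew_tail beta_pos(4), of _ 1])
     (use assms in \<open>auto simp: ew_tail_def ew_def\<close>)

lemma ew_tail_small: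
  assumes "d > 0"
  obtains l where "l > 0" "(LBINT u:{0<..1}. ew_tail l u) < d"
proof -
  have "(\<lambda>m. \<integral>u. indicator {0<..1} u *\<^sub>R ew_tail (real m) u \<partial>lborel) \<longlonglongrightarrow> (\<integral>u. (0::real) \<partial>(lborel :: real measure))"
  proof (rule integral_dominated_convergence[where w = "\<lambda>u. indicator {0<..1} u *\<^sub>R ew u"])
    show "integrable lborel (\<lambda>u. indicator {0<..1} u *\<^sub>R ew u)"
      using ew_integrable by (simp add: set_integrable_def)
    show "(\<lambda>u. indicator {0<..1} u *\<^sub>R ew_tail (real m) u) \<in> borel_measurable lborel" for m
      using ew_tail_integrable[of "real m"] by (auto simp: set_integrable_def)
    show "AE u in lborel. (\<lambda>m. indicator {0<..1} u *\<^sub>R ew_tail (real m) u) \<longlonglongrightarrow> 0"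
    proof (rule AE_I2)
      fix u :: real
      obtain m0 where "ew u \<le> real m0" using real_arch_simple by blast
      then have "eventually (\<lambda>m. indicator {0<..1} u *\<^sub>R ew_tail (real m) u = 0) sequentially"
        unfolding eventually_sequentially by (intro exI[of _ m0]) (auto simp: ew_tail_def)
      then show "(\<lambda>m. indicator {0<..1} u *\<^sub>R ew_tail (real m) u) \<longlonglongrightarrow> 0" by (rule tendsto_eventually)
    qed
    show "AE u in lborel. norm (indicator {0<..1} u *\<^sub>R ew_tail (real m) u) \<le> indicator {0<..1} u *\<^sub>R ew u" for m
      by (intro AE_I2) (auto simp: ew_tail_def ew_def indicator_def)
  qed auto
  then have "eventually (\<lambda>m. (LBINT u:{0<..1}. ew_tail (real m) u) < d) sequentially"
    unfolding set_lebesgue_integral_def using assms by (intro order_tendstoD) auto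
  then have "eventually (\<lambda>m. (LBINT u:{0<..1}. ew_tail (real m) u) < d \<and> m > 0) sequentially"
    using eventually_gt_at_top[of 0] by eventually_elim auto
  then obtain m where "(LBINT u:{0<..1}. ew_tail (real m) u) < d" "m > 0" by (auto dest: eventually_happens)
  then show ?thesis using that[of "real m"] by simp
qed

lemma wt_bound:
  assumes "0 < u" "u \<le> 1"
  shows "wt u \<le> K0 * ew u"
proof -
  have "wt u \<le> K0 * u powr (- \<beta>)" unfolding wt_def by (rule K0(2)[OF assms])
  also have "\<dots> \<le> K0 * ew u"
    unfolding ew_def using assms beta_pos K0(1) by (intro mult_left_mono powr_mono') auto
  finally show ?thesis .
qed

text \<open>The smallest of the \<open>k\<close> points is of order \<open>1 / k\<close>; the radius allowed in the uniform Hessian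
statement is exactly what \<open>wt\<close> requires there.\<close>

lemma wt_rate:
  assumes "c > 0"
  obtains C where "C > 0" "\<And>k u. k \<ge> 3 \<Longrightarrow> c / k \<le> u \<Longrightarrow> 0 < u \<Longrightarrow> u \<le> 1 \<Longrightarrow>
     wt u * min (1 / ln k) (k powr min \<gamma> 0) \<le> C"
proof -
  have lnk: "ln k \<ge> 1" if "k \<ge> 3" for k :: real
  proof -
    have "exp 1 \<le> k" using exp_le that by linarith
    then show ?thesis using that by (simp add: ln_ge_iff)
  qed
  have wt0: "wt u \<ge> 0" if "0 < u" "u \<le> 1" for u unfolding wt_def using zf_nonneg[OF that] by simp
  consider "\<gamma> > 0" | "\<gamma> = 0" | "\<gamma> < 0" by linarith
  then show ?thesis
  proof cases
    case 1
    show ?thesis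
    proof (rule that[of "1 + 1 / \<gamma>"])
      fix k u :: real assume k: "k \<ge> 3" and u: "0 < u" "u \<le> 1"
      have "(1 / u) powr \<gamma> * u powr \<gamma> = 1" using u by (simp add: powr_mult[symmetric])
      then have "wt u = u powr \<gamma> + (1 - u powr \<gamma>) / \<gamma>"
        using 1 by (simp add: wt_def zf_def box_cox_def field_simps)
      moreover have "u powr \<gamma> \<le> 1" using u 1 by (intro powr_le1) auto
      moreover have "(1 - u powr \<gamma>) / \<gamma> \<le> 1 / \<gamma>" using 1 by (simp add: divide_right_mono)
      ultimately have w: "wt u \<le> 1 + 1 / \<gamma>" by linarith
      have "min (1 / ln k) (k powr min \<gamma> 0) \<le> 1" using 1 k by simp
      then have "wt u * min (1 / ln k) (k powr min \<gamma> 0) \<le> wt u * 1"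
        using wt0[OF u] by (intro mult_left_mono) auto
      then show "wt u * min (1 / ln k) (k powr min \<gamma> 0) \<le> 1 + 1 / \<gamma>" using w by simp
    qed (use 1 in \<open>simp add: add_pos_pos\<close>)
  next
    case 2
    show ?thesis
    proof (rule that[of "2 + \<bar>ln c\<bar>"])
      fix k u :: real assume k: "k \<ge> 3" and c: "c / k \<le> u" and u: "0 < u" "u \<le> 1"
      have w: "wt u = 1 - ln u" unfolding wt_def zf_def box_cox_def using u 2 by (simp add: ln_div)
      have "ln (c / k) \<le> ln u" using c assms k u by (subst ln_le_cancel_iff) auto
      then have "wt u \<le> 1 + \<bar>ln c\<bar> + ln k" using assms k by (simp add: w ln_div)
      also have "\<dots> \<le> (2 + \<bar>ln c\<bar>) * ln k"
      proof -
        have "(1 + \<bar>ln c\<bar>) * 1 \<le> (1 + \<bar>ln c\<bar>) * ln k" using lnk[OF k] by (intro mult_left_mono) auto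
        then show ?thesis by (simp add: algebra_simps)
      qed
      finally have "wt u * (1 / ln k) \<le> 2 + \<bar>ln c\<bar>" using lnk[OF k] by (simp add: pos_divide_le_eq)
      moreover have "wt u * min (1 / ln k) (k powr min \<gamma> 0) \<le> wt u * (1 / ln k)"
        using wt0[OF u] by (intro mult_left_mono) auto
      ultimately show "wt u * min (1 / ln k) (k powr min \<gamma> 0) \<le> 2 + \<bar>ln c\<bar>" by linarith
    qed simp
  next
    case 3
    show ?thesis
    proof (rule that[of "(1 + 1 / (- \<gamma>)) * c powr \<gamma>"])
      fix k u :: real assume k: "k \<ge> 3" and c: "c / k \<le> u" and u: "0 < u" "u \<le> 1"
      have "zf u \<le> 1 / (- \<gamma>)"
      proof -
        have "zf u = (1 - (1 / u) powr \<gamma>) / (- \<gamma>)" using 3 by (simp add: zf_def box_cox_def field_simps)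
        also have "\<dots> \<le> 1 / (- \<gamma>)" using 3 by (intro divide_right_mono) auto
        finally show ?thesis .
      qed
      then have "wt u \<le> (1 + 1 / (- \<gamma>)) * u powr \<gamma>" unfolding wt_def by (intro mult_right_mono) auto
      also have "\<dots> \<le> (1 + 1 / (- \<gamma>)) * (c / k) powr \<gamma>"
        using 3 c assms k by (intro mult_left_mono powr_mono2') auto
      finally have w: "wt u \<le> (1 + 1 / (- \<gamma>)) * (c / k) powr \<gamma>" .
      have "wt u * min (1 / ln k) (k powr min \<gamma> 0) \<le> wt u * k powr \<gamma>"
        using wt0[OF u] 3 by (intro mult_left_mono) (auto simp: min_def)
      also have "\<dots> \<le> (1 + 1 / (- \<gamma>)) * (c / k) powr \<gamma> * k powr \<gamma>" using w by (intro mult_right_mono) auto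
      also have "\<dots> = (1 + 1 / (- \<gamma>)) * c powr \<gamma>"
        using k assms by (simp add: powr_divide)
      finally show "wt u * min (1 / ln k) (k powr min \<gamma> 0) \<le> (1 + 1 / (- \<gamma>)) * c powr \<gamma>" .
    qed (use 3 assms in \<open>auto intro!: mult_pos_pos add_pos_pos simp: divide_pos_neg\<close>)
  qed
qed

text \<open>The integrand is the Hessian of the likelihood of the single observation \<open>zf v\<close>, which is \<open>hess_fun\<close>
by \<open>hessian_L\<close>; its mean is minus \<open>gram\<close>.\<close>

lemma fisher_info_nth: "fisher_info \<gamma> $ i $ j = gram (axis i 1) (axis j 1)"
proof -
  let ?Hm = "\<lambda>v. hessian (\<lambda>\<theta>. real_of_ereal (gp_loglik \<theta> (zf v))) \<theta>0"
  have H: "?Hm v = (\<chi> i j. hess_fun (axis i 1) (axis j 1) v)" if v: "0 < v" "v < 1" for v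
  proof -
    interpret loglik_sum "{()}" "\<lambda>_. zf v" 1
      by unfold_locales (use zf_nonneg[of v] v in auto)
    have "\<theta>0 \<in> dom" using lin_\<theta>0_zf_pos[of v] v by (simp add: dom_def)
    moreover have "L = (\<lambda>\<theta>. gp_loglik \<theta> (zf v))" by (simp add: L_def fun_eq_iff)
    ultimately show ?thesis using hessian_L[of \<theta>0] by (simp add: S2_def hess_fun_def)
  qed
  have int: "set_integrable lborel {0<..<1} (\<lambda>v. hess_fun (axis i 1) (axis j 1) v)" for i j
    by (rule set_integrable_subset[OF hess_fun_mean(1)]) auto
  have "(LBINT v=ereal 0..ereal 1. hessian (\<lambda>\<theta>. real_of_ereal (gp_loglik \<theta> (box_cox \<gamma> (1 / v)))) (vector [\<gamma>, 1])) =
      (LBINT v:{0<..<1}. ?Hm v)"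
    by (simp add: interval_integral_Ioo zf_def \<theta>0_def)
  also have "\<dots> = (LBINT v:{0<..<1}. (\<chi> i j. hess_fun (axis i 1) (axis j 1) v) :: real^2^2)"
    by (rule set_lebesgue_integral_cong) (use H in auto)
  finally have F: "fisher_info \<gamma> = - (LBINT v:{0<..<1}. (\<chi> i j. hess_fun (axis i 1) (axis j 1) v))"
    by (simp add: fisher_info_def)
  have eq: "(\<lambda>v. indicator {0<..<1} v *\<^sub>R ((\<chi> i j. hess_fun (axis i 1) (axis j 1) v) :: real^2^2)) =
      (\<lambda>v. \<Sum>i\<in>UNIV. \<Sum>j\<in>UNIV. (indicator {0<..<1} v *\<^sub>R hess_fun (axis i 1) (axis j 1) v) *\<^sub>R (axis i (axis j 1)))"
    by (simp add: fun_eq_iff vec_eq_iff axis_def sum_2 forall_2)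
  have intM: "integrable lborel (\<lambda>v. indicator {0<..<1} v *\<^sub>R ((\<chi> i j. hess_fun (axis i 1) (axis j 1) v) :: real^2^2))"
    unfolding eq using int
    by (intro Bochner_Integration.integrable_sum integrable_scaleR_left) (simp add: set_integrable_def)
  have bl: "bounded_linear (\<lambda>M :: real^2^2. M $ i $ j)"
    using bounded_linear_compose[OF bounded_linear_vec_nth[of j] bounded_linear_vec_nth[of i]] by (simp add: o_def)
  have "(LBINT v:{0<..<1}. (\<chi> i j. hess_fun (axis i 1) (axis j 1) v) :: real^2^2) $ i $ j =
      (LBINT v:{0<..<1}. hess_fun (axis i 1) (axis j 1) v)"
    unfolding set_lebesgue_integral_def integral_bounded_linear[OF bl intM, symmetric] by simp
  also have "\<dots> = (LBINT v:{0<..1}. hess_fun (axis i 1) (axis j 1) v)"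
    unfolding set_lebesgue_integral_def
  proof (rule integral_cong_AE)
    show "AE x in lborel. indicator {0<..<1} x *\<^sub>R hess_fun (axis i 1) (axis j 1) x = indicator {0<..1} x *\<^sub>R hess_fun (axis i 1) (axis j 1) x"
      using AE_lborel_singleton[of "1::real"] by eventually_elim (auto simp: indicator_def)
  qed (use int[of i j] hess_fun_mean(1)[of "axis i 1" "axis j 1"] in \<open>auto simp: set_integrable_def\<close>)
  also have "\<dots> = - gram (axis i 1) (axis j 1)" by (rule hess_fun_mean)
  finally show ?thesis by (simp add: F)
qed

end

locale gp_model = gp_sample F a A \<gamma> \<rho> H k lam + gp_limit \<gamma>
  for F a A :: "real \<Rightarrow> real" and \<gamma> \<rho> :: real and H :: "real \<Rightarrow> real" and k :: "nat \<Rightarrow> nat" and lam :: real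
begin

abbreviation p :: "nat \<Rightarrow> (nat \<Rightarrow> real) \<Rightarrow> nat \<Rightarrow> real" where
  "p n v i \<equiv> pt n (k n) v i"

text \<open>On these samples every excess is near its limit, at the rate \<open>1 / sqrt k\<close> and with an error that may
grow as \<open>u\<close> tends to \<open>0\<close>. The factor \<open>u powr (- \<gamma>)\<close> is kept separate because it is the size of
\<open>lin \<theta>0\<close>.\<close>

definition close :: "real \<Rightarrow> real \<Rightarrow> nat \<Rightarrow> (nat \<Rightarrow> real) \<Rightarrow> bool" where
  "close C c n v \<longleftrightarrow> 0 < k n \<and> (\<forall>i<k n. 0 \<le> exc n v i \<and> 0 < p n v i \<and> p n v i \<le> 1 \<and> c / real (k n) \<le> p n v i \<and>
     \<bar>exc n v i - zf (p n v i)\<bar> \<le> C / sqrt (real (k n)) * p n v i powr (- \<beta>) * p n v i powr (- \<gamma>))"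

lemma likely_close:
  assumes "\<eta> > 0"
  obtains C c where "C > 0" "c > 0" "likely \<eta> (close C c)"
proof -
  obtain C c where *: "C > 0" "c > 0" "likely \<eta> (\<lambda>n v. \<forall>i<k n. 0 \<le> exc n v i \<and>
      0 < pt n (k n) v i \<and> pt n (k n) v i \<le> 1 \<and> c / real (k n) \<le> pt n (k n) v i \<and>
      \<bar>exc n v i - box_cox \<gamma> (1 / pt n (k n) v i)\<bar> \<le> C / sqrt (real (k n)) * pt n (k n) v i powr (- (\<gamma> + \<beta>)))"
    using exc_close[OF beta(5,4) assms] by blast
  have "likely \<eta> (close C c)"
  proof (rule likely_mono[OF *(3)])
    have "x powr (- (\<gamma> + \<beta>)) = x powr (- \<beta>) * x powr (- \<gamma>)" for x :: real
    proof -
      have "- (\<gamma> + \<beta>) = - \<beta> + - \<gamma>" by simp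
      then show ?thesis by (simp only: powr_add)
    qed
    then show "eventually (\<lambda>n. \<forall>v. (\<forall>i<k n. 0 \<le> exc n v i \<and>
      0 < pt n (k n) v i \<and> pt n (k n) v i \<le> 1 \<and> c / real (k n) \<le> pt n (k n) v i \<and>
      \<bar>exc n v i - box_cox \<gamma> (1 / pt n (k n) v i)\<bar> \<le> C / sqrt (real (k n)) * pt n (k n) v i powr (- (\<gamma> + \<beta>))) \<longrightarrow> close C c n v) sequentially"
      using ev_nk by (auto elim!: eventually_mono simp: close_def zf_def mult.assoc)
  qed
  then show ?thesis using that *(1,2) by blast
qed

text \<open>The relative errors are uniformly small: \<open>u \<ge> c / k\<close> and \<open>\<beta> < 1 / 2\<close>, so \<open>u powr (- \<beta>)\<close> is negligible
against \<open>sqrt k\<close>.\<close>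

lemma ev_close_rel:
  assumes "C > 0" "c > 0" "d > 0"
  shows "eventually (\<lambda>n. \<forall>v. close C c n v \<longrightarrow> (\<forall>i<k n.
    C / sqrt (real (k n)) * p n v i powr (- \<beta>) \<le> d \<and> \<bar>exc n v i - zf (p n v i)\<bar> \<le> d * p n v i powr (- \<gamma>))) sequentially"
proof -
  have "((\<lambda>n. (C * c powr (- \<beta>)) * real (k n) powr (\<beta> - 1/2)) \<longlongrightarrow> (C * c powr (- \<beta>)) * 0) sequentially"
    by (intro tendsto_mult tendsto_const tendsto_neg_powr k_real_at_top) (use beta in simp)
  then have "eventually (\<lambda>n. (C * c powr (- \<beta>)) * real (k n) powr (\<beta> - 1/2) < d) sequentially"
    using assms by (intro order_tendstoD) auto
  then show ?thesis
    using ev_nk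
  proof eventually_elim
    case (elim n)
    show ?case
    proof (intro allI impI)
      fix v i assume cl: "close C c n v" and i: "i < k n"
      have pp: "0 < p n v i" "c / real (k n) \<le> p n v i"
        and cc: "\<bar>exc n v i - zf (p n v i)\<bar> \<le> C / sqrt (real (k n)) * p n v i powr (- \<beta>) * p n v i powr (- \<gamma>)"
        using cl i by (auto simp: close_def)
      have "p n v i powr (- \<beta>) \<le> (c / real (k n)) powr (- \<beta>)"
        using pp assms elim beta_pos by (intro powr_mono2') auto
      also have "\<dots> = c powr (- \<beta>) * real (k n) powr \<beta>"
        using assms by (simp add: powr_divide powr_minus_divide)
      finally have "C / sqrt (real (k n)) * p n v i powr (- \<beta>) \<le> C / sqrt (real (k n)) * (c powr (- \<beta>) * real (k n) powr \<beta>)"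
        using assms by (intro mult_left_mono) auto
      also have "\<dots> = (C * c powr (- \<beta>)) * real (k n) powr (\<beta> - 1/2)"
        using elim by (simp add: powr_diff powr_half_sqrt)
      also have "\<dots> \<le> d" using elim by simp
      finally have 1: "C / sqrt (real (k n)) * p n v i powr (- \<beta>) \<le> d" .
      then have "C / sqrt (real (k n)) * p n v i powr (- \<beta>) * p n v i powr (- \<gamma>) \<le> d * p n v i powr (- \<gamma>)"
        by (intro mult_right_mono) auto
      with 1 cc show "C / sqrt (real (k n)) * p n v i powr (- \<beta>) \<le> d \<and> \<bar>exc n v i - zf (p n v i)\<bar> \<le> d * p n v i powr (- \<gamma>)"
        by linarith
    qed
  qed
qed

abbreviation "avg n g v \<equiv> pt_avg n (k n) g v"

definition S1 :: "nat \<Rightarrow> (nat \<Rightarrow> real) \<Rightarrow> real^2 \<Rightarrow> real^2 \<Rightarrow> real" where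
  "S1 n v = loglik_sum.S1 {..<k n} (exc n v) (1 / real (k n))"
definition S2 :: "nat \<Rightarrow> (nat \<Rightarrow> real) \<Rightarrow> real^2 \<Rightarrow> real^2 \<Rightarrow> real^2 \<Rightarrow> real" where
  "S2 n v = loglik_sum.S2 {..<k n} (exc n v) (1 / real (k n))"
definition LL :: "nat \<Rightarrow> (nat \<Rightarrow> real) \<Rightarrow> real^2 \<Rightarrow> ereal" where
  "LL n v = loglik_sum.L {..<k n} (exc n v) (1 / real (k n))"
definition dom :: "nat \<Rightarrow> (nat \<Rightarrow> real) \<Rightarrow> (real^2) set" where
  "dom n v = loglik_sum.dom {..<k n} (exc n v)"

lemma loglik_sum_close: "close C c n v \<Longrightarrow> loglik_sum {..<k n} (exc n v) (1 / real (k n))"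
  by unfold_locales (auto simp: close_def)

lemma S1_eq: "S1 n v \<theta> h = (\<Sum>i<k n. llik_D1 \<theta> h (exc n v i)) / real (k n)" if "close C c n v"
  using loglik_sum.S1_def[OF loglik_sum_close[OF that]] by (simp add: S1_def)

lemma S2_eq: "S2 n v \<theta> h h' = (\<Sum>i<k n. llik_D2 \<theta> h h' (exc n v i)) / real (k n)" if "close C c n v"
  using loglik_sum.S2_def[OF loglik_sum_close[OF that]] by (simp add: S2_def)

lemma dom_eq: "\<theta> \<in> dom n v \<longleftrightarrow> \<theta> $ 2 > 0 \<and> (\<forall>i<k n. lin \<theta> (exc n v i) > 0)" if "close C c n v"
  using loglik_sum.dom_def[OF loglik_sum_close[OF that]] by (auto simp: dom_def)

lemma mean_loglik_eq:
  assumes "close C c n v"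
  shows "mean_loglik (\<lambda>l y. y (l - 1)) a k n (qsample v) = LL n v"
proof
  fix \<theta>
  have "(\<Sum>i = 1..k n. gp_loglik \<theta> (excess (\<lambda>l y. y (l - 1)) a k n (qsample v) i)) = (\<Sum>i<k n. gp_loglik \<theta> (exc n v i))"
    by (rule sum.reindex_bij_witness[of _ Suc "\<lambda>i. i - 1"]) (auto simp: exc_def)
  then show "mean_loglik (\<lambda>l y. y (l - 1)) a k n (qsample v) \<theta> = LL n v \<theta>"
    using loglik_sum.L_def[OF loglik_sum_close[OF assms]] by (simp add: mean_loglik_def LL_def)
qed

lemma sum_avg_bound:
  assumes "\<And>i. i < k n \<Longrightarrow> \<bar>f i - g (p n v i)\<bar> \<le> b * ew (p n v i)"
  shows "\<bar>(\<Sum>i<k n. f i) / real (k n) - avg n g v\<bar> \<le> b * avg n ew v"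
proof -
  have "\<bar>(\<Sum>i<k n. f i) / real (k n) - avg n g v\<bar> = \<bar>\<Sum>i<k n. f i - g (p n v i)\<bar> / real (k n)"
    by (simp add: pt_avg_def sum_subtractf diff_divide_distrib[symmetric])
  also have "\<dots> \<le> (\<Sum>i<k n. b * ew (p n v i)) / real (k n)"
    by (intro divide_right_mono order_trans[OF sum_abs] sum_mono assms) auto
  also have "\<dots> = b * avg n ew v" by (simp add: pt_avg_def sum_distrib_left)
  finally show ?thesis .
qed

lemma likely_ew: "\<eta> > 0 \<Longrightarrow> likely \<eta> (\<lambda>n v. \<bar>avg n ew v - I0\<bar> \<le> 1)"
  unfolding I0_def by (rule pt_avg_LLN[OF continuous_on_ew ew_integrable]) auto

section \<open>The score at the true parameter\<close>

text \<open>Replacing each observation by its limit costs \<open>O (1 / sqrt k)\<close> (\<open>score_close\<close>), and what remains is an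
average of a centred, square integrable function of the points.\<close>

lemma likely_S1:
  assumes "\<eta> > 0"
  obtains C where "C > 0" "likely \<eta> (\<lambda>n v. \<theta>0 \<in> dom n v \<and> \<bar>S1 n v \<theta>0 h\<bar> \<le> C / sqrt (real (k n)))"
proof -
  obtain C c where C: "C > 0" "c > 0" "likely (\<eta>/3) (close C c)"
    using likely_close[of "\<eta>/3"] assms by auto
  obtain C' where C': "C' > 0" "likely (\<eta>/3) (\<lambda>n v. \<bar>avg n (score_fun h) v - (LBINT u:{0<..1}. score_fun h u)\<bar> \<le> C' / sqrt (real (k n)))"
    using pt_avg_CLT_rate[OF score_fun_continuous score_fun_mean(1,2), of "\<eta>/3"] assms by auto
  have le: "likely (\<eta>/3) (\<lambda>n v. \<bar>avg n ew v - I0\<bar> \<le> 1)" using assms by (intro likely_ew) auto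
  define B where "B = 16 * (1 + \<bar>\<gamma>\<bar>) * K0 * norm h"
  have B: "B \<ge> 0" using K0 by (simp add: B_def)
  define D where "D = C' + B * C * (I0 + 1)"
  have D: "D > 0" using C' B C I0_nonneg by (simp add: D_def add_pos_nonneg)
  have "likely (\<eta>/3 + (\<eta>/3 + \<eta>/3)) (\<lambda>n v. \<theta>0 \<in> dom n v \<and> \<bar>S1 n v \<theta>0 h\<bar> \<le> D / sqrt (real (k n)))"
  proof (rule likely_mono[OF likely_conj[OF C(3) likely_conj[OF C'(2) le]]])
    show "eventually (\<lambda>n. \<forall>v. close C c n v \<and> \<bar>avg n (score_fun h) v - (LBINT u:{0<..1}. score_fun h u)\<bar> \<le> C' / sqrt (real (k n)) \<and>
        \<bar>avg n ew v - I0\<bar> \<le> 1 \<longrightarrow> \<theta>0 \<in> dom n v \<and> \<bar>S1 n v \<theta>0 h\<bar> \<le> D / sqrt (real (k n))) sequentially"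
      using ev_close_rel[OF C(1,2) eta0(1)]
    proof eventually_elim
      case (elim n)
      let ?r = "sqrt (real (k n))"
      show ?case
      proof (intro allI impI, elim conjE)
        fix v assume cl: "close C c n v" and a1: "\<bar>avg n (score_fun h) v - (LBINT u:{0<..1}. score_fun h u)\<bar> \<le> C' / ?r"
          and a2: "\<bar>avg n ew v - I0\<bar> \<le> 1"
        note rel = elim[rule_format, OF cl]
        have pr: "0 < p n v i" "p n v i \<le> 1" "0 \<le> exc n v i"
          "\<bar>exc n v i - zf (p n v i)\<bar> \<le> C / ?r * p n v i powr (- \<beta>) * p n v i powr (- \<gamma>)" if "i < k n" for i
          using cl that by (auto simp: close_def)
        have "\<theta>0 \<in> dom n v"
          unfolding dom_eq[OF cl]
        proof (intro conjI allI impI)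
          fix i assume i: "i < k n"
          show "0 < lin \<theta>0 (exc n v i)"
            by (rule between_weights(1)[OF pr(1,2)[OF i] _ order_refl _ pr(3)[OF i]]) (use rel[OF i] eta0 in auto)
        qed simp
        moreover have "\<bar>S1 n v \<theta>0 h\<bar> \<le> D / ?r"
        proof -
          have "\<bar>(\<Sum>i<k n. llik_D1 \<theta>0 h (exc n v i)) / real (k n) - avg n (score_fun h) v\<bar> \<le> (B * (C / ?r)) * avg n ew v"
          proof (rule sum_avg_bound)
            fix i assume i: "i < k n"
            have "\<bar>llik_D1 \<theta>0 h (exc n v i) - score_fun h (p n v i)\<bar> \<le> 16 * (1 + \<bar>\<gamma>\<bar>) * K0 * norm h * (C / ?r * p n v i powr (- (2 * \<beta>)))"
              by (rule score_close[OF pr(1,2,3)[OF i] _ _ pr(4)[OF i]]) (use C rel[OF i] in auto)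
            then show "\<bar>llik_D1 \<theta>0 h (exc n v i) - score_fun h (p n v i)\<bar> \<le> (B * (C / ?r)) * ew (p n v i)"
              by (simp add: B_def ew_def mult_ac)
          qed
          also have "\<dots> \<le> (B * (C / ?r)) * (I0 + 1)"
            using a2 B C by (intro mult_left_mono) (auto simp: abs_le_iff)
          finally have 1: "\<bar>S1 n v \<theta>0 h - avg n (score_fun h) v\<bar> \<le> (B * (C / ?r)) * (I0 + 1)"
            using S1_eq[OF cl] by simp
          have "\<bar>avg n (score_fun h) v\<bar> \<le> C' / ?r" using a1 by (simp add: score_fun_mean)
          with 1 have "\<bar>S1 n v \<theta>0 h\<bar> \<le> C' / ?r + (B * (C / ?r)) * (I0 + 1)" by linarith
          also have "\<dots> = D / ?r" by (simp add: D_def add_divide_distrib)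
          finally show ?thesis .
        qed
        ultimately show "\<theta>0 \<in> dom n v \<and> \<bar>S1 n v \<theta>0 h\<bar> \<le> D / ?r" by simp
      qed
    qed
  qed
  then show ?thesis using that D by simp
qed

section \<open>The Hessian\<close>

lemma likely_hess_fun:
  assumes "\<eta> > 0" "\<delta> > 0"
  shows "likely \<eta> (\<lambda>n v. \<bar>avg n (hess_fun h h') v + gram h h'\<bar> \<le> \<delta>)"
  using pt_avg_LLN[OF hess_fun_continuous hess_fun_mean(1) assms, of h h'] by (simp add: hess_fun_mean(2))

lemma likely_hess_fun_axes:
  assumes "\<eta> > 0" "\<delta> > 0"
  shows "likely \<eta> (\<lambda>n v. \<forall>i j. \<bar>avg n (hess_fun (axis i 1) (axis j 1)) v + gram (axis i 1) (axis j 1)\<bar> \<le> \<delta>)"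
proof -
  have "likely (\<eta>/4 + (\<eta>/4 + (\<eta>/4 + \<eta>/4))) (\<lambda>n v. \<bar>avg n (hess_fun (axis 1 1) (axis 1 1)) v + gram (axis 1 1) (axis 1 1)\<bar> \<le> \<delta> \<and>
     \<bar>avg n (hess_fun (axis 1 1) (axis 2 1)) v + gram (axis 1 1) (axis 2 1)\<bar> \<le> \<delta> \<and>
     \<bar>avg n (hess_fun (axis 2 1) (axis 1 1)) v + gram (axis 2 1) (axis 1 1)\<bar> \<le> \<delta> \<and>
     \<bar>avg n (hess_fun (axis 2 1) (axis 2 1)) v + gram (axis 2 1) (axis 2 1)\<bar> \<le> \<delta>)"
    by (intro likely_conj likely_hess_fun) (use assms in auto)
  then show ?thesis by (simp add: forall_2 conj_assoc)
qed

text \<open>The average of \<open>hess_close\<close> over all observations; every one of them has to be comparable with its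
limit and little affected by the change of parameter.\<close>

lemma S2_close:
  assumes cl: "close C c n v" and e: "0 \<le> e" "e \<le> \<eta>0"
    and rel: "\<And>i. i < k n \<Longrightarrow> \<bar>exc n v i - zf (p n v i)\<bar> \<le> e * p n v i powr (- \<gamma>)"
    and t: "norm (\<theta> - \<theta>0) \<le> e" "\<And>i. i < k n \<Longrightarrow> 4 * norm (\<theta> - \<theta>0) * wt (p n v i) \<le> e"
  shows "\<theta> \<in> dom n v" "\<bar>S2 n v \<theta> h h' - avg n (hess_fun h h') v\<bar> \<le> K2 * (norm h * norm h') * e * avg n ew v"
proof -
  have pr: "0 < p n v i" "p n v i \<le> 1" "0 \<le> exc n v i" if "i < k n" for i
    using cl that by (auto simp: close_def)
  note hc = hess_close[OF pr(1) pr(2) pr(3) e rel t(1) t(2)]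
  have "0 < k n" using cl by (simp add: close_def)
  then show "\<theta> \<in> dom n v" unfolding dom_eq[OF cl] using hc(1,2) by blast
  show "\<bar>S2 n v \<theta> h h' - avg n (hess_fun h h') v\<bar> \<le> K2 * (norm h * norm h') * e * avg n ew v"
    unfolding S2_eq[OF cl]
    by (rule sum_avg_bound) (use hc(3) in \<open>simp add: ew_def mult.assoc\<close>)
qed

end

context gp_model
begin

text \<open>By \<open>wt_rate\<close>, the condition on \<open>R\<close> makes \<open>norm (\<theta> - \<theta>0) * wt u\<close> small for all points \<open>u\<close>, including
the smallest, so that \<open>S2_close\<close> applies throughout the ball.\<close>

lemma likely_hessian_shrinking:
  fixes R :: "nat \<Rightarrow> real"
  assumes R: "\<And>n. R n > 0"
    "R \<in> o(\<lambda>n. min (sqrt (real (k n)) / ln (real (k n))) (real (k n) powr (1 / 2 + min \<gamma> 0)))"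
    and "\<eta> > 0" "\<delta> > 0"
  shows "likely \<eta> (\<lambda>n v. \<forall>\<theta>\<in>theta_ball \<theta>0 (R n / sqrt (real (k n))).
    \<theta> \<in> dom n v \<and> (\<Sum>i\<in>UNIV. \<Sum>j\<in>UNIV. \<bar>S2 n v \<theta> (axis i 1) (axis j 1) + gram (axis i 1) (axis j 1)\<bar>) \<le> \<delta>)"
proof -
  obtain C c where C: "C > 0" "c > 0" "likely (\<eta>/3) (close C c)"
    using likely_close[of "\<eta>/3"] assms by auto
  have l1: "likely (\<eta>/3) (\<lambda>n v. \<forall>i j. \<bar>avg n (hess_fun (axis i 1) (axis j 1)) v + gram (axis i 1) (axis j 1)\<bar> \<le> \<delta>/8)"
    using assms by (intro likely_hess_fun_axes) auto
  have l2: "likely (\<eta>/3) (\<lambda>n v. \<bar>avg n ew v - I0\<bar> \<le> 1)" using assms by (intro likely_ew) auto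
  define e where "e = min \<eta>0 (\<delta> / (8 * (K2 * (I0 + 1))))"
  have KI: "K2 * (I0 + 1) > 0" using K2_pos I0_nonneg by simp
  have e: "0 < e" "e \<le> \<eta>0" using eta0 assms KI by (auto simp: e_def)
  have e8: "K2 * e * (I0 + 1) \<le> \<delta> / 8"
  proof -
    have "K2 * (I0 + 1) * e \<le> K2 * (I0 + 1) * (\<delta> / (8 * (K2 * (I0 + 1))))"
      using KI by (intro mult_left_mono) (auto simp: e_def)
    also have "\<dots> = \<delta> / 8"
      using nonzero_mult_div_cancel_left[of "K2 * (I0 + 1)" "\<delta> / 8"] KI
      by (metis less_irrefl divide_divide_eq_left times_divide_eq_right)
    finally show ?thesis by (simp only: mult_ac)
  qed
  obtain Cw where Cw: "Cw > 0" "\<And>k u. k \<ge> 3 \<Longrightarrow> c / k \<le> u \<Longrightarrow> 0 < u \<Longrightarrow> u \<le> 1 \<Longrightarrow>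
     wt u * min (1 / ln k) (k powr min \<gamma> 0) \<le> Cw"
    using wt_rate[OF C(2)] by blast
  define s where "s = min e (e / (4 * Cw))"
  have s: "s > 0" "s \<le> e" "4 * s * Cw \<le> e"
  proof -
    show "s > 0" "s \<le> e" using e Cw by (auto simp: s_def)
    have "s * (4 * Cw) \<le> e / (4 * Cw) * (4 * Cw)" using Cw by (intro mult_right_mono) (auto simp: s_def)
    then show "4 * s * Cw \<le> e" using Cw by (simp add: mult_ac)
  qed
  have Rev: "eventually (\<lambda>n. norm (R n) \<le> s * norm (min (sqrt (real (k n)) / ln (real (k n))) (real (k n) powr (1 / 2 + min \<gamma> 0)))) sequentially"
    by (rule landau_o.smallD[OF R(2) s(1)])
  have "likely (\<eta>/3 + (\<eta>/3 + \<eta>/3)) (\<lambda>n v. \<forall>\<theta>\<in>theta_ball \<theta>0 (R n / sqrt (real (k n))).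
    \<theta> \<in> dom n v \<and> (\<Sum>i\<in>UNIV. \<Sum>j\<in>UNIV. \<bar>S2 n v \<theta> (axis i 1) (axis j 1) + gram (axis i 1) (axis j 1)\<bar>) \<le> \<delta>)"
  proof (rule likely_mono[OF likely_conj[OF C(3) likely_conj[OF l1 l2]]])
    show "eventually (\<lambda>n. \<forall>v. close C c n v \<and>
      (\<forall>i j. \<bar>avg n (hess_fun (axis i 1) (axis j 1)) v + gram (axis i 1) (axis j 1)\<bar> \<le> \<delta>/8) \<and>
      \<bar>avg n ew v - I0\<bar> \<le> 1 \<longrightarrow> (\<forall>\<theta>\<in>theta_ball \<theta>0 (R n / sqrt (real (k n))).
    \<theta> \<in> dom n v \<and> (\<Sum>i\<in>UNIV. \<Sum>j\<in>UNIV. \<bar>S2 n v \<theta> (axis i 1) (axis j 1) + gram (axis i 1) (axis j 1)\<bar>) \<le> \<delta>)) sequentially"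
      using ev_close_rel[OF C(1,2) e(1)] Rev ev_k_ge[of 3]
    proof eventually_elim
      case (elim n)
      let ?k = "real (k n)"
      define m where "m = min (1 / ln ?k) (?k powr min \<gamma> 0)"
      have lnk: "ln ?k \<ge> 1"
      proof -
        have "exp 1 \<le> ?k" using exp_le elim(3) by linarith
        then show ?thesis using elim(3) by (simp add: ln_ge_iff)
      qed
      have mm: "min (sqrt ?k / ln ?k) (?k powr (1 / 2 + min \<gamma> 0)) = sqrt ?k * m"
        using elim(3) by (simp add: m_def powr_add powr_half_sqrt min_mult_distrib_left)
      have m0: "0 \<le> m" "m \<le> 1" using lnk elim(3) by (auto simp: m_def min_le_iff_disj)
      have "R n \<le> s * (sqrt ?k * m)" using elim(2) R(1)[of n] m0 unfolding mm by simp
      then have Rs: "R n / sqrt ?k \<le> s * m" using elim(3) by (simp add: pos_divide_le_eq mult_ac)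
      show ?case
      proof (intro allI impI ballI, elim conjE)
        fix v \<theta> assume cl: "close C c n v"
          and a1: "\<forall>i j. \<bar>avg n (hess_fun (axis i 1) (axis j 1)) v + gram (axis i 1) (axis j 1)\<bar> \<le> \<delta>/8"
          and a2: "\<bar>avg n ew v - I0\<bar> \<le> 1" and \<theta>: "\<theta> \<in> theta_ball \<theta>0 (R n / sqrt ?k)"
        have t0: "norm (\<theta> - \<theta>0) \<le> s * m" using theta_ballD(1)[OF \<theta>] Rs by linarith
        then have t1: "norm (\<theta> - \<theta>0) \<le> e"
          using mult_left_mono[OF m0(2), of s] s by linarith
        have t2: "4 * norm (\<theta> - \<theta>0) * wt (p n v i) \<le> e" if i: "i < k n" for i
        proof -
          have pp: "0 < p n v i" "p n v i \<le> 1" "c / ?k \<le> p n v i" using cl i by (auto simp: close_def)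
          have wt0: "wt (p n v i) \<ge> 0" unfolding wt_def using zf_nonneg[OF pp(1,2)] by simp
          have "4 * norm (\<theta> - \<theta>0) * wt (p n v i) \<le> 4 * (s * m) * wt (p n v i)"
            using t0 wt0 by (intro mult_right_mono mult_left_mono) auto
          also have "\<dots> = 4 * s * (wt (p n v i) * m)" by (simp add: mult_ac)
          also have "\<dots> \<le> 4 * s * Cw"
            using Cw(2)[OF elim(3) pp(3,1,2)] s by (intro mult_left_mono) (auto simp: m_def)
          also have "\<dots> \<le> e" by (rule s)
          finally show ?thesis .
        qed
        have rel: "\<bar>exc n v i - zf (p n v i)\<bar> \<le> e * p n v i powr (- \<gamma>)" if "i < k n" for i
          using elim(1) cl that by blast
        note S = S2_close[OF cl less_imp_le[OF e(1)] e(2) rel t1 t2]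
        have one: "\<bar>S2 n v \<theta> (axis i 1) (axis j 1) + gram (axis i 1) (axis j 1)\<bar> \<le> \<delta> / 4" for i j
        proof -
          have "\<bar>S2 n v \<theta> (axis i 1) (axis j 1) - avg n (hess_fun (axis i 1) (axis j 1)) v\<bar>
              \<le> K2 * (norm (axis i 1 :: real^2) * norm (axis j 1 :: real^2)) * e * avg n ew v" by (rule S(2))
          also have "\<dots> = K2 * e * avg n ew v" by simp
          also have "\<dots> \<le> K2 * e * (I0 + 1)"
            using a2 e K2_pos by (intro mult_left_mono) (auto simp: abs_le_iff)
          also have "\<dots> \<le> \<delta> / 8" by (rule e8)
          finally have "\<bar>S2 n v \<theta> (axis i 1) (axis j 1) - avg n (hess_fun (axis i 1) (axis j 1)) v\<bar> \<le> \<delta> / 8" .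
          with a1[rule_format, of i j] show ?thesis by linarith
        qed
        have "(\<Sum>i\<in>UNIV. \<Sum>j\<in>UNIV. \<bar>S2 n v \<theta> (axis i 1) (axis j 1) + gram (axis i 1) (axis j 1)\<bar>) \<le> (\<Sum>i\<in>(UNIV::2 set). \<Sum>j\<in>(UNIV::2 set). \<delta> / 4)"
          by (intro sum_mono one)
        then show "\<theta> \<in> dom n v \<and> (\<Sum>i\<in>UNIV. \<Sum>j\<in>UNIV. \<bar>S2 n v \<theta> (axis i 1) (axis j 1) + gram (axis i 1) (axis j 1)\<bar>) \<le> \<delta>"
          using S(1) by simp
      qed
    qed
  qed
  then show ?thesis by simp
qed

text \<open>On a ball of fixed radius the observations are split by the size of the weight \<open>ew\<close> of their
  limit: those with moderate weight are compared with the limit, while for the others the upper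
  bound \<open>hess_upper\<close> suffices, because their total weight is small.\<close>

lemma likely_S2_negative:
  obtains c \<epsilon> where "c > 0" "\<epsilon> > 0"
    "\<And>\<eta>. \<eta> > 0 \<Longrightarrow> likely \<eta> (\<lambda>n v. \<forall>\<theta>\<in>theta_ball \<theta>0 \<epsilon> \<inter> dom n v. \<forall>h. S2 n v \<theta> h h \<le> - c * (norm h)\<^sup>2)"
proof -
  obtain cI where cI: "cI > 0" "\<And>h. gram h h \<ge> cI * (norm h)\<^sup>2" using gram_coercive by blast
  obtain K \<epsilon>1 where K: "K > 0" "\<epsilon>1 > 0"
    "\<And>u Z e \<theta> h. 0 < u \<Longrightarrow> u \<le> 1 \<Longrightarrow> 0 \<le> Z \<Longrightarrow> 0 \<le> e \<Longrightarrow> e \<le> \<eta>0 \<Longrightarrow> \<bar>Z - zf u\<bar> \<le> e * u powr (- \<gamma>) \<Longrightarrow>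
      \<theta> \<in> theta_ball \<theta>0 \<epsilon>1 \<Longrightarrow> lin \<theta> Z > 0 \<Longrightarrow> llik_D2 \<theta> h h Z \<le> K * (norm h)\<^sup>2 * u powr (- (2 * \<beta>))"
    using hess_upper by blast
  define K' where "K' = K + K0\<^sup>2 * (1 + 1 / \<beta>)"
  have K': "K' > 0" using K beta_pos by (simp add: K'_def add_pos_nonneg)
  define d where "d = cI / (32 * K')"
  have d: "d > 0" using cI K' by (simp add: d_def)
  obtain l where l: "l > 0" "(LBINT u:{0<..1}. ew_tail l u) < d" using ew_tail_small[OF d] by blast
  define e where "e = min \<eta>0 (cI / (8 * (K2 * (I0 + 1))))"
  have KI: "K2 * (I0 + 1) > 0" using K2_pos I0_nonneg by simp
  have e: "0 < e" "e \<le> \<eta>0" using eta0 cI KI by (auto simp: e_def)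
  have e8: "K2 * e * (I0 + 1) \<le> cI / 8"
  proof -
    have "K2 * (I0 + 1) * e \<le> K2 * (I0 + 1) * (cI / (8 * (K2 * (I0 + 1))))"
      using KI by (intro mult_left_mono) (auto simp: e_def)
    also have "\<dots> = cI / 8"
      using nonzero_mult_div_cancel_left[of "K2 * (I0 + 1)" "cI / 8"] KI
      by (metis less_irrefl divide_divide_eq_left times_divide_eq_right)
    finally show ?thesis by (simp only: mult_ac)
  qed
  define \<epsilon> where "\<epsilon> = min \<epsilon>1 (min e (e / (8 * K0 * l)))"
  have K0p: "K0 > 0" using K0(1) by linarith
  have \<epsilon>: "\<epsilon> > 0" "\<epsilon> \<le> \<epsilon>1" "\<epsilon> \<le> e" "\<epsilon> * (8 * K0 * l) \<le> e"
  proof -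
    show "\<epsilon> > 0" "\<epsilon> \<le> \<epsilon>1" "\<epsilon> \<le> e" using K e K0p l by (auto simp: \<epsilon>_def)
    have "\<epsilon> * (8 * K0 * l) \<le> e / (8 * K0 * l) * (8 * K0 * l)" using K0p l by (intro mult_right_mono) (auto simp: \<epsilon>_def)
    then show "\<epsilon> * (8 * K0 * l) \<le> e" using K0p l by simp
  qed
  show ?thesis
  proof (rule that[of "cI / 2" \<epsilon>])
    fix \<eta> :: real assume \<eta>: "\<eta> > 0"
    obtain C c where C: "C > 0" "c > 0" "likely (\<eta>/4) (close C c)"
      using likely_close[of "\<eta>/4"] \<eta> by auto
    have l1: "likely (\<eta>/4) (\<lambda>n v. \<forall>i j. \<bar>avg n (hess_fun (axis i 1) (axis j 1)) v + gram (axis i 1) (axis j 1)\<bar> \<le> cI / 32)"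
      using \<eta> cI by (intro likely_hess_fun_axes) auto
    have l2: "likely (\<eta>/4) (\<lambda>n v. \<bar>avg n ew v - I0\<bar> \<le> 1)" using \<eta> by (intro likely_ew) auto
    have l3: "likely (\<eta>/4) (\<lambda>n v. \<bar>avg n (ew_tail l) v - (LBINT u:{0<..1}. ew_tail l u)\<bar> \<le> d)"
      using \<eta> d l by (intro pt_avg_LLN continuous_on_ew_tail ew_tail_integrable) auto
    have "likely (\<eta>/4 + (\<eta>/4 + (\<eta>/4 + \<eta>/4))) (\<lambda>n v. \<forall>\<theta>\<in>theta_ball \<theta>0 \<epsilon> \<inter> dom n v. \<forall>h. S2 n v \<theta> h h \<le> - (cI/2) * (norm h)\<^sup>2)"
    proof (rule likely_mono[OF likely_conj[OF C(3) likely_conj[OF l1 likely_conj[OF l2 l3]]]])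
      show "eventually (\<lambda>n. \<forall>v. close C c n v \<and>
        (\<forall>i j. \<bar>avg n (hess_fun (axis i 1) (axis j 1)) v + gram (axis i 1) (axis j 1)\<bar> \<le> cI / 32) \<and>
        \<bar>avg n ew v - I0\<bar> \<le> 1 \<and> \<bar>avg n (ew_tail l) v - (LBINT u:{0<..1}. ew_tail l u)\<bar> \<le> d \<longrightarrow>
        (\<forall>\<theta>\<in>theta_ball \<theta>0 \<epsilon> \<inter> dom n v. \<forall>h. S2 n v \<theta> h h \<le> - (cI/2) * (norm h)\<^sup>2)) sequentially"
        using ev_close_rel[OF C(1,2) e(1)]
      proof eventually_elim
        case (elim n)
        show ?case
        proof (intro allI impI ballI, elim conjE)
          fix v \<theta> and h :: "real^2" assume cl: "close C c n v"
            and a1: "\<forall>i j. \<bar>avg n (hess_fun (axis i 1) (axis j 1)) v + gram (axis i 1) (axis j 1)\<bar> \<le> cI / 32"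
            and a2: "\<bar>avg n ew v - I0\<bar> \<le> 1"
            and a3: "\<bar>avg n (ew_tail l) v - (LBINT u:{0<..1}. ew_tail l u)\<bar> \<le> d"
            and \<theta>: "\<theta> \<in> theta_ball \<theta>0 \<epsilon> \<inter> dom n v"
          have kpos: "0 < k n" using cl by (simp add: close_def)
          have nt: "norm (\<theta> - \<theta>0) \<le> \<epsilon>" using theta_ballD(1)[of \<theta>] \<theta> by fastforce
          have \<theta>1: "\<theta> \<in> theta_ball \<theta>0 \<epsilon>1" using theta_ball_mono[OF \<epsilon>(2)] \<theta> by blast
          have summand: "llik_D2 \<theta> h h (exc n v i) \<le> hess_fun h h (p n v i) + (norm h)\<^sup>2 * (K2 * e * ew (p n v i) + 2 * K' * ew_tail l (p n v i))"
            if i: "i < k n" for i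
          proof -
            define u where "u = p n v i"
            define Z where "Z = exc n v i"
            have pr: "0 < u" "u \<le> 1" "0 \<le> Z" "\<bar>Z - zf u\<bar> \<le> e * u powr (- \<gamma>)"
              using cl i elim unfolding u_def Z_def close_def by blast+
            have lZ: "lin \<theta> Z > 0" using \<theta> i unfolding Z_def by (simp add: dom_eq[OF cl])
            have ew0: "ew u \<ge> 0" by (simp add: ew_def)
            have tl: "ew_tail l u \<ge> 0" "ew_tail l u \<ge> ew u - l" by (auto simp: ew_tail_def)
            have "llik_D2 \<theta> h h Z \<le> hess_fun h h u + (norm h)\<^sup>2 * (K2 * e * ew u + 2 * K' * ew_tail l u)"
            proof (cases "ew u \<ge> 2 * l")
              case True
              have "llik_D2 \<theta> h h Z \<le> K * (norm h)\<^sup>2 * ew u"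
                unfolding ew_def by (rule K(3)[OF pr(1-3) less_imp_le[OF e(1)] e(2) pr(4) \<theta>1 lZ])
              moreover have "- hess_fun h h u \<le> (K0\<^sup>2 * (1 + 1 / \<beta>)) * (norm h)\<^sup>2 * ew u"
                using hess_fun_bound[OF pr(1,2), of h h] by (simp add: ew_def power2_eq_square abs_le_iff)
              moreover have "K * (norm h)\<^sup>2 * ew u + (K0\<^sup>2 * (1 + 1 / \<beta>)) * (norm h)\<^sup>2 * ew u = (norm h)\<^sup>2 * (K' * ew u)"
                by (simp add: K'_def algebra_simps)
              ultimately have A: "llik_D2 \<theta> h h Z \<le> hess_fun h h u + (norm h)\<^sup>2 * (K' * ew u)" by linarith
              have "K' * ew u \<le> K' * (2 * ew_tail l u)" using True tl K' by (intro mult_left_mono) auto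
              moreover have "0 \<le> K2 * e * ew u" using K2_pos e ew0 by simp
              ultimately have "K' * ew u \<le> K2 * e * ew u + 2 * K' * ew_tail l u" by linarith
              then have "(norm h)\<^sup>2 * (K' * ew u) \<le> (norm h)\<^sup>2 * (K2 * e * ew u + 2 * K' * ew_tail l u)"
                by (intro mult_left_mono) auto
              with A show ?thesis by linarith
            next
              case False
              have "4 * norm (\<theta> - \<theta>0) * wt u \<le> 4 * \<epsilon> * (K0 * (2 * l))"
              proof (intro mult_mono)
                show "wt u \<le> K0 * (2 * l)"
                  using wt_bound[OF pr(1,2)] False K0p by (meson order_trans mult_left_mono less_imp_le not_le)
                show "0 \<le> wt u" unfolding wt_def using zf_nonneg[OF pr(1,2)] by simp
              qed (use nt \<epsilon> in auto)
              also have "\<dots> \<le> e" using \<epsilon>(4) by (simp add: mult_ac)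
              finally have w: "4 * norm (\<theta> - \<theta>0) * wt u \<le> e" .
              have "norm (\<theta> - \<theta>0) \<le> e" using nt \<epsilon> by linarith
              from hess_close(3)[OF pr(1-3) less_imp_le[OF e(1)] e(2) pr(4) this w, of h h]
              have "llik_D2 \<theta> h h Z \<le> hess_fun h h u + K2 * (norm h * norm h) * (e * ew u)"
                by (simp add: ew_def abs_le_iff)
              also have "K2 * (norm h * norm h) * (e * ew u) = (norm h)\<^sup>2 * (K2 * e * ew u)"
                by (simp add: power2_eq_square mult_ac)
              also have "(norm h)\<^sup>2 * (K2 * e * ew u) \<le> (norm h)\<^sup>2 * (K2 * e * ew u + 2 * K' * ew_tail l u)"
                using K' tl by (intro mult_left_mono) auto
              finally show ?thesis by simp
            qed
            then show ?thesis unfolding u_def Z_def .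
          qed
          have "S2 n v \<theta> h h \<le> (\<Sum>i<k n. hess_fun h h (p n v i) + (norm h)\<^sup>2 * (K2 * e * ew (p n v i) + 2 * K' * ew_tail l (p n v i))) / real (k n)"
            unfolding S2_eq[OF cl] by (intro divide_right_mono sum_mono summand) auto
          also have "\<dots> = avg n (hess_fun h h) v + (norm h)\<^sup>2 * (K2 * e * avg n ew v + 2 * K' * avg n (ew_tail l) v)"
            by (simp add: pt_avg_def sum.distrib sum_distrib_left[symmetric] add_divide_distrib distrib_left mult.assoc)
          also have "\<dots> \<le> (- cI * (norm h)\<^sup>2 + cI / 8 * (norm h)\<^sup>2) + (norm h)\<^sup>2 * (cI / 4)"
          proof (intro add_mono mult_left_mono zero_le_power2)
          show "avg n (hess_fun h h) v \<le> - cI * (norm h)\<^sup>2 + cI / 8 * (norm h)\<^sup>2"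
          proof -
            let ?h = "\<lambda>i j. hess_fun (axis i 1) (axis j 1)" and ?g = "\<lambda>i j. gram (axis i 1) (axis j 1)"
            have "avg n (hess_fun h h) v = (h $ 1)\<^sup>2 * avg n (?h 1 1) v + 2 * h $ 1 * h $ 2 * avg n (?h 1 2) v + (h $ 2)\<^sup>2 * avg n (?h 2 2) v"
            proof -
              have "(\<Sum>i<k n. hess_fun h h (p n v i)) = (\<Sum>i<k n. (h $ 1)\<^sup>2 * ?h 1 1 (p n v i) + 2 * h $ 1 * h $ 2 * ?h 1 2 (p n v i) + (h $ 2)\<^sup>2 * ?h 2 2 (p n v i))"
                by (intro sum.cong refl hess_fun_expand) (use cl in \<open>auto simp: close_def\<close>)
              then show ?thesis
                by (simp add: pt_avg_def sum.distrib sum_distrib_left add_divide_distrib)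
            qed
            then have eq: "avg n (hess_fun h h) v + gram h h = (h $ 1)\<^sup>2 * (avg n (?h 1 1) v + ?g 1 1)
                + 2 * h $ 1 * h $ 2 * (avg n (?h 1 2) v + ?g 1 2) + (h $ 2)\<^sup>2 * (avg n (?h 2 2) v + ?g 2 2)"
              unfolding gram_expand[of h] by (simp add: algebra_simps)
            have "\<bar>(h $ 1)\<^sup>2 * (avg n (?h 1 1) v + ?g 1 1)
                + 2 * h $ 1 * h $ 2 * (avg n (?h 1 2) v + ?g 1 2) + (h $ 2)\<^sup>2 * (avg n (?h 2 2) v + ?g 2 2)\<bar> \<le> 4 * (cI / 32) * (norm h)\<^sup>2"
              using a1 by (intro abs_quadratic_le) auto
            then have "\<bar>avg n (hess_fun h h) v + gram h h\<bar> \<le> cI / 8 * (norm h)\<^sup>2"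
              unfolding eq[symmetric] by simp
            then show ?thesis using cI(2)[of h] by linarith
          qed
          show "K2 * e * avg n ew v + 2 * K' * avg n (ew_tail l) v \<le> cI / 4"
          proof -
            have "K2 * e * avg n ew v \<le> K2 * e * (I0 + 1)"
              using a2 e K2_pos by (intro mult_left_mono) (auto simp: abs_le_iff)
            moreover have "2 * K' * avg n (ew_tail l) v \<le> 2 * K' * (2 * d)"
              using a3 l K' by (intro mult_left_mono) (auto simp: abs_le_iff)
            moreover have "2 * K' * (2 * d) = cI / 8" using K' by (simp add: d_def)
            ultimately show ?thesis using e8 by linarith
          qed
          qed
          also have "\<dots> = - (cI * 5 / 8) * (norm h)\<^sup>2" by (simp add: algebra_simps)
          also have "\<dots> \<le> - (cI / 2) * (norm h)\<^sup>2" using cI by (intro mult_right_mono) auto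
          finally show "S2 n v \<theta> h h \<le> - (cI/2) * (norm h)\<^sup>2" .
        qed
      qed
    qed
    then show "likely \<eta> (\<lambda>n v. \<forall>\<theta>\<in>theta_ball \<theta>0 \<epsilon> \<inter> dom n v. \<forall>h. S2 n v \<theta> h h \<le> - (cI/2) * (norm h)\<^sup>2)" by simp
  qed (use cI \<epsilon> in auto)
qed

text \<open>For positive shape the whole ball lies in the domain of finiteness, and the Hessian is also
  bounded below there.\<close>

lemma likely_S2_bounded_below:
  assumes "\<gamma> > 0"
  obtains c \<epsilon> where "c > 0" "\<epsilon> > 0"
    "\<And>\<eta>. \<eta> > 0 \<Longrightarrow> likely \<eta> (\<lambda>n v. \<forall>\<theta>\<in>theta_ball \<theta>0 \<epsilon>. \<theta> \<in> dom n v \<and> (\<forall>h. S2 n v \<theta> h h \<ge> - c * (norm h)\<^sup>2))"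
proof -
  obtain K \<epsilon> where K: "K > 0" "\<epsilon> > 0"
    "\<And>u Z e \<theta> h. 0 < u \<Longrightarrow> u \<le> 1 \<Longrightarrow> 0 \<le> Z \<Longrightarrow> 0 \<le> e \<Longrightarrow> e \<le> \<eta>0 \<Longrightarrow> \<bar>Z - zf u\<bar> \<le> e * u powr (- \<gamma>) \<Longrightarrow>
      \<theta> \<in> theta_ball \<theta>0 \<epsilon> \<Longrightarrow> \<theta> $ 1 > 0 \<and> lin \<theta> Z > 0 \<and> llik_D2 \<theta> h h Z \<ge> - K * (norm h)\<^sup>2 * u powr (- (2 * \<beta>))"
    using hess_lower[OF assms] by blast
  show ?thesis
  proof (rule that[of "K * (I0 + 1)" \<epsilon>])
    fix \<eta> :: real assume \<eta>: "\<eta> > 0"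
    obtain C c where C: "C > 0" "c > 0" "likely (\<eta>/2) (close C c)"
      using likely_close[of "\<eta>/2"] \<eta> by auto
    have l2: "likely (\<eta>/2) (\<lambda>n v. \<bar>avg n ew v - I0\<bar> \<le> 1)" using \<eta> by (intro likely_ew) auto
    have "likely (\<eta>/2 + \<eta>/2) (\<lambda>n v. \<forall>\<theta>\<in>theta_ball \<theta>0 \<epsilon>. \<theta> \<in> dom n v \<and> (\<forall>h. S2 n v \<theta> h h \<ge> - (K * (I0 + 1)) * (norm h)\<^sup>2))"
    proof (rule likely_mono[OF likely_conj[OF C(3) l2]])
      show "eventually (\<lambda>n. \<forall>v. close C c n v \<and> \<bar>avg n ew v - I0\<bar> \<le> 1 \<longrightarrow>
        (\<forall>\<theta>\<in>theta_ball \<theta>0 \<epsilon>. \<theta> \<in> dom n v \<and> (\<forall>h. S2 n v \<theta> h h \<ge> - (K * (I0 + 1)) * (norm h)\<^sup>2))) sequentially"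
        using ev_close_rel[OF C(1,2) eta0(1)]
      proof eventually_elim
        case (elim n)
        show ?case
        proof (intro allI impI ballI, elim conjE)
          fix v \<theta> assume cl: "close C c n v" and a2: "\<bar>avg n ew v - I0\<bar> \<le> 1" and \<theta>: "\<theta> \<in> theta_ball \<theta>0 \<epsilon>"
          have each: "lin \<theta> (exc n v i) > 0 \<and> llik_D2 \<theta> h h (exc n v i) \<ge> - K * (norm h)\<^sup>2 * ew (p n v i)" if i: "i < k n" for i h
          proof -
            have pr: "0 < p n v i" "p n v i \<le> 1" "0 \<le> exc n v i" "\<bar>exc n v i - zf (p n v i)\<bar> \<le> \<eta>0 * p n v i powr (- \<gamma>)"
              using cl i elim unfolding close_def by blast+
            show ?thesis
              using K(3)[OF pr(1-3) less_imp_le[OF eta0(1)] order_refl pr(4) \<theta>, of h] by (simp add: ew_def)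
          qed
          show "\<theta> \<in> dom n v \<and> (\<forall>h. S2 n v \<theta> h h \<ge> - (K * (I0 + 1)) * (norm h)\<^sup>2)"
          proof (intro conjI allI)
            show "\<theta> \<in> dom n v" unfolding dom_eq[OF cl] using each theta_ballD(2)[OF \<theta>] by blast
            fix h :: "real^2"
            have "(K * (norm h)\<^sup>2) * avg n ew v \<le> (K * (norm h)\<^sup>2) * (I0 + 1)"
              using a2 K by (intro mult_left_mono) (auto simp: abs_le_iff)
            then have "- (K * (I0 + 1)) * (norm h)\<^sup>2 \<le> - ((K * (norm h)\<^sup>2) * avg n ew v)" by (simp add: mult_ac)
            also have "\<dots> = (\<Sum>i<k n. - K * (norm h)\<^sup>2 * ew (p n v i)) / real (k n)"
              by (simp add: pt_avg_def sum_distrib_left sum_negf mult_ac)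
            also have "\<dots> \<le> S2 n v \<theta> h h"
              unfolding S2_eq[OF cl] using each by (intro divide_right_mono sum_mono) auto
            finally show "S2 n v \<theta> h h \<ge> - (K * (I0 + 1)) * (norm h)\<^sup>2" .
          qed
        qed
      qed
    qed
    then show "likely \<eta> (\<lambda>n v. \<forall>\<theta>\<in>theta_ball \<theta>0 \<epsilon>. \<theta> \<in> dom n v \<and> (\<forall>h. S2 n v \<theta> h h \<ge> - (K * (I0 + 1)) * (norm h)\<^sup>2))" by simp
  qed (use K I0_nonneg in auto)
qed

end

section \<open>The four assertions for quantiles of a uniform sample\<close>

lemma open_theta_ball: "open (theta_ball \<theta> \<epsilon>)"
proof -
  have "open Theta"
    unfolding Theta_def by (intro open_Collect_conj open_Collect_less continuous_intros)
  then show ?thesis unfolding theta_ball_def by auto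
qed

context gp_model
begin

abbreviation "can \<equiv> (\<lambda>l (y :: nat \<Rightarrow> real). y (l - 1))"

lemma score_eq:
  assumes "close C c n v" "\<theta> \<in> dom n v"
  shows "score can a k n (qsample v) \<theta> = (\<chi> j. S1 n v \<theta> (axis j 1))"
proof -
  interpret ls: loglik_sum "{..<k n}" "exc n v" "1 / real (k n)" by (rule loglik_sum_close[OF assms(1)])
  show ?thesis
    unfolding score_def mean_loglik_eq[OF assms(1)] LL_def S1_def
    by (rule ls.gradient_L) (use assms(2) in \<open>simp add: dom_def\<close>)
qed

lemma loglik_hessian_eq:
  assumes "close C c n v" "\<theta> \<in> dom n v"
  shows "loglik_hessian can a k n (qsample v) \<theta> = (\<chi> i j. S2 n v \<theta> (axis i 1) (axis j 1))"
proof -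
  interpret ls: loglik_sum "{..<k n}" "exc n v" "1 / real (k n)" by (rule loglik_sum_close[OF assms(1)])
  show ?thesis
    unfolding loglik_hessian_def mean_loglik_eq[OF assms(1)] LL_def S2_def
    by (rule ls.hessian_L) (use assms(2) in \<open>simp add: dom_def\<close>)
qed

lemma \<theta>0_mem_ball: "0 < \<epsilon> \<Longrightarrow> \<theta>0 \<in> theta_ball \<theta>0 \<epsilon>"
  using gamma by (simp add: theta_ball_def Theta_def)

lemma likely_score:
  assumes "\<eta> > 0"
  obtains C where "likely \<eta> (\<lambda>n v. \<theta>0 \<in> dom n v \<and>
    norm (score can a k n (qsample v) \<theta>0) \<le> C * (1 / sqrt (real (k n))))"
proof -
  obtain C c where "C > 0" "c > 0" and cl: "likely (\<eta>/3) (close C c)"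
    using likely_close[of "\<eta>/3"] assms by auto
  obtain C1 where C1: "likely (\<eta>/3) (\<lambda>n v. \<theta>0 \<in> dom n v \<and> \<bar>S1 n v \<theta>0 (axis 1 1)\<bar> \<le> C1 / sqrt (real (k n)))"
    using likely_S1[of "\<eta>/3" "axis 1 1"] assms by auto
  obtain C2 where C2: "likely (\<eta>/3) (\<lambda>n v. \<theta>0 \<in> dom n v \<and> \<bar>S1 n v \<theta>0 (axis 2 1)\<bar> \<le> C2 / sqrt (real (k n)))"
    using likely_S1[of "\<eta>/3" "axis 2 1"] assms by auto
  have "likely (\<eta>/3 + (\<eta>/3 + \<eta>/3)) (\<lambda>n v. \<theta>0 \<in> dom n v \<and>
    norm (score can a k n (qsample v) \<theta>0) \<le> (C1 + C2) * (1 / sqrt (real (k n))))"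
  proof (rule likely_mono[OF likely_conj[OF cl likely_conj[OF C1 C2]]], intro always_eventually allI impI, elim conjE)
    fix n v assume cl: "close C c n v" and d: "\<theta>0 \<in> dom n v"
      and s: "\<bar>S1 n v \<theta>0 (axis 1 1)\<bar> \<le> C1 / sqrt (real (k n))" "\<bar>S1 n v \<theta>0 (axis 2 1)\<bar> \<le> C2 / sqrt (real (k n))"
    have "norm (score can a k n (qsample v) \<theta>0) \<le> \<bar>S1 n v \<theta>0 (axis 1 1)\<bar> + \<bar>S1 n v \<theta>0 (axis 2 1)\<bar>"
      using norm_le_l1_cart[of "score can a k n (qsample v) \<theta>0"] unfolding score_eq[OF cl d] by (simp add: sum_2)
    also have "\<dots> \<le> (C1 + C2) * (1 / sqrt (real (k n)))"
      using s by (simp add: add_divide_distrib)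
    finally show "\<theta>0 \<in> dom n v \<and> norm (score can a k n (qsample v) \<theta>0) \<le> (C1 + C2) * (1 / sqrt (real (k n)))"
      using d by simp
  qed
  then show ?thesis using that by simp
qed

text \<open>Taylor's formula at \<open>\<theta>0\<close>. Where the likelihood of \<open>\<theta>\<close> vanishes, the left-hand side is \<open>- \<infinity>\<close>.\<close>

lemma likely_quadratic_upper_bound:
  assumes S2: "\<And>\<eta>. \<eta> > 0 \<Longrightarrow> likely \<eta> (\<lambda>n v. \<forall>\<theta>\<in>theta_ball \<theta>0 \<epsilon> \<inter> dom n v. \<forall>h. S2 n v \<theta> h h \<le> - c * (norm h)\<^sup>2)"
    and "0 < \<epsilon>" "\<eta> > 0"
  shows "likely \<eta> (\<lambda>n v. \<forall>\<theta>\<in>theta_ball \<theta>0 \<epsilon>. mean_loglik can a k n (qsample v) \<theta> - mean_loglik can a k n (qsample v) \<theta>0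
    \<le> ereal ((\<theta> - \<theta>0) \<bullet> score can a k n (qsample v) \<theta>0 - c / 2 * (norm (\<theta> - \<theta>0))\<^sup>2))"
proof -
  obtain C c' where "C > 0" "c' > 0" and cl: "likely (\<eta>/3) (close C c')"
    using likely_close[of "\<eta>/3"] assms by auto
  obtain C1 where C1: "likely (\<eta>/3) (\<lambda>n v. \<theta>0 \<in> dom n v \<and> norm (score can a k n (qsample v) \<theta>0) \<le> C1 * (1 / sqrt (real (k n))))"
    using likely_score[of "\<eta>/3"] assms by auto
  have l: "likely (\<eta>/3) (\<lambda>n v. \<forall>\<theta>\<in>theta_ball \<theta>0 \<epsilon> \<inter> dom n v. \<forall>h. S2 n v \<theta> h h \<le> - c * (norm h)\<^sup>2)"
    using assms by (intro S2) auto
  have "likely (\<eta>/3 + (\<eta>/3 + \<eta>/3)) (\<lambda>n v. \<forall>\<theta>\<in>theta_ball \<theta>0 \<epsilon>. mean_loglik can a k n (qsample v) \<theta> - mean_loglik can a k n (qsample v) \<theta>0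
    \<le> ereal ((\<theta> - \<theta>0) \<bullet> score can a k n (qsample v) \<theta>0 - c / 2 * (norm (\<theta> - \<theta>0))\<^sup>2))"
  proof (rule likely_mono[OF likely_conj[OF cl likely_conj[OF C1 l]]], intro always_eventually allI impI ballI, elim conjE)
    fix n v \<theta> assume cl: "close C c' n v" and d: "\<theta>0 \<in> dom n v" and \<theta>: "\<theta> \<in> theta_ball \<theta>0 \<epsilon>"
      and neg: "\<forall>\<theta>\<in>theta_ball \<theta>0 \<epsilon> \<inter> dom n v. \<forall>h. S2 n v \<theta> h h \<le> - c * (norm h)\<^sup>2"
    interpret ls: loglik_sum "{..<k n}" "exc n v" "1 / real (k n)" by (rule loglik_sum_close[OF cl])
    have d': "\<theta>0 \<in> ls.dom" using d by (simp add: dom_def)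
    have t0: "\<theta>0 \<in> theta_ball \<theta>0 \<epsilon>" using \<theta>0_mem_ball \<open>0 < \<epsilon>\<close> .
    have Leq: "mean_loglik can a k n (qsample v) = ls.L" using mean_loglik_eq[OF cl] by (simp add: LL_def)
    have sc: "(\<theta> - \<theta>0) \<bullet> score can a k n (qsample v) \<theta>0 = ls.S1 \<theta>0 (\<theta> - \<theta>0)"
      unfolding score_def Leq by (rule ls.S1_inner[OF d', symmetric])
    show "mean_loglik can a k n (qsample v) \<theta> - mean_loglik can a k n (qsample v) \<theta>0
      \<le> ereal ((\<theta> - \<theta>0) \<bullet> score can a k n (qsample v) \<theta>0 - c / 2 * (norm (\<theta> - \<theta>0))\<^sup>2)"
    proof (cases "\<theta> \<in> ls.dom")
      case True
      have "ls.RL \<theta> \<le> ls.RL \<theta>0 + ls.S1 \<theta>0 (\<theta> - \<theta>0) - c / 2 * (norm (\<theta> - \<theta>0))\<^sup>2"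
      proof (rule ls.taylor_upper[OF d' True])
        fix t :: real and h :: "real^2" assume t: "0 < t" "t < 1"
        have "\<theta>0 + t *\<^sub>R (\<theta> - \<theta>0) \<in> theta_ball \<theta>0 \<epsilon>"
          by (rule ls.segment_in_convex[OF convex_theta_ball t0 \<theta> t])
        moreover have "\<theta>0 + t *\<^sub>R (\<theta> - \<theta>0) \<in> ls.dom"
          using ls.dom_segment[OF d', of "\<theta> - \<theta>0" t] True t by simp
        ultimately show "ls.S2 (\<theta>0 + t *\<^sub>R (\<theta> - \<theta>0)) h h \<le> - c * (norm h)\<^sup>2"
          using neg by (simp add: S2_def dom_def)
      qed
      moreover have "ls.L \<theta> - ls.L \<theta>0 = ereal (ls.RL \<theta> - ls.RL \<theta>0)"
        by (subst ls.L_eq_RL[OF True], subst ls.L_eq_RL[OF d']) simp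
      ultimately show ?thesis unfolding sc unfolding Leq by simp
    next
      case False
      have "ls.L \<theta> - ls.L \<theta>0 = - \<infinity>"
        using ls.L_not_dom[OF theta_ballD(2)[OF \<theta>] False] ls.L_dom[OF d'] by simp
      then show ?thesis unfolding Leq by simp
    qed
  qed
  then show ?thesis by simp
qed

text \<open>As \<open>\<theta>0\<close> lies in the ball, the supremum is nonnegative, and the entrywise bound of
\<open>likely_hessian_shrinking\<close> carries over to its absolute value.\<close>

lemma likely_loglik_hessian:
  fixes R :: "nat \<Rightarrow> real"
  assumes R: "\<And>n. R n > 0"
    "R \<in> o(\<lambda>n. min (sqrt (real (k n)) / ln (real (k n))) (real (k n) powr (1 / 2 + min \<gamma> 0)))"
    and "\<eta> > 0" "\<delta> > 0"
  shows "likely \<eta> (\<lambda>n v. \<bar>SUP \<theta>\<in>theta_ball \<theta>0 (R n / sqrt (real (k n))).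
    ereal (norm (loglik_hessian can a k n (qsample v) \<theta> + fisher_info \<gamma>))\<bar> \<le> ereal \<delta>)"
proof -
  obtain C c where "C > 0" "c > 0" and cl: "likely (\<eta>/2) (close C c)"
    using likely_close[of "\<eta>/2"] assms by auto
  have l: "likely (\<eta>/2) (\<lambda>n v. \<forall>\<theta>\<in>theta_ball \<theta>0 (R n / sqrt (real (k n))).
    \<theta> \<in> dom n v \<and> (\<Sum>i\<in>UNIV. \<Sum>j\<in>UNIV. \<bar>S2 n v \<theta> (axis i 1) (axis j 1) + gram (axis i 1) (axis j 1)\<bar>) \<le> \<delta>)"
    by (rule likely_hessian_shrinking) (use assms in auto)
  have "likely (\<eta>/2 + \<eta>/2) (\<lambda>n v. \<bar>SUP \<theta>\<in>theta_ball \<theta>0 (R n / sqrt (real (k n))).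
    ereal (norm (loglik_hessian can a k n (qsample v) \<theta> + fisher_info \<gamma>))\<bar> \<le> ereal \<delta>)"
  proof (rule likely_mono[OF likely_conj[OF cl l]], intro always_eventually allI impI, elim conjE)
    fix n v assume cl: "close C c n v"
      and b: "\<forall>\<theta>\<in>theta_ball \<theta>0 (R n / sqrt (real (k n))).
        \<theta> \<in> dom n v \<and> (\<Sum>i\<in>UNIV. \<Sum>j\<in>UNIV. \<bar>S2 n v \<theta> (axis i 1) (axis j 1) + gram (axis i 1) (axis j 1)\<bar>) \<le> \<delta>"
    define B where "B = theta_ball \<theta>0 (R n / sqrt (real (k n)))"
    define f where "f \<theta> = ereal (norm (loglik_hessian can a k n (qsample v) \<theta> + fisher_info \<gamma>))" for \<theta>
    have "0 < k n" using cl by (simp add: close_def)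
    then have t0: "\<theta>0 \<in> B" unfolding B_def using R(1)[of n] by (intro \<theta>0_mem_ball) simp
    have f_le: "f \<theta> \<le> ereal \<delta>" if "\<theta> \<in> B" for \<theta>
    proof -
      have \<theta>: "\<theta> \<in> dom n v" "(\<Sum>i\<in>UNIV. \<Sum>j\<in>UNIV. \<bar>S2 n v \<theta> (axis i 1) (axis j 1) + gram (axis i 1) (axis j 1)\<bar>) \<le> \<delta>"
        using b that unfolding B_def by blast+
      have "norm (loglik_hessian can a k n (qsample v) \<theta> + fisher_info \<gamma>) \<le> (\<Sum>i\<in>UNIV. \<Sum>j\<in>UNIV. \<bar>S2 n v \<theta> (axis i 1) (axis j 1) + gram (axis i 1) (axis j 1)\<bar>)"
        using norm_matrix22_le[of "loglik_hessian can a k n (qsample v) \<theta> + fisher_info \<gamma>"]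
        unfolding loglik_hessian_eq[OF cl \<theta>(1)] by (simp add: fisher_info_nth)
      with \<theta>(2) show ?thesis unfolding f_def by simp
    qed
    have "0 \<le> f \<theta>0" by (simp add: f_def)
    also have "\<dots> \<le> (SUP \<theta>\<in>B. f \<theta>)" by (rule SUP_upper[OF t0])
    finally have "\<bar>SUP \<theta>\<in>B. f \<theta>\<bar> = (SUP \<theta>\<in>B. f \<theta>)" by (rule abs_ereal_ge0)
    also have "\<dots> \<le> ereal \<delta>" by (rule SUP_least) (rule f_le)
    finally show "\<bar>SUP \<theta>\<in>theta_ball \<theta>0 (R n / sqrt (real (k n))).
      ereal (norm (loglik_hessian can a k n (qsample v) \<theta> + fisher_info \<gamma>))\<bar> \<le> ereal \<delta>"
      unfolding B_def f_def .
  qed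
  then show ?thesis by simp
qed

text \<open>The ball of radius \<open>\<epsilon> / 2\<close> lies in \<open>Theta\<close>, and the score at its centre tends to \<open>0\<close>, so
\<open>quadratic_behaviour_at_maximiser\<close> applies with this radius.\<close>

lemma likely_concave:
  assumes "\<gamma> > 0" and \<epsilon>: "0 < \<epsilon>" "\<epsilon> \<le> 1" and "b > 0"
    and neg: "\<And>\<eta>. \<eta> > 0 \<Longrightarrow> likely \<eta> (\<lambda>n v. \<forall>\<theta>\<in>theta_ball \<theta>0 \<epsilon> \<inter> dom n v. \<forall>h. S2 n v \<theta> h h \<le> - b * (norm h)\<^sup>2)"
    and low: "\<And>\<eta>. \<eta> > 0 \<Longrightarrow> likely \<eta> (\<lambda>n v. \<forall>\<theta>\<in>theta_ball \<theta>0 \<epsilon>. \<theta> \<in> dom n v \<and> (\<forall>h. S2 n v \<theta> h h \<ge> - b' * (norm h)\<^sup>2))"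
    and "\<eta> > 0"
  shows "likely \<eta> (\<lambda>n v. let L = mean_loglik can a k n (qsample v); B = theta_ball \<theta>0 \<epsilon> in
        strictly_concave_on B L \<and>
        (\<exists>!\<theta>h. is_arg_max L (\<lambda>\<theta>. \<theta> \<in> B) \<theta>h) \<and>
        (\<forall>\<theta>h. is_arg_max L (\<lambda>\<theta>. \<theta> \<in> B) \<theta>h \<longrightarrow>
          (\<forall>\<theta>\<in>B. ereal (- (b' / 2) * (norm (\<theta> - \<theta>h))\<^sup>2) \<le> L \<theta> - L \<theta>h \<and>
                  L \<theta> - L \<theta>h \<le> ereal (- (b / 2) * (norm (\<theta> - \<theta>h))\<^sup>2))))"
    (is "likely \<eta> ?P")
proof -
  obtain C c' where "C > 0" "c' > 0" and cl: "likely (\<eta>/4) (close C c')"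
    using likely_close[of "\<eta>/4"] assms by auto
  obtain C1 where C1: "likely (\<eta>/4) (\<lambda>n v. \<theta>0 \<in> dom n v \<and> norm (score can a k n (qsample v) \<theta>0) \<le> C1 * (1 / sqrt (real (k n))))"
    using likely_score[of "\<eta>/4"] assms by auto
  have l: "likely (\<eta>/4) (\<lambda>n v. \<forall>\<theta>\<in>theta_ball \<theta>0 \<epsilon> \<inter> dom n v. \<forall>h. S2 n v \<theta> h h \<le> - b * (norm h)\<^sup>2)"
     "likely (\<eta>/4) (\<lambda>n v. \<forall>\<theta>\<in>theta_ball \<theta>0 \<epsilon>. \<theta> \<in> dom n v \<and> (\<forall>h. S2 n v \<theta> h h \<ge> - b' * (norm h)\<^sup>2))"
    using assms by (intro neg low; simp)+
  have B: "convex (theta_ball \<theta>0 \<epsilon>)" "open (theta_ball \<theta>0 \<epsilon>)"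
    by (rule convex_theta_ball, rule open_theta_ball)
  have ball: "cball \<theta>0 (\<epsilon> / 2) \<subseteq> theta_ball \<theta>0 \<epsilon>"
  proof
    fix \<theta> :: "real^2" assume "\<theta> \<in> cball \<theta>0 (\<epsilon> / 2)"
    then have t: "norm (\<theta> - \<theta>0) \<le> \<epsilon> / 2" by (simp add: dist_norm norm_minus_commute)
    have "\<bar>\<theta> $ 1 - \<gamma>\<bar> \<le> norm (\<theta> - \<theta>0)" "\<bar>\<theta> $ 2 - 1\<bar> \<le> norm (\<theta> - \<theta>0)"
      using component_le_norm_cart[of "\<theta> - \<theta>0" 1] component_le_norm_cart[of "\<theta> - \<theta>0" 2] by (simp_all add: \<theta>0_def)
    then show "\<theta> \<in> theta_ball \<theta>0 \<epsilon>"
      using t \<epsilon> \<open>\<gamma> > 0\<close> by (auto simp: theta_ball_def Theta_def dist_norm norm_minus_commute)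
  qed
  have "likely (\<eta>/4 + (\<eta>/4 + (\<eta>/4 + \<eta>/4))) ?P"
  proof (rule likely_mono[OF likely_conj[OF cl likely_conj[OF C1 likely_conj[OF l]]]])
    have "(\<lambda>n. C1 * (1 / sqrt (real (k n)))) \<longlonglongrightarrow> C1 * 0"
      by (intro tendsto_mult tendsto_const real_tendsto_divide_at_top[OF tendsto_const]
          filterlim_compose[OF sqrt_at_top k_real_at_top])
    then have "eventually (\<lambda>n. C1 * (1 / sqrt (real (k n))) < b / 2 * (\<epsilon> / 2)) sequentially"
      using \<open>b > 0\<close> \<epsilon> by (intro order_tendstoD) auto
    then show "eventually (\<lambda>n. \<forall>v. close C c' n v \<and>
      (\<theta>0 \<in> dom n v \<and> norm (score can a k n (qsample v) \<theta>0) \<le> C1 * (1 / sqrt (real (k n)))) \<and>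
      (\<forall>\<theta>\<in>theta_ball \<theta>0 \<epsilon> \<inter> dom n v. \<forall>h. S2 n v \<theta> h h \<le> - b * (norm h)\<^sup>2) \<and>
      (\<forall>\<theta>\<in>theta_ball \<theta>0 \<epsilon>. \<theta> \<in> dom n v \<and> (\<forall>h. S2 n v \<theta> h h \<ge> - b' * (norm h)\<^sup>2)) \<longrightarrow> ?P n v) sequentially"
    proof eventually_elim
      case (elim n)
      show ?case
      proof (intro allI impI, elim conjE)
        fix v assume cl: "close C c' n v" and s: "norm (score can a k n (qsample v) \<theta>0) \<le> C1 * (1 / sqrt (real (k n)))"
          and n: "\<forall>\<theta>\<in>theta_ball \<theta>0 \<epsilon> \<inter> dom n v. \<forall>h. S2 n v \<theta> h h \<le> - b * (norm h)\<^sup>2"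
          and lo: "\<forall>\<theta>\<in>theta_ball \<theta>0 \<epsilon>. \<theta> \<in> dom n v \<and> (\<forall>h. S2 n v \<theta> h h \<ge> - b' * (norm h)\<^sup>2)"
        interpret ls: loglik_sum "{..<k n}" "exc n v" "1 / real (k n)" by (rule loglik_sum_close[OF cl])
        have Leq: "mean_loglik can a k n (qsample v) = ls.L" using mean_loglik_eq[OF cl] by (simp add: LL_def)
        show "?P n v" unfolding Let_def Leq
        proof (rule ls.quadratic_behaviour_at_maximiser[OF B _ ball _ \<open>b > 0\<close>])
          show "theta_ball \<theta>0 \<epsilon> \<subseteq> ls.dom" using lo by (auto simp: dom_def)
          show "norm (gradient ls.RL \<theta>0) < b / 2 * (\<epsilon> / 2)"
            using s elim unfolding score_def Leq by linarith
        qed (use \<epsilon> n lo in \<open>auto simp: S2_def\<close>)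
      qed
    qed
  qed
  then show ?thesis by simp
qed

end

section \<open>Transfer to the original sample\<close>

lemma order_stat_shift:
  "order_stat Y n j \<omega> = order_stat (\<lambda>l y. y (l - 1)) n j (\<lambda>i. Y (Suc i) \<omega>)"
proof -
  have "map (\<lambda>i. Y i \<omega>) [1..<n + 1] = map (\<lambda>i. Y (Suc (i - 1)) \<omega>) [1..<n + 1]"
    by (rule map_cong) auto
  then show ?thesis unfolding order_stat_def by (simp only:)
qed

lemma mean_loglik_shift:
  "mean_loglik Y a k n \<omega> = mean_loglik (\<lambda>l y. y (l - 1)) a k n (\<lambda>i. Y (Suc i) \<omega>)"
  by (rule ext) (simp only: mean_loglik_def excess_def order_stat_shift[of Y])

lemma score_shift: "score Y a k n \<omega> = score (\<lambda>l y. y (l - 1)) a k n (\<lambda>i. Y (Suc i) \<omega>)"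
  unfolding score_def mean_loglik_shift[of Y] by (rule refl)

lemma loglik_hessian_shift:
  "loglik_hessian Y a k n \<omega> = loglik_hessian (\<lambda>l y. y (l - 1)) a k n (\<lambda>i. Y (Suc i) \<omega>)"
  unfolding loglik_hessian_def mean_loglik_shift[of Y] by (rule refl)

theorem proposition2p1:
  fixes M :: "'a measure" and Y :: "nat \<Rightarrow> 'a \<Rightarrow> real" and F\<^sub>0 a\<^sub>0 A :: "real \<Rightarrow> real"
    and \<gamma>\<^sub>0 \<rho> lam :: real and k :: "nat \<Rightarrow> nat" and \<theta>\<^sub>0 :: "real^2"
  assumes "prob_space M"
    and "prob_space.indep_vars M (\<lambda>_. borel) Y {1..}"
    and "\<forall>i\<ge>1. cdf (distr M borel (Y i)) = F\<^sub>0"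
    and "\<gamma>\<^sub>0 > - 1 / 2"
    and "gev_attraction F\<^sub>0 \<gamma>\<^sub>0 a\<^sub>0"
    and "intermediate_seq k"
    and "second_order_condition F\<^sub>0 \<gamma>\<^sub>0 a\<^sub>0 \<rho> A"
    and "(\<lambda>n. sqrt (real (k n)) * A (real n / real (k n))) \<longlonglongrightarrow> lam"
    and "\<theta>\<^sub>0 = vector [\<gamma>\<^sub>0, 1]"
  shows "\<exists>\<epsilon>\<^sub>0>0. \<exists>c\<^sub>1>0. \<exists>c\<^sub>2>0. \<exists>c\<^sub>3>0.
    (\<gamma>\<^sub>0 > 0 \<longrightarrow>
      whp M (\<lambda>n \<omega>. let L = mean_loglik Y a\<^sub>0 k n \<omega>; B = theta_ball \<theta>\<^sub>0 \<epsilon>\<^sub>0 in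
        strictly_concave_on B L \<and>
        (\<exists>!\<theta>h. is_arg_max L (\<lambda>\<theta>. \<theta> \<in> B) \<theta>h) \<and>
        (\<forall>\<theta>h. is_arg_max L (\<lambda>\<theta>. \<theta> \<in> B) \<theta>h \<longrightarrow>
          (\<forall>\<theta>\<in>B. ereal (- c\<^sub>1 * (norm (\<theta> - \<theta>h))\<^sup>2) \<le> L \<theta> - L \<theta>h \<and>
                  L \<theta> - L \<theta>h \<le> ereal (- c\<^sub>2 * (norm (\<theta> - \<theta>h))\<^sup>2))))) \<and>
    bigO_P M (\<lambda>n \<omega>. score Y a\<^sub>0 k n \<omega> \<theta>\<^sub>0) (\<lambda>n. 1 / sqrt (real (k n))) \<and>
    whp M (\<lambda>n \<omega>. let L = mean_loglik Y a\<^sub>0 k n \<omega> in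
      \<forall>\<theta>\<in>theta_ball \<theta>\<^sub>0 \<epsilon>\<^sub>0.
        L \<theta> - L \<theta>\<^sub>0 \<le> ereal ((\<theta> - \<theta>\<^sub>0) \<bullet> score Y a\<^sub>0 k n \<omega> \<theta>\<^sub>0 - c\<^sub>3 * (norm (\<theta> - \<theta>\<^sub>0))\<^sup>2)) \<and>
    (\<forall>R :: nat \<Rightarrow> real. (\<forall>n. R n > 0) \<longrightarrow>
      R \<in> o(\<lambda>n. min (sqrt (real (k n)) / ln (real (k n))) (real (k n) powr (1 / 2 + min \<gamma>\<^sub>0 0))) \<longrightarrow>
      smallo_P_1 M (\<lambda>n \<omega>. SUP \<theta>\<in>theta_ball \<theta>\<^sub>0 (R n / sqrt (real (k n))).
        ereal (norm (loglik_hessian Y a\<^sub>0 k n \<omega> \<theta> + fisher_info \<gamma>\<^sub>0))))"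
proof -
  interpret M: prob_space M by fact
  have Y1: "Y 1 \<in> borel_measurable M" using assms(2) by (auto simp: M.indep_vars_def)
  have "real_distribution (distr M borel (Y 1))"
    using M.prob_space_distr[OF Y1] by (simp add: real_distribution_def real_distribution_axioms_def)
  then interpret rc: real_cdf "distr M borel (Y 1)" F\<^sub>0
    by (rule real_cdf.intro) (use assms(3) in simp)
  note so = assms(7)[unfolded second_order_condition_def] and ga = assms(5)[unfolded gev_attraction_def]
  interpret gp_model F\<^sub>0 a\<^sub>0 A \<gamma>\<^sub>0 \<rho> "second_order_limit \<gamma>\<^sub>0 \<rho>" k lam
  proof (unfold_locales)
    show "mono_on {1<..} (tail_quantile F\<^sub>0)"
    proof (rule mono_onI)
      fix r s :: real assume "r \<in> {1<..}" "s \<in> {1<..}" "r \<le> s"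
      then show "tail_quantile F\<^sub>0 r \<le> tail_quantile F\<^sub>0 s"
        unfolding tail_quantile_def
        by (intro mono_onD[OF rc.mono_on_quantile]) (auto simp: frac_le)
    qed
    show "mono_on {0<..<1} (quantile F\<^sub>0)" by (rule rc.mono_on_quantile)
    show "A t \<noteq> 0" if "t > 0" for t using so that by force
  qed (use so ga assms in auto)
  have \<theta>\<^sub>0: "\<theta>\<^sub>0 = \<theta>0" unfolding \<theta>0_def by fact
  \<comment> \<open>what is likely for quantiles of a uniform sample is likely for the given sample\<close>
  have transfer: "eventually (\<lambda>n. inner_prob M (\<lambda>\<omega>. P n (\<lambda>i. Y (Suc i) \<omega>)) \<ge> 1 - \<eta>) sequentially"
    if "likely \<eta> (\<lambda>n v. P n (qsample v))" for \<eta> and P :: "nat \<Rightarrow> (nat \<Rightarrow> real) \<Rightarrow> bool"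
    using that unfolding likely_def qsample_def
    by eventually_elim (rule order_trans[OF _ inner_prob_quantile_transform[OF assms(1-3)]])
  obtain b \<epsilon>1 where b: "b > 0" "\<epsilon>1 > 0"
    "\<And>\<eta>. \<eta> > 0 \<Longrightarrow> likely \<eta> (\<lambda>n v. \<forall>\<theta>\<in>theta_ball \<theta>0 \<epsilon>1 \<inter> dom n v. \<forall>h. S2 n v \<theta> h h \<le> - b * (norm h)\<^sup>2)"
    using likely_S2_negative by blast
  have "\<exists>b' \<epsilon>2. b' > 0 \<and> \<epsilon>2 > 0 \<and> (\<gamma>\<^sub>0 > 0 \<longrightarrow>
    (\<forall>\<eta>>0. likely \<eta> (\<lambda>n v. \<forall>\<theta>\<in>theta_ball \<theta>0 \<epsilon>2. \<theta> \<in> dom n v \<and> (\<forall>h. S2 n v \<theta> h h \<ge> - b' * (norm h)\<^sup>2))))"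
  proof (cases "\<gamma>\<^sub>0 > 0")
    case True
    show ?thesis by (rule likely_S2_bounded_below[OF True]) blast
  next
    case False
    then show ?thesis by (intro exI[of _ "1::real"]) simp
  qed
  then obtain b' \<epsilon>2 where b': "b' > 0" "\<epsilon>2 > 0"
    "\<And>\<eta>. \<gamma>\<^sub>0 > 0 \<Longrightarrow> \<eta> > 0 \<Longrightarrow> likely \<eta> (\<lambda>n v. \<forall>\<theta>\<in>theta_ball \<theta>0 \<epsilon>2. \<theta> \<in> dom n v \<and> (\<forall>h. S2 n v \<theta> h h \<ge> - b' * (norm h)\<^sup>2))"
    by blast
  \<comment> \<open>one radius for all assertions; at most \<open>1\<close> so that half of it keeps the scale positive\<close>
  define \<epsilon> where "\<epsilon> = min 1 (min \<epsilon>1 \<epsilon>2)"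
  have \<epsilon>: "0 < \<epsilon>" "\<epsilon> \<le> 1" "\<epsilon> \<le> \<epsilon>1" "\<epsilon> \<le> \<epsilon>2" using b b' by (auto simp: \<epsilon>_def)
  have neg: "likely \<eta> (\<lambda>n v. \<forall>\<theta>\<in>theta_ball \<theta>0 \<epsilon> \<inter> dom n v. \<forall>h. S2 n v \<theta> h h \<le> - b * (norm h)\<^sup>2)" if "\<eta> > 0" for \<eta>
    using theta_ball_mono[OF \<epsilon>(3)] by (intro likely_mono[OF b(3)[OF that]] always_eventually) blast
  have low: "likely \<eta> (\<lambda>n v. \<forall>\<theta>\<in>theta_ball \<theta>0 \<epsilon>. \<theta> \<in> dom n v \<and> (\<forall>h. S2 n v \<theta> h h \<ge> - b' * (norm h)\<^sup>2))"
    if "\<gamma>\<^sub>0 > 0" "\<eta> > 0" for \<eta>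
    using theta_ball_mono[OF \<epsilon>(4)] by (intro likely_mono[OF b'(3)[OF that]] always_eventually) blast
  have p1: "\<forall>\<eta>>0. likely \<eta> (\<lambda>n v. let L = mean_loglik can a\<^sub>0 k n (qsample v); B = theta_ball \<theta>0 \<epsilon> in
        strictly_concave_on B L \<and>
        (\<exists>!\<theta>h. is_arg_max L (\<lambda>\<theta>. \<theta> \<in> B) \<theta>h) \<and>
        (\<forall>\<theta>h. is_arg_max L (\<lambda>\<theta>. \<theta> \<in> B) \<theta>h \<longrightarrow>
          (\<forall>\<theta>\<in>B. ereal (- (b' / 2) * (norm (\<theta> - \<theta>h))\<^sup>2) \<le> L \<theta> - L \<theta>h \<and>
                  L \<theta> - L \<theta>h \<le> ereal (- (b / 2) * (norm (\<theta> - \<theta>h))\<^sup>2))))" if "\<gamma>\<^sub>0 > 0"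
    using likely_concave[OF that \<epsilon>(1,2) b(1) neg low] that by blast
  have p3: "\<forall>\<eta>>0. likely \<eta> (\<lambda>n v. let L = mean_loglik can a\<^sub>0 k n (qsample v) in \<forall>\<theta>\<in>theta_ball \<theta>0 \<epsilon>.
        L \<theta> - L \<theta>0 \<le> ereal ((\<theta> - \<theta>0) \<bullet> score can a\<^sub>0 k n (qsample v) \<theta>0 - b / 2 * (norm (\<theta> - \<theta>0))\<^sup>2))"
    unfolding Let_def using likely_quadratic_upper_bound[OF neg \<epsilon>(1)] by blast
  show ?thesis
    unfolding \<theta>\<^sub>0 score_shift[of Y] mean_loglik_shift[of Y] loglik_hessian_shift[of Y]
  proof (rule exI[of _ \<epsilon>], rule conjI[OF \<epsilon>(1)], rule exI[of _ "b' / 2"], rule conjI, use b'(1) in simp,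
      rule exI[of _ "b / 2"], rule conjI, use b(1) in simp, rule exI[of _ "b / 2"], rule conjI, use b(1) in simp,
      intro conjI impI allI)
    assume "\<gamma>\<^sub>0 > 0"
    show "whp M (\<lambda>n \<omega>. let L = mean_loglik can a\<^sub>0 k n (\<lambda>i. Y (Suc i) \<omega>); B = theta_ball \<theta>0 \<epsilon> in
        strictly_concave_on B L \<and>
        (\<exists>!\<theta>h. is_arg_max L (\<lambda>\<theta>. \<theta> \<in> B) \<theta>h) \<and>
        (\<forall>\<theta>h. is_arg_max L (\<lambda>\<theta>. \<theta> \<in> B) \<theta>h \<longrightarrow>
          (\<forall>\<theta>\<in>B. ereal (- (b' / 2) * (norm (\<theta> - \<theta>h))\<^sup>2) \<le> L \<theta> - L \<theta>h \<and>
                  L \<theta> - L \<theta>h \<le> ereal (- (b / 2) * (norm (\<theta> - \<theta>h))\<^sup>2))))"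
      unfolding M.whp_iff by (intro allI impI transfer) (use p1[OF \<open>\<gamma>\<^sub>0 > 0\<close>] in blast)
  next
    show "whp M (\<lambda>n \<omega>. let L = mean_loglik can a\<^sub>0 k n (\<lambda>i. Y (Suc i) \<omega>) in \<forall>\<theta>\<in>theta_ball \<theta>0 \<epsilon>.
        L \<theta> - L \<theta>0 \<le> ereal ((\<theta> - \<theta>0) \<bullet> score can a\<^sub>0 k n (\<lambda>i. Y (Suc i) \<omega>) \<theta>0 - b / 2 * (norm (\<theta> - \<theta>0))\<^sup>2))"
      unfolding M.whp_iff by (intro allI impI transfer) (use p3 in blast)
  next
    show "bigO_P M (\<lambda>n \<omega>. score can a\<^sub>0 k n (\<lambda>i. Y (Suc i) \<omega>) \<theta>0) (\<lambda>n. 1 / sqrt (real (k n)))"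
      unfolding bigO_P_def
    proof (intro allI impI)
      fix \<eta> :: real assume "\<eta> > 0"
      then obtain C where "likely \<eta> (\<lambda>n v. \<theta>0 \<in> dom n v \<and> norm (score can a\<^sub>0 k n (qsample v) \<theta>0) \<le> C * (1 / sqrt (real (k n))))"
        using likely_score by blast
      then have "likely \<eta> (\<lambda>n v. norm (score can a\<^sub>0 k n (qsample v) \<theta>0) \<le> C * (1 / sqrt (real (k n))))"
        by (rule likely_mono) auto
      from transfer[OF this] show "\<exists>C. \<forall>\<^sub>F n in sequentially. 1 - \<eta> \<le> inner_prob M
          (\<lambda>\<omega>. norm (score can a\<^sub>0 k n (\<lambda>i. Y (Suc i) \<omega>) \<theta>0) \<le> C * (1 / sqrt (real (k n))))" by blast
    qed
  next
    fix R :: "nat \<Rightarrow> real" assume R: "\<forall>n. R n > 0"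
      "R \<in> o(\<lambda>n. min (sqrt (real (k n)) / ln (real (k n))) (real (k n) powr (1 / 2 + min \<gamma>\<^sub>0 0)))"
    show "smallo_P_1 M (\<lambda>n \<omega>. SUP \<theta>\<in>theta_ball \<theta>0 (R n / sqrt (real (k n))).
        ereal (norm (loglik_hessian can a\<^sub>0 k n (\<lambda>i. Y (Suc i) \<omega>) \<theta> + fisher_info \<gamma>\<^sub>0)))"
      unfolding smallo_P_1_def M.whp_iff
      by (intro allI impI transfer likely_loglik_hessian) (use R in auto)
  qed
qed

end
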